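(* Let $H$ be a finite-dimensional Hopf algebra over a field $k$ and $R \subseteq H$ a Hopf subalgebra such that the quotient module $Q=H/R^+H$ is a projective and conditionally faithful right $R$-module. Then: (i) $R$ is semisimple; (ii) $\ell_Q \leq t$, where $t$ is the number of irreducible representations of $R$ (isomorphism classes of simple $R$-modules); (iii) every simple right $R$-module $S$ is isomorphic to a direct summand of $Q^{\otimes \ell_Q}$; (iv) the minimum depth satisfies $2\ell_Q + 1 \leq d(R,H) \leq 2\ell_Q + 2$.
   Context: $R^+ = \ker\varepsilon|_R$ with $\varepsilon$ the counit of $H$. $Q=H/R^+H$ is a right $H$-module by right multiplication, restricted to $R$; the tensor powers $Q^{\otimes n}$ (over $k$) carry the diagonal $R$-action via the coproduct, and $Q^{\otimes 0}=k$ is the trivial module. Put $I_n=\mathrm{Ann}_R\,Q^{\otimes n}$ (so $I_0=R^+$). These form a descending chain $I_0\supseteq I_1\supseteq I_2\supseteq\cdots$. Put $I_Q=\bigcap_{n\ge 1} I_n$; it is the largest Hopf ideal of $R$ contained in $\mathrm{Ann}_R\,Q$. $\ell_Q$ is the least $n\ge 0$ with $I_n=I_Q$. $Q$ is conditionally faithful if $I_Q=0$, i.e. $\mathrm{Ann}_R\,Q$ contains no nonzero Hopf ideal of $R$; then $\ell_Q$ is the least $n$ such that $Q^{\otimes n}$ is a faithful $R$-module. Modules $X, Y$ are similar if each is isomorphic to a direct summand of a finite direct sum of copies of the other. For a unital subalgebra $B\subseteq A$ of finite-dimensional algebras let $A^{\otimes_B n}$ be the $n$-fold tensor product of $A$ over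 $B$, $A^{\otimes_B 0}=B$. The extension has depth $2n+1$ ($n\ge 0$) if $A^{\otimes_B(n+1)}$ and $A^{\otimes_B n}$ are similar as $B$-$B$-bimodules, and depth $2n$ ($n\ge 1$) if they are similar as $B$-$A$-bimodules or as $A$-$B$-bimodules. The minimum depth $d(B,A)$ is the least $m\geq 1$ such that $B\subseteq A$ has depth $m$. *)

theory Defs
  imports
    "HOL-Algebra.Module"
    "HOL-Library.Poly_Mapping"
    "HOL-Library.Set_Algebras"
    "HOL-Library.Extended_Nat"
begin

section \<open>Modules and bimodules\<close>

text \<open>
  The ambient algebra is a type of class \<^class>\<open>ring_1\<close>; subalgebras are subsets of it.
  A module over a set \<open>A\<close> of scalars is a record \<^typ>\<open>('s, 'm) module\<close> of which only the
  additive group and \<open>\<odot>\<close> matter (the fields \<open>mult\<close> and \<open>one\<close> are never used), and only scalars in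
  \<open>A\<close> count.
  For a right module, \<open>r \<odot> x\<close> denotes \<open>x\<cdot>r\<close>. For a \<open>B\<close>-\<open>C\<close>-bimodule the scalars are
  \<open>bi_scalars B C\<close>, where \<open>Inl b \<odot> x\<close> denotes \<open>b\<cdot>x\<close> and \<open>Inr c \<odot> x\<close> denotes \<open>x\<cdot>c\<close>.
\<close>

definition mk_module ::
  "'m set \<Rightarrow> ('m \<Rightarrow> 'm \<Rightarrow> 'm) \<Rightarrow> 'm \<Rightarrow> ('s \<Rightarrow> 'm \<Rightarrow> 'm) \<Rightarrow> ('s, 'm) module" where
  "mk_module C pl z act =
     \<lparr>carrier = C, mult = undefined, one = undefined, zero = z, add = pl, smult = act\<rparr>"

definition bi_scalars :: "'a set \<Rightarrow> 'b set \<Rightarrow> ('a + 'b) set" where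
  "bi_scalars B C = Inl ` B \<union> Inr ` C"

definition mod_hom :: "'s set \<Rightarrow> ('s, 'm) module \<Rightarrow> ('s, 'n) module \<Rightarrow> ('m \<Rightarrow> 'n) set" where
  "mod_hom A M N =
     {f \<in> carrier M \<rightarrow> carrier N.
        (\<forall>x\<in>carrier M. \<forall>y\<in>carrier M. f (x \<oplus>\<^bsub>M\<^esub> y) = f x \<oplus>\<^bsub>N\<^esub> f y) \<and>
        (\<forall>s\<in>A. \<forall>x\<in>carrier M. f (s \<odot>\<^bsub>M\<^esub> x) = s \<odot>\<^bsub>N\<^esub> f x)}"

definition mod_iso :: "'s set \<Rightarrow> ('s, 'm) module \<Rightarrow> ('s, 'n) module \<Rightarrow> bool" where
  "mod_iso A M N \<longleftrightarrow> (\<exists>f\<in>mod_hom A M N. bij_betw f (carrier M) (carrier N))"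

definition is_submodule :: "'s set \<Rightarrow> 'm set \<Rightarrow> ('s, 'm) module \<Rightarrow> bool" where
  "is_submodule A U M \<longleftrightarrow>
     subgroup U (add_monoid M) \<and> (\<forall>s\<in>A. \<forall>x\<in>U. s \<odot>\<^bsub>M\<^esub> x \<in> U)"

definition internal_direct_sum :: "('s, 'm) module \<Rightarrow> 'm set \<Rightarrow> 'm set \<Rightarrow> bool" where
  "internal_direct_sum M U V \<longleftrightarrow>
     U \<inter> V = {\<zero>\<^bsub>M\<^esub>} \<and> carrier M = {u \<oplus>\<^bsub>M\<^esub> v | u v. u \<in> U \<and> v \<in> V}"

definition iso_to_summand :: "'s set \<Rightarrow> ('s, 'm) module \<Rightarrow> ('s, 'n) module \<Rightarrow> bool" where
  "iso_to_summand A M N \<longleftrightarrow>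
     (\<exists>U V. is_submodule A U N \<and> is_submodule A V N \<and> internal_direct_sum N U V \<and>
            mod_iso A M (N\<lparr>carrier := U\<rparr>))"

text \<open>The direct sum of copies of \<open>M\<close> indexed by a (possibly infinite) set \<open>I\<close>.\<close>

definition direct_power :: "'i set \<Rightarrow> ('s, 'm) module \<Rightarrow> ('s, 'i \<Rightarrow> 'm) module" where
  "direct_power I M =
     mk_module {f \<in> I \<rightarrow>\<^sub>E carrier M. finite {i \<in> I. f i \<noteq> \<zero>\<^bsub>M\<^esub>}}
       (\<lambda>f g. \<lambda>i\<in>I. f i \<oplus>\<^bsub>M\<^esub> g i) (\<lambda>i\<in>I. \<zero>\<^bsub>M\<^esub>) (\<lambda>s f. \<lambda>i\<in>I. s \<odot>\<^bsub>M\<^esub> f i)"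

definition similar :: "'s set \<Rightarrow> ('s, 'm) module \<Rightarrow> ('s, 'n) module \<Rightarrow> bool" where
  "similar A M N \<longleftrightarrow>
     (\<exists>n. iso_to_summand A M (direct_power {..<n::nat} N)) \<and>
     (\<exists>n. iso_to_summand A N (direct_power {..<n::nat} M))"

definition right_module :: "'a::ring_1 set \<Rightarrow> ('a, 'm) module \<Rightarrow> bool" where
  "right_module R M \<longleftrightarrow> abelian_group M \<and>
     (\<forall>r\<in>R. \<forall>x\<in>carrier M. r \<odot>\<^bsub>M\<^esub> x \<in> carrier M) \<and>
     (\<forall>r\<in>R. \<forall>s\<in>R. \<forall>x\<in>carrier M. (r + s) \<odot>\<^bsub>M\<^esub> x = r \<odot>\<^bsub>M\<^esub> x \<oplus>\<^bsub>M\<^esub> s \<odot>\<^bsub>M\<^esub> x) \<and>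
     (\<forall>r\<in>R. \<forall>x\<in>carrier M. \<forall>y\<in>carrier M.
        r \<odot>\<^bsub>M\<^esub> (x \<oplus>\<^bsub>M\<^esub> y) = r \<odot>\<^bsub>M\<^esub> x \<oplus>\<^bsub>M\<^esub> r \<odot>\<^bsub>M\<^esub> y) \<and>
     (\<forall>r\<in>R. \<forall>s\<in>R. \<forall>x\<in>carrier M. (r * s) \<odot>\<^bsub>M\<^esub> x = s \<odot>\<^bsub>M\<^esub> (r \<odot>\<^bsub>M\<^esub> x)) \<and>
     (\<forall>x\<in>carrier M. 1 \<odot>\<^bsub>M\<^esub> x = x)"

definition simple_right_module :: "'a::ring_1 set \<Rightarrow> ('a, 'm) module \<Rightarrow> bool" where
  "simple_right_module R M \<longleftrightarrow> right_module R M \<and> carrier M \<noteq> {\<zero>\<^bsub>M\<^esub>} \<and>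
     (\<forall>U. is_submodule R U M \<longrightarrow> U = {\<zero>\<^bsub>M\<^esub>} \<or> U = carrier M)"

text \<open>
  Every simple right \<open>R\<close>-module is isomorphic to \<open>R/I\<close> for a maximal right ideal \<open>I\<close>, whose
  elements are subsets of \<open>R\<close>. So every isomorphism class is represented on the type
  \<^typ>\<open>'a set\<close>, and it suffices to count there.
\<close>

definition num_simple_modules :: "'a::ring_1 set \<Rightarrow> nat" where
  "num_simple_modules R =
     card ({M :: ('a, 'a set) module. simple_right_module R M} //
           {(M, N). simple_right_module R M \<and> simple_right_module R N \<and> mod_iso R M N})"

definition regular_right_module :: "'a::ring_1 set \<Rightarrow> ('a, 'a) module" where
  "regular_right_module R = mk_module R (+) 0 (\<lambda>r x. x * r)"

definition semisimple_module :: "'s set \<Rightarrow> ('s, 'm) module \<Rightarrow> bool" where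
  "semisimple_module A M \<longleftrightarrow>
     (\<forall>U. is_submodule A U M \<longrightarrow> (\<exists>V. is_submodule A V M \<and> internal_direct_sum M U V))"

definition semisimple_algebra :: "'a::ring_1 set \<Rightarrow> bool" where
  "semisimple_algebra R \<longleftrightarrow> semisimple_module R (regular_right_module R)"

text \<open>
  A module is projective if it is isomorphic to a direct summand of a free module. As \<open>M\<close> is a
  quotient of the free module on its own carrier, index sets in the type of \<open>M\<close> are no restriction.
\<close>

definition projective_right_module :: "'a::ring_1 set \<Rightarrow> ('a, 'm) module \<Rightarrow> bool" where
  "projective_right_module R M \<longleftrightarrow>
     right_module R M \<and>
     (\<exists>I :: 'm set. iso_to_summand R M (direct_power I (regular_right_module R)))"

definition annihilator :: "'s set \<Rightarrow> ('s, 'm) module \<Rightarrow> 's set" where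
  "annihilator A M = {s \<in> A. \<forall>x\<in>carrier M. s \<odot>\<^bsub>M\<^esub> x = \<zero>\<^bsub>M\<^esub>}"

text \<open>
  The quotient \<open>V/W\<close> of subgroups of an ambient abelian group, with elements the cosets
  \<open>v +o W\<close>. Sums of cosets are elementwise, and \<open>act s ` X + W\<close> is the coset of \<open>act s v\<close> for
  any \<open>v \<in> X\<close>, provided that \<open>act s\<close> is additive and maps \<open>W\<close> into itself.
\<close>

definition quotient_module ::
  "'v::ab_group_add set \<Rightarrow> 'v set \<Rightarrow> ('s \<Rightarrow> 'v \<Rightarrow> 'v) \<Rightarrow> ('s, 'v set) module" where
  "quotient_module V W act = mk_module {v +o W | v. v \<in> V} (+) W (\<lambda>s X. act s ` X + W)"


section \<open>Tensor powers\<close>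

text \<open>
  The \<open>n\<close>-fold tensor power of a \<open>'k\<close>-space \<open>V\<close> is the free \<open>'k\<close>-space on the \<open>n\<close>-tuples in \<open>V\<close>
  (lists of length \<open>n\<close>), modulo the multilinearity relations; for \<open>n = 0\<close> this is \<open>'k\<close> itself, with
  basis the empty list.
\<close>

definition fscale :: "'k::field \<Rightarrow> ('x \<Rightarrow>\<^sub>0 'k) \<Rightarrow> ('x \<Rightarrow>\<^sub>0 'k)" where
  "fscale c p = Poly_Mapping.map ((*) c) p"

definition pure :: "'x \<Rightarrow> ('x \<Rightarrow>\<^sub>0 'k::field)" where
  "pure x = Poly_Mapping.single x 1"

text \<open>Linear extension of \<open>f\<close> to formal sums, with values in a space with scalar multiplication
  \<open>sc\<close>.\<close>

definition lin_ext ::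
  "('k::field \<Rightarrow> 'v::ab_group_add \<Rightarrow> 'v) \<Rightarrow> ('x \<Rightarrow> 'v) \<Rightarrow> ('x \<Rightarrow>\<^sub>0 'k) \<Rightarrow> 'v" where
  "lin_ext sc f p = (\<Sum>x\<in>Poly_Mapping.keys p. sc (Poly_Mapping.lookup p x) (f x))"

definition juxtapose ::
  "('x list \<Rightarrow>\<^sub>0 'k::field) \<Rightarrow> ('x list \<Rightarrow>\<^sub>0 'k) \<Rightarrow> ('x list \<Rightarrow>\<^sub>0 'k)" where
  "juxtapose p q =
     lin_ext fscale (\<lambda>xs. lin_ext fscale (\<lambda>ys. pure (xs @ ys)) q) p"

definition formal_tensors :: "'x set \<Rightarrow> nat \<Rightarrow> ('x list \<Rightarrow>\<^sub>0 'k::field) set" where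
  "formal_tensors C n = {p. \<forall>xs\<in>Poly_Mapping.keys p. length xs = n \<and> set xs \<subseteq> C}"

definition multilinear_rels :: "('k::field, 'x) module \<Rightarrow> nat \<Rightarrow> ('x list \<Rightarrow>\<^sub>0 'k) set" where
  "multilinear_rels V n =
     {pure (us @ [x \<oplus>\<^bsub>V\<^esub> y] @ vs) - pure (us @ [x] @ vs) - pure (us @ [y] @ vs) | us vs x y.
        length us + 1 + length vs = n \<and> set us \<union> set vs \<union> {x, y} \<subseteq> carrier V} \<union>
     {pure (us @ [c \<odot>\<^bsub>V\<^esub> x] @ vs) - fscale c (pure (us @ [x] @ vs)) | us vs c x.
        length us + 1 + length vs = n \<and> set us \<union> set vs \<union> {x} \<subseteq> carrier V}"

definition tensor_null :: "('k::field, 'x) module \<Rightarrow> nat \<Rightarrow> ('x list \<Rightarrow>\<^sub>0 'k) set" where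
  "tensor_null V n = Modules.module.span fscale (multilinear_rels V n)"

definition tensor_class ::
  "('k::field, 'x) module \<Rightarrow> nat \<Rightarrow> ('x list \<Rightarrow>\<^sub>0 'k) \<Rightarrow> ('x list \<Rightarrow>\<^sub>0 'k) set" where
  "tensor_class V n p = p +o tensor_null V n"

definition tensor_power ::
  "('k::field, 'x) module \<Rightarrow> nat \<Rightarrow> ('k, ('x list \<Rightarrow>\<^sub>0 'k) set) module" where
  "tensor_power V n = quotient_module (formal_tensors (carrier V) n) (tensor_null V n) fscale"


section \<open>Depth of an algebra extension\<close>

definition underlying_space :: "('k::field \<Rightarrow> 'a::ring_1 \<Rightarrow> 'a) \<Rightarrow> ('k, 'a) module" where
  "underlying_space sc = mk_module UNIV (+) 0 sc"

definition balanced_rels :: "'a::ring_1 set \<Rightarrow> nat \<Rightarrow> ('a list \<Rightarrow>\<^sub>0 'k::field) set" where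
  "balanced_rels B n =
     {pure (us @ [x * b, y] @ vs) - pure (us @ [x, b * y] @ vs) | us vs x y b.
        length us + 2 + length vs = n \<and> b \<in> B}"

text \<open>
  The \<open>n\<close>-fold tensor product of the whole algebra \<open>'a\<close> over \<open>B\<close>, for \<open>n \<ge> 1\<close>, as a bimodule
  over \<open>'a\<close>.
\<close>

definition tensor_power_over ::
  "('k::field \<Rightarrow> 'a::ring_1 \<Rightarrow> 'a) \<Rightarrow> 'a set \<Rightarrow> nat
     \<Rightarrow> ('a + 'a, ('a list \<Rightarrow>\<^sub>0 'k) set) module" where
  "tensor_power_over sc B n =
     quotient_module
       (formal_tensors UNIV n)
       (Modules.module.span fscale
          (multilinear_rels (underlying_space sc) n \<union> balanced_rels B n))
       (\<lambda>s. case s of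
              Inl a \<Rightarrow> lin_ext fscale (\<lambda>xs. pure ((a * hd xs) # tl xs))
            | Inr a \<Rightarrow> lin_ext fscale (\<lambda>xs. pure (butlast xs @ [last xs * a])))"

definition regular_bimodule :: "'a::ring_1 set \<Rightarrow> ('a + 'a, 'a) module" where
  "regular_bimodule B =
     mk_module B (+) 0 (\<lambda>s x. case s of Inl a \<Rightarrow> a * x | Inr a \<Rightarrow> x * a)"

text \<open>
  The extension of \<open>B\<close> by the whole algebra \<open>'a\<close> has depth \<open>m\<close>. Depth 1 is separate because the
  zeroth tensor power over \<open>B\<close> is \<open>B\<close>.
\<close>

definition has_depth :: "('k::field \<Rightarrow> 'a::ring_1 \<Rightarrow> 'a) \<Rightarrow> 'a set \<Rightarrow> nat \<Rightarrow> bool" where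
  "has_depth sc B m \<longleftrightarrow>
     (m = 1 \<and> similar (bi_scalars B B) (tensor_power_over sc B 1) (regular_bimodule B)) \<or>
     (\<exists>n\<ge>1. m = 2 * n + 1 \<and>
        similar (bi_scalars B B) (tensor_power_over sc B (n + 1)) (tensor_power_over sc B n)) \<or>
     (\<exists>n\<ge>1. m = 2 * n \<and>
        (similar (bi_scalars B UNIV) (tensor_power_over sc B (n + 1)) (tensor_power_over sc B n) \<or>
         similar (bi_scalars UNIV B) (tensor_power_over sc B (n + 1)) (tensor_power_over sc B n)))"

text \<open>The value is \<open>\<infinity>\<close> if the extension has no finite depth.\<close>

definition min_depth :: "('k::field \<Rightarrow> 'a::ring_1 \<Rightarrow> 'a) \<Rightarrow> 'a set \<Rightarrow> enat" where
  "min_depth sc B = (INF m\<in>{m. 1 \<le> m \<and> has_depth sc B m}. enat m)"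


section \<open>Hopf algebras\<close>

text \<open>The ring structure of the Hopf algebra is that of the type \<open>'h\<close>; the comultiplication takes
  values in the second tensor power, i.e. in cosets of formal sums of pairs.\<close>

record (overloaded) ('k, 'h) hopf =
  hscale :: "'k \<Rightarrow> 'h \<Rightarrow> 'h"
  comult :: "'h \<Rightarrow> ('h list \<Rightarrow>\<^sub>0 'k) set"
  counit :: "'h \<Rightarrow> 'k"
  antipode :: "'h \<Rightarrow> 'h"

abbreviation hspace :: "('k::field, 'h::ring_1) hopf \<Rightarrow> ('k, 'h) module" where
  "hspace H \<equiv> underlying_space (hscale H)"

text \<open>A formal sum of pairs representing the coproduct of \<open>h\<close>; it is only used in expressions
  that do not depend on the choice.\<close>

definition comult_rep :: "('k::field, 'h::ring_1) hopf \<Rightarrow> 'h \<Rightarrow> ('h list \<Rightarrow>\<^sub>0 'k)" where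
  "comult_rep H h = (SOME p. p \<in> comult H h)"

text \<open>The Sweedler sum \<open>\<Sum> f h\<^sub>1 h\<^sub>2\<close>, to be used with \<open>f\<close> bilinear.\<close>

definition sweedler ::
  "('k::field, 'h::ring_1) hopf \<Rightarrow> ('k \<Rightarrow> 'v::ab_group_add \<Rightarrow> 'v) \<Rightarrow> ('h \<Rightarrow> 'h \<Rightarrow> 'v) \<Rightarrow> 'h \<Rightarrow> 'v"
  where
  "sweedler H sc f h = lin_ext sc (\<lambda>xs. f (xs ! 0) (xs ! 1)) (comult_rep H h)"

locale hopf_algebra = vector_space "hscale H"
  for H :: "('k::field, 'h::ring_1) hopf" +
  assumes scale_mult_left: "hscale H c x * y = hscale H c (x * y)"
    and scale_mult_right: "x * hscale H c y = hscale H c (x * y)"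
    and comult_closed: "comult H x \<in> carrier (tensor_power (hspace H) 2)"
    and comult_add:
      "comult H (x + y) = comult H x \<oplus>\<^bsub>tensor_power (hspace H) 2\<^esub> comult H y"
    and comult_scale:
      "comult H (hscale H c x) = c \<odot>\<^bsub>tensor_power (hspace H) 2\<^esub> comult H x"
    and counit_linear: "Vector_Spaces.linear (hscale H) (*) (counit H)"
    and coassoc:
      "tensor_class (hspace H) 3
         (sweedler H fscale (\<lambda>x1 x2. juxtapose (comult_rep H x1) (pure [x2])) x) =
       tensor_class (hspace H) 3
         (sweedler H fscale (\<lambda>x1 x2. juxtapose (pure [x1]) (comult_rep H x2)) x)"
    and counit_left: "sweedler H (hscale H) (\<lambda>x1 x2. hscale H (counit H x1) x2) x = x"
    and counit_right: "sweedler H (hscale H) (\<lambda>x1 x2. hscale H (counit H x2) x1) x = x"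
    and comult_mult:
      "comult H (x * y) =
         tensor_class (hspace H) 2
           (sweedler H fscale
              (\<lambda>x1 x2. sweedler H fscale (\<lambda>y1 y2. pure [x1 * y1, x2 * y2]) y) x)"
    and comult_one: "comult H 1 = tensor_class (hspace H) 2 (pure [1, 1])"
    and counit_mult: "counit H (x * y) = counit H x * counit H y"
    and counit_one: "counit H 1 = 1"
    and antipode_linear: "Vector_Spaces.linear (hscale H) (hscale H) (antipode H)"
    and antipode_left:
      "sweedler H (hscale H) (\<lambda>x1 x2. antipode H x1 * x2) x = hscale H (counit H x) 1"
    and antipode_right:
      "sweedler H (hscale H) (\<lambda>x1 x2. x1 * antipode H x2) x = hscale H (counit H x) 1"

definition fin_dim :: "('k::field, 'h::ring_1) hopf \<Rightarrow> bool" where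
  "fin_dim H \<longleftrightarrow> (\<exists>B. finite B \<and> Modules.module.span (hscale H) B = UNIV)"

definition hopf_subalgebra :: "('k::field, 'h::ring_1) hopf \<Rightarrow> 'h set \<Rightarrow> bool" where
  "hopf_subalgebra H R \<longleftrightarrow>
     Modules.module.subspace (hscale H) R \<and> 1 \<in> R \<and> (\<forall>r\<in>R. \<forall>s\<in>R. r * s \<in> R) \<and>
     (\<forall>r\<in>R. \<exists>p\<in>formal_tensors R 2. comult H r = tensor_class (hspace H) 2 p) \<and>
     (\<forall>r\<in>R. antipode H r \<in> R)"


section \<open>The quotient module and its tensor powers\<close>

definition augmentation_ideal :: "('k::field, 'h::ring_1) hopf \<Rightarrow> 'h set \<Rightarrow> 'h set" where
  "augmentation_ideal H R = {r \<in> R. counit H r = 0}"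

text \<open>The right \<open>H\<close>-module \<open>Q = H/R\<^sup>+H\<close>.\<close>

definition Qmod :: "('k::field, 'h::ring_1) hopf \<Rightarrow> 'h set \<Rightarrow> ('h, 'h set) module" where
  "Qmod H R =
     quotient_module UNIV
       (Modules.module.span (hscale H) {r * h | r h. r \<in> augmentation_ideal H R})
       (\<lambda>h x. x * h)"

definition restrict_to_field ::
  "('k::field, 'h::ring_1) hopf \<Rightarrow> ('h, 'm) module \<Rightarrow> ('k, 'm) module" where
  "restrict_to_field H M =
     mk_module (carrier M) (add M) \<zero>\<^bsub>M\<^esub> (\<lambda>c x. hscale H c 1 \<odot>\<^bsub>M\<^esub> x)"

text \<open>A formal sum of \<open>n\<close>-tuples representing \<open>h\<^sub>1 \<otimes> \<dots> \<otimes> h\<^sub>n\<close>; for \<open>n = 0\<close> it is the counit.\<close>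

primrec iterated_comult ::
  "('k::field, 'h::ring_1) hopf \<Rightarrow> nat \<Rightarrow> 'h \<Rightarrow> ('h list \<Rightarrow>\<^sub>0 'k)" where
  "iterated_comult H 0 h = Poly_Mapping.single [] (counit H h)"
| "iterated_comult H (Suc n) h =
     sweedler H fscale (\<lambda>h1 h2. juxtapose (pure [h1]) (iterated_comult H n h2)) h"

text \<open>
  The diagonal action
  \<open>(q\<^sub>1 \<otimes> \<dots> \<otimes> q\<^sub>n)\<cdot>h = \<Sum> q\<^sub>1\<cdot>h\<^sub>1 \<otimes> \<dots> \<otimes> q\<^sub>n\<cdot>h\<^sub>n\<close> on the tensor powers of a right \<open>H\<close>-module.
\<close>

definition diagonal_power ::
  "('k::field, 'h::ring_1) hopf \<Rightarrow> ('h, 'm) module \<Rightarrow> nat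
     \<Rightarrow> ('h, ('m list \<Rightarrow>\<^sub>0 'k) set) module" where
  "diagonal_power H M n =
     quotient_module
       (formal_tensors (carrier M) n)
       (tensor_null (restrict_to_field H M) n)
       (\<lambda>h. lin_ext fscale
              (\<lambda>qs. lin_ext fscale (\<lambda>hs. pure (map2 (\<lambda>q g. g \<odot>\<^bsub>M\<^esub> q) qs hs))
                      (iterated_comult H n h)))"

definition Qpower ::
  "('k::field, 'h::ring_1) hopf \<Rightarrow> 'h set \<Rightarrow> nat \<Rightarrow> ('h, ('h set list \<Rightarrow>\<^sub>0 'k) set) module" where
  "Qpower H R n = diagonal_power H (Qmod H R) n"

definition ann_power :: "('k::field, 'h::ring_1) hopf \<Rightarrow> 'h set \<Rightarrow> nat \<Rightarrow> 'h set" where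
  "ann_power H R n = annihilator R (Qpower H R n)"

definition ann_limit :: "('k::field, 'h::ring_1) hopf \<Rightarrow> 'h set \<Rightarrow> 'h set" where
  "ann_limit H R = (\<Inter>n\<in>{1..}. ann_power H R n)"

definition ell_Q :: "('k::field, 'h::ring_1) hopf \<Rightarrow> 'h set \<Rightarrow> nat" where
  "ell_Q H R = (LEAST n. ann_power H R n = ann_limit H R)"

definition conditionally_faithful :: "('k::field, 'h::ring_1) hopf \<Rightarrow> 'h set \<Rightarrow> bool" where
  "conditionally_faithful H R \<longleftrightarrow> ann_limit H R = {0}"

end

theory Submission
  imports Defs "HOL-Library.Function_Algebras"
begin

text \<open>
  The trivial module is a direct summand of a free one because \<open>Q\<close> is projective; this gives an
  integral of \<open>R\<close> with counit 1, and averaging with it (Maschke) makes \<open>R\<close> semisimple. If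
  \<open>I\<^sub>n \<subseteq> I\<^sub>m\<close>, averaging also shows that the tensor power \<open>Q\<^sup>m\<close> is a direct summand of a finite direct sum of
  copies of \<open>Q\<^sup>n\<close>. Tensoring with \<open>Q\<close>, the chain of the \<open>I\<^sub>n\<close> is
  constant as soon as it is stationary once. Hence every step \<open>n < \<ell>\<close> contributes a simple module
  that is annihilated by \<open>I\<^sub>n\<^sub>+\<^sub>1\<close> but not by \<open>I\<^sub>n\<close>, and these are pairwise non-isomorphic; and \<open>I\<^sub>\<ell> = 0\<close>
  makes every simple module a summand of \<open>Q\<^sup>\<ell>\<close>.

  For the depth, the tensor power of \<open>n + 1\<close> copies of \<open>H\<close> over \<open>R\<close> is isomorphic to \<open>H \<otimes> Q\<^sup>n\<close> as an
  \<open>H\<close>-\<open>R\<close>-bimodule, so that \<open>I\<^sub>\<ell> = I\<^sub>\<ell>\<^sub>+\<^sub>1\<close> gives depth \<open>2\<ell> + 2\<close>. Conversely, applying the counit to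
  the left factor of a bimodule similarity gives \<open>I\<^sub>n \<subseteq> I\<^sub>n\<^sub>+\<^sub>1\<close> for some \<open>n\<close>, hence \<open>\<ell> \<le> n\<close>. For
  depth conditions on \<open>R\<close>-\<open>H\<close>-bimodules the two sides are exchanged by the antipode, which is
  bijective in finite dimension.
\<close>

section \<open>Linear maps on formal sums\<close>

text \<open>Tensors are rarely manipulated directly. A linear map out of a tensor power is a
  function on words that is linear in each letter and respects the relations, with values in an
  arbitrary vector space \<open>sc\<close>; a homomorphism of tensor powers becomes an operator on
  such functions in the opposite direction. All computations are thus Sweedler sums of ordinary
  values. The indices in the lower bound come from two spaces of coinvariants: k \<otimes>_R (H
  \<otimes> Q^n) is Q^(n+1), while k \<otimes>_H (H \<otimes> Q^n) is Q^n. The former makes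
  R-R-similarity in depth 2n+1 compare I_n with I_(n+1); the latter makes the one-sided
  H-similarities in depth 2n compare I_(n-1) with I_n. Module homomorphisms are only additive by
  definition; linearity over k is recovered from the action of the multiples of 1. Injectivity of
  the antipode is derived from a nonzero integral on H, which is itself constructed as a trace, so
  that no invertibility of the antipode is presupposed.\<close>

abbreviation lin :: "('k::field \<Rightarrow> 'v::ab_group_add \<Rightarrow> 'v) \<Rightarrow> ('k \<Rightarrow> 'w::ab_group_add \<Rightarrow> 'w) \<Rightarrow> ('v \<Rightarrow> 'w) \<Rightarrow> bool"
  where "lin \<equiv> Vector_Spaces.linear"

lemma linI:
  assumes "vector_space s1" "vector_space s2"
    "\<And>x y. f (x + y) = f x + f y" "\<And>c x. f (s1 c x) = s2 c (f x)"
  shows "lin s1 s2 f"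
  using assms by (simp add: Vector_Spaces.linear_iff)

lemma linD:
  assumes "lin s1 s2 f"
  shows "vector_space s1" "vector_space s2" "f (x + y) = f x + f y" "f (s1 c x) = s2 c (f x)"
    "f 0 = 0" "f (x - y) = f x - f y" "f (sum g B) = (\<Sum>b\<in>B. f (g b))"
proof -
  interpret Vector_Spaces.linear s1 s2 f by fact
  show "vector_space s1" "vector_space s2" by unfold_locales
  show "f (x + y) = f x + f y" "f (s1 c x) = s2 c (f x)" "f 0 = 0" "f (x - y) = f x - f y"
     "f (sum g B) = (\<Sum>b\<in>B. f (g b))"
    by (auto simp: add scale diff sum)
qed

lemma lin_zero: "vector_space s1 \<Longrightarrow> vector_space s2 \<Longrightarrow> lin s1 s2 (\<lambda>x. 0)"
  by (auto intro!: linI simp: module_iff_vector_space[symmetric] module.scale_zero_right)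

lemma lin_id: "vector_space s \<Longrightarrow> lin s s (\<lambda>x. x)"
  by (auto intro!: linI)

lemma lin_plus:
  assumes "lin s1 s2 f" "lin s1 s2 g"
  shows "lin s1 s2 (\<lambda>x. f x + g x)"
proof -
  interpret vector_space s2 by (rule linD[OF assms(1)])
  show ?thesis by (rule linI) (use assms in \<open>auto simp: linD scale_right_distrib\<close>)
qed

lemma lin_minus:
  assumes "lin s1 s2 f" "lin s1 s2 g"
  shows "lin s1 s2 (\<lambda>x. f x - g x)"
proof -
  interpret vector_space s2 by (rule linD[OF assms(1)])
  show ?thesis by (rule linI) (use assms in \<open>auto simp: linD scale_right_diff_distrib\<close>)
qed

lemma lin_scale: "lin s1 s2 f \<Longrightarrow> lin s1 s2 (\<lambda>x. s2 c (f x))"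
proof -
  assume f: "lin s1 s2 f"
  interpret vector_space s2 by (rule linD[OF f])
  show ?thesis by (rule linI) (use f in \<open>auto simp: linD scale_right_distrib mult.commute\<close>)
qed

lemma lin_sum:
  "vector_space s1 \<Longrightarrow> vector_space s2 \<Longrightarrow> (\<And>i. i \<in> I \<Longrightarrow> lin s1 s2 (f i)) \<Longrightarrow> lin s1 s2 (\<lambda>x. \<Sum>i\<in>I. f i x)"
proof (induction I rule: infinite_finite_induct)
  case (insert x F)
  then show ?case by (simp add: lin_plus)
qed (auto intro: lin_zero)

lemma lin_comp: "lin s1 s2 f \<Longrightarrow> lin s2 s3 g \<Longrightarrow> lin s1 s3 (\<lambda>x. g (f x))"
  using Vector_Spaces.linear_compose[of s1 s2 f s3 g] by (simp add: o_def)

lemma lin_scale_left: "vector_space s \<Longrightarrow> lin s1 (*) f \<Longrightarrow> lin s1 s (\<lambda>x. s (f x) v)"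
  by (simp add: Vector_Spaces.linear_iff vector_space.vector_space_assms)

lemma vs_field: "vector_space ((*) :: 'k::field \<Rightarrow> 'k \<Rightarrow> 'k)"
  by unfold_locales (auto simp: algebra_simps)

text \<open>For a linear retraction \<open>g\<close> onto \<open>N\<close> the map
  \<open>x - g x\<close> has kernel exactly \<open>N\<close>. It stands in for the quotient map by
  \<open>N\<close> without leaving the type.\<close>

lemma exists_projection:
  assumes "vector_space sc" "Modules.module.subspace sc N"
  obtains p where "lin sc sc p" "\<And>x. p x = 0 \<longleftrightarrow> x \<in> N" "\<And>x. x - p x \<in> N"
proof -
  interpret vector_space sc by fact
  obtain g where g: "range g \<subseteq> N" "lin sc sc g" "\<And>v. v \<in> N \<Longrightarrow> g v = v"
  proof -
    interpret p: vector_space_pair sc sc by unfold_locales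
    have "\<exists>g. g ` UNIV \<subseteq> N \<and> lin sc sc g \<and> (\<forall>v\<in>(\<lambda>x. x) ` N. g v = v)"
      by (rule p.linear_exists_right_inverse_on) (use assms lin_id in auto)
    then show ?thesis using that by auto
  qed
  show ?thesis
  proof
    show "lin sc sc (\<lambda>x. x - g x)" using g(2) by (intro lin_minus lin_id assms)
    show "x - g x = 0 \<longleftrightarrow> x \<in> N" for x using g(1) g(3)[of x] by (metis eq_iff_diff_eq_0 rangeI subsetD)
    show "x - (x - g x) \<in> N" for x using g(1) by auto
  qed
qed

lemma lookup_fscale [simp]: "Poly_Mapping.lookup (fscale c p) x = c * Poly_Mapping.lookup p x"
  by (simp add: fscale_def map.rep_eq when_def)

lemma vs_fscale: "vector_space (fscale :: 'k::field \<Rightarrow> ('x \<Rightarrow>\<^sub>0 'k) \<Rightarrow> _)"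
  by unfold_locales (auto intro!: poly_mapping_eqI simp: lookup_add algebra_simps)

interpretation fs: vector_space "fscale :: 'k::field \<Rightarrow> ('x \<Rightarrow>\<^sub>0 'k) \<Rightarrow> _"
  by (rule vs_fscale)

lemma lookup_pure: "Poly_Mapping.lookup (pure x) y = (1 when x = y)"
  by (simp add: pure_def lookup_single)

lemma keys_pure [simp]: "Poly_Mapping.keys (pure x) = {x}"
  by (simp add: pure_def)

lemma pure_expand: "p = (\<Sum>x\<in>Poly_Mapping.keys p. fscale (Poly_Mapping.lookup p x) (pure x))"
proof (rule poly_mapping_eqI)
  fix k
  have "(\<Sum>x\<in>Poly_Mapping.keys p. Poly_Mapping.lookup p x * (1 when x = k)) =
     (\<Sum>x\<in>Poly_Mapping.keys p. if k = x then Poly_Mapping.lookup p x else 0)"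
    by (rule sum.cong) (auto simp: when_def)
  then show "Poly_Mapping.lookup p k = Poly_Mapping.lookup (\<Sum>x\<in>Poly_Mapping.keys p. fscale (Poly_Mapping.lookup p x) (pure x)) k"
    by (simp add: lookup_sum lookup_pure sum.delta in_keys_iff)
qed

lemma lin_ext_superset:
  assumes "vector_space sc" "finite K" "Poly_Mapping.keys p \<subseteq> K"
  shows "lin_ext sc f p = (\<Sum>x\<in>K. sc (Poly_Mapping.lookup p x) (f x))"
proof -
  interpret vector_space sc by fact
  show ?thesis unfolding lin_ext_def
    by (rule sum.mono_neutral_left) (use assms in \<open>auto simp: in_keys_iff\<close>)
qed

lemma lin_lin_ext:
  assumes "vector_space sc"
  shows "lin fscale sc (lin_ext sc f)"
proof -
  interpret vector_space sc by fact
  show ?thesis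
  proof (rule linI[OF vs_fscale assms])
    fix p q :: "'c \<Rightarrow>\<^sub>0 'a"
    let ?K = "Poly_Mapping.keys p \<union> Poly_Mapping.keys q"
    have "Poly_Mapping.keys (p + q) \<subseteq> ?K" by (rule Poly_Mapping.keys_add)
    then show "lin_ext sc f (p + q) = lin_ext sc f p + lin_ext sc f q"
      by (subst (1 2 3) lin_ext_superset[OF assms, of ?K])
        (auto simp: lookup_add scale_left_distrib sum.distrib)
  next
    fix c and p :: "'c \<Rightarrow>\<^sub>0 'a"
    have "Poly_Mapping.keys (fscale c p) \<subseteq> Poly_Mapping.keys p" by (auto simp: in_keys_iff)
    then show "lin_ext sc f (fscale c p) = sc c (lin_ext sc f p)"
      by (subst (1 2) lin_ext_superset[OF assms, of "Poly_Mapping.keys p"])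
        (auto simp: scale_sum_right)
  qed
qed

lemma lin_ext_pure [simp]: "vector_space sc \<Longrightarrow> lin_ext sc f (pure x) = f x"
  by (simp add: lin_ext_def lookup_pure vector_space.vector_space_assms)

lemma lin_ext_push: "lin sc sc' G \<Longrightarrow> G (lin_ext sc f p) = lin_ext sc' (\<lambda>x. G (f x)) p"
  by (simp add: lin_ext_def linD)

lemma lin_ext_unique: "lin fscale sc G \<Longrightarrow> G p = lin_ext sc (\<lambda>x. G (pure x)) p"
  by (subst pure_expand[of p]) (simp add: lin_ext_def linD)

lemma lin_ext_cong: "(\<And>x. x \<in> Poly_Mapping.keys p \<Longrightarrow> f x = g x) \<Longrightarrow> lin_ext sc f p = lin_ext sc g p"
  by (simp add: lin_ext_def)

lemma lin_ext_swap:
  assumes "vector_space sc"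
  shows "lin_ext sc (\<lambda>x. lin_ext sc (F x) q) p = lin_ext sc (\<lambda>y. lin_ext sc (\<lambda>x. F x y) p) q"
proof -
  interpret vector_space sc by fact
  show ?thesis unfolding lin_ext_def
    by (simp add: scale_sum_right) (subst sum.swap, simp add: mult.commute)
qed

lemma lin_ext_lin_fun:
  assumes "\<And>x. x \<in> Poly_Mapping.keys p \<Longrightarrow> lin s1 s2 (\<lambda>z. F z x)" "vector_space s1" "vector_space s2"
  shows "lin s1 s2 (\<lambda>z. lin_ext s2 (F z) p)"
  unfolding lin_ext_def using assms by (intro lin_sum lin_scale) auto

lemma lin_eq_on_span:
  assumes "lin s1 s2 f" "lin s1 s2 g" "\<And>x. x \<in> S \<Longrightarrow> f x = g x" "x \<in> Modules.module.span s1 S"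
  shows "f x = g x"
proof -
  interpret vector_space_pair s1 s2 using assms(1) by (simp add: linD vector_space_pair_def)
  show ?thesis using linear_eq_on[OF assms(1,2,4)] assms(3) by auto
qed

lemma lin_span_image:
  assumes "lin s1 s2 f"
  shows "f ` Modules.module.span s1 S = Modules.module.span s2 (f ` S)"
proof -
  interpret Vector_Spaces.linear s1 s2 f by fact
  show ?thesis by (rule span_image[symmetric])
qed

lemma formal_tensors_span:
  "formal_tensors C n = fs.span {pure w | w. length w = n \<and> set w \<subseteq> C}" (is "?L = fs.span ?S")
proof
  show "?L \<subseteq> fs.span ?S"
  proof
    fix p assume "p \<in> ?L"
    then show "p \<in> fs.span ?S"
      by (subst pure_expand, intro fs.span_sum fs.span_scale fs.span_base) (auto simp: formal_tensors_def)
  qed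
  have "fs.subspace ?L"
  proof (rule fs.subspaceI)
    show "x + y \<in> ?L" if "x \<in> ?L" "y \<in> ?L" for x y
      using that Poly_Mapping.keys_add[of x y] unfolding formal_tensors_def by blast
    have "Poly_Mapping.keys (fscale c x) \<subseteq> Poly_Mapping.keys x" for c and x :: "'a list \<Rightarrow>\<^sub>0 'b"
      by (auto simp: in_keys_iff)
    then show "fscale c x \<in> ?L" if "x \<in> ?L" for c x
      using that unfolding formal_tensors_def by blast
  qed (simp add: formal_tensors_def)
  then show "fs.span ?S \<subseteq> ?L"
    by (intro fs.span_minimal) (auto simp: formal_tensors_def)
qed

lemma subspace_formal_tensors: "fs.subspace (formal_tensors C n)"
  by (simp add: formal_tensors_span)

section \<open>Multilinear functions and Sweedler sums\<close>

text \<open>Exactly the conditions under which the linear extension of \<open>g\<close> vanishes on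
  \<open>multilinear_rels V n\<close>. Such functions represent the linear maps out of the tensor
  power.\<close>

definition multilinear_on ::
  "('k::field, 'x) module \<Rightarrow> ('k \<Rightarrow> 'v::ab_group_add \<Rightarrow> 'v) \<Rightarrow> nat \<Rightarrow> ('x list \<Rightarrow> 'v) \<Rightarrow> bool" where
  "multilinear_on V sc n g \<longleftrightarrow> vector_space sc \<and>
     (\<forall>us vs x y. length us + 1 + length vs = n \<and> set us \<union> set vs \<union> {x, y} \<subseteq> carrier V \<longrightarrow>
        g (us @ [x \<oplus>\<^bsub>V\<^esub> y] @ vs) = g (us @ [x] @ vs) + g (us @ [y] @ vs)) \<and>
     (\<forall>us vs c x. length us + 1 + length vs = n \<and> set us \<union> set vs \<union> {x} \<subseteq> carrier V \<longrightarrow>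
        g (us @ [c \<odot>\<^bsub>V\<^esub> x] @ vs) = sc c (g (us @ [x] @ vs)))"

lemma span_subset_kernel:
  assumes "lin s1 s2 f" "\<And>x. x \<in> S \<Longrightarrow> f x = 0" "p \<in> Modules.module.span s1 S"
  shows "f p = 0"
  using lin_eq_on_span[OF assms(1) lin_zero[OF linD(1,2)[OF assms(1)]] assms(2,3)] by simp

lemma multilinear_on_null:
  assumes "multilinear_on V sc n g" "p \<in> tensor_null V n"
  shows "lin_ext sc g p = 0"
proof (rule span_subset_kernel[of fscale sc])
  have sc: "vector_space sc" using assms(1) by (simp add: multilinear_on_def)
  then interpret vector_space sc .
  note l = linD[OF lin_lin_ext[OF sc, of g]]
  show "lin_ext sc g x = 0" if "x \<in> multilinear_rels V n" for x
    using that assms(1) unfolding multilinear_rels_def multilinear_on_def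
    by (auto simp: l lin_ext_pure[OF sc])
  show "lin fscale sc (lin_ext sc g)" by (rule lin_lin_ext[OF sc])
qed (use assms(2) in \<open>simp add: tensor_null_def\<close>)

lemma subspace_tensor_null: "fs.subspace (tensor_null V n)"
  by (simp add: tensor_null_def)

lemma pure_formal: "length w = n \<Longrightarrow> set w \<subseteq> C \<Longrightarrow> pure w \<in> formal_tensors C n"
  by (auto simp: formal_tensors_def)

lemma tensor_null_formal:
  assumes "\<And>x y. x \<in> carrier V \<Longrightarrow> y \<in> carrier V \<Longrightarrow> x \<oplus>\<^bsub>V\<^esub> y \<in> carrier V"
    "\<And>c x. x \<in> carrier V \<Longrightarrow> c \<odot>\<^bsub>V\<^esub> x \<in> carrier V"
  shows "tensor_null V n \<subseteq> formal_tensors (carrier V) n"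
  unfolding tensor_null_def
proof (rule fs.span_minimal[OF _ subspace_formal_tensors], rule subsetI)
  fix p assume "p \<in> multilinear_rels V n"
  then show "p \<in> formal_tensors (carrier V) n"
    unfolding multilinear_rels_def
    by (auto intro!: fs.subspace_diff[OF subspace_formal_tensors]
        fs.subspace_scale[OF subspace_formal_tensors] pure_formal simp: assms)
qed

text \<open>Converse of \<open>multilinear_on_null\<close>: a linear map that kills the relations
  restricts to a multilinear function on words. Applied to a projection along the relations it gives
  the universal multilinear function.\<close>

lemma multilinear_on_proj:
  assumes "lin fscale fscale p" "\<And>x. x \<in> tensor_null V n \<Longrightarrow> p x = 0"
  shows "multilinear_on V fscale n (\<lambda>w. p (pure w))"
  unfolding multilinear_on_def
proof (intro conjI allI impI vs_fscale)
  fix us vs x y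
  assume *: "length us + 1 + length vs = n \<and> set us \<union> set vs \<union> {x, y} \<subseteq> carrier V"
  have "pure (us @ [x \<oplus>\<^bsub>V\<^esub> y] @ vs) - pure (us @ [x] @ vs) - pure (us @ [y] @ vs) \<in> tensor_null V n"
    unfolding tensor_null_def multilinear_rels_def using * by (intro fs.span_base) blast
  from assms(2)[OF this] show "p (pure (us @ [x \<oplus>\<^bsub>V\<^esub> y] @ vs)) = p (pure (us @ [x] @ vs)) + p (pure (us @ [y] @ vs))"
    by (simp add: linD[OF assms(1)] algebra_simps)
next
  fix us vs c x
  assume *: "length us + 1 + length vs = n \<and> set us \<union> set vs \<union> {x} \<subseteq> carrier V"
  have "pure (us @ [c \<odot>\<^bsub>V\<^esub> x] @ vs) - fscale c (pure (us @ [x] @ vs)) \<in> tensor_null V n"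
    unfolding tensor_null_def multilinear_rels_def using * by (intro fs.span_base) blast
  from assms(2)[OF this] show "p (pure (us @ [c \<odot>\<^bsub>V\<^esub> x] @ vs)) = fscale c (p (pure (us @ [x] @ vs)))"
    by (simp add: linD[OF assms(1)] algebra_simps)
qed

context hopf_algebra
begin

abbreviation "hs \<equiv> hscale H"
abbreviation "eps \<equiv> counit H"
abbreviation "S \<equiv> antipode H"
abbreviation "sw \<equiv> sweedler H"

text \<open>The case of \<open>H\<close> itself, whose carrier is the whole type, so that membership
  conditions disappear and each slot is handled by the rules for \<open>lin\<close>.\<close>

definition mlin :: "('k \<Rightarrow> 'v::ab_group_add \<Rightarrow> 'v) \<Rightarrow> nat \<Rightarrow> ('h list \<Rightarrow> 'v) \<Rightarrow> bool" where
  "mlin sc n g \<longleftrightarrow> vector_space sc \<and>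
     (\<forall>us vs. length us + 1 + length vs = n \<longrightarrow> lin hs sc (\<lambda>x. g (us @ x # vs)))"

definition bil :: "('k \<Rightarrow> 'v::ab_group_add \<Rightarrow> 'v) \<Rightarrow> ('h \<Rightarrow> 'h \<Rightarrow> 'v) \<Rightarrow> bool" where
  "bil sc f \<longleftrightarrow> (\<forall>a. lin hs sc (f a)) \<and> (\<forall>b. lin hs sc (\<lambda>a. f a b))"

lemma hs_vs: "vector_space hs" by unfold_locales

lemma multilinear_on_hspace: "multilinear_on (hspace H) sc n g \<longleftrightarrow> mlin sc n g"
  unfolding multilinear_on_def mlin_def Vector_Spaces.linear_iff
  by (auto simp: underlying_space_def mk_module_def hs_vs)

lemma mlinD: "mlin sc n g \<Longrightarrow> vector_space sc"
  "mlin sc n g \<Longrightarrow> length us + 1 + length vs = n \<Longrightarrow> lin hs sc (\<lambda>x. g (us @ x # vs))"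
  by (auto simp: mlin_def)

lemma bilI: "(\<And>a. lin hs sc (\<lambda>b. f a b)) \<Longrightarrow> (\<And>b. lin hs sc (\<lambda>a. f a b)) \<Longrightarrow> bil sc f"
  by (simp add: bil_def)

lemma bil_vs: "bil sc f \<Longrightarrow> vector_space sc"
  unfolding bil_def using linD(2) by blast

lemma bil1: "bil sc f \<Longrightarrow> lin s hs g \<Longrightarrow> lin s sc (\<lambda>x. f (g x) b)"
  unfolding bil_def by (rule lin_comp) auto

lemma bil2: "bil sc f \<Longrightarrow> lin s hs g \<Longrightarrow> lin s sc (\<lambda>x. f a (g x))"
  unfolding bil_def by (rule lin_comp) auto

lemma mlin_bil:
  assumes "bil sc f"
  shows "mlin sc 2 (\<lambda>xs. f (xs ! 0) (xs ! 1))"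
proof -
  have "lin hs sc (\<lambda>x. f ((us @ x # vs) ! 0) ((us @ x # vs) ! 1))" if l: "length us + 1 + length vs = 2" for us vs
  proof (cases us)
    case Nil
    then obtain v where "vs = [v]" using l by (auto simp: length_Suc_conv)
    with Nil show ?thesis using assms by (simp add: bil_def)
  next
    case (Cons u us')
    then have "us = [u]" "vs = []" using l by auto
    then show ?thesis using assms by (simp add: bil_def)
  qed
  with assms show ?thesis by (auto simp: mlin_def bil_vs)
qed

lemma mlin_tri:
  assumes "\<And>a b. lin hs sc (f a b)" "\<And>a c. lin hs sc (\<lambda>b. f a b c)" "\<And>b c. lin hs sc (\<lambda>a. f a b c)"
  shows "mlin sc 3 (\<lambda>xs. f (xs ! 0) (xs ! 1) (xs ! 2))"
proof -
  have "lin hs sc (\<lambda>x. f ((us @ x # vs) ! 0) ((us @ x # vs) ! 1) ((us @ x # vs) ! 2))"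
    if l: "length us + 1 + length vs = 3" for us vs
  proof -
    consider (a) b c where "us = []" "vs = [b, c]" | (b) a c where "us = [a]" "vs = [c]"
      | (c) a b where "us = [a, b]" "vs = []"
    proof -
      have "length us = 0 \<and> length vs = 2 \<or> length us = 1 \<and> length vs = 1 \<or> length us = 2 \<and> length vs = 0"
        using l by linarith
      then show ?thesis using that by (auto simp: length_Suc_conv numeral_2_eq_2)
    qed
    then show ?thesis by cases (use assms in auto)
  qed
  moreover have "vector_space sc" using assms(1) by (rule linD)
  ultimately show ?thesis by (simp add: mlin_def)
qed

lemma mlin_null: "mlin sc n g \<Longrightarrow> p \<in> tensor_null (hspace H) n \<Longrightarrow> lin_ext sc g p = 0"
  using multilinear_on_null multilinear_on_hspace by blast

lemma tensor_class_eqD: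
  assumes "tensor_class V n p = tensor_class V n q"
  shows "p - q \<in> tensor_null V n"
proof -
  have "p \<in> p +o tensor_null V n"
    using set_plus_intro2[of 0 "tensor_null V n" p] fs.subspace_0[OF subspace_tensor_null] by auto
  then have "p \<in> q +o tensor_null V n" using assms by (simp add: tensor_class_def)
  then show ?thesis by (rule set_plus_imp_minus)
qed

text \<open>This makes Sweedler expressions independent of the chosen representative, and it turns
  axioms stated for tensor classes into identities between values.\<close>

lemma mlin_class_eq:
  assumes "mlin sc n g" "tensor_class (hspace H) n p = tensor_class (hspace H) n q"
  shows "lin_ext sc g p = lin_ext sc g q"
  using mlin_null[OF assms(1) tensor_class_eqD[OF assms(2)]]
  by (simp add: linD[OF lin_lin_ext[OF mlinD(1)[OF assms(1)]]])

lemma coset_eq: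
  assumes "\<And>x y. x \<in> N \<Longrightarrow> y \<in> N \<Longrightarrow> x - y \<in> N" "0 \<in> N"
  shows "a +o N = b +o N \<longleftrightarrow> a - b \<in> (N :: 'z::ab_group_add set)"
proof
  have m: "- x \<in> N" if "x \<in> N" for x using assms(1)[OF assms(2) that] by simp
  have p: "x + y \<in> N" if "x \<in> N" "y \<in> N" for x y using assms(1)[OF that(1) m[OF that(2)]] by simp
  show "a - b \<in> N" if "a +o N = b +o N"
    using set_plus_intro2[OF assms(2), of a] that by (auto dest: set_plus_imp_minus)
  assume ab: "a - b \<in> N"
  have "x \<in> a +o N \<longleftrightarrow> x \<in> b +o N" for x
  proof -
    have "x - a \<in> N \<longleftrightarrow> x - b \<in> N"
      using p[OF _ ab, of "x - a"] p[OF _ m[OF ab], of "x - b"] by (auto simp: algebra_simps)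
    then show ?thesis by (simp add: set_minus_plus)
  qed
  then show "a +o N = b +o N" by blast
qed

lemma null_sub: "x \<in> tensor_null V n \<Longrightarrow> y \<in> tensor_null V n \<Longrightarrow> x - y \<in> tensor_null V n"
  "0 \<in> tensor_null V n"
  by (auto simp: tensor_null_def fs.span_diff fs.span_zero)

text \<open>The coproduct is a nonempty coset, so the choice picks one of its elements; as the
  relations are themselves formal sums of pairs, so is the chosen element.\<close>

lemma comult_rep: "comult_rep H x \<in> formal_tensors UNIV 2" "comult H x = tensor_class (hspace H) 2 (comult_rep H x)"
proof -
  obtain v where v: "v \<in> formal_tensors UNIV 2" "comult H x = v +o tensor_null (hspace H) 2"
    using comult_closed[of x]
    by (auto simp: tensor_power_def quotient_module_def mk_module_def underlying_space_def)
  have "v \<in> comult H x" using v(2) set_plus_intro2[OF null_sub(2), of v] by auto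
  then have r: "comult_rep H x \<in> v +o tensor_null (hspace H) 2"
    unfolding comult_rep_def using v(2) by (metis someI)
  then have d: "comult_rep H x - v \<in> tensor_null (hspace H) 2" by (rule set_plus_imp_minus)
  show "comult H x = tensor_class (hspace H) 2 (comult_rep H x)"
    unfolding tensor_class_def v(2) using fs.subspace_neg[OF subspace_tensor_null d]
    by (simp add: coset_eq[OF null_sub])
  have "comult_rep H x - v \<in> formal_tensors UNIV 2"
    using tensor_null_formal[of "hspace H" 2] d by (auto simp: underlying_space_def mk_module_def)
  then show "comult_rep H x \<in> formal_tensors UNIV 2"
    using fs.subspace_add[OF subspace_formal_tensors _ v(1)] by force
qed

lemma comult_rep_keys: "xs \<in> Poly_Mapping.keys (comult_rep H x) \<Longrightarrow> length xs = 2"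
  using comult_rep(1)[of x] by (simp add: formal_tensors_def)

text \<open>A Sweedler sum may be computed from any representative of the coproduct: a sum of two
  others, the formula in \<open>comult_mult\<close>, or one with entries in a Hopf
  subalgebra.\<close>

lemma sw_rep:
  assumes "bil sc f" "comult H h = tensor_class (hspace H) 2 p"
  shows "sw sc f h = lin_ext sc (\<lambda>xs. f (xs ! 0) (xs ! 1)) p"
  unfolding sweedler_def
  by (rule mlin_class_eq[OF mlin_bil[OF assms(1)]]) (use assms(2) comult_rep(2) in simp)

lemma tensor_power_add:
  "tensor_class V n p \<oplus>\<^bsub>tensor_power V n\<^esub> tensor_class V n q = tensor_class V n (p + q)"
proof -
  have "tensor_null V n + tensor_null V n = tensor_null V n"
  proof
    show "tensor_null V n + tensor_null V n \<subseteq> tensor_null V n"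
      using fs.subspace_add[OF subspace_tensor_null] by (auto elim!: set_plus_elim)
    show "tensor_null V n \<subseteq> tensor_null V n + tensor_null V n"
      using null_sub(2) by (rule set_zero_plus2)
  qed
  then show ?thesis
    by (simp add: tensor_power_def quotient_module_def mk_module_def tensor_class_def set_plus_rearrange)
qed

lemma tensor_power_smult:
  "c \<odot>\<^bsub>tensor_power V n\<^esub> tensor_class V n p = tensor_class V n (fscale c p)"
proof -
  have "fscale c ` (p +o N) + N = fscale c p +o N" if N: "fs.subspace N" for N
  proof (intro equalityI subsetI)
    fix x assume "x \<in> fscale c ` (p +o N) + N"
    then obtain a b where "a \<in> N" "b \<in> N" "x = fscale c (p + a) + b"
      by (auto simp: elt_set_plus_def elim!: set_plus_elim)
    then show "x \<in> fscale c p +o N"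
      using fs.subspace_add[OF N fs.subspace_scale[OF N]]
      by (auto simp: elt_set_plus_def fs.scale_right_distrib add.assoc)
  next
    fix x assume "x \<in> fscale c p +o N"
    then obtain b where b: "b \<in> N" "x = fscale c p + b" by (auto simp: elt_set_plus_def)
    have "p \<in> p +o N" using set_plus_intro2[OF fs.subspace_0[OF N], of p] by simp
    with b show "x \<in> fscale c ` (p +o N) + N" by blast
  qed
  from this[OF subspace_tensor_null] show ?thesis
    by (simp add: tensor_power_def quotient_module_def mk_module_def tensor_class_def)
qed

lemma lin_sw:
  assumes "bil sc f"
  shows "lin hs sc (sw sc f)"
proof (rule linI[OF hs_vs bil_vs[OF assms]])
  note l = linD[OF lin_lin_ext[OF bil_vs[OF assms], of "\<lambda>xs. f (xs ! 0) (xs ! 1)"]]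
  fix x y c
  have "comult H (x + y) = tensor_class (hspace H) 2 (comult_rep H x + comult_rep H y)"
    unfolding comult_add comult_rep(2)[of x] comult_rep(2)[of y] by (rule tensor_power_add)
  from sw_rep[OF assms this] show "sw sc f (x + y) = sw sc f x + sw sc f y"
    by (simp only: l sweedler_def)
  have "comult H (hs c x) = tensor_class (hspace H) 2 (fscale c (comult_rep H x))"
    unfolding comult_scale comult_rep(2)[of x] by (rule tensor_power_smult)
  from sw_rep[OF assms this] show "sw sc f (hs c x) = sc c (sw sc f x)"
    by (simp only: l sweedler_def)
qed

lemma sw_push: "lin sc sc' G \<Longrightarrow> G (sw sc f h) = sw sc' (\<lambda>a b. G (f a b)) h"
  unfolding sweedler_def by (rule lin_ext_push)

text \<open>Both sides are the same finite double sum over the chosen representatives, which is why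
  \<open>F\<close> is arbitrary here.\<close>

lemma sw_swap:
  "vector_space sc \<Longrightarrow> sw sc (\<lambda>a b. sw sc (\<lambda>c d. F a b c d) y) x = sw sc (\<lambda>c d. sw sc (\<lambda>a b. F a b c d) x) y"
  unfolding sweedler_def by (rule lin_ext_swap)

lemma lin_sw_fun:
  assumes "\<And>a b. lin s1 sc (\<lambda>z. F z a b)"
  shows "lin s1 sc (\<lambda>z. sw sc (\<lambda>a b. F z a b) h)"
  unfolding sweedler_def using linD(1,2)[OF assms] assms by (intro lin_ext_lin_fun) auto

lemma lin_sw_arg:
  assumes "bil sc f" "lin s hs g"
  shows "lin s sc (\<lambda>z. sw sc f (g z))"
  using lin_comp[OF assms(2) lin_sw[OF assms(1)]] .

lemma lin_mult_left: "lin s hs f \<Longrightarrow> lin s hs (\<lambda>x. c * f x)"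
  by (auto intro!: linI hs_vs simp: linD distrib_left scale_mult_right)

lemma lin_mult_right: "lin s hs f \<Longrightarrow> lin s hs (\<lambda>x. f x * c)"
  by (auto intro!: linI hs_vs simp: linD distrib_right scale_mult_left)

lemma lin_S: "lin s hs f \<Longrightarrow> lin s hs (\<lambda>x. S (f x))"
  using lin_comp antipode_linear by blast

lemma lin_eps: "lin s hs f \<Longrightarrow> lin s (*) (\<lambda>x. eps (f x))"
  using lin_comp counit_linear by blast

text \<open>These rules follow the syntax of a Sweedler expression, so that linearity in a chosen
  variable is derived by repeated introduction.\<close>

lemmas lin_intros = lin_sw_arg lin_sw_fun lin_mult_left lin_mult_right lin_S lin_eps lin_scale_left lin_scale bilI
  lin_id hs_vs vs_field vs_fscale

text \<open>The linear extension of the trilinear function \<open>f\<close> is applied to the two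
  formal sums of triples in \<open>coassoc\<close>, which have the same class.\<close>

lemma sw_coassoc:
  assumes "\<And>a b. lin hs sc (f a b)" "\<And>a c. lin hs sc (\<lambda>b. f a b c)" "\<And>b c. lin hs sc (\<lambda>a. f a b c)"
  shows "sw sc (\<lambda>a u. sw sc (\<lambda>b c. f a b c) u) h = sw sc (\<lambda>u c. sw sc (\<lambda>a b. f a b c) u) h"
proof -
  have sc: "vector_space sc" using assms(1) by (rule linD)
  let ?g = "\<lambda>xs. f (xs ! 0) (xs ! 1) (xs ! 2)"
  note l = lin_lin_ext[OF sc, of ?g]
  have "lin_ext sc ?g (sweedler H fscale (\<lambda>x1 x2. juxtapose (comult_rep H x1) (pure [x2])) h) =
      sw sc (\<lambda>u c. sw sc (\<lambda>a b. f a b c) u) h"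
    unfolding sw_push[OF l] juxtapose_def lin_ext_push[OF l]
    by (simp add: lin_ext_pure[OF vs_fscale] lin_ext_pure[OF sc] sweedler_def)
      (intro lin_ext_cong, auto dest!: comult_rep_keys simp: nth_append)
  moreover have "lin_ext sc ?g (sweedler H fscale (\<lambda>x1 x2. juxtapose (pure [x1]) (comult_rep H x2)) h) =
      sw sc (\<lambda>a u. sw sc (\<lambda>b c. f a b c) u) h"
    unfolding sw_push[OF l] juxtapose_def lin_ext_push[OF l]
    by (simp add: lin_ext_pure[OF vs_fscale] lin_ext_push[OF l] lin_ext_pure[OF sc] sweedler_def)
  ultimately show ?thesis
    using mlin_class_eq[OF mlin_tri coassoc, of sc f h] assms by simp
qed

lemma sw_counit_left:
  assumes "lin hs sc g"
  shows "sw sc (\<lambda>a b. sc (eps a) (g b)) h = g h"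
  using arg_cong[OF counit_left, of g h] by (simp add: sw_push[OF assms] linD[OF assms])

lemma sw_counit_right:
  assumes "lin hs sc g"
  shows "sw sc (\<lambda>a b. sc (eps b) (g a)) h = g h"
  using arg_cong[OF counit_right, of g h] by (simp add: sw_push[OF assms] linD[OF assms])

lemma sw_antipode_left:
  assumes "lin hs sc g"
  shows "sw sc (\<lambda>a b. g (S a * b)) h = sc (eps h) (g 1)"
  using arg_cong[OF antipode_left, of g h] by (simp add: sw_push[OF assms] linD[OF assms])

lemma sw_antipode_right:
  assumes "lin hs sc g"
  shows "sw sc (\<lambda>a b. g (a * S b)) h = sc (eps h) (g 1)"
  using arg_cong[OF antipode_right, of g h] by (simp add: sw_push[OF assms] linD[OF assms])

lemma sw_mult:
  assumes "bil sc f"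
  shows "sw sc f (x * y) = sw sc (\<lambda>a b. sw sc (\<lambda>c d. f (a * c) (b * d)) y) x"
proof -
  note l = lin_lin_ext[OF bil_vs[OF assms], of "\<lambda>xs. f (xs ! 0) (xs ! 1)"]
  show ?thesis
    unfolding sw_rep[OF assms comult_mult] sw_push[OF l]
    by (simp add: lin_ext_pure[OF bil_vs[OF assms]])
qed

lemma sw_one:
  assumes "bil sc f"
  shows "sw sc f 1 = f 1 1"
  unfolding sw_rep[OF assms comult_one]
  by (simp add: lin_ext_pure[OF bil_vs[OF assms]])

end

section \<open>Antipodes of finite-dimensional Hopf algebras\<close>

context hopf_algebra
begin

text \<open>Uniqueness of convolution inverses: \<open>S (x * y)\<close> is a left inverse and
  \<open>S y * S x\<close> a right inverse of the product as a function of \<open>x\<close> and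
  \<open>y\<close>. The sum of \<open>S (x1 * y1) * (x2 * y2) * S y3 * S x3\<close> is contracted
  from either end.\<close>

lemma S_mult: "S (x * y) = S y * S x"
proof -
  let ?F = "\<lambda>x1 x2 x3 y1 y2 y3. S (x1 * y1) * (x2 * y2) * S y3 * S x3"
  let ?E = "sw hs (\<lambda>x1 u. sw hs (\<lambda>x2 x3. sw hs (\<lambda>y1 v. sw hs (?F x1 x2 x3 y1) v) y) u) x"
  have "sw hs (?F x1 x2 x3 y1) v = hs (eps v) (S (x1 * y1) * x2 * S x3)" for x1 x2 x3 y1 v
    using sw_antipode_right[of hs "\<lambda>z. S (x1 * y1) * x2 * z * S x3" v]
    by (simp add: lin_intros mult.assoc)
  moreover have "sw hs (\<lambda>y1 v. hs (eps v) (S (x1 * y1) * x2 * S x3)) y = S (x1 * y) * x2 * S x3" for x1 x2 x3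
    by (rule sw_counit_right) (intro lin_intros)
  moreover have "sw hs (\<lambda>x2 x3. S (x1 * y) * x2 * S x3) u = hs (eps u) (S (x1 * y))" for x1 u
    using sw_antipode_right[of hs "\<lambda>z. S (x1 * y) * z" u]
    by (simp add: lin_intros mult.assoc)
  moreover have "sw hs (\<lambda>x1 u. hs (eps u) (S (x1 * y))) x = S (x * y)"
    by (rule sw_counit_right) (intro lin_intros)
  ultimately have 1: "?E = S (x * y)" by simp
  have 2: "sw hs (\<lambda>x1 x2. sw hs (\<lambda>y1 y2. ?F x1 x2 x3 y1 y2 y3) v) u = hs (eps u) (hs (eps v) (S y3 * S x3))" for u x3 v y3
  proof -
    have "sw hs (\<lambda>x1 x2. sw hs (\<lambda>y1 y2. ?F x1 x2 x3 y1 y2 y3) v) u = sw hs (\<lambda>a b. S a * b * S y3 * S x3) (u * v)"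
      by (rule sw_mult[symmetric]) (intro lin_intros)
    also have "\<dots> = hs (eps (u * v)) (1 * S y3 * S x3)"
      by (rule sw_antipode_left) (intro lin_intros)
    finally show ?thesis by (simp add: counit_mult)
  qed
  have 3: "sw hs (\<lambda>v y3. hs (eps u) (hs (eps v) (S y3 * S x3))) y = hs (eps u) (S y * S x3)" for u x3
    unfolding scale_left_commute[of "eps u"] by (rule sw_counit_left) (intro lin_intros)
  have 4: "sw hs (\<lambda>u x3. hs (eps u) (S y * S x3)) x = S y * S x"
    by (rule sw_counit_left) (intro lin_intros)
  \<comment> \<open>Regrouped so that the first two legs of \<open>x\<close> and of \<open>y\<close>
    meet; by \<open>sw_mult\<close> they are the two legs of a single product.\<close>
  have "?E = sw hs (\<lambda>x1 u. sw hs (\<lambda>x2 x3. sw hs (\<lambda>v y3. sw hs (\<lambda>y1 y2. ?F x1 x2 x3 y1 y2 y3) v) y) u) x"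
    by (subst sw_coassoc[of hs, symmetric]) (intro lin_intros refl)+
  also have "\<dots> = sw hs (\<lambda>u x3. sw hs (\<lambda>x1 x2. sw hs (\<lambda>v y3. sw hs (\<lambda>y1 y2. ?F x1 x2 x3 y1 y2 y3) v) y) u) x"
    by (rule sw_coassoc) (intro lin_intros)+
  also have "\<dots> = sw hs (\<lambda>u x3. sw hs (\<lambda>v y3. sw hs (\<lambda>x1 x2. sw hs (\<lambda>y1 y2. ?F x1 x2 x3 y1 y2 y3) v) u) y) x"
    by (subst sw_swap[OF hs_vs]) rule
  also have "\<dots> = S y * S x" by (simp only: 2 3 4)
  finally show ?thesis using 1 by simp
qed

lemma S_one: "S 1 = 1"
  using antipode_left[of 1] by (subst (asm) sw_one) (auto simp: counit_one intro!: lin_intros)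

text \<open>The antipode reverses the coproduct. Again by uniqueness of convolution inverses, now of
  the coproduct as a map into \<open>H \<otimes> H\<close>: the coproduct of \<open>S x1\<close>,
  the tensor \<open>x2 \<otimes> x3\<close> and the tensor \<open>S x5 \<otimes> S x4\<close> are
  multiplied, and the result is contracted from the right in \<open>r1\<close> to \<open>r4\<close>
  and from the left in \<open>q1\<close> and \<open>q2\<close>.\<close>

lemma sw_S:
  assumes f: "bil sc f"
  shows "sw sc f (S x) = sw sc (\<lambda>a b. f (S b) (S a)) x"
proof -
  note sc = bil_vs[OF f]
  note li = lin_intros bil1[OF f] bil2[OF f]
  let ?F = "\<lambda>x1 x2 x3 x4 x5. sw sc (\<lambda>p q. f (p * x2 * S x5) (q * x3 * S x4)) (S x1)"
  let ?E = "sw sc (\<lambda>x1 u. sw sc (\<lambda>x2 w. sw sc (\<lambda>x3 z. sw sc (\<lambda>x4 x5. ?F x1 x2 x3 x4 x5) z) w) u) x"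
  have r1: "sw sc (\<lambda>x3 x4. ?F x1 x2 x3 x4 x5) t = sc (eps t) (sw sc (\<lambda>p q. f (p * x2 * S x5) q) (S x1))"
    for x1 x2 x5 t
    using sw_antipode_right[of sc "\<lambda>z. sw sc (\<lambda>p q. f (p * x2 * S x5) (q * z)) (S x1)" t]
    by (simp add: li mult.assoc)
  have r2: "sw sc (\<lambda>t x5. sc (eps t) (sw sc (\<lambda>p q. f (p * x2 * S x5) q) (S x1))) w =
      sw sc (\<lambda>p q. f (p * x2 * S w) q) (S x1)" for x1 x2 w
    by (rule sw_counit_left) (intro li)
  have r3: "sw sc (\<lambda>x2 w. sw sc (\<lambda>p q. f (p * x2 * S w) q) (S x1)) u = sc (eps u) (sw sc f (S x1))" for x1 u
    using sw_antipode_right[of sc "\<lambda>z. sw sc (\<lambda>p q. f (p * z) q) (S x1)" u]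
    by (simp add: li mult.assoc)
  have r4: "sw sc (\<lambda>x1 u. sc (eps u) (sw sc f (S x1))) x = sw sc f (S x)"
    by (rule sw_counit_right) (intro li f)
  have "?E = sw sc (\<lambda>x1 u. sw sc (\<lambda>x2 w. sw sc (\<lambda>t x5. sw sc (\<lambda>x3 x4. ?F x1 x2 x3 x4 x5) t) w) u) x"
    by (subst sw_coassoc[of sc, symmetric]) (intro li refl)+
  also have "\<dots> = sw sc f (S x)" by (simp only: r1 r2 r3 r4)
  finally have 1: "?E = sw sc f (S x)" .
  have q1: "sw sc (\<lambda>x1 t. sw sc (\<lambda>x2 x3. sw sc (\<lambda>x4 x5. ?F x1 x2 x3 x4 x5) z) t) v
     = sc (eps v) (sw sc (\<lambda>x4 x5. f (S x5) (S x4)) z)" for v z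
  proof -
    have s1: "sw sc (\<lambda>x2 x3. ?F x1 x2 x3 x4 x5) t = sw sc (\<lambda>a b. f (a * S x5) (b * S x4)) (S x1 * t)" for x1 t x4 x5
      by (subst sw_swap[OF sc], subst sw_mult) (intro li refl)+
    have s2: "sw sc (\<lambda>x1 t. sw sc (\<lambda>a b. f (a * S x5) (b * S x4)) (S x1 * t)) v =
        sc (eps v) (sw sc (\<lambda>a b. f (a * S x5) (b * S x4)) 1)" for x4 x5
      by (rule sw_antipode_left) (intro li)
    have s3: "sw sc (\<lambda>a b. f (a * S x5) (b * S x4)) 1 = f (S x5) (S x4)" for x4 x5
      by (subst sw_one) (auto intro!: li)
    have s4: "sw sc (\<lambda>x4 x5. sc (eps v) (f (S x5) (S x4))) z = sc (eps v) (sw sc (\<lambda>x4 x5. f (S x5) (S x4)) z)"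
      by (rule sw_push[symmetric]) (intro lin_scale lin_id sc)
    have "sw sc (\<lambda>x1 t. sw sc (\<lambda>x2 x3. sw sc (\<lambda>x4 x5. ?F x1 x2 x3 x4 x5) z) t) v
       = sw sc (\<lambda>x1 t. sw sc (\<lambda>x4 x5. sw sc (\<lambda>x2 x3. ?F x1 x2 x3 x4 x5) t) z) v"
      by (subst sw_swap[OF sc]) rule
    also have "\<dots> = sw sc (\<lambda>x4 x5. sw sc (\<lambda>x1 t. sw sc (\<lambda>x2 x3. ?F x1 x2 x3 x4 x5) t) v) z"
      by (rule sw_swap[OF sc])
    also have "\<dots> = sc (eps v) (sw sc (\<lambda>x4 x5. f (S x5) (S x4)) z)"
      by (simp only: s1 s2 s3 s4)
    finally show ?thesis .
  qed
  have q2: "sw sc (\<lambda>v z. sc (eps v) (sw sc (\<lambda>x4 x5. f (S x5) (S x4)) z)) x = sw sc (\<lambda>x4 x5. f (S x5) (S x4)) x"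
    by (rule sw_counit_left) (intro li)
  have "?E = sw sc (\<lambda>x1 u. sw sc (\<lambda>t z. sw sc (\<lambda>x2 x3. sw sc (\<lambda>x4 x5. ?F x1 x2 x3 x4 x5) z) t) u) x"
    by (subst sw_coassoc[of sc, symmetric]) (intro li refl)+
  also have "\<dots> = sw sc (\<lambda>v z. sw sc (\<lambda>x1 t. sw sc (\<lambda>x2 x3. sw sc (\<lambda>x4 x5. ?F x1 x2 x3 x4 x5) z) t) v) x"
    by (rule sw_coassoc) (intro li)+
  also have "\<dots> = sw sc (\<lambda>a b. f (S b) (S a)) x"
    by (simp only: q1 q2)
  finally show ?thesis using 1 by simp
qed

lemma dual_basis:
  assumes "fin_dim H"
  obtains B co where "finite B" "\<And>b. lin hs (*) (co b)" "\<And>x. (\<Sum>b\<in>B. hs (co b x) b) = x"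
proof -
  obtain B0 where B0: "finite B0" "span B0 = UNIV" using assms by (auto simp: fin_dim_def)
  obtain B where B: "B \<subseteq> B0" "independent B" "B0 \<subseteq> span B"
    using maximal_independent_subset by metis
  have sp: "span B = UNIV" using B(3) B0(2) by (metis span_mono span_span top.extremum_uniqueI)
  show ?thesis
  proof
    show "finite B" using B(1) B0(1) by (rule finite_subset)
    show "lin hs (*) (\<lambda>x. representation B x b)" for b
      by (rule linI[OF hs_vs vs_field]) (auto simp: representation_add representation_scale B(2) sp)
    show "(\<Sum>b\<in>B. hs (representation B x b) b) = x" for x
      by (rule sum_representation_eq) (use B(2) sp \<open>finite B\<close> in auto)
  qed
qed

lemma dual_basis_expand:
  assumes "\<And>x. (\<Sum>b\<in>B. hs (co b x) b) = x" "lin hs sc G"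
  shows "G x = (\<Sum>b\<in>B. sc (co b x) (G b))"
  using arg_cong[OF assms(1), of G x] by (simp add: linD[OF assms(2)])

text \<open>The integral is the trace functional \<open>x \<mapsto> Tr (h \<mapsto> x S\<^sup>2(h\<^sub>1) f(h\<^sub>2))\<close> for a suitable linear form \<open>f\<close>.\<close>

lemma exists_dual_integral:
  assumes "fin_dim H"
  obtains l x0 where "lin hs (*) l" "l x0 \<noteq> 0" "\<And>x. sw hs (\<lambda>a b. hs (l b) a) x = hs (l x) 1"
proof -
  obtain B co where B: "finite B" "\<And>b. lin hs (*) (co b)" "\<And>x. (\<Sum>b\<in>B. hs (co b x) b) = x"
    using dual_basis[OF assms] by blast
  have lco: "lin s (*) (\<lambda>x. co b (g x))" if "lin s hs g" for s g b
    using lin_comp[OF that B(2)] .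
  note ex = dual_basis_expand[OF B(3)]
  \<comment> \<open>\<open>f (V y)\<close> is the trace attached to \<open>f\<close>, so
    \<open>V\<close> treats all linear forms at once, and it suffices to find one \<open>y\<close>
    with \<open>V y\<close> nonzero.\<close>
  define V where "V y = (\<Sum>b\<in>B. sw hs (\<lambda>b1 b2. hs (co b (y * S (S b1))) b2) b)" for y
  note li0 = lin_intros lco lin_sum
  have V: "lin hs hs V"
    unfolding V_def by (intro li0)
  have main: "sw hs (\<lambda>x1 x2. hs (f (V x2)) x1) x = hs (f (V x)) 1" if f: "lin hs (*) f" for f x
  proof -
    note li = li0 lin_comp[OF _ f]
    have fV: "f (V y) = (\<Sum>b\<in>B. sw (*) (\<lambda>b1 b2. co b (y * S (S b1)) * f b2) b)" for y
      unfolding V_def linD(7)[OF f] by (intro sum.cong refl) (simp add: sw_push[OF f] linD[OF f])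
    \<comment> \<open>The trace term rewritten with the coproduct of the product
      \<open>x * S (S b2)\<close>. The extra factor of the form \<open>S (S p)\<close> on its first
      leg is cancelled by \<open>S b1\<close>, because \<open>S (S p) * S b1\<close> is
      \<open>S (b1 * S p)\<close>; this is what \<open>X1\<close> shows.\<close>
    let ?X = "\<lambda>b. sw hs (\<lambda>b1 u. sw hs (\<lambda>b2 b3. sw hs (\<lambda>w1 w2. hs (co b w2) (hs (f b3) (w1 * S b1))) (x * S (S b2))) u) b"
    have X1: "?X b = sw hs (\<lambda>x1 x2. sw hs (\<lambda>q b3. hs (co b (x2 * S (S q))) (hs (f b3) x1)) b) x" for b
    proof -
      have a1: "sw hs (\<lambda>w1 w2. hs (co b w2) (hs (f b3) (w1 * S b1))) (x * S (S b2)) =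
        sw hs (\<lambda>x1 x2. sw hs (\<lambda>p q. hs (co b (x2 * S (S q))) (hs (f b3) (x1 * S (S p) * S b1))) b2) x" for b1 b2 b3
        by (subst sw_mult, (intro li)+, subst sw_S, (intro li)+, subst sw_S, (intro li)+, rule refl)
      have a2: "sw hs (\<lambda>b1 p. sw hs (\<lambda>q b3. hs (co b (x2 * S (S q))) (hs (f b3) (x1 * S (S p) * S b1))) r) t
         = hs (eps t) (sw hs (\<lambda>q b3. hs (co b (x2 * S (S q))) (hs (f b3) x1)) r)" for x1 x2 r t
      proof -
        have "lin hs hs (\<lambda>z. sw hs (\<lambda>q b3. hs (co b (x2 * S (S q))) (hs (f b3) (x1 * S z))) r)"
          by (intro li)
        from sw_antipode_right[OF this, of t] show ?thesis
          by (simp add: S_mult S_one mult.assoc)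
      qed
      have a3: "sw hs (\<lambda>t r. hs (eps t) (sw hs (\<lambda>q b3. hs (co b (x2 * S (S q))) (hs (f b3) x1)) r)) b
         = sw hs (\<lambda>q b3. hs (co b (x2 * S (S q))) (hs (f b3) x1)) b" for x1 x2
        by (rule sw_counit_left) (intro li)
      let ?K = "\<lambda>x1 x2 b1 p q b3. hs (co b (x2 * S (S q))) (hs (f b3) (x1 * S (S p) * S b1))"
      have "?X b = sw hs (\<lambda>b1 u. sw hs (\<lambda>b2 b3. sw hs (\<lambda>x1 x2. sw hs (\<lambda>p q. ?K x1 x2 b1 p q b3) b2) x) u) b"
        by (simp only: a1)
      also have "\<dots> = sw hs (\<lambda>b1 u. sw hs (\<lambda>x1 x2. sw hs (\<lambda>b2 b3. sw hs (\<lambda>p q. ?K x1 x2 b1 p q b3) b2) u) x) b"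
        by (subst sw_swap[OF hs_vs]) rule
      also have "\<dots> = sw hs (\<lambda>x1 x2. sw hs (\<lambda>b1 u. sw hs (\<lambda>b2 b3. sw hs (\<lambda>p q. ?K x1 x2 b1 p q b3) b2) u) b) x"
        by (rule sw_swap[OF hs_vs])
      also have "\<dots> = sw hs (\<lambda>x1 x2. sw hs (\<lambda>b1 u. sw hs (\<lambda>p r. sw hs (\<lambda>q b3. ?K x1 x2 b1 p q b3) r) u) b) x"
        by (subst sw_coassoc) (intro li refl)+
      also have "\<dots> = sw hs (\<lambda>x1 x2. sw hs (\<lambda>t r. sw hs (\<lambda>b1 p. sw hs (\<lambda>q b3. ?K x1 x2 b1 p q b3) r) t) b) x"
        by (subst sw_coassoc) (intro li refl)+
      finally show ?thesis by (simp only: a2 a3)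
    qed
    have "sw hs (\<lambda>x1 x2. hs (f (V x2)) x1) x = (\<Sum>b\<in>B. ?X b)"
    proof -
      have "hs (f (V x2)) x1 = (\<Sum>b\<in>B. sw hs (\<lambda>q b3. hs (co b (x2 * S (S q))) (hs (f b3) x1)) b)" for x1 x2
      proof -
        have "hs (f (V x2)) x1 = (\<Sum>b\<in>B. hs (sw (*) (\<lambda>b1 b2. co b (x2 * S (S b1)) * f b2) b) x1)"
          unfolding fV by (rule scale_sum_left)
        also have "\<dots> = (\<Sum>b\<in>B. sw hs (\<lambda>q b3. hs (co b (x2 * S (S q))) (hs (f b3) x1)) b)"
          by (intro sum.cong refl) (subst sw_push[of "(*)" hs], auto intro!: lin_scale_left lin_id vs_field hs_vs)
        finally show ?thesis .
      qed
      then have "sw hs (\<lambda>x1 x2. hs (f (V x2)) x1) x =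
        sw hs (\<lambda>x1 x2. \<Sum>b\<in>B. sw hs (\<lambda>q b3. hs (co b (x2 * S (S q))) (hs (f b3) x1)) b) x" by simp
      also have "\<dots> = (\<Sum>b\<in>B. sw hs (\<lambda>x1 x2. sw hs (\<lambda>q b3. hs (co b (x2 * S (S q))) (hs (f b3) x1)) b) x)"
        unfolding sweedler_def lin_ext_def scale_sum_right by (subst sum.swap) rule
      finally show ?thesis by (simp only: X1)
    qed
    \<comment> \<open>Cyclicity of the trace: \<open>x * S (S b2)\<close> is expanded in the basis
      and the sums over \<open>b\<close> and \<open>c\<close> are exchanged. Then \<open>b3\<close>
      resums the coordinates and \<open>b4\<close> contracts the remaining antipode.\<close>
    also have "\<dots> = (\<Sum>c\<in>B. sw hs (\<lambda>b2 b3. hs (co c (x * S (S b2))) (hs (f b3) 1)) c)"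
    proof -
      let ?M = "\<lambda>c c1 y. sw hs (\<lambda>b1 u. sw hs (\<lambda>b2 b3. hs (co c (x * S (S b2))) (hs (f b3) (c1 * S b1))) u) y"
      have b1: "sw hs (\<lambda>w1 w2. hs (co b w2) (hs (f b3) (w1 * S b1))) (x * S (S b2)) =
         (\<Sum>c\<in>B. hs (co c (x * S (S b2))) (sw hs (\<lambda>c1 c2. hs (co b c2) (hs (f b3) (c1 * S b1))) c))" for b b1 b2 b3
        by (rule ex) (intro li)
      have sws: "sw hs (\<lambda>a b. \<Sum>c\<in>B. F a b c) y = (\<Sum>c\<in>B. sw hs (\<lambda>a b. F a b c) y)" for F y
        unfolding sweedler_def lin_ext_def scale_sum_right by (rule sum.swap)
      have sc: "hs k (sw hs F y) = sw hs (\<lambda>a b. hs k (F a b)) y" for k F y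
        by (rule sw_push) (intro lin_scale lin_id hs_vs)
      have b2: "?X b = (\<Sum>c\<in>B. sw hs (\<lambda>c1 c2. hs (co b c2) (?M c c1 b)) c)" for b
      proof -
        have "?X b = (\<Sum>c\<in>B. sw hs (\<lambda>b1 u. sw hs (\<lambda>b2 b3. sw hs (\<lambda>c1 c2. hs (co b c2) (hs (co c (x * S (S b2))) (hs (f b3) (c1 * S b1)))) c) u) b)"
          by (simp only: b1 sws sc scale_left_commute[of "co _ (x * _)"])
        also have "\<dots> = (\<Sum>c\<in>B. sw hs (\<lambda>b1 u. sw hs (\<lambda>c1 c2. sw hs (\<lambda>b2 b3. hs (co b c2) (hs (co c (x * S (S b2))) (hs (f b3) (c1 * S b1)))) u) c) b)"
          by (subst sw_swap[OF hs_vs]) rule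
        also have "\<dots> = (\<Sum>c\<in>B. sw hs (\<lambda>c1 c2. sw hs (\<lambda>b1 u. sw hs (\<lambda>b2 b3. hs (co b c2) (hs (co c (x * S (S b2))) (hs (f b3) (c1 * S b1)))) u) b) c)"
          by (subst sw_swap[OF hs_vs]) rule
        finally show ?thesis by (simp only: sc)
      qed
      have b3: "(\<Sum>b\<in>B. hs (co b c2) (?M c c1 b)) = ?M c c1 c2" for c c1 c2
        by (rule ex[symmetric]) (intro li)
      have b4: "sw hs (\<lambda>c1 c2. ?M c c1 c2) c = sw hs (\<lambda>b2 b3. hs (co c (x * S (S b2))) (hs (f b3) 1)) c" for c
      proof -
        have d1: "sw hs (\<lambda>c1 b1. sw hs (\<lambda>b2 b3. hs (co c (x * S (S b2))) (hs (f b3) (c1 * S b1))) u) t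
           = hs (eps t) (sw hs (\<lambda>b2 b3. hs (co c (x * S (S b2))) (hs (f b3) 1)) u)" for t u
          by (rule sw_antipode_right[of hs "\<lambda>z. sw hs (\<lambda>b2 b3. hs (co c (x * S (S b2))) (hs (f b3) z)) u" t])
             (intro li)
        have d2: "sw hs (\<lambda>t u. hs (eps t) (sw hs (\<lambda>b2 b3. hs (co c (x * S (S b2))) (hs (f b3) 1)) u)) c =
            sw hs (\<lambda>b2 b3. hs (co c (x * S (S b2))) (hs (f b3) 1)) c"
          by (rule sw_counit_left) (intro li)
        have "sw hs (\<lambda>c1 c2. ?M c c1 c2) c = sw hs (\<lambda>t u. sw hs (\<lambda>c1 b1. sw hs (\<lambda>b2 b3. hs (co c (x * S (S b2))) (hs (f b3) (c1 * S b1))) u) t) c"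
          by (rule sw_coassoc) (intro li)+
        then show ?thesis by (simp only: d1 d2)
      qed
      have "(\<Sum>b\<in>B. ?X b) = (\<Sum>c\<in>B. sw hs (\<lambda>c1 c2. \<Sum>b\<in>B. hs (co b c2) (?M c c1 b)) c)"
        unfolding b2 sws by (rule sum.swap)
      then show ?thesis by (simp only: b3 b4)
    qed
    also have "\<dots> = hs (f (V x)) 1"
      unfolding fV scale_sum_left
      by (intro sum.cong refl, subst sw_push[of "(*)" hs]) (auto intro!: lin_scale_left lin_id vs_field hs_vs)
    finally show ?thesis .
  qed
  \<comment> \<open>Since \<open>S b2 * S (S b1)\<close> is \<open>S (S b1 * b2)\<close>, the sum
    over the basis of \<open>co b (S b2 * S (S b1))\<close> times \<open>b3\<close> is 1. Expanding
    \<open>S b2\<close> in the basis instead expresses 1 through the values \<open>V c\<close>,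
    which therefore cannot all vanish.\<close>
  have "\<exists>y. V y \<noteq> 0"
  proof (rule ccontr)
    assume "\<not> (\<exists>y. V y \<noteq> 0)"
    then have V0: "V y = 0" for y by blast
    let ?g = "\<lambda>c u. sw hs (\<lambda>b2 b3. hs (co c (S b2)) b3) u"
    have e1: "sw hs (\<lambda>b1 u. sw hs (\<lambda>b2 b3. hs (co b (S b2 * S (S b1))) b3) u) b = hs (co b 1) b" for b
    proof -
      have f1: "sw hs (\<lambda>b1 b2. hs (co b (S b2 * S (S b1))) b3) t = hs (eps t) (hs (co b 1) b3)" for t b3
      proof -
        have "lin hs hs (\<lambda>z. hs (co b (S z)) b3)" by (intro li0)
        from sw_antipode_left[OF this, of t] show ?thesis by (simp add: S_mult S_one)
      qed
      have f2: "sw hs (\<lambda>t b3. hs (eps t) (hs (co b 1) b3)) b = hs (co b 1) b"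
        by (rule sw_counit_left) (intro li0)
      have "sw hs (\<lambda>b1 u. sw hs (\<lambda>b2 b3. hs (co b (S b2 * S (S b1))) b3) u) b =
         sw hs (\<lambda>t b3. sw hs (\<lambda>b1 b2. hs (co b (S b2 * S (S b1))) b3) t) b"
        by (rule sw_coassoc) (intro li0)+
      then show ?thesis by (simp only: f1 f2)
    qed
    have sws: "sw hs (\<lambda>a b. \<Sum>c\<in>B. F a b c) y = (\<Sum>c\<in>B. sw hs (\<lambda>a b. F a b c) y)" for F y
      unfolding sweedler_def lin_ext_def scale_sum_right by (rule sum.swap)
    have e2: "sw hs (\<lambda>b2 b3. hs (co b (S b2 * S (S b1))) b3) u = (\<Sum>c\<in>B. hs (co b (c * S (S b1))) (?g c u))" for b b1 u
    proof -
      have "hs (co b (S b2 * S (S b1))) b3 = (\<Sum>c\<in>B. hs (co c (S b2)) (hs (co b (c * S (S b1))) b3))" for b2 b3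
        by (rule ex) (intro li0)
      then have "sw hs (\<lambda>b2 b3. hs (co b (S b2 * S (S b1))) b3) u =
         (\<Sum>c\<in>B. sw hs (\<lambda>b2 b3. hs (co b (c * S (S b1))) (hs (co c (S b2)) b3)) u)"
        by (simp only: sws scale_left_commute[of "co _ (S _)"])
      also have "\<dots> = (\<Sum>c\<in>B. hs (co b (c * S (S b1))) (?g c u))"
        by (intro sum.cong refl sw_push[symmetric]) (intro lin_scale lin_id hs_vs)
      finally show ?thesis .
    qed
    have g: "lin hs hs (?g c)" for c by (intro li0)
    have gV: "?g c (V c) = (\<Sum>b\<in>B. sw hs (\<lambda>b1 u. hs (co b (c * S (S b1))) (?g c u)) b)" for c
      unfolding V_def linD(7)[OF g] by (intro sum.cong refl) (simp only: sw_push[OF g] linD[OF g])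
    have "1 = (\<Sum>b\<in>B. hs (co b 1) b)" using B(3) by simp
    also have "\<dots> = (\<Sum>b\<in>B. sw hs (\<lambda>b1 u. \<Sum>c\<in>B. hs (co b (c * S (S b1))) (?g c u)) b)"
      by (simp only: e1[symmetric] e2)
    also have "\<dots> = (\<Sum>c\<in>B. ?g c (V c))"
      unfolding sws gV by (rule sum.swap)
    also have "\<dots> = 0" by (simp only: V0 linD(5)[OF g]) simp
    finally show False by simp
  qed
  then obtain y where y: "V y \<noteq> 0" by blast
  have "\<exists>b. co b (V y) \<noteq> 0"
  proof (rule ccontr)
    assume "\<not> (\<exists>b. co b (V y) \<noteq> 0)"
    then have "V y = 0" using B(3)[of "V y"] by simp
    with y show False by simp
  qed
  then obtain b where b: "co b (V y) \<noteq> 0" by blast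
  show ?thesis
    by (rule that[of "\<lambda>x. co b (V x)" y]) (use b main[OF B(2)] lin_comp[OF V B(2)] in auto)
qed

text \<open>The integral \<open>l\<close> gives \<open>id\<close>: the sum of
  \<open>l (x * S h1)\<close> times \<open>h2\<close> depends on \<open>h\<close> only through
  \<open>S h\<close>, so it vanishes for all \<open>x\<close> if \<open>S h = 0\<close>. With three
  legs and \<open>x0 * S (S h2)\<close> in place of \<open>x\<close>, the antipodes contract and
  \<open>l x0\<close> times \<open>h\<close> remains.\<close>

lemma inj_antipode:
  assumes "fin_dim H"
  shows "inj S"
proof -
  obtain B co where B: "finite B" "\<And>b. lin hs (*) (co b)" "\<And>x. (\<Sum>b\<in>B. hs (co b x) b) = x"
    using dual_basis[OF assms] by blast
  have lco: "lin s (*) (\<lambda>x. co b (g x))" if "lin s hs g" for s g b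
    using lin_comp[OF that B(2)] .
  obtain l x0 where l: "lin hs (*) l" "l x0 \<noteq> 0" "\<And>x. sw hs (\<lambda>a b. hs (l b) a) x = hs (l x) 1"
    by (rule exists_dual_integral[OF assms]) blast
  note ex = dual_basis_expand[OF B(3)]
  note li = lin_intros lco lin_comp[OF _ l(1)]
  have id: "sw hs (\<lambda>h1 h2. hs (l (x * S h1)) h2) h = sw hs (\<lambda>x1 x2. hs (l (x2 * S h)) x1) x" for x h
  proof -
    have a1: "hs (l (x * S h1)) h2 = sw hs (\<lambda>x1 x2. sw hs (\<lambda>a b. hs (l (x2 * S a)) (x1 * S b * h2)) h1) x" for h1 h2
    proof -
      have "hs (l (x * S h1)) h2 = hs (l (x * S h1)) 1 * h2" by (simp add: scale_mult_left)
      also have "\<dots> = sw hs (\<lambda>a b. hs (l b) (a * h2)) (x * S h1)"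
        unfolding l(3)[symmetric]
        by (subst sw_push[of hs hs "\<lambda>z. z * h2"]) (auto intro!: li simp: scale_mult_left)
      also have "\<dots> = sw hs (\<lambda>x1 x2. sw hs (\<lambda>a b. hs (l (x2 * S a)) (x1 * S b * h2)) h1) x"
        by (subst sw_mult, (intro li)+, subst sw_S, (intro li)+, rule refl)
      finally show ?thesis .
    qed
    have a2: "sw hs (\<lambda>b h2. hs (l (x2 * S a)) (x1 * S b * h2)) t = hs (eps t) (hs (l (x2 * S a)) x1)" for a t x1 x2
      using sw_antipode_left[of hs "\<lambda>z. hs (l (x2 * S a)) (x1 * z)" t] by (simp add: li mult.assoc)
    have a3: "sw hs (\<lambda>a t. hs (eps t) (hs (l (x2 * S a)) x1)) h = hs (l (x2 * S h)) x1" for x1 x2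
      by (rule sw_counit_right) (intro li)
    have "sw hs (\<lambda>h1 h2. hs (l (x * S h1)) h2) h =
       sw hs (\<lambda>h1 h2. sw hs (\<lambda>x1 x2. sw hs (\<lambda>a b. hs (l (x2 * S a)) (x1 * S b * h2)) h1) x) h"
      by (simp only: a1)
    also have "\<dots> = sw hs (\<lambda>x1 x2. sw hs (\<lambda>h1 h2. sw hs (\<lambda>a b. hs (l (x2 * S a)) (x1 * S b * h2)) h1) h) x"
      by (rule sw_swap[OF hs_vs])
    also have "\<dots> = sw hs (\<lambda>x1 x2. sw hs (\<lambda>a t. sw hs (\<lambda>b h2. hs (l (x2 * S a)) (x1 * S b * h2)) t) h) x"
      by (subst sw_coassoc) (intro li refl)+
    finally show ?thesis by (simp only: a2 a3)
  qed
  have "h = 0" if h: "S h = 0" for h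
  proof -
    let ?Z = "\<lambda>y. sw hs (\<lambda>h1 h2. hs (l (y * S h1)) h2) h"
    have Z0: "?Z y = 0" for y
      unfolding id h by (simp add: linD(5)[OF l(1)] sweedler_def lin_ext_def)
    let ?g = "\<lambda>c t. sw hs (\<lambda>h2 h3. hs (co c (x0 * S (S h2))) h3) t"
    have g: "lin hs hs (?g c)" for c by (intro li)
    have sws: "sw hs (\<lambda>a b. \<Sum>c\<in>B. F a b c) y = (\<Sum>c\<in>B. sw hs (\<lambda>a b. F a b c) y)" for F y
      unfolding sweedler_def lin_ext_def scale_sum_right by (rule sum.swap)
    \<comment> \<open>The factor \<open>x0 * S (S h2)\<close> varies with the legs of
      \<open>h\<close>; its expansion in the basis separates it from the sum \<open>?Z\<close>,
      which vanishes for each fixed argument.\<close>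
    have e2: "sw hs (\<lambda>h2 h3. hs (l (x0 * S (S h2) * S h1)) h3) t = (\<Sum>c\<in>B. hs (l (c * S h1)) (?g c t))" for h1 t
    proof -
      have "hs (l (x0 * S (S h2) * S h1)) h3 = (\<Sum>c\<in>B. hs (co c (x0 * S (S h2))) (hs (l (c * S h1)) h3))" for h2 h3
        by (rule ex) (intro li)
      then have "sw hs (\<lambda>h2 h3. hs (l (x0 * S (S h2) * S h1)) h3) t =
         (\<Sum>c\<in>B. sw hs (\<lambda>h2 h3. hs (l (c * S h1)) (hs (co c (x0 * S (S h2))) h3)) t)"
        by (simp only: sws scale_left_commute[of "co _ (x0 * _)"])
      also have "\<dots> = (\<Sum>c\<in>B. hs (l (c * S h1)) (?g c t))"
        by (intro sum.cong refl sw_push[symmetric]) (intro lin_scale lin_id hs_vs)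
      finally show ?thesis .
    qed
    have f1: "sw hs (\<lambda>h1 h2. hs (l (x0 * S (S h2) * S h1)) h3) t = hs (eps t) (hs (l x0) h3)" for t h3
    proof -
      have "lin hs hs (\<lambda>z. hs (l (x0 * S z)) h3)" by (intro li)
      from sw_antipode_right[OF this, of t] show ?thesis by (simp add: S_mult S_one mult.assoc)
    qed
    have f2: "sw hs (\<lambda>t h3. hs (eps t) (hs (l x0) h3)) h = hs (l x0) h"
      by (rule sw_counit_left) (intro li)
    have "hs (l x0) h = sw hs (\<lambda>t h3. sw hs (\<lambda>h1 h2. hs (l (x0 * S (S h2) * S h1)) h3) t) h"
      by (simp only: f1 f2)
    also have "\<dots> = sw hs (\<lambda>h1 t. sw hs (\<lambda>h2 h3. hs (l (x0 * S (S h2) * S h1)) h3) t) h"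
      by (rule sw_coassoc[symmetric]) (intro li)+
    also have "\<dots> = (\<Sum>c\<in>B. sw hs (\<lambda>h1 t. hs (l (c * S h1)) (?g c t)) h)"
      by (simp only: e2 sws)
    also have "\<dots> = (\<Sum>c\<in>B. ?g c (?Z c))"
      by (intro sum.cong refl) (simp only: sw_push[OF g] linD(4)[OF g])
    also have "\<dots> = 0" by (simp only: Z0 linD(5)[OF g]) simp
    finally show "h = 0" using l(2) by simp
  qed
  then have "x = y" if "S x = S y" for x y
    using that linD(6)[OF antipode_linear, of x y] by (metis eq_iff_diff_eq_0)
  then show ?thesis by (rule injI)
qed

text \<open>An injective linear map preserves dimension. Applied to the antipode on \<open>H\<close>
  and on the Hopf subalgebra.\<close>

lemma surj_on_subspace:
  assumes "fin_dim H" "subspace R" "lin hs hs f" "inj f" "f ` R \<subseteq> R"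
  shows "f ` R = R"
proof -
  obtain B0 where B0: "finite B0" "span B0 = UNIV" using assms(1) by (auto simp: fin_dim_def)
  obtain B where B: "B \<subseteq> B0" "independent B" "B0 \<subseteq> span B"
    using maximal_independent_subset by metis
  have sp: "span B = UNIV" using B(3) B0(2) by (metis span_mono span_span top.extremum_uniqueI)
  interpret fd: finite_dimensional_vector_space hs B
    by unfold_locales (use B sp B0 finite_subset in auto)
  interpret l: Vector_Spaces.linear hs hs f by fact
  show ?thesis
  proof (rule fd.subspace_dim_equal)
    show "subspace (f ` R)" using assms(2) by (rule l.subspace_image)
    obtain C where C: "finite C" "C \<subseteq> R" "independent C" "span C = R" "card C = dim R"
      using fd.basis_subspace_exists[OF assms(2)] by blast
    have "independent (f ` C)"
      using C(3) assms(4) by (intro l.independent_injective_image) (auto intro: inj_on_subset)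
    moreover have "card (f ` C) = dim R"
      using C(5) assms(4) by (simp add: card_image inj_on_subset)
    ultimately show "dim R \<le> dim (f ` R)"
      using C(2) fd.independent_card_le_dim[of "f ` C" "f ` R"] by auto
  qed (use assms in auto)
qed

end

section \<open>The diagonal action on multilinear functions\<close>

context hopf_algebra
begin

text \<open>\<open>dact sc w g h\<close> is the value of \<open>g\<close> at \<open>w\<cdot>h\<close>, for the diagonal right action on the word \<open>w\<close>.\<close>

primrec dact :: "('k \<Rightarrow> 'v::ab_group_add \<Rightarrow> 'v) \<Rightarrow> 'h list \<Rightarrow> ('h list \<Rightarrow> 'v) \<Rightarrow> 'h \<Rightarrow> 'v" where
  "dact sc [] g h = sc (eps h) (g [])"
| "dact sc (x # w) g h = sw sc (\<lambda>a u. dact sc w (\<lambda>v. g ((x * a) # v)) u) h"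

text \<open>Connects \<open>dact\<close> with the iterated coproduct in
  \<open>diagonal_power\<close>; from here on the action is handled through the recursion of
  \<open>dact\<close>, each step of which is a Sweedler sum.\<close>

lemma lin_ext_iterated_comult:
  assumes sc: "vector_space sc"
  shows "lin_ext sc (\<lambda>hs. g (map2 (*) w hs)) (iterated_comult H (length w) h) = dact sc w g h"
proof (induction w arbitrary: g h)
  case Nil
  have "Poly_Mapping.single ([] :: 'h list) (eps h) = fscale (eps h) (pure [])"
    by (rule poly_mapping_eqI) (simp add: lookup_single lookup_pure when_def)
  then show ?case by (simp only: iterated_comult.simps list.size dact.simps linD[OF lin_lin_ext[OF sc]] lin_ext_pure[OF sc]) simp
next
  case (Cons x w)
  note l = lin_lin_ext[OF sc]
  have "lin_ext sc (\<lambda>hs. g ((x * a) # map2 (*) w hs)) (iterated_comult H (length w) b) =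
      dact sc w (\<lambda>v. g ((x * a) # v)) b" for a b
    by (rule Cons.IH)
  then show ?case
    by (simp add: sw_push[OF l] juxtapose_def lin_ext_push[OF l] lin_ext_pure[OF vs_fscale] lin_ext_pure[OF sc])
qed

text \<open>Functionals \<open>F\<close> given by evaluation on a formal sum; such \<open>F\<close> commute with all linear maps.\<close>

definition comb :: "('k \<Rightarrow> 'v::ab_group_add \<Rightarrow> 'v) \<Rightarrow> nat \<Rightarrow> (('h list \<Rightarrow> 'v) \<Rightarrow> 'v) \<Rightarrow> bool" where
  "comb sc n F \<longleftrightarrow> vector_space sc \<and> (\<exists>p\<in>formal_tensors UNIV n. \<forall>g. F g = lin_ext sc g p)"

lemma comb_eval: "vector_space sc \<Longrightarrow> length w = n \<Longrightarrow> comb sc n (\<lambda>g. g w)"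
  unfolding comb_def by (intro conjI bexI[of _ "pure w"]) (auto simp: pure_formal)

lemma comb_lin_ext:
  assumes "vector_space sc" "\<And>x. x \<in> Poly_Mapping.keys p \<Longrightarrow> comb sc n (F x)"
  shows "comb sc n (\<lambda>g. lin_ext sc (\<lambda>x. F x g) p)"
proof -
  obtain P where P: "\<And>x. x \<in> Poly_Mapping.keys p \<Longrightarrow> P x \<in> formal_tensors UNIV n"
    "\<And>x g. x \<in> Poly_Mapping.keys p \<Longrightarrow> F x g = lin_ext sc g (P x)"
    using assms(2) unfolding comb_def by metis
  show ?thesis unfolding comb_def
  proof (intro conjI bexI allI)
    show "lin_ext sc (\<lambda>x. F x g) p = lin_ext sc g (lin_ext fscale P p)" for g
      unfolding lin_ext_push[OF lin_lin_ext[OF assms(1)]] by (rule lin_ext_cong) (rule P(2))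
    show "lin_ext fscale P p \<in> formal_tensors UNIV n"
      unfolding lin_ext_def
      by (intro fs.subspace_sum[OF subspace_formal_tensors] fs.subspace_scale[OF subspace_formal_tensors] P(1))
  qed (rule assms(1))
qed

lemma comb_sw:
  assumes "vector_space sc" "\<And>a b. comb sc n (F a b)"
  shows "comb sc n (\<lambda>g. sw sc (\<lambda>a b. F a b g) h)"
  unfolding sweedler_def by (rule comb_lin_ext[OF assms(1)]) (rule assms(2))

lemma comb_scale:
  assumes "comb sc n F"
  shows "comb sc n (\<lambda>g. sc c (F g))"
proof -
  have sc: "vector_space sc" using assms by (simp add: comb_def)
  obtain p where p: "p \<in> formal_tensors UNIV n" "\<And>g. F g = lin_ext sc g p" using assms by (auto simp: comb_def)
  show ?thesis unfolding comb_def p(2)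
    by (intro conjI sc bexI[of _ "fscale c p"] allI)
      (auto simp: linD[OF lin_lin_ext[OF sc]] p fs.subspace_scale[OF subspace_formal_tensors])
qed

lemma comb_comp:
  assumes "comb sc n F" "\<And>v. length v = n \<Longrightarrow> comb sc m (\<lambda>g. G g v)"
  shows "comb sc m (\<lambda>g. F (G g))"
proof -
  obtain p where p: "p \<in> formal_tensors UNIV n" "\<And>g. F g = lin_ext sc g p" using assms by (auto simp: comb_def)
  show ?thesis unfolding p(2)
    by (rule comb_lin_ext) (use assms p in \<open>auto simp: comb_def formal_tensors_def\<close>)
qed

lemma comb_cong:
  assumes "comb sc n F" "\<And>v. length v = n \<Longrightarrow> g v = g' v"
  shows "F g = F g'"
  using assms by (auto simp: comb_def formal_tensors_def intro!: lin_ext_cong)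

lemma comb_lin:
  assumes "comb sc n F" "vector_space s" "\<And>v. length v = n \<Longrightarrow> lin s sc (\<lambda>z. g z v)"
  shows "lin s sc (\<lambda>z. F (g z))"
proof -
  obtain p where p: "p \<in> formal_tensors UNIV n" "\<And>g. F g = lin_ext sc g p" using assms by (auto simp: comb_def)
  show ?thesis unfolding p(2)
    by (rule lin_ext_lin_fun) (use assms p in \<open>auto simp: comb_def formal_tensors_def\<close>)
qed

lemma comb_swap:
  assumes "comb sc n F"
  shows "F (\<lambda>v. sw sc (\<lambda>a b. G a b v) h) = sw sc (\<lambda>a b. F (G a b)) h"
proof -
  obtain p where p: "p \<in> formal_tensors UNIV n" "\<And>g. F g = lin_ext sc g p" using assms by (auto simp: comb_def)
  show ?thesis unfolding p(2) sweedler_def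
    by (rule lin_ext_swap) (use assms in \<open>simp add: comb_def\<close>)
qed

lemma comb_push:
  assumes "comb sc n F" "lin sc sc G"
  shows "G (F g) = F (\<lambda>v. G (g v))"
  using assms by (auto simp: comb_def lin_ext_push[OF assms(2)])

lemma comb_dact: "vector_space sc \<Longrightarrow> length w = n \<Longrightarrow> comb sc n (\<lambda>g. dact sc w g h)"
proof (induction w arbitrary: h n)
  case Nil
  then show ?case by (auto intro!: comb_scale comb_eval)
next
  case (Cons x w)
  have "comb sc n (\<lambda>g. dact sc w (\<lambda>v. g ((x * a) # v)) u)" for a u
    by (rule comb_comp[OF Cons.IH[OF Cons.prems(1) refl]]) (use Cons.prems in \<open>auto intro!: comb_eval\<close>)
  then show ?case by (auto intro!: comb_sw Cons.prems)
qed

lemma dact_push: "lin sc sc' G \<Longrightarrow> G (dact sc w g h) = dact sc' w (\<lambda>v. G (g v)) h"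
  by (induction w arbitrary: g h) (simp_all add: linD sw_push)

lemma mlin_Cons:
  assumes "mlin sc (Suc n) g"
  shows "mlin sc n (\<lambda>v. g (x # v))"
proof -
  have "lin hs sc (\<lambda>z. g (x # us @ z # vs))" if "length us + 1 + length vs = n" for us vs
    using mlinD(2)[OF assms, of "x # us" vs] that by simp
  with assms show ?thesis by (simp add: mlin_def)
qed

lemma mlin_snoc:
  assumes "mlin sc (Suc n) g"
  shows "mlin sc n (\<lambda>v. g (v @ [x]))"
proof -
  have "lin hs sc (\<lambda>z. g ((us @ z # vs) @ [x]))" if "length us + 1 + length vs = n" for us vs
    using mlinD(2)[OF assms, of us "vs @ [x]"] that by simp
  with assms show ?thesis by (simp add: mlin_def)
qed

lemma lin_at: "mlin sc n g \<Longrightarrow> length us + 1 + length vs = n \<Longrightarrow> lin s hs f \<Longrightarrow> lin s sc (\<lambda>z. g (us @ f z # vs))"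
  using lin_comp mlinD(2) by blast

lemma lin_hd: "mlin sc (Suc n) g \<Longrightarrow> length v = n \<Longrightarrow> lin s hs f \<Longrightarrow> lin s sc (\<lambda>z. g (f z # v))"
  using lin_at[of sc "Suc n" g "[]" v] by simp

lemma lin_last: "mlin sc (Suc n) g \<Longrightarrow> length v = n \<Longrightarrow> lin s hs f \<Longrightarrow> lin s sc (\<lambda>z. g (v @ [f z]))"
  using lin_at[of sc "Suc n" g v "[]"] by simp

lemma lin_dact: "mlin sc (length w) g \<Longrightarrow> lin hs sc (dact sc w g)"
proof (induction w arbitrary: g)
  case Nil
  then show ?case by (auto intro!: lin_intros mlinD(1)[of sc 0 g])
next
  case (Cons x w)
  have sc: "vector_space sc" using Cons.prems by (rule mlinD)
  have "bil sc (\<lambda>a u. dact sc w (\<lambda>v. g ((x * a) # v)) u)"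
  proof (rule bilI)
    show "lin hs sc (dact sc w (\<lambda>v. g ((x * a) # v)))" for a
      by (rule Cons.IH) (use Cons.prems mlin_Cons in auto)
    show "lin hs sc (\<lambda>a. dact sc w (\<lambda>v. g ((x * a) # v)) u)" for u
      by (rule comb_lin[OF comb_dact[OF sc refl] hs_vs], rule lin_hd)
        (use Cons.prems in \<open>auto intro!: lin_intros\<close>)
  qed
  then show ?case by (simp add: lin_sw)
qed

lemma lin_dact_arg: "mlin sc (length w) g \<Longrightarrow> lin s hs f \<Longrightarrow> lin s sc (\<lambda>z. dact sc w g (f z))"
  using lin_comp lin_dact by blast

lemma mlin_dact: "mlin sc n g \<Longrightarrow> mlin sc n (\<lambda>w. dact sc w g h)"
proof -
  assume g: "mlin sc n g"
  have sc: "vector_space sc" using g by (rule mlinD)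
  have "lin hs sc (\<lambda>x. dact sc (us @ x # vs) g h)" if "mlin sc (length us + 1 + length vs) g" for us vs
    using that
  proof (induction us arbitrary: g h)
    case Nil
    show ?case unfolding append_Nil dact.simps
      by (rule lin_sw_fun, rule comb_lin[OF comb_dact[OF sc refl] hs_vs], rule lin_hd[of sc "length vs"])
       (use Nil in \<open>auto intro!: lin_intros\<close>)
  next
    case (Cons u us)
    have "mlin sc (length us + 1 + length vs) (\<lambda>v. g (x # v))" for x
      by (rule mlin_Cons) (use Cons.prems in simp)
    then show ?case unfolding append_Cons dact.simps
      by (intro lin_sw_fun Cons.IH)
  qed
  with g show ?thesis unfolding mlin_def[of sc n "\<lambda>w. dact sc w g h"] by (auto simp: sc)
qed

lemma dact_one: "mlin sc (length w) g \<Longrightarrow> dact sc w g 1 = g w"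
proof (induction w arbitrary: g)
  case Nil
  have "vector_space sc" using Nil by (rule mlinD)
  then show ?case by (simp add: counit_one vector_space.vector_space_assms)
next
  case (Cons x w)
  have sc: "vector_space sc" using Cons.prems by (rule mlinD)
  have "bil sc (\<lambda>a u. dact sc w (\<lambda>v. g ((x * a) # v)) u)"
    by (intro bilI lin_dact comb_lin[OF comb_dact[OF sc refl] hs_vs] lin_hd[of sc "length w"])
       (use Cons.prems mlin_Cons in \<open>auto intro!: lin_intros\<close>)
  then show ?case using Cons.IH[of "\<lambda>v. g (x # v)"] Cons.prems mlin_Cons[of sc "length w" g] by (simp add: sw_one)
qed

lemma dact_dact:
  "mlin sc (length w) g \<Longrightarrow> dact sc w (\<lambda>v. dact sc v g h') h = dact sc w g (h * h')"
proof (induction w arbitrary: g h h')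
  case Nil
  have "vector_space sc" using Nil by (rule mlinD)
  then show ?case by (simp add: counit_mult vector_space.vector_space_assms)
next
  case (Cons x w)
  have sc: "vector_space sc" using Cons.prems by (rule mlinD)
  have m: "mlin sc (length w) (\<lambda>v. g (y # v))" for y using Cons.prems by (auto intro: mlin_Cons)
  have b: "bil sc (\<lambda>a u. dact sc w (\<lambda>v. g ((x * a) # v)) u)"
    by (intro bilI lin_dact comb_lin[OF comb_dact[OF sc refl] hs_vs] lin_hd[of sc "length w"] m)
       (use Cons.prems in \<open>auto intro!: lin_intros\<close>)
  have "dact sc (x # w) (\<lambda>v. dact sc v g h') h =
      sw sc (\<lambda>a u. dact sc w (\<lambda>v. sw sc (\<lambda>c d. dact sc v (\<lambda>v'. g ((x * a * c) # v')) d) h') u) h"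
    by simp
  also have "\<dots> = sw sc (\<lambda>a u. sw sc (\<lambda>c d. dact sc w (\<lambda>v'. g ((x * a * c) # v')) (u * d)) h') h"
    by (subst comb_swap[OF comb_dact[OF sc refl]]) (simp add: Cons.IH[OF m])
  also have "\<dots> = dact sc (x # w) g (h * h')"
    using sw_mult[OF b, of h h'] by (simp add: mult.assoc)
  finally show ?case .
qed

text \<open>\<open>dact\<close> splits off the first letter, whereas \<open>Ph\<close> and
  \<open>Ps\<close> split off the last one; coassociativity reconciles the two recursions.\<close>

lemma dact_snoc:
  "mlin sc (Suc (length w)) g \<Longrightarrow>
     dact sc (w @ [y]) g h = sw sc (\<lambda>a b. dact sc w (\<lambda>v. g (v @ [y * b])) a) h"
proof (induction w arbitrary: g h)
  case Nil
  have sc: "vector_space sc" using Nil by (rule mlinD)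
  have l: "lin hs sc (\<lambda>a. g [y * a])" by (rule lin_hd[of sc 0 g "[]"]) (use Nil in \<open>auto intro!: lin_intros\<close>)
  show ?case by (simp add: sw_counit_right[OF l] sw_counit_left[OF l])
next
  case (Cons x w)
  have sc: "vector_space sc" using Cons.prems by (rule mlinD)
  have m: "mlin sc (Suc (length w)) (\<lambda>v. g (y # v))" for y using Cons.prems by (auto intro: mlin_Cons)
  let ?f = "\<lambda>a c b. dact sc w (\<lambda>v. g ((x * a) # v @ [y * b])) c"
  have "dact sc ((x # w) @ [y]) g h = sw sc (\<lambda>a u. sw sc (\<lambda>c b. ?f a c b) u) h"
    by (simp add: Cons.IH[OF m])
  also have "\<dots> = sw sc (\<lambda>u b. sw sc (\<lambda>a c. ?f a c b) u) h"
  proof (rule sw_coassoc)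
    show "lin hs sc (?f a c)" for a c
      by (rule comb_lin[OF comb_dact[OF sc refl] hs_vs], rule lin_last[OF m]) (auto intro!: lin_intros)
    show "lin hs sc (\<lambda>c. ?f a c b)" for a b
      by (rule lin_dact) (use mlin_snoc[OF m] in auto)
    show "lin hs sc (\<lambda>a. ?f a c b)" for c b
      by (rule comb_lin[OF comb_dact[OF sc refl] hs_vs], rule lin_hd[OF Cons.prems]) (auto intro!: lin_intros)
  qed
  finally show ?case by simp
qed

end

section \<open>Tensor powers of \<open>H\<close> over \<open>R\<close> compared with
  \<open>H\<close> tensored with powers of \<open>Q\<close>\<close>

locale hopf_pair = hopf_algebra H for H :: "('k::field, 'h::ring_1) hopf" +
  fixes R :: "'h set"
  assumes fin_dim: "fin_dim H" and hopf_subalgebra: "hopf_subalgebra H R"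
begin

lemma R_sub: "subspace R" and R_one: "1 \<in> R" and R_mult: "r \<in> R \<Longrightarrow> s \<in> R \<Longrightarrow> r * s \<in> R"
  and R_S: "r \<in> R \<Longrightarrow> S r \<in> R"
  using hopf_subalgebra by (auto simp: hopf_subalgebra_def)

lemma pair_mem: "length xs = 2 \<and> set xs \<subseteq> A \<Longrightarrow> xs ! 0 \<in> A" "length xs = 2 \<and> set xs \<subseteq> A \<Longrightarrow> xs ! 1 \<in> A"
  by (auto dest: nth_mem)

text \<open>The coproduct of \<open>r\<close> has a representative with entries in \<open>R\<close>,
  so only the values of \<open>f\<close> and \<open>g\<close> on \<open>R\<close> matter, although
  both are bilinear on all of \<open>H\<close>.\<close>

lemma sw_R_cong:
  assumes "r \<in> R" "bil sc f" "bil sc g" "\<And>a b. a \<in> R \<Longrightarrow> b \<in> R \<Longrightarrow> f a b = g a b"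
  shows "sw sc f r = sw sc g r"
proof -
  obtain p where p: "p \<in> formal_tensors R 2" "comult H r = tensor_class (hspace H) 2 p"
    using hopf_subalgebra assms(1) unfolding hopf_subalgebra_def by blast
  show ?thesis
    unfolding sw_rep[OF assms(2) p(2)] sw_rep[OF assms(3) p(2)]
    by (rule lin_ext_cong, rule assms(4)) (use p(1) pair_mem[of _ R] in \<open>auto simp: formal_tensors_def\<close>)
qed

lemma sw_R_mem:
  assumes "r \<in> R" "bil sc f" "Modules.module.subspace sc U" "\<And>a b. a \<in> R \<Longrightarrow> b \<in> R \<Longrightarrow> f a b \<in> U"
  shows "sw sc f r \<in> U"
proof -
  obtain p where p: "p \<in> formal_tensors R 2" "comult H r = tensor_class (hspace H) 2 p"
    using hopf_subalgebra assms(1) unfolding hopf_subalgebra_def by blast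
  interpret v: vector_space sc using assms(2) by (rule bil_vs)
  show ?thesis
    unfolding sw_rep[OF assms(2) p(2)] lin_ext_def
    by (intro v.subspace_sum[OF assms(3)] v.subspace_scale[OF assms(3)] assms(4))
      (use p(1) pair_mem[of _ R] in \<open>auto simp: formal_tensors_def\<close>)
qed

text \<open>Linear maps out of \<open>H \<otimes> Q\<^sup>n\<close> are represented by \<open>good\<close> functions on words of length \<open>n + 1\<close>, linear maps
  out of the tensor power of \<open>n + 1\<close> copies of \<open>H\<close> over \<open>R\<close> by \<open>balanced\<close> ones. \<open>Ph\<close> is composition with the
  isomorphism \<open>x\<^sub>0 \<otimes> x\<^sub>1 \<otimes> \<dots> \<otimes> x\<^sub>n \<mapsto> (\<dots>((x\<^sub>0 \<cdot> x\<^sub>1) \<cdot> x\<^sub>2)\<dots>) \<cdot> x\<^sub>n\<close>, where \<open>u \<cdot> x = u x\<^sub>(\<^sub>1\<^sub>) \<otimes> x\<^sub>(\<^sub>2\<^sub>)\<close>, and \<open>Ps\<close> with its inverse.\<close>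

primrec Ph :: "('k \<Rightarrow> 'v::ab_group_add \<Rightarrow> 'v) \<Rightarrow> nat \<Rightarrow> ('h list \<Rightarrow> 'v) \<Rightarrow> 'h list \<Rightarrow> 'v" where
  "Ph sc 0 g w = g w"
| "Ph sc (Suc n) g w =
     sw sc (\<lambda>a b. Ph sc n (\<lambda>v. dact sc v (\<lambda>u. g (u @ [b])) a) (butlast w)) (last w)"

primrec Ps :: "('k \<Rightarrow> 'v::ab_group_add \<Rightarrow> 'v) \<Rightarrow> nat \<Rightarrow> ('h list \<Rightarrow> 'v) \<Rightarrow> 'h list \<Rightarrow> 'v" where
  "Ps sc 0 g w = g w"
| "Ps sc (Suc n) g w =
     sw sc (\<lambda>a b. dact sc (butlast w) (Ps sc n (\<lambda>u. g (u @ [b]))) (S a)) (last w)"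

definition good :: "('k \<Rightarrow> 'v::ab_group_add \<Rightarrow> 'v) \<Rightarrow> nat \<Rightarrow> ('h list \<Rightarrow> 'v) \<Rightarrow> bool" where
  "good sc n g \<longleftrightarrow> mlin sc (Suc n) g \<and>
     (\<forall>us x vs r. length us + length vs = n \<and> us \<noteq> [] \<and> r \<in> R \<longrightarrow>
        g (us @ (r * x) # vs) = sc (eps r) (g (us @ x # vs)))"

definition balanced :: "('k \<Rightarrow> 'v::ab_group_add \<Rightarrow> 'v) \<Rightarrow> nat \<Rightarrow> ('h list \<Rightarrow> 'v) \<Rightarrow> bool" where
  "balanced sc n g \<longleftrightarrow> mlin sc n g \<and>
     (\<forall>us x y vs r. length us + 2 + length vs = n \<and> r \<in> R \<longrightarrow>
        g (us @ [x * r, y] @ vs) = g (us @ [x, r * y] @ vs))"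

lemma goodD: "good sc n g \<Longrightarrow> mlin sc (Suc n) g"
  "good sc n g \<Longrightarrow> length us + length vs = n \<Longrightarrow> us \<noteq> [] \<Longrightarrow> r \<in> R \<Longrightarrow>
     g (us @ (r * x) # vs) = sc (eps r) (g (us @ x # vs))"
  by (auto simp: good_def)

lemma balancedD: "balanced sc n g \<Longrightarrow> mlin sc n g"
  "balanced sc n g \<Longrightarrow> length us + 2 + length vs = n \<Longrightarrow> r \<in> R \<Longrightarrow>
     g (us @ [x * r, y] @ vs) = g (us @ [x, r * y] @ vs)"
  by (auto simp: balanced_def)

lemma good_snoc: "good sc (Suc n) g \<Longrightarrow> good sc n (\<lambda>v. g (v @ [y]))"
  unfolding good_def[of sc n]
proof (intro conjI allI impI)
  assume g: "good sc (Suc n) g"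
  show "mlin sc (Suc n) (\<lambda>v. g (v @ [y]))" using goodD(1)[OF g] by (rule mlin_snoc)
  fix us vs :: "'h list" and x r assume "length us + length vs = n \<and> us \<noteq> [] \<and> r \<in> R"
  then show "g ((us @ (r * x) # vs) @ [y]) = sc (eps r) (g ((us @ x # vs) @ [y]))"
    using goodD(2)[OF g, of us "vs @ [y]" r x] by simp
qed

lemma balanced_snoc: "balanced sc (Suc n) g \<Longrightarrow> balanced sc n (\<lambda>v. g (v @ [y]))"
  unfolding balanced_def[of sc n]
proof (intro conjI allI impI)
  assume g: "balanced sc (Suc n) g"
  show "mlin sc n (\<lambda>v. g (v @ [y]))" using balancedD(1)[OF g] by (rule mlin_snoc)
  fix us vs :: "'h list" and x z r assume "length us + 2 + length vs = n \<and> r \<in> R"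
  then show "g ((us @ [x * r, z] @ vs) @ [y]) = g ((us @ [x, r * z] @ vs) @ [y])"
    using balancedD(2)[OF g, of us "vs @ [y]" r x z] by simp
qed

text \<open>The action multiplies each letter on the right, so a factor on the left of a letter
  stays where it is.\<close>

lemma dact_slot:
  assumes "vector_space sc"
    "\<And>us' vs' y. length us' = length us \<Longrightarrow> length vs' = length vs \<Longrightarrow>
       g (us' @ (r * y) # vs') = sc c (g (us' @ y # vs'))"
  shows "dact sc (us @ (r * x) # vs) g h = sc c (dact sc (us @ x # vs) g h)"
  using assms(2)
proof (induction us arbitrary: g h)
  case Nil
  have push: "sc c (sw sc F y) = sw sc (\<lambda>a b. sc c (F a b)) y" for F y
    by (rule sw_push) (intro lin_scale lin_id assms(1))
  have "dact sc vs (\<lambda>v. g ((r * x * a) # v)) u = sc c (dact sc vs (\<lambda>v. g ((x * a) # v)) u)" for a u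
  proof -
    have "dact sc vs (\<lambda>v. g ((r * x * a) # v)) u = dact sc vs (\<lambda>v. sc c (g ((x * a) # v))) u"
      by (rule comb_cong[OF comb_dact[OF assms(1) refl]]) (use Nil[of "[]"] in \<open>simp add: mult.assoc\<close>)
    also have "\<dots> = sc c (dact sc vs (\<lambda>v. g ((x * a) # v)) u)"
      by (rule comb_push[OF comb_dact[OF assms(1) refl], symmetric]) (intro lin_scale lin_id assms(1))
    finally show ?thesis .
  qed
  then show ?case by (simp add: push)
next
  case (Cons z us)
  have push: "sc c (sw sc F y) = sw sc (\<lambda>a b. sc c (F a b)) y" for F y
    by (rule sw_push) (intro lin_scale lin_id assms(1))
  have "dact sc (us @ (r * x) # vs) (\<lambda>v. g ((z * a) # v)) u =
      sc c (dact sc (us @ x # vs) (\<lambda>v. g ((z * a) # v)) u)" for a u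
    by (rule Cons.IH) (use Cons.prems[of "(z * a) # _"] in simp)
  then show ?case by (simp add: push)
qed

lemma good_dact: "good sc n g \<Longrightarrow> good sc n (\<lambda>v. dact sc v g h)"
  unfolding good_def[of sc n "\<lambda>v. dact sc v g h"]
proof (intro conjI allI impI)
  assume g: "good sc n g"
  show "mlin sc (Suc n) (\<lambda>v. dact sc v g h)" using goodD(1)[OF g] by (rule mlin_dact)
  fix us vs :: "'h list" and x r assume a: "length us + length vs = n \<and> us \<noteq> [] \<and> r \<in> R"
  then show "dact sc (us @ (r * x) # vs) g h = sc (eps r) (dact sc (us @ x # vs) g h)"
    by (intro dact_slot[OF mlinD(1)[OF goodD(1)[OF g]]] goodD(2)[OF g]) auto
qed

lemma comb_Ph: "vector_space sc \<Longrightarrow> length w = Suc n \<Longrightarrow> comb sc (Suc n) (\<lambda>g. Ph sc n g w)"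
proof (induction n arbitrary: w)
  case 0
  then show ?case by (auto intro!: comb_eval)
next
  case (Suc n)
  have "comb sc (Suc (Suc n)) (\<lambda>g. Ph sc n (\<lambda>v. dact sc v (\<lambda>u. g (u @ [b])) a) (butlast w))" for a b
    by (rule comb_comp[OF Suc.IH[OF Suc.prems(1)]], use Suc.prems in simp,
       rule comb_comp[OF comb_dact[OF Suc.prems(1)]]) (use Suc.prems in \<open>auto intro!: comb_eval\<close>)
  then show ?case by (auto intro!: comb_sw Suc.prems)
qed

lemma comb_Ps: "vector_space sc \<Longrightarrow> length w = Suc n \<Longrightarrow> comb sc (Suc n) (\<lambda>g. Ps sc n g w)"
proof (induction n arbitrary: w)
  case 0
  then show ?case by (auto intro!: comb_eval)
next
  case (Suc n)
  have "comb sc (Suc (Suc n)) (\<lambda>g. dact sc (butlast w) (Ps sc n (\<lambda>u. g (u @ [b]))) (S a))" for a b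
  proof (rule comb_comp[OF comb_dact[OF Suc.prems(1) refl]])
    fix v :: "'h list" assume v: "length v = length (butlast w)"
    show "comb sc (Suc (Suc n)) (\<lambda>g. Ps sc n (\<lambda>u. g (u @ [b])) v)"
      by (rule comb_comp[OF Suc.IH[OF Suc.prems(1)]]) (use v Suc.prems in \<open>auto intro!: comb_eval\<close>)
  qed
  then show ?case by (auto intro!: comb_sw Suc.prems)
qed

lemma lin_Ph_fun: "vector_space sc \<Longrightarrow> vector_space s \<Longrightarrow> length w = Suc n \<Longrightarrow>
    (\<And>v. length v = Suc n \<Longrightarrow> lin s sc (\<lambda>z. g z v)) \<Longrightarrow> lin s sc (\<lambda>z. Ph sc n (g z) w)"
  by (rule comb_lin[OF comb_Ph]) auto

lemma lin_Ps_fun: "vector_space sc \<Longrightarrow> vector_space s \<Longrightarrow> length w = Suc n \<Longrightarrow>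
    (\<And>v. length v = Suc n \<Longrightarrow> lin s sc (\<lambda>z. g z v)) \<Longrightarrow> lin s sc (\<lambda>z. Ps sc n (g z) w)"
  by (rule comb_lin[OF comb_Ps]) auto

lemma lin_dact_fun': "vector_space sc \<Longrightarrow> vector_space s \<Longrightarrow>
    (\<And>v. length v = length w \<Longrightarrow> lin s sc (\<lambda>z. g z v)) \<Longrightarrow> lin s sc (\<lambda>z. dact sc w (g z) h)"
  by (rule comb_lin[OF comb_dact]) auto

lemma bil_Ph_step:
  assumes "mlin sc (Suc (Suc n)) g" "length w = Suc n"
  shows "bil sc (\<lambda>a b. Ph sc n (\<lambda>v. dact sc v (\<lambda>u. g (u @ [b])) a) w)"
proof (rule bilI)
  note sc = mlinD(1)[OF assms(1)]
  show "lin hs sc (\<lambda>b. Ph sc n (\<lambda>v. dact sc v (\<lambda>u. g (u @ [b])) a) w)" for a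
    by (rule lin_Ph_fun[OF sc hs_vs assms(2)], rule lin_dact_fun'[OF sc hs_vs], rule lin_last[OF assms(1)])
      (auto intro: lin_id hs_vs)
  show "lin hs sc (\<lambda>a. Ph sc n (\<lambda>v. dact sc v (\<lambda>u. g (u @ [b])) a) w)" for b
    by (rule lin_Ph_fun[OF sc hs_vs assms(2)], rule lin_dact) (use mlin_snoc[OF assms(1)] in auto)
qed

lemma mlin_Ph: "mlin sc (Suc n) g \<Longrightarrow> mlin sc (Suc n) (Ph sc n g)"
proof (induction n arbitrary: g)
  case 0
  then show ?case by (simp add: Ph.simps(1)[abs_def])
next
  case (Suc n)
  note sc = mlinD(1)[OF Suc.prems]
  have "lin hs sc (\<lambda>x. Ph sc (Suc n) g (us @ x # vs))" if l: "length us + 1 + length vs = Suc (Suc n)" for us vs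
  proof (cases vs rule: rev_cases)
    case Nil
    then have "length us = Suc n" using l by simp
    with Nil show ?thesis
      by (simp add: butlast_append) (rule lin_sw[OF bil_Ph_step[OF Suc.prems]])
  next
    case (snoc vs' y)
    have "mlin sc (Suc n) (Ph sc n (\<lambda>v. dact sc v (\<lambda>u. g (u @ [b])) a))" for a b
      by (intro Suc.IH mlin_dact mlin_snoc[OF Suc.prems])
    then have "lin hs sc (\<lambda>x. sw sc (\<lambda>a b. Ph sc n (\<lambda>v. dact sc v (\<lambda>u. g (u @ [b])) a) (us @ x # vs')) y)"
      by (intro lin_sw_fun mlinD(2)) (use l snoc in auto)
    then show ?thesis by (simp add: snoc butlast_append)
  qed
  with sc show ?case by (simp add: mlin_def)
qed

lemma bil_Ps_step:
  assumes "mlin sc (Suc (Suc n)) g" "length w = Suc n" "\<And>b. mlin sc (Suc n) (Ps sc n (\<lambda>u. g (u @ [b])))"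
  shows "bil sc (\<lambda>a b. dact sc w (Ps sc n (\<lambda>u. g (u @ [b]))) (S a))"
proof (rule bilI)
  note sc = mlinD(1)[OF assms(1)]
  show "lin hs sc (\<lambda>b. dact sc w (Ps sc n (\<lambda>u. g (u @ [b]))) (S a))" for a
    by (rule lin_dact_fun'[OF sc hs_vs], rule lin_Ps_fun[OF sc hs_vs], simp add: assms(2), rule lin_last[OF assms(1)])
      (auto intro: lin_id hs_vs)
  show "lin hs sc (\<lambda>a. dact sc w (Ps sc n (\<lambda>u. g (u @ [b]))) (S a))" for b
    by (rule lin_dact_arg) (use assms in \<open>auto intro!: lin_intros\<close>)
qed

lemma mlin_Ps: "mlin sc (Suc n) g \<Longrightarrow> mlin sc (Suc n) (Ps sc n g)"
proof (induction n arbitrary: g)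
  case 0
  then show ?case by (simp add: Ps.simps(1)[abs_def])
next
  case (Suc n)
  note sc = mlinD(1)[OF Suc.prems]
  have m: "mlin sc (Suc n) (Ps sc n (\<lambda>u. g (u @ [b])))" for b
    by (intro Suc.IH mlin_snoc[OF Suc.prems])
  have "lin hs sc (\<lambda>x. Ps sc (Suc n) g (us @ x # vs))" if l: "length us + 1 + length vs = Suc (Suc n)" for us vs
  proof (cases vs rule: rev_cases)
    case Nil
    then have "length us = Suc n" using l by simp
    with Nil show ?thesis
      by (simp add: butlast_append) (rule lin_sw[OF bil_Ps_step[OF Suc.prems _ m]])
  next
    case (snoc vs' y)
    have "lin hs sc (\<lambda>x. sw sc (\<lambda>a b. dact sc (us @ x # vs') (Ps sc n (\<lambda>u. g (u @ [b]))) (S a)) y)"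
      by (intro lin_sw_fun mlinD(2)[OF mlin_dact[OF m]]) (use l snoc in auto)
    then show ?thesis by (simp add: snoc butlast_append)
  qed
  with sc show ?case by (simp add: mlin_def)
qed

text \<open>Linearity of the isomorphism for the right action of \<open>H\<close>: the diagonal
  action on all letters corresponds to multiplication of the last letter alone.\<close>

lemma Ph_dact:
  assumes "mlin sc (Suc n) g" "length w = n"
  shows "Ph sc n (\<lambda>v. dact sc v g h) (w @ [y]) = Ph sc n g (w @ [y * h])"
  using assms
proof (induction n arbitrary: g w y h)
  case 0
  note sc = mlinD(1)[OF 0(1)]
  have l: "lin hs sc (\<lambda>a. g [y * a])"
    by (rule lin_hd[of sc 0 g "[]"]) (use 0 in \<open>auto intro!: lin_intros\<close>)
  show ?case using 0 by (simp add: sw_counit_right[OF l])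
next
  case (Suc n)
  note sc = mlinD(1)[OF Suc.prems(1)]
  note m = mlin_snoc[OF Suc.prems(1)]
  have "Ph sc n (\<lambda>v. dact sc v (\<lambda>u. dact sc (u @ [b]) g h) a) w =
      sw sc (\<lambda>c d. Ph sc n (\<lambda>v. dact sc v (\<lambda>u. g (u @ [b * d])) (a * c)) w) h" for a b
  proof -
    have "dact sc v (\<lambda>u. dact sc (u @ [b]) g h) a = sw sc (\<lambda>c d. dact sc v (\<lambda>u. g (u @ [b * d])) (a * c)) h"
      if "length v = Suc n" for v
    proof -
      have "dact sc v (\<lambda>u. dact sc (u @ [b]) g h) a = dact sc v (\<lambda>u. sw sc (\<lambda>c d. dact sc u (\<lambda>v. g (v @ [b * d])) c) h) a"
        by (rule comb_cong[OF comb_dact[OF sc refl]]) (use that Suc.prems in \<open>simp add: dact_snoc\<close>)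
      also have "\<dots> = sw sc (\<lambda>c d. dact sc v (\<lambda>u. g (u @ [b * d])) (a * c)) h"
        by (subst comb_swap[OF comb_dact[OF sc refl]]) (use m that in \<open>simp add: dact_dact\<close>)
      finally show ?thesis .
    qed
    then have "Ph sc n (\<lambda>v. dact sc v (\<lambda>u. dact sc (u @ [b]) g h) a) w =
       Ph sc n (\<lambda>v. sw sc (\<lambda>c d. dact sc v (\<lambda>u. g (u @ [b * d])) (a * c)) h) w"
      by (intro comb_cong[OF comb_Ph[OF sc]]) (use Suc.prems in auto)
    also have "\<dots> = sw sc (\<lambda>c d. Ph sc n (\<lambda>v. dact sc v (\<lambda>u. g (u @ [b * d])) (a * c)) w) h"
      by (rule comb_swap[OF comb_Ph[OF sc Suc.prems(2)]])
    finally show ?thesis .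
  qed
  then show ?case
    using sw_mult[OF bil_Ph_step[OF Suc.prems], of y h] by simp
qed

lemma Ps_dact:
  assumes "mlin sc (Suc n) g" "length w = Suc n"
  shows "dact sc w (Ps sc n g) h = Ps sc n (\<lambda>v. g (butlast v @ [last v * h])) w"
  using assms
proof (induction n arbitrary: g w h)
  case 0
  note sc = mlinD(1)[OF 0(1)]
  obtain y where y: "w = [y]" using 0 by (auto simp: length_Suc_conv)
  have l: "lin hs sc (\<lambda>a. g [y * a])"
    by (rule lin_hd[of sc 0 g "[]"]) (use 0 in \<open>auto intro!: lin_intros\<close>)
  show ?case using 0 by (simp add: y sw_counit_right[OF l])
next
  case (Suc n)
  note sc = mlinD(1)[OF Suc.prems(1)]
  note m = mlin_snoc[OF Suc.prems(1)]
  note mP = mlin_Ps[OF m]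
  obtain w' y where w: "w = w' @ [y]" "length w' = Suc n"
    using Suc.prems(2) by (cases w rule: rev_cases) auto
  let ?K = "\<lambda>c. dact sc w' (Ps sc n (\<lambda>u. g (u @ [c])))"
  have lK: "lin s sc (\<lambda>z. dact sc w' (Ps sc n (\<lambda>u. g (u @ [f z]))) a)" if "lin s hs f" for s :: "'k \<Rightarrow> 'h \<Rightarrow> 'h" and f a
    by (rule lin_dact_fun'[OF sc linD(1)[OF that]], rule lin_Ps_fun[OF sc linD(1)[OF that]], simp add: w,
        rule lin_last[OF Suc.prems(1) _ that]) simp
  note li = lin_intros lK lin_dact_arg[OF mP[folded w(2)]]
  have "dact sc w (Ps sc (Suc n) g) h = sw sc (\<lambda>p q. dact sc w' (\<lambda>v. Ps sc (Suc n) g (v @ [y * q])) p) h"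
    unfolding w(1) by (rule dact_snoc) (use mlin_Ps[OF Suc.prems(1)] w in simp)
  also have "\<dots> = sw sc (\<lambda>p q. sw sc (\<lambda>a c. sw sc (\<lambda>d e. ?K (c * e) (p * S d * S a)) q) y) h"
  proof -
    have "dact sc w' (\<lambda>v. Ps sc (Suc n) g (v @ [y * q])) p = sw sc (\<lambda>a c. sw sc (\<lambda>d e. ?K (c * e) (p * S d * S a)) q) y" for p q
    proof -
      have "dact sc w' (\<lambda>v. Ps sc (Suc n) g (v @ [y * q])) p =
          dact sc w' (\<lambda>v. sw sc (\<lambda>a c. dact sc v (Ps sc n (\<lambda>u. g (u @ [c]))) (S a)) (y * q)) p" by simp
      also have "\<dots> = sw sc (\<lambda>a c. ?K c (p * S a)) (y * q)"
        by (subst comb_swap[OF comb_dact[OF sc refl]]) (use mP w in \<open>simp add: dact_dact\<close>)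
      also have "\<dots> = sw sc (\<lambda>a c. sw sc (\<lambda>d e. ?K (c * e) (p * S (a * d))) q) y"
        by (rule sw_mult) (intro li)
      finally show ?thesis by (simp add: S_mult mult.assoc)
    qed
    then show ?thesis by simp
  qed
  also have "\<dots> = sw sc (\<lambda>a c. sw sc (\<lambda>p q. sw sc (\<lambda>d e. ?K (c * e) (p * S d * S a)) q) h) y"
    by (rule sw_swap[OF sc])
  \<comment> \<open>Coassociativity puts the leg of \<open>h\<close> that acts on the front letters
    next to the antipode of the following leg; the two cancel, and \<open>h\<close> remains on the
    last letter only.\<close>
  also have "\<dots> = sw sc (\<lambda>a c. sw sc (\<lambda>t e. sw sc (\<lambda>p d. ?K (c * e) (p * S d * S a)) t) h) y"
    by (subst sw_coassoc) (intro li refl)+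
  also have "\<dots> = sw sc (\<lambda>a c. ?K (c * h) (S a)) y"
  proof -
    have 1: "sw sc (\<lambda>p d. ?K (c * e) (p * S d * S a)) t = sc (eps t) (?K (c * e) (S a))" for a c e t
    proof -
      have "lin hs sc (\<lambda>z. ?K (c * e) (z * S a))" by (intro li)
      from sw_antipode_right[OF this, of t] show ?thesis by simp
    qed
    have 2: "sw sc (\<lambda>t e. sc (eps t) (?K (c * e) (S a))) h = ?K (c * h) (S a)" for a c
      by (rule sw_counit_left) (intro li)
    show ?thesis by (simp only: 1 2)
  qed
  finally have e: "dact sc w (Ps sc (Suc n) g) h = sw sc (\<lambda>a c. ?K (c * h) (S a)) y" .
  show ?case unfolding e by (simp add: w)
qed

text \<open>On the front letters a leg of the last letter acts through \<open>Ph\<close> and the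
  antipode of the next leg through \<open>Ps\<close>; the two contract, and induction does the rest.
  \<open>Ps_Ph\<close> uses the antipode axiom of the other side.\<close>

lemma Ph_Ps:
  assumes "mlin sc (Suc n) g" "length w = Suc n"
  shows "Ph sc n (Ps sc n g) w = g w"
  using assms
proof (induction n arbitrary: g w)
  case (Suc n)
  note sc = mlinD(1)[OF Suc.prems(1)]
  note m = mlin_snoc[OF Suc.prems(1)]
  note mP = mlin_Ps[OF m]
  obtain w' y where w: "w = w' @ [y]" "length w' = Suc n"
    using Suc.prems(2) by (cases w rule: rev_cases) auto
  let ?K = "\<lambda>e t. Ph sc n (\<lambda>v. dact sc v (Ps sc n (\<lambda>u. g (u @ [e]))) t) w'"
  have lK1: "lin s sc (\<lambda>z. ?K (f z) t)" if "lin s hs f" for s :: "'k \<Rightarrow> 'h \<Rightarrow> 'h" and f t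
    by (rule lin_Ph_fun[OF sc linD(1)[OF that] w(2)], rule lin_dact_fun'[OF sc linD(1)[OF that]],
        rule lin_Ps_fun[OF sc linD(1)[OF that]], simp add: w, rule lin_last[OF Suc.prems(1) _ that]) simp
  have lK2: "lin s sc (\<lambda>z. ?K e (f z))" if "lin s hs f" for s :: "'k \<Rightarrow> 'h \<Rightarrow> 'h" and f e
    by (rule lin_Ph_fun[OF sc linD(1)[OF that] w(2)], rule lin_dact_arg[OF _ that]) (use mP in simp)
  note li = lin_intros lK1 lK2
  have "Ph sc n (\<lambda>v. dact sc v (\<lambda>u. Ps sc (Suc n) g (u @ [c])) a) w' = sw sc (\<lambda>d e. ?K e (a * S d)) c" for a c
  proof -
    have "dact sc v (\<lambda>u. Ps sc (Suc n) g (u @ [c])) a =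
        sw sc (\<lambda>d e. dact sc v (Ps sc n (\<lambda>u. g (u @ [e]))) (a * S d)) c" if "length v = Suc n" for v
      by (simp, subst comb_swap[OF comb_dact[OF sc refl]]) (use mP that in \<open>simp add: dact_dact\<close>)
    then have "Ph sc n (\<lambda>v. dact sc v (\<lambda>u. Ps sc (Suc n) g (u @ [c])) a) w' =
      Ph sc n (\<lambda>v. sw sc (\<lambda>d e. dact sc v (Ps sc n (\<lambda>u. g (u @ [e]))) (a * S d)) c) w'"
      by (intro comb_cong[OF comb_Ph[OF sc w(2)]])
    then show ?thesis by (simp only: comb_swap[OF comb_Ph[OF sc w(2)]])
  qed
  then have "Ph sc (Suc n) (Ps sc (Suc n) g) w = sw sc (\<lambda>a c. sw sc (\<lambda>d e. ?K e (a * S d)) c) y"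
    by (simp add: w del: Ps.simps)
  also have "\<dots> = sw sc (\<lambda>t e. sw sc (\<lambda>a d. ?K e (a * S d)) t) y"
    by (rule sw_coassoc) (intro li)+
  also have "\<dots> = ?K y 1"
  proof -
    have 1: "sw sc (\<lambda>a d. ?K e (a * S d)) t = sc (eps t) (?K e 1)" for e t
      by (rule sw_antipode_right) (intro li)
    have 2: "sw sc (\<lambda>t e. sc (eps t) (?K e 1)) y = ?K y 1"
      by (rule sw_counit_left) (intro li)
    show ?thesis by (simp only: 1 2)
  qed
  also have "\<dots> = Ph sc n (Ps sc n (\<lambda>u. g (u @ [y]))) w'"
    by (rule comb_cong[OF comb_Ph[OF sc w(2)]]) (use mP in \<open>simp add: dact_one\<close>)
  also have "\<dots> = g w" using Suc.IH[OF m w(2)] w by simp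
  finally show ?case .
qed simp

lemma Ps_Ph:
  assumes "mlin sc (Suc n) g" "length w = Suc n"
  shows "Ps sc n (Ph sc n g) w = g w"
  using assms
proof (induction n arbitrary: g w)
  case (Suc n)
  note sc = mlinD(1)[OF Suc.prems(1)]
  note m = mlin_snoc[OF Suc.prems(1)]
  obtain w' y where w: "w = w' @ [y]" "length w' = Suc n"
    using Suc.prems(2) by (cases w rule: rev_cases) auto
  let ?K = "\<lambda>e t. dact sc w' (\<lambda>u. g (u @ [e])) t"
  have lK1: "lin s sc (\<lambda>z. ?K (f z) t)" if "lin s hs f" for s :: "'k \<Rightarrow> 'h \<Rightarrow> 'h" and f t
    by (rule lin_dact_fun'[OF sc linD(1)[OF that]], rule lin_last[OF Suc.prems(1) _ that]) (simp add: w)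
  have lK2: "lin s sc (\<lambda>z. ?K e (f z))" if "lin s hs f" for s :: "'k \<Rightarrow> 'h \<Rightarrow> 'h" and f e
    by (rule lin_dact_arg[OF _ that]) (use m w in simp)
  note li = lin_intros lK1 lK2
  have "dact sc w' (Ps sc n (\<lambda>u. Ph sc (Suc n) g (u @ [c]))) (S a) = sw sc (\<lambda>d e. ?K e (S a * d)) c" for a c
  proof -
    have "Ps sc n (\<lambda>u. Ph sc (Suc n) g (u @ [c])) v = sw sc (\<lambda>d e. dact sc v (\<lambda>u. g (u @ [e])) d) c"
      if "length v = Suc n" for v
      by (simp, subst comb_swap[OF comb_Ps[OF sc that]])
        (simp add: Suc.IH[OF mlin_dact[OF m] that])
    then have "dact sc w' (Ps sc n (\<lambda>u. Ph sc (Suc n) g (u @ [c]))) (S a) =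
      dact sc w' (\<lambda>v. sw sc (\<lambda>d e. dact sc v (\<lambda>u. g (u @ [e])) d) c) (S a)"
      by (intro comb_cong[OF comb_dact[OF sc w(2)]])
    also have "\<dots> = sw sc (\<lambda>d e. ?K e (S a * d)) c"
      by (subst comb_swap[OF comb_dact[OF sc refl]]) (use m w in \<open>simp add: dact_dact\<close>)
    finally show ?thesis .
  qed
  then have "Ps sc (Suc n) (Ph sc (Suc n) g) w = sw sc (\<lambda>a c. sw sc (\<lambda>d e. ?K e (S a * d)) c) y"
    by (simp add: w del: Ph.simps)
  also have "\<dots> = sw sc (\<lambda>t e. sw sc (\<lambda>a d. ?K e (S a * d)) t) y"
    by (rule sw_coassoc) (intro li)+
  also have "\<dots> = ?K y 1"
  proof -
    have 1: "sw sc (\<lambda>a d. ?K e (S a * d)) t = sc (eps t) (?K e 1)" for e t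
      by (rule sw_antipode_left) (intro li)
    have 2: "sw sc (\<lambda>t e. sc (eps t) (?K e 1)) y = ?K y 1"
      by (rule sw_counit_left) (intro li)
    show ?thesis by (simp only: 1 2)
  qed
  also have "\<dots> = g w" using m w by (simp add: dact_one)
  finally show ?case .
qed simp

text \<open>The counit axiom for a function whose second argument acts through the counit when it
  lies in \<open>R\<close>.\<close>

lemma sw_eps_R:
  assumes "r \<in> R" "bil sc f" "lin hs sc g" "\<And>a b. a \<in> R \<Longrightarrow> b \<in> R \<Longrightarrow> f a b = sc (eps b) (g a)"
  shows "sw sc f r = g r"
proof -
  have "sw sc f r = sw sc (\<lambda>a b. sc (eps b) (g a)) r"
    by (rule sw_R_cong[OF assms(1,2) _ assms(4)]) (use assms(3) linD[OF assms(3)] in \<open>auto intro!: lin_intros\<close>)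
  then show ?thesis by (simp add: sw_counit_right[OF assms(3)])
qed

text \<open>This is where \<open>Q\<close> enters. The coproduct of \<open>r * y\<close> has the
  legs \<open>r1 * y1\<close> and \<open>r2 * y2\<close>; the second goes to a slot where
  \<open>R\<close> acts from the left by the counit, so that only \<open>r * y1\<close> is left to
  act on the front letters. There \<open>Ph_dact\<close> moves \<open>r\<close> onto the letter
  \<open>x\<close>.\<close>

lemma balanced_Ph: "good sc n g \<Longrightarrow> balanced sc (Suc n) (Ph sc n g)"
proof (induction n arbitrary: g)
  case 0
  then show ?case by (auto simp: balanced_def Ph.simps(1)[abs_def] goodD)
next
  case (Suc n)
  note mg = goodD(1)[OF Suc.prems]
  note sc = mlinD(1)[OF mg]
  have "Ph sc (Suc n) g (us @ [x * r, y] @ vs) = Ph sc (Suc n) g (us @ [x, r * y] @ vs)"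
    if l: "length us + 2 + length vs = Suc (Suc n)" and r: "r \<in> R" for us x y vs r
  proof (cases vs rule: rev_cases)
    case (snoc vs' z)
    have bal: "balanced sc (Suc n) (Ph sc n (\<lambda>v. dact sc v (\<lambda>u. g (u @ [b])) a))" for a b
      by (intro Suc.IH good_dact good_snoc[OF Suc.prems])
    have "Ph sc n (\<lambda>v. dact sc v (\<lambda>u. g (u @ [b])) a) (us @ x * r # y # vs') =
        Ph sc n (\<lambda>v. dact sc v (\<lambda>u. g (u @ [b])) a) (us @ x # r * y # vs')" for a b
      using balancedD(2)[OF bal, of us vs' r b a x y] l snoc r by simp
    then show ?thesis by (simp add: snoc butlast_append)
  next
    case Nil
    then have us: "length us = n" using l by simp
    let ?K = "\<lambda>b a. Ph sc n (\<lambda>v. dact sc v (\<lambda>u. g (u @ [b])) a) (us @ [x])"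
    have usx: "length (us @ [x]) = Suc n" using us by simp
    have lK1: "lin s sc (\<lambda>z. ?K (f z) t)" if "lin s hs f" for s :: "'k \<Rightarrow> 'h \<Rightarrow> 'h" and f t
      by (rule lin_Ph_fun[OF sc linD(1)[OF that] usx], rule lin_dact_fun'[OF sc linD(1)[OF that]],
          rule lin_last[OF mg _ that]) simp
    have lK2: "lin s sc (\<lambda>z. ?K e (f z))" if "lin s hs f" for s :: "'k \<Rightarrow> 'h \<Rightarrow> 'h" and f e
      by (rule lin_Ph_fun[OF sc linD(1)[OF that] usx], rule lin_dact_arg[OF _ that]) (use mlin_snoc[OF mg] in simp)
    note li = lin_intros lK1 lK2
    have "Ph sc (Suc n) g (us @ [x, r * y]) = sw sc (\<lambda>a b. ?K b a) (r * y)" by (simp add: butlast_append)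
    also have "\<dots> = sw sc (\<lambda>p q. sw sc (\<lambda>a b. ?K (q * b) (p * a)) y) r"
      by (rule sw_mult) (intro li)
    also have "\<dots> = sw sc (\<lambda>a b. ?K b (r * a)) y"
    proof (rule sw_eps_R[OF r])
      show "bil sc (\<lambda>p q. sw sc (\<lambda>a b. ?K (q * b) (p * a)) y)" by (intro li)
      show "lin hs sc (\<lambda>r. sw sc (\<lambda>a b. ?K b (r * a)) y)" by (intro li)
      fix p q assume q: "q \<in> R"
      have "?K (q * b) t = sc (eps q) (?K b t)" for b t
      proof -
        have "?K (q * b) t = Ph sc n (\<lambda>v. dact sc v (\<lambda>u. sc (eps q) (g (u @ [b]))) t) (us @ [x])"
          by (intro comb_cong[OF comb_Ph[OF sc usx]] comb_cong[OF comb_dact[OF sc refl]])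
           (use goodD(2)[OF Suc.prems, of _ "[]" q b] q in \<open>auto simp flip: length_greater_0_conv\<close>)
        also have "\<dots> = Ph sc n (\<lambda>v. sc (eps q) (dact sc v (\<lambda>u. g (u @ [b])) t)) (us @ [x])"
          by (intro comb_cong[OF comb_Ph[OF sc usx]] comb_push[OF comb_dact[OF sc refl], symmetric] lin_scale lin_id sc)
        also have "\<dots> = sc (eps q) (?K b t)"
          by (intro comb_push[OF comb_Ph[OF sc usx], symmetric] lin_scale lin_id sc)
        finally show ?thesis .
      qed
      then have "sw sc (\<lambda>a b. ?K (q * b) (p * a)) y = sw sc (\<lambda>a b. sc (eps q) (?K b (p * a))) y" by simp
      also have "\<dots> = sc (eps q) (sw sc (\<lambda>a b. ?K b (p * a)) y)"
        by (rule sw_push[symmetric]) (intro lin_scale lin_id sc)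
      finally show "sw sc (\<lambda>a b. ?K (q * b) (p * a)) y = sc (eps q) (sw sc (\<lambda>a b. ?K b (p * a)) y)" .
    qed
    also have "\<dots> = Ph sc (Suc n) g (us @ [x * r, y])"
    proof -
      have "?K b (r * a) = Ph sc n (\<lambda>v. dact sc v (\<lambda>u. g (u @ [b])) a) (us @ [x * r])" for a b
      proof -
        have "?K b (r * a) = Ph sc n (\<lambda>v. dact sc v (\<lambda>v. dact sc v (\<lambda>u. g (u @ [b])) a) r) (us @ [x])"
          by (rule comb_cong[OF comb_Ph[OF sc usx]]) (use mlin_snoc[OF mg] in \<open>simp add: dact_dact\<close>)
        then show ?thesis using Ph_dact[OF mlin_dact[OF mlin_snoc[OF mg]] us] by simp
      qed
      then show ?thesis by (simp add: butlast_append)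
    qed
    finally show ?thesis using Nil by simp
  qed
  then show ?case unfolding balanced_def using mlin_Ph[OF mg] by blast
qed

text \<open>A left factor \<open>r\<close> of the last letter, with legs \<open>p\<close> and
  \<open>q\<close>, acts by \<open>S p\<close> on the front letters and by \<open>q\<close> on the
  last one. As \<open>S p\<close> lies in \<open>R\<close>, \<open>Ps_dact\<close> and balancedness
  move it next to \<open>q\<close>, and \<open>S p * q\<close> contracts to the counit of
  \<open>r\<close>.\<close>

lemma good_Ps: "balanced sc (Suc n) g \<Longrightarrow> good sc n (Ps sc n g)"
proof (induction n arbitrary: g)
  case 0
  then show ?case by (auto simp: good_def Ps.simps(1)[abs_def] balancedD)
next
  case (Suc n)
  note mg = balancedD(1)[OF Suc.prems]
  note sc = mlinD(1)[OF mg]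
  note m = mlin_snoc[OF mg]
  note mP = mlin_Ps[OF m]
  have "Ps sc (Suc n) g (us @ (r * x) # vs) = sc (eps r) (Ps sc (Suc n) g (us @ x # vs))"
    if l: "length us + length vs = Suc n" "us \<noteq> []" and r: "r \<in> R" for us x vs r
  proof (cases vs rule: rev_cases)
    case (snoc vs' z)
    have gd: "good sc n (\<lambda>v. dact sc v (Ps sc n (\<lambda>u. g (u @ [b]))) a)" for a b
      by (intro Suc.IH good_dact balanced_snoc[OF Suc.prems])
    have "dact sc (us @ (r * x) # vs') (Ps sc n (\<lambda>u. g (u @ [b]))) a =
        sc (eps r) (dact sc (us @ x # vs') (Ps sc n (\<lambda>u. g (u @ [b]))) a)" for a b
      using goodD(2)[OF gd, of us vs' r x b a] l snoc r by simp
    then have "Ps sc (Suc n) g (us @ (r * x) # vs) =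
       sw sc (\<lambda>a b. sc (eps r) (dact sc (us @ x # vs') (Ps sc n (\<lambda>u. g (u @ [b]))) (S a))) z"
      by (simp add: snoc butlast_append)
    also have "\<dots> = sc (eps r) (sw sc (\<lambda>a b. dact sc (us @ x # vs') (Ps sc n (\<lambda>u. g (u @ [b]))) (S a)) z)"
      by (rule sw_push[symmetric]) (intro lin_scale lin_id sc)
    finally show ?thesis by (simp add: snoc butlast_append)
  next
    case Nil
    then have us: "length us = Suc n" using l by simp
    let ?K = "\<lambda>c a. dact sc us (Ps sc n (\<lambda>u. g (u @ [c]))) a"
    have lK1: "lin s sc (\<lambda>z. ?K (f z) t)" if "lin s hs f" for s :: "'k \<Rightarrow> 'h \<Rightarrow> 'h" and f t
      by (rule lin_dact_fun'[OF sc linD(1)[OF that]], rule lin_Ps_fun[OF sc linD(1)[OF that]], simp add: us,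
          rule lin_last[OF mg _ that]) simp
    have lK2: "lin s sc (\<lambda>z. ?K e (f z))" if "lin s hs f" for s :: "'k \<Rightarrow> 'h \<Rightarrow> 'h" and f e
      by (rule lin_dact_arg[OF _ that]) (use mP us in simp)
    note li = lin_intros lK1 lK2
    have "Ps sc (Suc n) g (us @ [r * x]) = sw sc (\<lambda>a c. ?K c (S a)) (r * x)" by (simp add: butlast_append)
    also have "\<dots> = sw sc (\<lambda>p q. sw sc (\<lambda>a c. ?K (q * c) (S (p * a))) x) r"
      by (rule sw_mult) (intro li)
    also have "\<dots> = sw sc (\<lambda>p q. sw sc (\<lambda>a c. ?K (S p * q * c) (S a)) x) r"
    proof (rule sw_R_cong[OF r])
      show "bil sc (\<lambda>p q. sw sc (\<lambda>a c. ?K (q * c) (S (p * a))) x)" by (intro li)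
      show "bil sc (\<lambda>p q. sw sc (\<lambda>a c. ?K (S p * q * c) (S a)) x)" by (intro li)
      fix p q assume p: "p \<in> R"
      have "?K (q * c) (S (p * a)) = ?K (S p * q * c) (S a)" for a c
      proof -
        have "?K (q * c) (S (p * a)) = dact sc us (\<lambda>v. dact sc v (Ps sc n (\<lambda>u. g (u @ [q * c]))) (S p)) (S a)"
          using mP us by (simp add: dact_dact S_mult)
        also have "\<dots> = ?K (S p * q * c) (S a)"
        proof (rule comb_cong[OF comb_dact[OF sc refl]])
          fix v :: "'h list" assume v: "length v = length us"
          have "dact sc v (Ps sc n (\<lambda>u. g (u @ [q * c]))) (S p) = Ps sc n (\<lambda>u. g ((butlast u @ [last u * S p]) @ [q * c])) v"
            by (rule Ps_dact[OF m]) (use v us in simp)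
          also have "\<dots> = Ps sc n (\<lambda>u. g (u @ [S p * q * c])) v"
          proof (rule comb_cong[OF comb_Ps[OF sc]])
            show "length v = Suc n" using v us by simp
            fix u :: "'h list" assume u: "length u = Suc n"
            have "g (butlast u @ [last u * S p, q * c] @ []) = g (butlast u @ [last u, S p * (q * c)] @ [])"
              by (rule balancedD(2)[OF Suc.prems]) (use u R_S[OF p] in auto)
            also have "butlast u @ [last u, S p * (q * c)] @ [] = u @ [S p * (q * c)]"
              using u append_butlast_last_id[of u] by (cases u rule: rev_cases) auto
            finally show "g ((butlast u @ [last u * S p]) @ [q * c]) = g (u @ [S p * q * c])"
              by (simp add: mult.assoc)
          qed
          finally show "dact sc v (Ps sc n (\<lambda>u. g (u @ [q * c]))) (S p) = Ps sc n (\<lambda>u. g (u @ [S p * q * c])) v" .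
        qed
        finally show ?thesis .
      qed
      then show "sw sc (\<lambda>a c. ?K (q * c) (S (p * a))) x = sw sc (\<lambda>a c. ?K (S p * q * c) (S a)) x" by simp
    qed
    also have "\<dots> = sc (eps r) (sw sc (\<lambda>a c. ?K (1 * c) (S a)) x)"
      by (rule sw_antipode_left) (intro li)
    finally show ?thesis using Nil by (simp add: butlast_append)
  qed
  then show ?case unfolding good_def using mlin_Ps[OF mg] by blast
qed

text \<open>The action gives the first letter factors on the right only, so left multiplication by
  \<open>h\<close> commutes with it; \<open>Ph_left\<close> and \<open>Ps_left\<close> deduce the
  left \<open>H\<close>-linearity of the isomorphism.\<close>

lemma dact_left: "w \<noteq> [] \<Longrightarrow> dact sc (h * hd w # tl w) g a = dact sc w (\<lambda>v. g (h * hd v # tl v)) a"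
  by (cases w) (simp_all add: mult.assoc)

lemma Ph_left:
  "vector_space sc \<Longrightarrow> length w = Suc n \<Longrightarrow> Ph sc n g (h * hd w # tl w) = Ph sc n (\<lambda>v. g (h * hd v # tl v)) w"
proof (induction n arbitrary: g w)
  case (Suc n)
  obtain w' y where w: "w = w' @ [y]" "length w' = Suc n"
    using Suc.prems(2) by (cases w rule: rev_cases) auto
  have ne: "v \<noteq> []" if "length v = Suc n" for v :: "'h list" using that by auto
  have "Ph sc n (\<lambda>v. dact sc v (\<lambda>u. g (u @ [b])) a) (h * hd w' # tl w') =
      Ph sc n (\<lambda>v. dact sc v (\<lambda>u. g (h * hd (u @ [b]) # tl (u @ [b]))) a) w'" for a b
  proof -
    have "Ph sc n (\<lambda>v. dact sc v (\<lambda>u. g (u @ [b])) a) (h * hd w' # tl w') =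
        Ph sc n (\<lambda>v. dact sc (h * hd v # tl v) (\<lambda>u. g (u @ [b])) a) w'"
      by (rule Suc.IH[OF Suc.prems(1) w(2)])
    also have "\<dots> = Ph sc n (\<lambda>v. dact sc v (\<lambda>u. g (h * hd (u @ [b]) # tl (u @ [b]))) a) w'"
    proof (rule comb_cong[OF comb_Ph[OF Suc.prems(1) w(2)]])
      fix v :: "'h list" assume v: "length v = Suc n"
      show "dact sc (h * hd v # tl v) (\<lambda>u. g (u @ [b])) a = dact sc v (\<lambda>u. g (h * hd (u @ [b]) # tl (u @ [b]))) a"
        unfolding dact_left[OF ne[OF v]]
        by (rule comb_cong[OF comb_dact[OF Suc.prems(1) refl]]) (use ne v in simp)
    qed
    finally show ?thesis .
  qed
  moreover have "h * hd w # tl w = (h * hd w' # tl w') @ [y]" using w ne[OF w(2)] by simp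
  ultimately show ?case using w by simp
qed simp

lemma Ps_left:
  "vector_space sc \<Longrightarrow> length w = Suc n \<Longrightarrow> Ps sc n g (h * hd w # tl w) = Ps sc n (\<lambda>v. g (h * hd v # tl v)) w"
proof (induction n arbitrary: g w)
  case (Suc n)
  obtain w' y where w: "w = w' @ [y]" "length w' = Suc n"
    using Suc.prems(2) by (cases w rule: rev_cases) auto
  have ne: "v \<noteq> []" if "length v = Suc n" for v :: "'h list" using that by auto
  have "dact sc (h * hd w' # tl w') (Ps sc n (\<lambda>u. g (u @ [b]))) a =
      dact sc w' (Ps sc n (\<lambda>u. g (h * hd (u @ [b]) # tl (u @ [b])))) a" for a b
    unfolding dact_left[OF ne[OF w(2)]]
  proof (rule comb_cong[OF comb_dact[OF Suc.prems(1) w(2)]])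
    fix v :: "'h list" assume v: "length v = Suc n"
    show "Ps sc n (\<lambda>u. g (u @ [b])) (h * hd v # tl v) = Ps sc n (\<lambda>u. g (h * hd (u @ [b]) # tl (u @ [b]))) v"
      unfolding Suc.IH[OF Suc.prems(1) v]
      by (rule comb_cong[OF comb_Ps[OF Suc.prems(1) v]]) (use ne in simp)
  qed
  moreover have "h * hd w # tl w = (h * hd w' # tl w') @ [y]" using w ne[OF w(2)] by simp
  ultimately show ?case using w by simp
qed simp

end

section \<open>Summands and direct powers of modules\<close>

text \<open>The axioms that right modules and bimodules share and that suffice for splitting off
  summands.\<close>

definition additive_module :: "'s set \<Rightarrow> ('s, 'm) module \<Rightarrow> bool" where
  "additive_module A M \<longleftrightarrow> abelian_group M \<and>
     (\<forall>s\<in>A. \<forall>x\<in>carrier M. s \<odot>\<^bsub>M\<^esub> x \<in> carrier M) \<and>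
     (\<forall>s\<in>A. \<forall>x\<in>carrier M. \<forall>y\<in>carrier M. s \<odot>\<^bsub>M\<^esub> (x \<oplus>\<^bsub>M\<^esub> y) = s \<odot>\<^bsub>M\<^esub> x \<oplus>\<^bsub>M\<^esub> s \<odot>\<^bsub>M\<^esub> y)"

lemma right_module_additive: "right_module R M \<Longrightarrow> additive_module R M"
  by (simp add: right_module_def additive_module_def)

lemma mod_homD:
  assumes "f \<in> mod_hom A M N"
  shows "x \<in> carrier M \<Longrightarrow> f x \<in> carrier N"
    "x \<in> carrier M \<Longrightarrow> y \<in> carrier M \<Longrightarrow> f (x \<oplus>\<^bsub>M\<^esub> y) = f x \<oplus>\<^bsub>N\<^esub> f y"
    "s \<in> A \<Longrightarrow> x \<in> carrier M \<Longrightarrow> f (s \<odot>\<^bsub>M\<^esub> x) = s \<odot>\<^bsub>N\<^esub> f x"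
  using assms by (auto simp: mod_hom_def)

lemma mod_homI:
  assumes "\<And>x. x \<in> carrier M \<Longrightarrow> f x \<in> carrier N"
    "\<And>x y. x \<in> carrier M \<Longrightarrow> y \<in> carrier M \<Longrightarrow> f (x \<oplus>\<^bsub>M\<^esub> y) = f x \<oplus>\<^bsub>N\<^esub> f y"
    "\<And>s x. s \<in> A \<Longrightarrow> x \<in> carrier M \<Longrightarrow> f (s \<odot>\<^bsub>M\<^esub> x) = s \<odot>\<^bsub>N\<^esub> f x"
  shows "f \<in> mod_hom A M N"
  using assms by (auto simp: mod_hom_def)

lemma mod_hom_comp: "f \<in> mod_hom A M N \<Longrightarrow> g \<in> mod_hom A N P \<Longrightarrow> (\<lambda>x. g (f x)) \<in> mod_hom A M P"
  by (rule mod_homI) (simp_all add: mod_homD[of f] mod_homD[of g])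

lemma additive_zero_minus:
  assumes "abelian_group M" "abelian_group N" "\<And>x. x \<in> carrier M \<Longrightarrow> f x \<in> carrier N"
    "\<And>x y. x \<in> carrier M \<Longrightarrow> y \<in> carrier M \<Longrightarrow> f (x \<oplus>\<^bsub>M\<^esub> y) = f x \<oplus>\<^bsub>N\<^esub> f y"
  shows "f \<zero>\<^bsub>M\<^esub> = \<zero>\<^bsub>N\<^esub>" "x \<in> carrier M \<Longrightarrow> f (\<ominus>\<^bsub>M\<^esub> x) = \<ominus>\<^bsub>N\<^esub> f x"
proof -
  interpret M: abelian_group M by fact
  interpret N: abelian_group N by fact
  have z: "f \<zero>\<^bsub>M\<^esub> \<in> carrier N" by (rule assms(3)) simp
  have "f \<zero>\<^bsub>M\<^esub> \<oplus>\<^bsub>N\<^esub> f \<zero>\<^bsub>M\<^esub> = f \<zero>\<^bsub>M\<^esub>" using assms(4)[of "\<zero>\<^bsub>M\<^esub>" "\<zero>\<^bsub>M\<^esub>"] by simp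
  then show fz: "f \<zero>\<^bsub>M\<^esub> = \<zero>\<^bsub>N\<^esub>" using N.add.l_cancel_one[OF z z] by simp
  show "f (\<ominus>\<^bsub>M\<^esub> x) = \<ominus>\<^bsub>N\<^esub> f x" if x: "x \<in> carrier M"
  proof (rule N.minus_equality[symmetric])
    show "f (\<ominus>\<^bsub>M\<^esub> x) \<oplus>\<^bsub>N\<^esub> f x = \<zero>\<^bsub>N\<^esub>"
      using assms(4)[of "\<ominus>\<^bsub>M\<^esub> x" x] x fz by (simp add: M.l_neg)
  qed (use assms(3) x in auto)
qed

lemma submodule_restrict:
  assumes "is_submodule A U M"
  shows "U \<subseteq> carrier M" "\<zero>\<^bsub>M\<^esub> \<in> U" "x \<in> U \<Longrightarrow> y \<in> U \<Longrightarrow> x \<oplus>\<^bsub>M\<^esub> y \<in> U"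
    "x \<in> U \<Longrightarrow> \<ominus>\<^bsub>M\<^esub> x \<in> U" "s \<in> A \<Longrightarrow> x \<in> U \<Longrightarrow> s \<odot>\<^bsub>M\<^esub> x \<in> U"
proof -
  interpret subgroup U "add_monoid M" using assms by (simp add: is_submodule_def)
  show "U \<subseteq> carrier M" using subset by simp
  show "\<zero>\<^bsub>M\<^esub> \<in> U" using one_closed by simp
  show "x \<in> U \<Longrightarrow> y \<in> U \<Longrightarrow> x \<oplus>\<^bsub>M\<^esub> y \<in> U" using m_closed by simp
  show "x \<in> U \<Longrightarrow> \<ominus>\<^bsub>M\<^esub> x \<in> U" unfolding a_inv_def by (rule m_inv_closed)
  show "s \<in> A \<Longrightarrow> x \<in> U \<Longrightarrow> s \<odot>\<^bsub>M\<^esub> x \<in> U" using assms by (simp add: is_submodule_def)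
qed

lemma is_submoduleI:
  assumes M: "abelian_group M" and "U \<subseteq> carrier M" "\<zero>\<^bsub>M\<^esub> \<in> U" "\<And>x y. x \<in> U \<Longrightarrow> y \<in> U \<Longrightarrow> x \<oplus>\<^bsub>M\<^esub> y \<in> U"
    "\<And>x. x \<in> U \<Longrightarrow> \<ominus>\<^bsub>M\<^esub> x \<in> U" "\<And>s x. s \<in> A \<Longrightarrow> x \<in> U \<Longrightarrow> s \<odot>\<^bsub>M\<^esub> x \<in> U"
  shows "is_submodule A U M"
  unfolding is_submodule_def
  by (intro conjI subgroup.intro) (use assms in \<open>auto simp: a_inv_def\<close>)

text \<open>The image of \<open>f\<close> and the kernel of \<open>g\<close> are complementary
  submodules.\<close>

lemma retract_summand:
  assumes M: "additive_module A M" and N: "additive_module A N"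
    and f: "f \<in> mod_hom A M N" and g: "g \<in> mod_hom A N M"
    and gf: "\<And>x. x \<in> carrier M \<Longrightarrow> g (f x) = x"
  shows "iso_to_summand A M N"
proof -
  interpret M: abelian_group M using M by (simp add: additive_module_def)
  interpret N: abelian_group N using N by (simp add: additive_module_def)
  note f' = mod_homD[OF f] and g' = mod_homD[OF g]
  have fz: "f \<zero>\<^bsub>M\<^esub> = \<zero>\<^bsub>N\<^esub>" "x \<in> carrier M \<Longrightarrow> f (\<ominus>\<^bsub>M\<^esub> x) = \<ominus>\<^bsub>N\<^esub> f x" for x
    by (rule additive_zero_minus[of M N f]; use f' M.abelian_group_axioms N.abelian_group_axioms in simp)+
  have gz: "g \<zero>\<^bsub>N\<^esub> = \<zero>\<^bsub>M\<^esub>" "x \<in> carrier N \<Longrightarrow> g (\<ominus>\<^bsub>N\<^esub> x) = \<ominus>\<^bsub>M\<^esub> g x" for x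
    by (rule additive_zero_minus[of N M g]; use g' M.abelian_group_axioms N.abelian_group_axioms in simp)+
  let ?U = "f ` carrier M" and ?V = "{y \<in> carrier N. g y = \<zero>\<^bsub>M\<^esub>}"
  have U: "is_submodule A ?U N"
  proof (rule is_submoduleI[OF N.abelian_group_axioms])
    show "\<zero>\<^bsub>N\<^esub> \<in> ?U" using fz(1) by (metis M.zero_closed image_eqI)
    fix x assume "x \<in> ?U"
    then obtain a where a: "a \<in> carrier M" "x = f a" by blast
    show "\<ominus>\<^bsub>N\<^esub> x \<in> ?U"
      unfolding a(2) fz(2)[OF a(1), symmetric] using a(1) by simp
    show "x \<oplus>\<^bsub>N\<^esub> y \<in> ?U" if "y \<in> ?U" for y
    proof -
      obtain b where b: "b \<in> carrier M" "y = f b" using \<open>y \<in> ?U\<close> by blast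
      show ?thesis unfolding a(2) b(2) f'(2)[OF a(1) b(1), symmetric] using a(1) b(1) by simp
    qed
    show "s \<odot>\<^bsub>N\<^esub> x \<in> ?U" if "s \<in> A" for s
      unfolding a(2) f'(3)[OF that a(1), symmetric] using M that a(1) by (simp add: additive_module_def)
  next
    show "?U \<subseteq> carrier N" using f'(1) by blast
  qed
  have smz: "s \<odot>\<^bsub>M\<^esub> \<zero>\<^bsub>M\<^esub> = \<zero>\<^bsub>M\<^esub>" if "s \<in> A" for s
    by (rule additive_zero_minus[of M M "\<lambda>x. s \<odot>\<^bsub>M\<^esub> x"]) (use M that in \<open>auto simp: additive_module_def\<close>)
  have V: "is_submodule A ?V N"
  proof (rule is_submoduleI[OF N.abelian_group_axioms])
    show "s \<odot>\<^bsub>N\<^esub> x \<in> ?V" if "s \<in> A" "x \<in> ?V" for s x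
      using that g'(3) smz N by (auto simp: additive_module_def)
  qed (use g' gz in auto)
  have "internal_direct_sum N ?U ?V"
    unfolding internal_direct_sum_def
  proof
    show "?U \<inter> ?V = {\<zero>\<^bsub>N\<^esub>}"
    proof (intro equalityI subsetI)
      fix y assume "y \<in> ?U \<inter> ?V"
      then obtain x where "x \<in> carrier M" "y = f x" "g y = \<zero>\<^bsub>M\<^esub>" by auto
      then show "y \<in> {\<zero>\<^bsub>N\<^esub>}" using gf fz(1) by auto
    next
      fix y assume "y \<in> {\<zero>\<^bsub>N\<^esub>}"
      then show "y \<in> ?U \<inter> ?V" using submodule_restrict(2)[OF U] submodule_restrict(2)[OF V] by auto
    qed
    show "carrier N = {u \<oplus>\<^bsub>N\<^esub> v |u v. u \<in> ?U \<and> v \<in> ?V}"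
    proof (intro equalityI subsetI)
      fix y assume y: "y \<in> carrier N"
      let ?v = "\<ominus>\<^bsub>N\<^esub> f (g y) \<oplus>\<^bsub>N\<^esub> y"
      have gy: "g y \<in> carrier M" "f (g y) \<in> carrier N" using y f' g' by auto
      have "g ?v = \<zero>\<^bsub>M\<^esub>"
        using gy y by (simp add: g' gz gf M.l_neg)
      then have "?v \<in> ?V" using gy y by auto
      moreover have "y = f (g y) \<oplus>\<^bsub>N\<^esub> ?v" using gy y N.a_assoc[of "f (g y)" "\<ominus>\<^bsub>N\<^esub> f (g y)" y] by (simp add: N.r_neg)
      ultimately show "y \<in> {u \<oplus>\<^bsub>N\<^esub> v |u v. u \<in> ?U \<and> v \<in> ?V}" using gy by blast
    qed (use f' in auto)
  qed
  moreover have "f \<in> mod_hom A M (N\<lparr>carrier := ?U\<rparr>)" using f by (auto simp: mod_hom_def)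
  moreover have "bij_betw f (carrier M) (carrier (N\<lparr>carrier := ?U\<rparr>))"
    unfolding bij_betw_def using inj_on_inverseI[of "carrier M" g f, OF gf] by simp
  ultimately show ?thesis unfolding iso_to_summand_def mod_iso_def using U V by blast
qed

text \<open>The retraction is the projection along the complement \<open>V\<close>, followed by the
  inverse of the isomorphism onto \<open>U\<close>.\<close>

lemma summand_retract:
  assumes M: "additive_module A M" and N: "additive_module A N" and "iso_to_summand A M N"
  shows "\<exists>f\<in>mod_hom A M N. \<exists>g\<in>mod_hom A N M. \<forall>x\<in>carrier M. g (f x) = x"
proof -
  interpret M: abelian_group M using M by (simp add: additive_module_def)
  interpret N: abelian_group N using N by (simp add: additive_module_def)
  obtain U V f where U: "is_submodule A U N" and V: "is_submodule A V N" and ds: "internal_direct_sum N U V"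
    and f: "f \<in> mod_hom A M (N\<lparr>carrier := U\<rparr>)" and bij: "bij_betw f (carrier M) U"
    using assms(3) by (auto simp: iso_to_summand_def mod_iso_def)
  note U' = submodule_restrict[OF U] and V' = submodule_restrict[OF V]
  have fU: "f x \<in> U" if "x \<in> carrier M" for x using f that by (auto simp: mod_hom_def)
  have fh: "f (x \<oplus>\<^bsub>M\<^esub> y) = f x \<oplus>\<^bsub>N\<^esub> f y" if "x \<in> carrier M" "y \<in> carrier M" for x y
    using f that by (auto simp: mod_hom_def)
  have fs: "f (s \<odot>\<^bsub>M\<^esub> x) = s \<odot>\<^bsub>N\<^esub> f x" if "x \<in> carrier M" "s \<in> A" for x s
    using f that by (auto simp: mod_hom_def)
  have uniq: "u = u'" if uv: "u \<in> U" "u' \<in> U" "v \<in> V" "v' \<in> V" "u \<oplus>\<^bsub>N\<^esub> v = u' \<oplus>\<^bsub>N\<^esub> v'" for u u' v v'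
  proof -
    have c: "u \<in> carrier N" "u' \<in> carrier N" "v \<in> carrier N" "v' \<in> carrier N"
      using uv U'(1) V'(1) by auto
    have "\<ominus>\<^bsub>N\<^esub> u' \<oplus>\<^bsub>N\<^esub> u = v' \<oplus>\<^bsub>N\<^esub> \<ominus>\<^bsub>N\<^esub> v"
    proof -
      have "\<ominus>\<^bsub>N\<^esub> u' \<oplus>\<^bsub>N\<^esub> u = \<ominus>\<^bsub>N\<^esub> u' \<oplus>\<^bsub>N\<^esub> ((u \<oplus>\<^bsub>N\<^esub> v) \<oplus>\<^bsub>N\<^esub> \<ominus>\<^bsub>N\<^esub> v)"
        using c by (simp add: N.a_assoc N.r_neg)
      also have "\<dots> = v' \<oplus>\<^bsub>N\<^esub> \<ominus>\<^bsub>N\<^esub> v"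
        unfolding uv(5) using c by (simp add: N.a_assoc[symmetric] N.l_neg)
      finally show ?thesis .
    qed
    moreover have "\<ominus>\<^bsub>N\<^esub> u' \<oplus>\<^bsub>N\<^esub> u \<in> U" by (intro U'(3,4) uv)
    moreover have "v' \<oplus>\<^bsub>N\<^esub> \<ominus>\<^bsub>N\<^esub> v \<in> V" by (intro V'(3,4) uv)
    ultimately have "\<ominus>\<^bsub>N\<^esub> u' \<oplus>\<^bsub>N\<^esub> u \<in> U \<inter> V" by simp
    moreover have "U \<inter> V = {\<zero>\<^bsub>N\<^esub>}" using ds unfolding internal_direct_sum_def by (rule conjunct1)
    ultimately have "\<ominus>\<^bsub>N\<^esub> u' \<oplus>\<^bsub>N\<^esub> u = \<zero>\<^bsub>N\<^esub>" by simp
    then have "\<ominus>\<^bsub>N\<^esub> u = \<ominus>\<^bsub>N\<^esub> u'" using c by (intro N.minus_equality) auto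
    from arg_cong[OF this, of "a_inv N"] show ?thesis using c by (simp only: N.minus_minus)
  qed
  define P where "P y = (THE u. u \<in> U \<and> (\<exists>v\<in>V. y = u \<oplus>\<^bsub>N\<^esub> v))" for y
  have Peq: "P (u \<oplus>\<^bsub>N\<^esub> v) = u" if "u \<in> U" "v \<in> V" for u v
    unfolding P_def
  proof (rule the_equality)
    show "u \<in> U \<and> (\<exists>v'\<in>V. u \<oplus>\<^bsub>N\<^esub> v = u \<oplus>\<^bsub>N\<^esub> v')" using that by blast
    fix w assume "w \<in> U \<and> (\<exists>v'\<in>V. u \<oplus>\<^bsub>N\<^esub> v = w \<oplus>\<^bsub>N\<^esub> v')"
    then obtain v' where "w \<in> U" "v' \<in> V" "u \<oplus>\<^bsub>N\<^esub> v = w \<oplus>\<^bsub>N\<^esub> v'" by blast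
    then show "w = u" using uniq[of u w v v'] that by simp
  qed
  have ex: "\<exists>u v. u \<in> U \<and> v \<in> V \<and> y = u \<oplus>\<^bsub>N\<^esub> v" if "y \<in> carrier N" for y
  proof -
    have "carrier N \<subseteq> {u \<oplus>\<^bsub>N\<^esub> v |u v. u \<in> U \<and> v \<in> V}"
      using ds unfolding internal_direct_sum_def by (intro equalityD1) (rule conjunct2)
    from subsetD[OF this that] show ?thesis by blast
  qed
  have PU: "P y \<in> U" if y: "y \<in> carrier N" for y
  proof -
    obtain u v where "u \<in> U" "v \<in> V" "y = u \<oplus>\<^bsub>N\<^esub> v" using ex[OF y] by blast
    then show ?thesis using Peq by simp
  qed
  have Padd: "P (x \<oplus>\<^bsub>N\<^esub> y) = P x \<oplus>\<^bsub>N\<^esub> P y" if xy: "x \<in> carrier N" "y \<in> carrier N" for x y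
  proof -
    obtain u v u' v' where a: "u \<in> U" "v \<in> V" "x = u \<oplus>\<^bsub>N\<^esub> v" "u' \<in> U" "v' \<in> V" "y = u' \<oplus>\<^bsub>N\<^esub> v'"
      using ex[OF xy(1)] ex[OF xy(2)] by blast
    then have c: "u \<in> carrier N" "u' \<in> carrier N" "v \<in> carrier N" "v' \<in> carrier N" using U'(1) V'(1) by auto
    have "x \<oplus>\<^bsub>N\<^esub> y = (u \<oplus>\<^bsub>N\<^esub> u') \<oplus>\<^bsub>N\<^esub> (v \<oplus>\<^bsub>N\<^esub> v')" using a c by (simp add: N.a_ac)
    then have "P (x \<oplus>\<^bsub>N\<^esub> y) = u \<oplus>\<^bsub>N\<^esub> u'" using a Peq[of "u \<oplus>\<^bsub>N\<^esub> u'" "v \<oplus>\<^bsub>N\<^esub> v'"] U'(3) V'(3) by simp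
    moreover have "P x = u" "P y = u'" using a Peq by simp_all
    ultimately show ?thesis by simp
  qed
  have Ps: "P (s \<odot>\<^bsub>N\<^esub> x) = s \<odot>\<^bsub>N\<^esub> P x" if xs: "x \<in> carrier N" "s \<in> A" for x s
  proof -
    obtain u v where a: "u \<in> U" "v \<in> V" "x = u \<oplus>\<^bsub>N\<^esub> v" using ex[OF xs(1)] by blast
    then have "s \<odot>\<^bsub>N\<^esub> x = s \<odot>\<^bsub>N\<^esub> u \<oplus>\<^bsub>N\<^esub> s \<odot>\<^bsub>N\<^esub> v"
      using N xs U'(1) V'(1) unfolding additive_module_def by blast
    moreover have "P (s \<odot>\<^bsub>N\<^esub> u \<oplus>\<^bsub>N\<^esub> s \<odot>\<^bsub>N\<^esub> v) = s \<odot>\<^bsub>N\<^esub> u"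
      using a xs by (intro Peq U'(5) V'(5))
    moreover have "P x = u" using a Peq by simp
    ultimately show ?thesis by simp
  qed
  let ?i = "inv_into (carrier M) f"
  have i: "?i u \<in> carrier M" "f (?i u) = u" if "u \<in> U" for u
    using bij that by (auto simp: bij_betw_def inv_into_into f_inv_into_f)
  have i': "?i (f x) = x" if "x \<in> carrier M" for x
    using bij that by (auto simp: bij_betw_def)
  show ?thesis
  proof (intro bexI[of _ f] bexI[of _ "\<lambda>y. ?i (P y)"] ballI)
    show "f \<in> mod_hom A M N" using fU U'(1) fh fs by (intro mod_homI) auto
    show "(\<lambda>y. ?i (P y)) \<in> mod_hom A N M"
    proof (rule mod_homI)
      show "?i (P x) \<in> carrier M" if "x \<in> carrier N" for x using PU[OF that] i by auto
      show "?i (P (x \<oplus>\<^bsub>N\<^esub> y)) = ?i (P x) \<oplus>\<^bsub>M\<^esub> ?i (P y)" if "x \<in> carrier N" "y \<in> carrier N" for x y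
        using i'[of "?i (P x) \<oplus>\<^bsub>M\<^esub> ?i (P y)"] i[OF PU[OF that(1)]] i[OF PU[OF that(2)]] Padd that fh by simp
      show "?i (P (s \<odot>\<^bsub>N\<^esub> x)) = s \<odot>\<^bsub>M\<^esub> ?i (P x)" if "s \<in> A" "x \<in> carrier N" for x s
        using i'[of "s \<odot>\<^bsub>M\<^esub> ?i (P x)"] i[OF PU[OF that(2)]] Ps that fs M by (auto simp: additive_module_def)
    qed
    show "?i (P (f x)) = x" if "x \<in> carrier M" for x
      using Peq[OF fU[OF that] V'(2)] i'[OF that] fU[OF that] U'(1) by (auto simp: N.r_zero)
  qed
qed

lemma direct_power_simps:
  "carrier (direct_power I M) = {f \<in> I \<rightarrow>\<^sub>E carrier M. finite {i \<in> I. f i \<noteq> \<zero>\<^bsub>M\<^esub>}}"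
  "f \<oplus>\<^bsub>direct_power I M\<^esub> g = (\<lambda>i\<in>I. f i \<oplus>\<^bsub>M\<^esub> g i)"
  "\<zero>\<^bsub>direct_power I M\<^esub> = (\<lambda>i\<in>I. \<zero>\<^bsub>M\<^esub>)"
  "s \<odot>\<^bsub>direct_power I M\<^esub> f = (\<lambda>i\<in>I. s \<odot>\<^bsub>M\<^esub> f i)"
  by (simp_all add: direct_power_def mk_module_def)

lemma direct_power_additive:
  assumes M: "additive_module A M"
  shows "additive_module A (direct_power I M)"
proof -
  interpret M: abelian_group M using M by (simp add: additive_module_def)
  have c: "f i \<in> carrier M" if "f \<in> carrier (direct_power I M)" "i \<in> I" for f i
    using that by (auto simp: direct_power_simps)
  have fin: "finite {i \<in> I. F (f i) (g i) \<noteq> \<zero>\<^bsub>M\<^esub>}"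
    if "f \<in> carrier (direct_power I M)" "g \<in> carrier (direct_power I M)" "F \<zero>\<^bsub>M\<^esub> \<zero>\<^bsub>M\<^esub> = \<zero>\<^bsub>M\<^esub>" for F f g
  proof (rule finite_subset)
    show "{i \<in> I. F (f i) (g i) \<noteq> \<zero>\<^bsub>M\<^esub>} \<subseteq> {i \<in> I. f i \<noteq> \<zero>\<^bsub>M\<^esub>} \<union> {i \<in> I. g i \<noteq> \<zero>\<^bsub>M\<^esub>}" using that(3) by auto
  qed (use that in \<open>auto simp: direct_power_simps\<close>)
  have cl: "(\<lambda>i\<in>I. F (f i) (g i)) \<in> carrier (direct_power I M)"
    if "f \<in> carrier (direct_power I M)" "g \<in> carrier (direct_power I M)" "F \<zero>\<^bsub>M\<^esub> \<zero>\<^bsub>M\<^esub> = \<zero>\<^bsub>M\<^esub>"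
      "\<And>x y. x \<in> carrier M \<Longrightarrow> y \<in> carrier M \<Longrightarrow> F x y \<in> carrier M" for F f g
  proof -
    have "finite {i \<in> I. (\<lambda>i\<in>I. F (f i) (g i)) i \<noteq> \<zero>\<^bsub>M\<^esub>}"
      using fin[of f g F, OF that(1-3)] by (rule finite_subset[rotated]) auto
    then show ?thesis using that c by (auto simp: direct_power_simps(1))
  qed
  have smz: "s \<odot>\<^bsub>M\<^esub> \<zero>\<^bsub>M\<^esub> = \<zero>\<^bsub>M\<^esub>" if "s \<in> A" for s
    by (rule additive_zero_minus[of M M "\<lambda>x. s \<odot>\<^bsub>M\<^esub> x"]) (use M that in \<open>auto simp: additive_module_def\<close>)
  have ext: "f = g" if "f \<in> carrier (direct_power I M)" "g \<in> carrier (direct_power I M)" "\<And>i. i \<in> I \<Longrightarrow> f i = g i" for f g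
    using that by (auto simp: direct_power_simps intro: PiE_ext)
  have zero: "\<zero>\<^bsub>direct_power I M\<^esub> \<in> carrier (direct_power I M)"
    by (auto simp: direct_power_simps)
  have add: "f \<oplus>\<^bsub>direct_power I M\<^esub> g \<in> carrier (direct_power I M)"
    if "f \<in> carrier (direct_power I M)" "g \<in> carrier (direct_power I M)" for f g
    unfolding direct_power_simps(2) by (rule cl) (use that in auto)
  have sm: "s \<odot>\<^bsub>direct_power I M\<^esub> f \<in> carrier (direct_power I M)"
    if "f \<in> carrier (direct_power I M)" "s \<in> A" for f s
    unfolding direct_power_simps(4) using cl[of f f "\<lambda>x y. s \<odot>\<^bsub>M\<^esub> x"] that M smz
    by (auto simp: additive_module_def)
  have "abelian_group (direct_power I M)"
  proof (rule abelian_groupI)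
    show "\<exists>y\<in>carrier (direct_power I M). y \<oplus>\<^bsub>direct_power I M\<^esub> x = \<zero>\<^bsub>direct_power I M\<^esub>"
      if x: "x \<in> carrier (direct_power I M)" for x
    proof
      show "(\<lambda>i\<in>I. \<ominus>\<^bsub>M\<^esub> x i) \<in> carrier (direct_power I M)"
        using cl[of x x "\<lambda>x y. \<ominus>\<^bsub>M\<^esub> x"] x by auto
      show "(\<lambda>i\<in>I. \<ominus>\<^bsub>M\<^esub> x i) \<oplus>\<^bsub>direct_power I M\<^esub> x = \<zero>\<^bsub>direct_power I M\<^esub>"
        using c[OF x] by (auto simp: direct_power_simps M.l_neg)
    qed
    fix x y z assume x: "x \<in> carrier (direct_power I M)" and y: "y \<in> carrier (direct_power I M)"
      and z: "z \<in> carrier (direct_power I M)"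
    note cc = c[OF x] c[OF y] c[OF z]
    show "x \<oplus>\<^bsub>direct_power I M\<^esub> y \<oplus>\<^bsub>direct_power I M\<^esub> z = x \<oplus>\<^bsub>direct_power I M\<^esub> (y \<oplus>\<^bsub>direct_power I M\<^esub> z)"
      unfolding direct_power_simps using cc by (auto simp: M.a_assoc)
    show "x \<oplus>\<^bsub>direct_power I M\<^esub> y = y \<oplus>\<^bsub>direct_power I M\<^esub> x"
      unfolding direct_power_simps using cc by (auto simp: M.a_comm)
    show "\<zero>\<^bsub>direct_power I M\<^esub> \<oplus>\<^bsub>direct_power I M\<^esub> x = x"
      by (rule ext[OF add[OF zero x] x]) (use cc in \<open>auto simp: direct_power_simps\<close>)
  qed (use zero add in auto)
  moreover have "s \<odot>\<^bsub>direct_power I M\<^esub> (x \<oplus>\<^bsub>direct_power I M\<^esub> y) =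
      s \<odot>\<^bsub>direct_power I M\<^esub> x \<oplus>\<^bsub>direct_power I M\<^esub> s \<odot>\<^bsub>direct_power I M\<^esub> y"
    if "s \<in> A" "x \<in> carrier (direct_power I M)" "y \<in> carrier (direct_power I M)" for s x y
    unfolding direct_power_simps using M c[OF that(2)] c[OF that(3)] that(1)
    by (auto simp: additive_module_def)
  ultimately show ?thesis using sm by (simp add: additive_module_def)
qed

definition dp_inj :: "'i set \<Rightarrow> ('s, 'm) module \<Rightarrow> 'i \<Rightarrow> 'm \<Rightarrow> 'i \<Rightarrow> 'm" where
  "dp_inj I M j x = (\<lambda>i\<in>I. if i = j then x else \<zero>\<^bsub>M\<^esub>)"

lemma dp_inj_hom:
  assumes M: "additive_module A M" and j: "j \<in> I"
  shows "dp_inj I M j \<in> mod_hom A M (direct_power I M)"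
proof (rule mod_homI)
  interpret M: abelian_group M using M by (simp add: additive_module_def)
  have smz: "s \<odot>\<^bsub>M\<^esub> \<zero>\<^bsub>M\<^esub> = \<zero>\<^bsub>M\<^esub>" if "s \<in> A" for s
    by (rule additive_zero_minus[of M M "\<lambda>x. s \<odot>\<^bsub>M\<^esub> x"]) (use M that in \<open>auto simp: additive_module_def\<close>)
  fix x assume x: "x \<in> carrier M"
  have "finite {i \<in> I. dp_inj I M j x i \<noteq> \<zero>\<^bsub>M\<^esub>}"
    by (rule finite_subset[of _ "{j}"]) (auto simp: dp_inj_def split: if_splits)
  then show "dp_inj I M j x \<in> carrier (direct_power I M)"
    using x by (auto simp: direct_power_simps dp_inj_def)
  show "dp_inj I M j (s \<odot>\<^bsub>M\<^esub> x) = s \<odot>\<^bsub>direct_power I M\<^esub> dp_inj I M j x" if "s \<in> A" for s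
    using smz[OF that] by (auto simp: direct_power_simps dp_inj_def)
  show "dp_inj I M j (x \<oplus>\<^bsub>M\<^esub> y) = dp_inj I M j x \<oplus>\<^bsub>direct_power I M\<^esub> dp_inj I M j y" if "y \<in> carrier M" for y
    using that x by (auto simp: direct_power_simps dp_inj_def)
qed

text \<open>Elements of a direct power have finite support even if \<open>I\<close> is infinite; the
  induction removes one coordinate of the support at a time.\<close>

lemma direct_power_additive_sum:
  fixes G :: "('i \<Rightarrow> 'm) \<Rightarrow> 'z::ab_group_add"
  assumes M: "additive_module A M"
    and add: "\<And>x y. x \<in> carrier (direct_power I M) \<Longrightarrow> y \<in> carrier (direct_power I M) \<Longrightarrow>
       G (x \<oplus>\<^bsub>direct_power I M\<^esub> y) = G x + G y"
    and J: "finite J" "J \<subseteq> I" and d: "d \<in> carrier (direct_power I M)" "\<And>i. i \<in> I - J \<Longrightarrow> d i = \<zero>\<^bsub>M\<^esub>"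
  shows "G d = (\<Sum>i\<in>J. G (dp_inj I M i (d i)))"
  using J d
proof (induction J arbitrary: d rule: finite_induct)
  case empty
  interpret D: abelian_group "direct_power I M"
    using direct_power_additive[OF M, of I] by (simp add: additive_module_def)
  have "d = \<zero>\<^bsub>direct_power I M\<^esub>"
    using empty by (auto simp: direct_power_simps PiE_def extensional_def fun_eq_iff)
  moreover have "G \<zero>\<^bsub>direct_power I M\<^esub> = 0"
    using add[OF D.zero_closed D.zero_closed] by simp
  ultimately show ?case by simp
next
  case (insert j J)
  interpret M: abelian_group M using M by (simp add: additive_module_def)
  let ?d = "d(j := \<zero>\<^bsub>M\<^esub>)"
  have jI: "j \<in> I" using insert by auto
  have "finite {i \<in> I. ?d i \<noteq> \<zero>\<^bsub>M\<^esub>}"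
    using insert.prems(2) by (auto simp: direct_power_simps elim: finite_subset[rotated])
  then have d': "?d \<in> carrier (direct_power I M)"
    using insert.prems(2) jI by (auto simp: direct_power_simps PiE_def extensional_def)
  have dj: "d j \<in> carrier M" using insert.prems(2) jI by (auto simp: direct_power_simps)
  have i: "dp_inj I M j (d j) \<in> carrier (direct_power I M)"
    by (rule mod_homD(1)[OF dp_inj_hom[OF M jI] dj])
  have "d = dp_inj I M j (d j) \<oplus>\<^bsub>direct_power I M\<^esub> ?d"
    using insert.prems(2) dj by (auto simp: direct_power_simps dp_inj_def fun_eq_iff PiE_def extensional_def Pi_def)
  then have "G d = G (dp_inj I M j (d j)) + G ?d" using add[OF i d'] by metis
  also have "G ?d = (\<Sum>i\<in>J. G (dp_inj I M i (?d i)))"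
    by (rule insert.IH) (use insert.prems d' in \<open>auto simp del: fun_upd_apply\<close>, auto)
  also have "\<dots> = (\<Sum>i\<in>J. G (dp_inj I M i (d i)))"
    using insert.hyps by (intro sum.cong refl) auto
  finally show ?case using insert.hyps by simp
qed

lemma power_retract_homs:
  assumes N: "additive_module A N"
    and F: "F \<in> mod_hom A M (direct_power I N)" and G: "G \<in> mod_hom A (direct_power I N) M" and i: "i \<in> I"
  shows "(\<lambda>x. F x i) \<in> mod_hom A M N" "(\<lambda>y. G (dp_inj I N i y)) \<in> mod_hom A N M"
proof -
  show "(\<lambda>x. F x i) \<in> mod_hom A M N"
    by (rule mod_homI) (use mod_homD[OF F] i in \<open>auto simp: direct_power_simps\<close>)
  show "(\<lambda>y. G (dp_inj I N i y)) \<in> mod_hom A N M"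
    by (rule mod_hom_comp[OF dp_inj_hom[OF N i] G])
qed

text \<open>If \<open>M\<close> is a retract of a direct power of \<open>N\<close>, the value of an
  additive function on \<open>M\<close> is a finite sum of contributions that each pass through one
  copy of \<open>N\<close>. Properties of functions on \<open>N\<close> are transferred to
  \<open>M\<close> in this way.\<close>

lemma power_retract_sum:
  fixes B :: "'m \<Rightarrow> 'z::ab_group_add"
  assumes N: "additive_module A N"
    and F: "F \<in> mod_hom A M (direct_power I N)" and G: "G \<in> mod_hom A (direct_power I N) M"
    and GF: "G (F x) = x" and x: "x \<in> carrier M"
    and B: "\<And>x y. x \<in> carrier M \<Longrightarrow> y \<in> carrier M \<Longrightarrow> B (x \<oplus>\<^bsub>M\<^esub> y) = B x + B y"
  shows "B x = (\<Sum>i\<in>{i \<in> I. F x i \<noteq> \<zero>\<^bsub>N\<^esub>}. B (G (dp_inj I N i (F x i))))"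
proof -
  have "B (G (F x)) = (\<Sum>i\<in>{i \<in> I. F x i \<noteq> \<zero>\<^bsub>N\<^esub>}. B (G (dp_inj I N i (F x i))))"
    by (rule direct_power_additive_sum[OF N, where G = "\<lambda>d. B (G d)"])
      (use mod_homD[OF G] mod_homD(1)[OF F x] B in \<open>auto simp: direct_power_simps(1)\<close>)
  then show ?thesis by (simp add: GF)
qed

lemma finsum_hom_sum:
  assumes M: "abelian_group M" and "finite J"
    and c: "\<And>x. x \<in> C \<Longrightarrow> c x \<in> carrier M" "\<And>x y. x \<in> C \<Longrightarrow> y \<in> C \<Longrightarrow> c (x + y) = c x \<oplus>\<^bsub>M\<^esub> c y" "c 0 = \<zero>\<^bsub>M\<^esub>"
    and C: "0 \<in> C" "\<And>x y. x \<in> C \<Longrightarrow> y \<in> C \<Longrightarrow> x + y \<in> (C :: 'z::ab_group_add set)"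
    and p: "\<And>i. i \<in> J \<Longrightarrow> p i \<in> C"
  shows "finsum M (\<lambda>i. c (p i)) J = c (\<Sum>i\<in>J. p i) \<and> (\<Sum>i\<in>J. p i) \<in> C"
  using assms(2) p
proof (induction J rule: finite_induct)
  case empty
  interpret M: abelian_group M by fact
  show ?case using c C by simp
next
  case (insert j J)
  interpret M: abelian_group M by fact
  show ?case using insert c C by (simp add: Pi_def)
qed

text \<open>The \<open>f i\<close> are the coordinates of an embedding into the direct power, and
  the sum of the \<open>g i\<close> is its retraction.\<close>

lemma family_summand:
  assumes M: "additive_module A M" and N: "additive_module A N" and I: "finite I"
    and f: "\<And>i. i \<in> I \<Longrightarrow> f i \<in> mod_hom A M N" and g: "\<And>i. i \<in> I \<Longrightarrow> g i \<in> mod_hom A N M"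
    and gf: "\<And>x. x \<in> carrier M \<Longrightarrow> finsum M (\<lambda>i. g i (f i x)) I = x"
  shows "iso_to_summand A M (direct_power I N)"
proof (rule retract_summand[OF M direct_power_additive[OF N]])
  interpret M: abelian_group M using M by (simp add: additive_module_def)
  note f' = mod_homD[OF f] and g' = mod_homD[OF g]
  show "(\<lambda>x. \<lambda>i\<in>I. f i x) \<in> mod_hom A M (direct_power I N)"
    by (rule mod_homI) (use f' I in \<open>auto simp: direct_power_simps\<close>)
  have dc: "d i \<in> carrier N" if "d \<in> carrier (direct_power I N)" "i \<in> I" for d i
    using that by (auto simp: direct_power_simps)
  have gc: "(\<lambda>i. g i (d i)) \<in> I \<rightarrow> carrier M" if "d \<in> carrier (direct_power I N)" for d
    using g'(1) that by (force simp: direct_power_simps(1))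
  show "(\<lambda>d. finsum M (\<lambda>i. g i (d i)) I) \<in> mod_hom A (direct_power I N) M"
  proof (rule mod_homI)
    show "finsum M (\<lambda>i. g i (d i)) I \<in> carrier M" if "d \<in> carrier (direct_power I N)" for d
      using gc[OF that] by (rule M.finsum_closed)
    show "finsum M (\<lambda>i. g i ((d \<oplus>\<^bsub>direct_power I N\<^esub> e) i)) I =
        finsum M (\<lambda>i. g i (d i)) I \<oplus>\<^bsub>M\<^esub> finsum M (\<lambda>i. g i (e i)) I"
      if d: "d \<in> carrier (direct_power I N)" and e: "e \<in> carrier (direct_power I N)" for d e
    proof -
      have "finsum M (\<lambda>i. g i ((d \<oplus>\<^bsub>direct_power I N\<^esub> e) i)) I = finsum M (\<lambda>i. g i (d i) \<oplus>\<^bsub>M\<^esub> g i (e i)) I"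
        by (rule M.finsum_cong') (use g' dc[OF d] dc[OF e] in \<open>auto simp: direct_power_simps\<close>)
      also have "\<dots> = finsum M (\<lambda>i. g i (d i)) I \<oplus>\<^bsub>M\<^esub> finsum M (\<lambda>i. g i (e i)) I"
        by (rule M.finsum_addf[OF gc[OF d] gc[OF e]])
      finally show ?thesis .
    qed
    show "finsum M (\<lambda>i. g i ((s \<odot>\<^bsub>direct_power I N\<^esub> d) i)) I = s \<odot>\<^bsub>M\<^esub> finsum M (\<lambda>i. g i (d i)) I"
      if s: "s \<in> A" and d: "d \<in> carrier (direct_power I N)" for s d
    proof -
      have sc: "s \<odot>\<^bsub>M\<^esub> x \<in> carrier M" if "x \<in> carrier M" for x using M s that by (simp add: additive_module_def)
      have sa: "s \<odot>\<^bsub>M\<^esub> (x \<oplus>\<^bsub>M\<^esub> y) = s \<odot>\<^bsub>M\<^esub> x \<oplus>\<^bsub>M\<^esub> s \<odot>\<^bsub>M\<^esub> y" if "x \<in> carrier M" "y \<in> carrier M" for x y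
        using M s that by (simp add: additive_module_def)
      have smz: "s \<odot>\<^bsub>M\<^esub> \<zero>\<^bsub>M\<^esub> = \<zero>\<^bsub>M\<^esub>"
        by (rule additive_zero_minus[of M M "\<lambda>x. s \<odot>\<^bsub>M\<^esub> x"]) (use sc sa M.abelian_group_axioms in auto)
      have "finsum M (\<lambda>i. g i ((s \<odot>\<^bsub>direct_power I N\<^esub> d) i)) I = finsum M (\<lambda>i. s \<odot>\<^bsub>M\<^esub> g i (d i)) I"
        by (rule M.finsum_cong') (use g' s sc dc[OF d] in \<open>auto simp: direct_power_simps\<close>)
      also have "\<dots> = s \<odot>\<^bsub>M\<^esub> finsum M (\<lambda>i. g i (d i)) I"
        using I gc[OF d]
      proof (induction I rule: finite_induct)
        case (insert j J)
        then show ?case using sa sc by (simp add: Pi_def)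
      qed (simp add: smz)
      finally show ?thesis .
    qed
  qed
  show "finsum M (\<lambda>i. g i ((\<lambda>i\<in>I. f i x) i)) I = x" if x: "x \<in> carrier M" for x
  proof -
    have "finsum M (\<lambda>i. g i ((\<lambda>i\<in>I. f i x) i)) I = finsum M (\<lambda>i. g i (f i x)) I"
      by (rule M.finsum_cong') (use x f' g' in auto)
    then show ?thesis using gf[OF x] by simp
  qed
qed

section \<open>Quotients of spaces of formal sums\<close>

text \<open>The quotient by \<open>N\<close> is replaced by the image of a linear projection with kernel \<open>N\<close>, so that
  universal multilinear functions take values in a vector space in the sense of a type class.\<close>

definition nproj :: "('x \<Rightarrow>\<^sub>0 'k::field) set \<Rightarrow> ('x \<Rightarrow>\<^sub>0 'k) \<Rightarrow> ('x \<Rightarrow>\<^sub>0 'k)" where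
  "nproj N = (SOME p. lin fscale fscale p \<and> (\<forall>x. p x = 0 \<longleftrightarrow> x \<in> N) \<and> (\<forall>x. x - p x \<in> N))"

lemma nproj:
  assumes "fs.subspace N"
  shows "lin fscale fscale (nproj N)" "nproj N x = 0 \<longleftrightarrow> x \<in> N" "x - nproj N x \<in> N"
proof -
  have "\<exists>p. lin fscale fscale p \<and> (\<forall>x. p x = 0 \<longleftrightarrow> x \<in> N) \<and> (\<forall>x. x - p x \<in> N)"
    using exists_projection[OF vs_fscale assms] by metis
  from someI_ex[OF this] show "lin fscale fscale (nproj N)" "nproj N x = 0 \<longleftrightarrow> x \<in> N" "x - nproj N x \<in> N"
    unfolding nproj_def by blast+
qed

lemma lin_ext_mem:
  assumes "vector_space sc" "Modules.module.subspace sc U" "\<And>x. x \<in> Poly_Mapping.keys p \<Longrightarrow> f x \<in> U"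
  shows "lin_ext sc f p \<in> U"
proof -
  interpret vector_space sc by fact
  show ?thesis unfolding lin_ext_def by (intro subspace_sum[OF assms(2)] subspace_scale[OF assms(2)] assms(3))
qed

lemma coset_set_plus:
  assumes "0 \<in> N" "\<And>x y. x \<in> N \<Longrightarrow> y \<in> N \<Longrightarrow> x + y \<in> (N :: 'z::ab_group_add set)"
  shows "(a +o N) + (b +o N) = (a + b) +o N"
proof -
  have "N + N = N"
    using set_zero_plus2[OF assms(1), of N] assms(2) by (auto elim!: set_plus_elim)
  then show ?thesis by (simp add: set_plus_rearrange)
qed

lemma coset_image_plus:
  assumes N: "0 \<in> N" "\<And>x y. x \<in> N \<Longrightarrow> y \<in> N \<Longrightarrow> x + y \<in> (N :: 'z::ab_group_add set)"
    and f: "\<And>x y. f (x + y) = f x + f y" "\<And>x. x \<in> N \<Longrightarrow> f x \<in> N"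
  shows "f ` (a +o N) + N = f a +o N"
proof (intro equalityI subsetI)
  fix x assume "x \<in> f ` (a +o N) + N"
  then obtain b c where "b \<in> N" "c \<in> N" "x = f (a + b) + c"
    by (auto simp: elt_set_plus_def elim!: set_plus_elim)
  then show "x \<in> f a +o N" using N f by (auto simp: elt_set_plus_def add.assoc)
next
  fix x assume "x \<in> f a +o N"
  then obtain b where b: "b \<in> N" "x = f a + b" by (auto simp: elt_set_plus_def)
  have "a \<in> a +o N" using set_plus_intro2[OF N(1), of a] by simp
  with b show "x \<in> f ` (a +o N) + N" by blast
qed

text \<open>The conditions under which the coset operations of \<open>quotient_module\<close> are
  well defined. They are verified for the powers of \<open>Q\<close> and for the tensor powers of
  \<open>H\<close> over \<open>R\<close>.\<close>

locale quotient_action =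
  fixes C N :: "('x \<Rightarrow>\<^sub>0 'k::field) set" and act :: "'s \<Rightarrow> ('x \<Rightarrow>\<^sub>0 'k) \<Rightarrow> ('x \<Rightarrow>\<^sub>0 'k)" and A :: "'s set"
  assumes C: "fs.subspace C" and N: "fs.subspace N" and NC: "N \<subseteq> C"
    and act_lin: "\<And>s. s \<in> A \<Longrightarrow> lin fscale fscale (act s)"
    and act_C: "\<And>s x. s \<in> A \<Longrightarrow> x \<in> C \<Longrightarrow> act s x \<in> C"
    and act_N: "\<And>s x. s \<in> A \<Longrightarrow> x \<in> N \<Longrightarrow> act s x \<in> N"
begin

abbreviation "cls x \<equiv> x +o N"
abbreviation "M \<equiv> quotient_module C N act"

lemma cls_eq: "cls x = cls y \<longleftrightarrow> x - y \<in> N"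
  unfolding elt_set_plus_def[symmetric]
proof -
  have "x +o N = y +o N" if d: "x - y \<in> N"
  proof -
    have "z \<in> x +o N \<longleftrightarrow> z \<in> y +o N" for z
      using fs.subspace_add[OF N, of "z - x" "x - y"] fs.subspace_diff[OF N, of "z - y" "x - y"] d
      by (auto simp: set_minus_plus[symmetric])
    then show ?thesis by blast
  qed
  moreover have "x - y \<in> N" if "x +o N = y +o N"
    using set_plus_intro2[OF fs.subspace_0[OF N], of x] that by (auto dest: set_plus_imp_minus)
  ultimately show "x +o N = y +o N \<longleftrightarrow> x - y \<in> N" by blast
qed

lemma carrier_M: "carrier M = cls ` C"
  by (auto simp: quotient_module_def mk_module_def)

lemma add_M: "cls x \<oplus>\<^bsub>M\<^esub> cls y = cls (x + y)"
  by (simp add: quotient_module_def mk_module_def coset_set_plus fs.subspace_0[OF N] fs.subspace_add[OF N])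

lemma zero_M: "\<zero>\<^bsub>M\<^esub> = cls 0"
  by (simp add: quotient_module_def mk_module_def)

lemma smult_M: "s \<in> A \<Longrightarrow> s \<odot>\<^bsub>M\<^esub> cls x = cls (act s x)"
  by (simp add: quotient_module_def mk_module_def coset_image_plus fs.subspace_0[OF N] fs.subspace_add[OF N]
      linD[OF act_lin] act_N)

lemma additive_M: "additive_module A M"
  unfolding additive_module_def
proof (intro conjI ballI)
  show "abelian_group M"
  proof (rule abelian_groupI)
    show "\<zero>\<^bsub>M\<^esub> \<in> carrier M" unfolding zero_M carrier_M using fs.subspace_0[OF C] by (rule imageI)
    fix X assume "X \<in> carrier M"
    then obtain x where x: "x \<in> C" "X = cls x" by (auto simp: carrier_M)
    show "\<zero>\<^bsub>M\<^esub> \<oplus>\<^bsub>M\<^esub> X = X" by (simp add: x zero_M add_M del: set_zero_plus)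
    show "\<exists>Y\<in>carrier M. Y \<oplus>\<^bsub>M\<^esub> X = \<zero>\<^bsub>M\<^esub>"
      using fs.subspace_neg[OF C x(1)] by (intro bexI[of _ "cls (- x)"]) (auto simp: x carrier_M zero_M add_M simp del: set_zero_plus)
    fix Y assume "Y \<in> carrier M"
    then obtain y where y: "y \<in> C" "Y = cls y" by (auto simp: carrier_M)
    show "X \<oplus>\<^bsub>M\<^esub> Y \<in> carrier M" using x y fs.subspace_add[OF C] by (auto simp: carrier_M add_M)
    show "X \<oplus>\<^bsub>M\<^esub> Y = Y \<oplus>\<^bsub>M\<^esub> X" by (simp add: x y add_M add.commute)
    fix Z assume "Z \<in> carrier M"
    then obtain z where z: "z \<in> C" "Z = cls z" by (auto simp: carrier_M)
    show "X \<oplus>\<^bsub>M\<^esub> Y \<oplus>\<^bsub>M\<^esub> Z = X \<oplus>\<^bsub>M\<^esub> (Y \<oplus>\<^bsub>M\<^esub> Z)" by (simp add: x y z add_M add.assoc)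
  qed
  fix s X assume s: "s \<in> A" and "X \<in> carrier M"
  then obtain x where x: "x \<in> C" "X = cls x" by (auto simp: carrier_M)
  show "s \<odot>\<^bsub>M\<^esub> X \<in> carrier M" using act_C[OF s x(1)] by (simp add: x smult_M[OF s] carrier_M)
  fix Y assume "Y \<in> carrier M"
  then obtain y where y: "y \<in> C" "Y = cls y" by (auto simp: carrier_M)
  show "s \<odot>\<^bsub>M\<^esub> (X \<oplus>\<^bsub>M\<^esub> Y) = s \<odot>\<^bsub>M\<^esub> X \<oplus>\<^bsub>M\<^esub> s \<odot>\<^bsub>M\<^esub> Y"
    by (simp add: x y add_M smult_M[OF s] linD[OF act_lin[OF s]])
qed

definition lift :: "(('x \<Rightarrow>\<^sub>0 'k) \<Rightarrow> 'z) \<Rightarrow> ('x \<Rightarrow>\<^sub>0 'k) set \<Rightarrow> 'z" where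
  "lift f X = f (SOME x. X = cls x)"

lemma lift_cls:
  assumes "\<And>x y. x - y \<in> N \<Longrightarrow> f x = f y"
  shows "lift f (cls x) = f x"
proof -
  have "cls x = cls (SOME y. cls x = cls y)" by (rule someI_ex) blast
  then have "x - (SOME y. cls x = cls y) \<in> N" by (simp only: cls_eq)
  from assms[OF this] show ?thesis by (simp add: lift_def)
qed

end

section \<open>Universal functions on the tensor powers of \<open>Q\<close>\<close>

context hopf_pair
begin

definition W :: "'h set" where "W = span {r * h | r h. r \<in> augmentation_ideal H R}"

abbreviation "Qc x \<equiv> x +o W"

lemma W_sub: "subspace W" by (simp add: W_def)

lemma W_mult: "x \<in> W \<Longrightarrow> x * h \<in> W"
proof -
  assume x: "x \<in> W"
  have "(\<lambda>x. x * h) ` span {r * h | r h. r \<in> augmentation_ideal H R} \<subseteq> W"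
    unfolding lin_span_image[OF lin_mult_right[OF lin_id[OF hs_vs]], of h]
    unfolding W_def by (intro span_mono) (auto simp: mult.assoc, blast)
  with x show ?thesis unfolding W_def by blast
qed

lemma Qc_eq: "Qc x = Qc y \<longleftrightarrow> x - y \<in> W"
  by (rule coset_eq) (auto intro: subspace_diff[OF W_sub] subspace_0[OF W_sub])

lemma Qmod_simps:
  "carrier (Qmod H R) = range (\<lambda>x. Qc x)"
  "Qc x \<oplus>\<^bsub>Qmod H R\<^esub> Qc y = Qc (x + y)"
  "\<zero>\<^bsub>Qmod H R\<^esub> = Qc 0"
  "h \<odot>\<^bsub>Qmod H R\<^esub> Qc x = Qc (x * h)"
proof -
  note W0 = subspace_0[OF W_sub] and Wp = subspace_add[OF W_sub]
  show "carrier (Qmod H R) = range (\<lambda>x. Qc x)" "\<zero>\<^bsub>Qmod H R\<^esub> = Qc 0"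
    by (auto simp: Qmod_def quotient_module_def mk_module_def W_def)
  show "Qc x \<oplus>\<^bsub>Qmod H R\<^esub> Qc y = Qc (x + y)"
    using coset_set_plus[OF W0 Wp] by (simp add: Qmod_def quotient_module_def mk_module_def)
  show "h \<odot>\<^bsub>Qmod H R\<^esub> Qc x = Qc (x * h)"
    using coset_image_plus[OF W0 Wp, of "\<lambda>x. x * h" x] W_mult
    by (simp add: Qmod_def quotient_module_def mk_module_def W_def distrib_right)
qed

definition Qrep :: "'h set \<Rightarrow> 'h" where "Qrep q = (SOME x. q = Qc x)"

lemma Qrep: "q \<in> carrier (Qmod H R) \<Longrightarrow> Qc (Qrep q) = q"
proof -
  assume "q \<in> carrier (Qmod H R)"
  then have "\<exists>x. q = Qc x" by (auto simp: Qmod_simps)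
  then have "q = Qc (Qrep q)" unfolding Qrep_def by (rule someI_ex)
  then show ?thesis by (rule sym)
qed

abbreviation "Qvec \<equiv> restrict_to_field H (Qmod H R)"

lemma Qvec_simps:
  "carrier Qvec = range (\<lambda>x. Qc x)"
  "Qc x \<oplus>\<^bsub>Qvec\<^esub> Qc y = Qc (x + y)"
  "c \<odot>\<^bsub>Qvec\<^esub> Qc x = Qc (hs c x)"
  by (simp_all add: restrict_to_field_def mk_module_def Qmod_simps scale_mult_right)

text \<open>Represents linear maps out of Q^n by functions on words in \<open>H\<close>: in every
  slot, \<open>r * x\<close> minus the counit of \<open>r\<close> times \<open>x\<close> is killed,
  and these elements span R^+H. Unlike in \<open>good\<close>, the first slot is included.\<close>

definition Qgood :: "('k \<Rightarrow> 'v::ab_group_add \<Rightarrow> 'v) \<Rightarrow> nat \<Rightarrow> ('h list \<Rightarrow> 'v) \<Rightarrow> bool" where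
  "Qgood sc n g \<longleftrightarrow> mlin sc n g \<and>
     (\<forall>us x vs r. length us + 1 + length vs = n \<and> r \<in> R \<longrightarrow>
        g (us @ (r * x) # vs) = sc (eps r) (g (us @ x # vs)))"

lemma QgoodD: "Qgood sc n g \<Longrightarrow> mlin sc n g"
  "Qgood sc n g \<Longrightarrow> length us + 1 + length vs = n \<Longrightarrow> r \<in> R \<Longrightarrow>
     g (us @ (r * x) # vs) = sc (eps r) (g (us @ x # vs))"
  by (auto simp: Qgood_def)

lemma Qgood_W:
  assumes g: "Qgood sc n g" and l: "length us + 1 + length vs = n" and xy: "x - y \<in> W"
  shows "g (us @ x # vs) = g (us @ y # vs)"
proof -
  note L = mlinD(2)[OF QgoodD(1)[OF g] l]
  interpret v: vector_space sc using QgoodD(1)[OF g] by (rule mlinD)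
  have "g (us @ (x - y) # vs) = 0"
  proof (rule span_subset_kernel[OF L])
    show "x - y \<in> span {r * h | r h. r \<in> augmentation_ideal H R}" using xy by (simp add: W_def)
    show "g (us @ z # vs) = 0" if "z \<in> {r * h | r h. r \<in> augmentation_ideal H R}" for z
      using that QgoodD(2)[OF g l] by (auto simp: augmentation_ideal_def)
  qed
  then show ?thesis by (simp add: linD(6)[OF L])
qed

lemma Qgood_map:
  assumes g: "Qgood sc n g" and w: "length w = n" "map (\<lambda>x. Qc x) w = map (\<lambda>x. Qc x) w'"
  shows "g w = g w'"
proof -
  have "g (us @ w) = g (us @ w')" if "length us + length w = n" "map (\<lambda>x. Qc x) w = map (\<lambda>x. Qc x) w'" for us w w'
    using that
  proof (induction w arbitrary: us w')
    case (Cons x w)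
    then obtain y v where w': "w' = y # v" "Qc x = Qc y" "map (\<lambda>x. Qc x) w = map (\<lambda>x. Qc x) v" by auto
    have "g (us @ x # w) = g (us @ y # w)"
      by (rule Qgood_W[OF g]) (use Cons.prems w' Qc_eq in auto)
    also have "\<dots> = g ((us @ [y]) @ w)" by simp
    also have "\<dots> = g ((us @ [y]) @ v)"
      by (rule Cons.IH) (use Cons.prems w' in auto)
    finally show ?case by (simp add: w')
  qed simp
  from this[of "[]" w w'] w show ?thesis by simp
qed

lemma Qgood_dact: "Qgood sc n g \<Longrightarrow> Qgood sc n (\<lambda>v. dact sc v g h)"
  unfolding Qgood_def[of sc n "\<lambda>v. dact sc v g h"]
proof (intro conjI allI impI)
  assume g: "Qgood sc n g"
  show "mlin sc n (\<lambda>v. dact sc v g h)" using QgoodD(1)[OF g] by (rule mlin_dact)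
  fix us vs :: "'h list" and x r assume a: "length us + 1 + length vs = n \<and> r \<in> R"
  then show "dact sc (us @ (r * x) # vs) g h = sc (eps r) (dact sc (us @ x # vs) g h)"
    by (intro dact_slot[OF mlinD(1)[OF QgoodD(1)[OF g]]] QgoodD(2)[OF g]) auto
qed

text \<open>The linear map on formal sums of words of cosets that comes from a function on words in
  \<open>H\<close>; for \<open>Qgood\<close> functions the representatives \<open>Qrep\<close> do
  not matter, by \<open>Qgood_map\<close>.\<close>

definition hat :: "('k \<Rightarrow> 'v::ab_group_add \<Rightarrow> 'v) \<Rightarrow> ('h list \<Rightarrow> 'v) \<Rightarrow> ('h set list \<Rightarrow>\<^sub>0 'k) \<Rightarrow> 'v" where
  "hat sc g = lin_ext sc (\<lambda>qs. g (map Qrep qs))"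

abbreviation "NQ n \<equiv> tensor_null Qvec n"
abbreviation CQ :: "nat \<Rightarrow> ('h set list \<Rightarrow>\<^sub>0 'k) set" where "CQ n \<equiv> formal_tensors (carrier (Qmod H R)) n"
text \<open>The class of a word in Q^n, with the projection \<open>nproj\<close> in place of the
  quotient map. It is the universal \<open>Qgood\<close> function: by \<open>hat_uQ\<close> every
  other one factors through it.\<close>

definition uQ :: "nat \<Rightarrow> 'h list \<Rightarrow> ('h set list \<Rightarrow>\<^sub>0 'k)" where
  "uQ n w = nproj (NQ n) (pure (map (\<lambda>x. Qc x) w))"

lemma Qlist: "set qs \<subseteq> carrier (Qmod H R) \<Longrightarrow> map (\<lambda>x. Qc x) (map Qrep qs) = qs"
  by (induction qs) (auto simp: Qrep)

lemma map_Qrep_Qc: "map (\<lambda>x. Qc x) (map Qrep (map (\<lambda>x. Qc x) w)) = map (\<lambda>x. Qc x) w"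
  by (rule Qlist) (auto simp: Qmod_simps)

lemma multilinear_Qgood:
  assumes g: "Qgood sc n g"
  shows "multilinear_on Qvec sc n (\<lambda>qs. g (map Qrep qs))"
  unfolding multilinear_on_def
proof (intro conjI allI impI)
  show "vector_space sc" using QgoodD(1)[OF g] by (rule mlinD)
  have *: "g (map Qrep (us @ [Qc x] @ vs)) = g (map Qrep us @ x # map Qrep vs)"
    if "length us + 1 + length vs = n" "set us \<union> set vs \<subseteq> carrier Qvec" for us vs x
    by (rule Qgood_map[OF g]) (use that in \<open>auto simp: Qrep Qmod_simps Qvec_simps\<close>)
  fix us vs x y
  assume a: "length us + 1 + length vs = n \<and> set us \<union> set vs \<union> {x, y} \<subseteq> carrier Qvec"
  then obtain x' y' where xy: "x = Qc x'" "y = Qc y'" by (auto simp: Qvec_simps)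
  have L: "lin hs sc (\<lambda>z. g (map Qrep us @ z # map Qrep vs))"
    by (rule mlinD(2)[OF QgoodD(1)[OF g]]) (use a in simp)
  show "g (map Qrep (us @ [x \<oplus>\<^bsub>Qvec\<^esub> y] @ vs)) = g (map Qrep (us @ [x] @ vs)) + g (map Qrep (us @ [y] @ vs))"
    unfolding xy Qvec_simps using a by (subst (1 2 3) *) (auto simp: linD(3)[OF L])
next
  have *: "g (map Qrep (us @ [Qc x] @ vs)) = g (map Qrep us @ x # map Qrep vs)"
    if "length us + 1 + length vs = n" "set us \<union> set vs \<subseteq> carrier Qvec" for us vs x
    by (rule Qgood_map[OF g]) (use that in \<open>auto simp: Qrep Qmod_simps Qvec_simps\<close>)
  fix us vs c x
  assume a: "length us + 1 + length vs = n \<and> set us \<union> set vs \<union> {x} \<subseteq> carrier Qvec"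
  then obtain x' where xy: "x = Qc x'" by (auto simp: Qvec_simps)
  have L: "lin hs sc (\<lambda>z. g (map Qrep us @ z # map Qrep vs))"
    by (rule mlinD(2)[OF QgoodD(1)[OF g]]) (use a in simp)
  show "g (map Qrep (us @ [c \<odot>\<^bsub>Qvec\<^esub> x] @ vs)) = sc c (g (map Qrep (us @ [x] @ vs)))"
    unfolding xy Qvec_simps using a by (subst (1 2) *) (auto simp: linD(4)[OF L])
qed

lemma lin_hat: "vector_space sc \<Longrightarrow> lin fscale sc (hat sc g)"
  unfolding hat_def by (rule lin_lin_ext)

lemma hat_null: "Qgood sc n g \<Longrightarrow> x \<in> NQ n \<Longrightarrow> hat sc g x = 0"
  unfolding hat_def by (rule multilinear_on_null[OF multilinear_Qgood])

lemma hat_pure: "Qgood sc n g \<Longrightarrow> length w = n \<Longrightarrow> hat sc g (pure (map (\<lambda>x. Qc x) w)) = g w"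
proof -
  assume g: "Qgood sc n g" and w: "length w = n"
  have sc: "vector_space sc" using QgoodD(1)[OF g] by (rule mlinD)
  show ?thesis unfolding hat_def lin_ext_pure[OF sc]
    by (rule Qgood_map[OF g]) (simp add: w, rule map_Qrep_Qc)
qed

lemma nproj_NQ: "lin fscale fscale (nproj (NQ n))" "nproj (NQ n) x = 0 \<longleftrightarrow> x \<in> NQ n" "x - nproj (NQ n) x \<in> NQ n"
  by (rule nproj[OF subspace_tensor_null])+

lemma hat_nproj: "Qgood sc n g \<Longrightarrow> hat sc g (nproj (NQ n) x) = hat sc g x"
proof -
  assume g: "Qgood sc n g"
  have sc: "vector_space sc" using QgoodD(1)[OF g] by (rule mlinD)
  show ?thesis using hat_null[OF g nproj_NQ(3)[of x n]] by (simp add: linD(6)[OF lin_hat[OF sc]])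
qed

lemma hat_uQ: "Qgood sc n g \<Longrightarrow> length w = n \<Longrightarrow> hat sc g (uQ n w) = g w"
  unfolding uQ_def by (simp add: hat_nproj hat_pure)

lemma Qgood_uQ: "Qgood fscale n (uQ n)"
  unfolding Qgood_def
proof (intro conjI allI impI)
  have m: "multilinear_on Qvec fscale n (\<lambda>w. nproj (NQ n) (pure w))"
    by (rule multilinear_on_proj) (auto simp: nproj_NQ)
  have "lin hs fscale (\<lambda>x. uQ n (us @ x # vs))" if l: "length us + 1 + length vs = n" for us vs
  proof (rule linI[OF hs_vs vs_fscale])
    show "uQ n (us @ (x + y) # vs) = uQ n (us @ x # vs) + uQ n (us @ y # vs)" for x y
      using m l unfolding multilinear_on_def uQ_def
      by (auto simp flip: Qvec_simps(2) simp: Qvec_simps(1) image_subset_iff)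
    show "uQ n (us @ hs c x # vs) = fscale c (uQ n (us @ x # vs))" for c x
      using m l unfolding multilinear_on_def uQ_def
      by (auto simp flip: Qvec_simps(3) simp: Qvec_simps(1) image_subset_iff)
  qed
  then show mm: "mlin fscale n (uQ n)" by (simp add: mlin_def vs_fscale)
  fix us vs :: "'h list" and x r assume a: "length us + 1 + length vs = n \<and> r \<in> R"
  have "r * x - hs (eps r) x = (r - hs (eps r) 1) * x" by (simp add: left_diff_distrib scale_mult_left)
  moreover have "r - hs (eps r) 1 \<in> augmentation_ideal H R"
    using a R_sub R_one linD[OF counit_linear] counit_one
    by (auto simp: augmentation_ideal_def intro!: subspace_diff subspace_scale)
  ultimately have "r * x - hs (eps r) x \<in> W" unfolding W_def by (intro span_base) auto
  then have "Qc (r * x) = Qc (hs (eps r) x)" by (simp add: Qc_eq)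
  then have "uQ n (us @ (r * x) # vs) = uQ n (us @ hs (eps r) x # vs)" by (simp add: uQ_def)
  also have "\<dots> = fscale (eps r) (uQ n (us @ x # vs))"
    using a by (intro linD(4)[OF mlinD(2)[OF mm]]) simp
  finally show "uQ n (us @ (r * x) # vs) = fscale (eps r) (uQ n (us @ x # vs))" .
qed

definition actQ :: "nat \<Rightarrow> 'h \<Rightarrow> ('h set list \<Rightarrow>\<^sub>0 'k) \<Rightarrow> ('h set list \<Rightarrow>\<^sub>0 'k)" where
  "actQ n h = lin_ext fscale (\<lambda>qs. lin_ext fscale (\<lambda>hs. pure (map2 (\<lambda>q g. g \<odot>\<^bsub>Qmod H R\<^esub> q) qs hs))
                      (iterated_comult H n h))"

lemma Qpower_quotient: "Qpower H R n = quotient_module (CQ n) (NQ n) (actQ n)"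
  unfolding Qpower_def diagonal_power_def actQ_def ..

lemma iterated_comult_formal: "iterated_comult H n h \<in> formal_tensors UNIV n"
proof (induction n arbitrary: h)
  case (Suc n)
  show ?case unfolding iterated_comult.simps sweedler_def juxtapose_def
    by (intro lin_ext_mem[OF vs_fscale subspace_formal_tensors] pure_formal)
      (use Suc in \<open>auto simp: formal_tensors_def\<close>)
qed (auto simp: formal_tensors_def)

lemma actQ_pure:
  assumes "length w = n"
  shows "nproj (NQ n) (actQ n h (pure (map (\<lambda>x. Qc x) w))) = dact fscale w (uQ n) h"
proof -
  have m: "map2 (\<lambda>q g. g \<odot>\<^bsub>Qmod H R\<^esub> q) (map (\<lambda>x. Qc x) w) hs = map (\<lambda>x. Qc x) (map2 (*) w hs)" for hs
    by (induction w arbitrary: hs) (auto simp: Qmod_simps zip_Cons1 split: list.splits)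
  have "nproj (NQ n) (actQ n h (pure (map (\<lambda>x. Qc x) w))) = lin_ext fscale (\<lambda>hs. uQ n (map2 (*) w hs)) (iterated_comult H n h)"
    unfolding actQ_def lin_ext_pure[OF vs_fscale] lin_ext_push[OF nproj_NQ(1)] m uQ_def ..
  then show ?thesis using lin_ext_iterated_comult[OF vs_fscale, of "uQ n" w h] assms by simp
qed

lemma Qpower_action: "quotient_action (CQ n) (NQ n) (actQ n) A"
proof (rule quotient_action.intro)
  show "fs.subspace (CQ n)" "fs.subspace (NQ n)" by (rule subspace_formal_tensors subspace_tensor_null)+
  have "NQ n \<subseteq> formal_tensors (carrier Qvec) n"
    by (rule tensor_null_formal) (auto simp: Qvec_simps)
  then show "NQ n \<subseteq> CQ n" by (simp add: Qvec_simps Qmod_simps)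
  show "lin fscale fscale (actQ n h)" for h unfolding actQ_def by (rule lin_lin_ext[OF vs_fscale])
  have cl: "lin_ext fscale (\<lambda>hs. pure (map2 (\<lambda>q g. g \<odot>\<^bsub>Qmod H R\<^esub> q) qs hs)) (iterated_comult H n h) \<in> CQ n"
    if "length qs = n" "set qs \<subseteq> carrier (Qmod H R)" for qs h
  proof (rule lin_ext_mem[OF vs_fscale subspace_formal_tensors], rule pure_formal)
    fix hs assume "hs \<in> Poly_Mapping.keys (iterated_comult H n h)"
    then have "length hs = n" using iterated_comult_formal[of n h] by (auto simp: formal_tensors_def)
    then show "length (map2 (\<lambda>q g. g \<odot>\<^bsub>Qmod H R\<^esub> q) qs hs) = n" using that by simp
    show "set (map2 (\<lambda>q g. g \<odot>\<^bsub>Qmod H R\<^esub> q) qs hs) \<subseteq> carrier (Qmod H R)"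
      using that(2) by (auto simp: Qmod_simps(1) dest!: set_zip_leftD) (use Qmod_simps(4) in blast)
  qed
  show "actQ n h x \<in> CQ n" if "x \<in> CQ n" for h x
    unfolding actQ_def
    by (rule lin_ext_mem[OF vs_fscale subspace_formal_tensors], rule cl) (use that in \<open>auto simp: formal_tensors_def\<close>)
  \<comment> \<open>Acting and then projecting is the linear map induced by a \<open>Qgood\<close>
    function, namely \<open>uQ\<close> evaluated after the action, so it vanishes on the relations;
    hence the action preserves them.\<close>
  have "nproj (NQ n) (actQ n h x) = 0" if x: "x \<in> NQ n" for h x
  proof -
    have l: "lin fscale fscale (\<lambda>x. nproj (NQ n) (actQ n h x))"
      unfolding actQ_def by (rule lin_comp[OF lin_lin_ext[OF vs_fscale] nproj_NQ(1)])
    have e: "nproj (NQ n) (actQ n h y) = hat fscale (\<lambda>w. dact fscale w (uQ n) h) y" if "y \<in> CQ n" for y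
    proof (rule lin_eq_on_span[OF l lin_hat[OF vs_fscale]])
      show "y \<in> fs.span {pure w | w. length w = n \<and> set w \<subseteq> carrier (Qmod H R)}"
        using that by (simp add: formal_tensors_span)
      fix z :: "'h set list \<Rightarrow>\<^sub>0 'k" assume "z \<in> {pure w | w. length w = n \<and> set w \<subseteq> carrier (Qmod H R)}"
      then obtain qs where qs: "z = pure qs" "length qs = n" "set qs \<subseteq> carrier (Qmod H R)" by blast
      show "nproj (NQ n) (actQ n h z) = hat fscale (\<lambda>w. dact fscale w (uQ n) h) z"
        using actQ_pure[of "map Qrep qs" n h] Qlist[OF qs(3)] qs(2)
        by (simp add: qs(1) hat_def lin_ext_pure[OF vs_fscale])
    qed
    show ?thesis using e[of x] hat_null[OF Qgood_dact[OF Qgood_uQ] x] x \<open>NQ n \<subseteq> CQ n\<close> by auto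
  qed
  then show "actQ n h x \<in> NQ n" if "x \<in> NQ n" for h x using that nproj_NQ(2) by blast
qed

lemma CQ_span: "CQ n = fs.span {pure (map (\<lambda>x. Qc x) w) | w. length w = n}"
proof -
  have "{pure w | w. length w = n \<and> set w \<subseteq> carrier (Qmod H R)} = ({pure (map (\<lambda>x. Qc x) w) | w. length w = n} :: ('h set list \<Rightarrow>\<^sub>0 'k) set)"
    (is "?A = ?B")
  proof
    show "?A \<subseteq> ?B"
    proof
      fix z :: "'h set list \<Rightarrow>\<^sub>0 'k" assume "z \<in> ?A"
      then obtain qs where qs: "z = pure qs" "length qs = n" "set qs \<subseteq> carrier (Qmod H R)" by blast
      then show "z \<in> ?B" using Qlist[OF qs(3)] by (intro CollectI exI[of _ "map Qrep qs"]) simp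
    qed
    show "?B \<subseteq> ?A"
    proof
      fix z assume "z \<in> ?B"
      then obtain w where w: "z = pure (map (\<lambda>x. Qc x) w)" "length w = n" by blast
      then show "z \<in> ?A" by (intro CollectI exI[of _ "map (\<lambda>x. Qc x) w"]) (auto simp: Qmod_simps)
    qed
  qed
  then show ?thesis by (simp add: formal_tensors_span)
qed

lemma ann_power_iff: "r \<in> ann_power H R n \<longleftrightarrow> r \<in> R \<and> (\<forall>w. length w = n \<longrightarrow> dact fscale w (uQ n) r = 0)"
proof -
  interpret q: quotient_action "CQ n" "NQ n" "actQ n" UNIV by (rule Qpower_action)
  have l: "lin fscale fscale (\<lambda>x. nproj (NQ n) (actQ n r x))"
    by (rule lin_comp[OF q.act_lin[OF UNIV_I] nproj_NQ(1)])
  have "r \<in> ann_power H R n \<longleftrightarrow> r \<in> R \<and> (\<forall>x\<in>CQ n. nproj (NQ n) (actQ n r x) = 0)"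
    unfolding ann_power_def annihilator_def Qpower_quotient
    by (auto simp: q.carrier_M q.smult_M q.zero_M q.cls_eq nproj_NQ simp del: set_zero_plus)
  also have "(\<forall>x\<in>CQ n. nproj (NQ n) (actQ n r x) = 0) \<longleftrightarrow> (\<forall>w. length w = n \<longrightarrow> dact fscale w (uQ n) r = 0)"
  proof
    assume "\<forall>x\<in>CQ n. nproj (NQ n) (actQ n r x) = 0"
    then show "\<forall>w. length w = n \<longrightarrow> dact fscale w (uQ n) r = 0"
      using actQ_pure fs.span_base unfolding CQ_span by (metis (mono_tags, lifting) mem_Collect_eq)
  next
    assume a: "\<forall>w. length w = n \<longrightarrow> dact fscale w (uQ n) r = 0"
    show "\<forall>x\<in>CQ n. nproj (NQ n) (actQ n r x) = 0"
    proof
      fix x assume "x \<in> CQ n"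
      then have x: "x \<in> fs.span {pure (map (\<lambda>x. Qc x) w) | w. length w = n}" by (simp add: CQ_span)
      show "nproj (NQ n) (actQ n r x) = 0"
        by (rule span_subset_kernel[OF l _ x]) (use a actQ_pure in auto)
    qed
  qed
  finally show ?thesis .
qed

text \<open>\<open>ann_power_iff\<close> speaks of the universal function only; every other
  \<open>Qgood\<close> function factors through it.\<close>

lemma ann_power_Qgood:
  assumes r: "r \<in> ann_power H R n" and g: "Qgood sc n g" and w: "length w = n"
  shows "dact sc w g r = 0"
proof -
  have sc: "vector_space sc" using QgoodD(1)[OF g] by (rule mlinD)
  have "dact sc w g r = dact sc w (\<lambda>v. hat sc g (uQ n v)) r"
    by (rule comb_cong[OF comb_dact[OF sc w]]) (simp add: hat_uQ[OF g])
  also have "\<dots> = hat sc g (dact fscale w (uQ n) r)"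
    by (rule dact_push[OF lin_hat[OF sc], symmetric])
  also have "\<dots> = 0" using r w by (simp add: ann_power_iff linD(5)[OF lin_hat[OF sc]])
  finally show ?thesis .
qed

subsection \<open>Tensor powers over the subalgebra\<close>

abbreviation "NB n \<equiv> fs.span (multilinear_rels (hspace H) n \<union> balanced_rels R n)"
abbreviation CB :: "nat \<Rightarrow> ('h list \<Rightarrow>\<^sub>0 'k) set" where "CB n \<equiv> formal_tensors UNIV n"
text \<open>The universal \<open>balanced\<close> function, related to the tensor powers over
  \<open>R\<close> as \<open>uQ\<close> is to the powers of \<open>Q\<close>.\<close>

definition vB :: "nat \<Rightarrow> 'h list \<Rightarrow> ('h list \<Rightarrow>\<^sub>0 'k)" where
  "vB n w = nproj (NB n) (pure w)"
definition actB :: "'h + 'h \<Rightarrow> ('h list \<Rightarrow>\<^sub>0 'k) \<Rightarrow> ('h list \<Rightarrow>\<^sub>0 'k)" where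
  "actB s = (case s of
              Inl a \<Rightarrow> lin_ext fscale (\<lambda>xs. pure ((a * hd xs) # tl xs))
            | Inr a \<Rightarrow> lin_ext fscale (\<lambda>xs. pure (butlast xs @ [last xs * a])))"

lemma tensor_power_over_quotient: "tensor_power_over hs R n = quotient_module (CB n) (NB n) actB"
  unfolding tensor_power_over_def actB_def ..

lemma nproj_NB: "lin fscale fscale (nproj (NB n))" "nproj (NB n) x = 0 \<longleftrightarrow> x \<in> NB n" "x - nproj (NB n) x \<in> NB n"
  by (rule nproj[OF fs.subspace_span])+

lemma balanced_null:
  assumes b: "balanced sc n b" and x: "x \<in> NB n"
  shows "lin_ext sc b x = 0"
proof -
  have sc: "vector_space sc" using balancedD(1)[OF b] by (rule mlinD)
  note l = lin_lin_ext[OF sc, of b]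
  show ?thesis
  proof (rule span_subset_kernel[OF l _ x])
    fix y assume "y \<in> multilinear_rels (hspace H) n \<union> balanced_rels R n"
    then show "lin_ext sc b y = 0"
    proof
      assume "y \<in> multilinear_rels (hspace H) n"
      then show ?thesis
        by (intro mlin_null[OF balancedD(1)[OF b]]) (simp add: tensor_null_def fs.span_base)
    next
      assume "y \<in> balanced_rels R n"
      then obtain us vs :: "'h list" and x y' r where e: "y = pure (us @ [x * r, y'] @ vs) - pure (us @ [x, r * y'] @ vs)"
        "length us + 2 + length vs = n" "r \<in> R" unfolding balanced_rels_def by blast
      have "b (us @ [x * r, y'] @ vs) = b (us @ [x, r * y'] @ vs)"
        by (rule balancedD(2)[OF b e(2,3)])
      then show ?thesis unfolding e(1) linD(6)[OF l] lin_ext_pure[OF sc] by simp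
    qed
  qed
qed

lemma bhat_vB: "balanced sc n b \<Longrightarrow> lin_ext sc b (vB n w) = b w"
proof -
  assume b: "balanced sc n b"
  have sc: "vector_space sc" using balancedD(1)[OF b] by (rule mlinD)
  have "lin_ext sc b (pure w - vB n w) = 0"
    by (rule balanced_null[OF b]) (simp add: vB_def nproj_NB)
  then show ?thesis by (simp add: linD(6)[OF lin_lin_ext[OF sc]] lin_ext_pure[OF sc])
qed

lemma balanced_vB: "balanced fscale n (vB n)"
  unfolding balanced_def
proof (intro conjI allI impI)
  have "multilinear_on (hspace H) fscale n (\<lambda>w. nproj (NB n) (pure w))"
    by (rule multilinear_on_proj)
      (use nproj_NB(1) fs.span_mono[of "multilinear_rels (hspace H) n" "multilinear_rels (hspace H) n \<union> balanced_rels R n"] in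
        \<open>auto simp: nproj_NB(2) tensor_null_def\<close>)
  then show "mlin fscale n (vB n)" unfolding multilinear_on_hspace vB_def[abs_def] .
  fix us vs :: "'h list" and x y r assume a: "length us + 2 + length vs = n \<and> r \<in> R"
  have "pure (us @ [x * r, y] @ vs) - pure (us @ [x, r * y] @ vs) \<in> NB n"
    by (rule fs.span_base) (use a in \<open>unfold balanced_rels_def, blast\<close>)
  then have "nproj (NB n) (pure (us @ [x * r, y] @ vs) - pure (us @ [x, r * y] @ vs)) = 0"
    using nproj_NB(2) by blast
  then show "vB n (us @ [x * r, y] @ vs) = vB n (us @ [x, r * y] @ vs)"
    by (simp add: vB_def linD(6)[OF nproj_NB(1)])
qed

lemma balanced_left: "balanced sc n b \<Longrightarrow> balanced sc n (\<lambda>w. b (h * hd w # tl w))"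
  unfolding balanced_def[of sc n "\<lambda>w. b (h * hd w # tl w)"]
proof (intro conjI allI impI)
  assume b: "balanced sc n b"
  have sc: "vector_space sc" using balancedD(1)[OF b] by (rule mlinD)
  have "lin hs sc (\<lambda>x. b (h * hd (us @ x # vs) # tl (us @ x # vs)))" if l: "length us + 1 + length vs = n" for us vs
  proof (cases us)
    case Nil
    then show ?thesis
      using lin_at[OF balancedD(1)[OF b], of "[]" vs, OF _ lin_mult_left[OF lin_id[OF hs_vs], of h]] l by simp
  next
    case (Cons u us')
    then show ?thesis using mlinD(2)[OF balancedD(1)[OF b], of "(h * u) # us'" vs] l by simp
  qed
  then show "mlin sc n (\<lambda>w. b (h * hd w # tl w))" by (simp add: mlin_def sc)
  fix us vs :: "'h list" and x y r assume a: "length us + 2 + length vs = n \<and> r \<in> R"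
  show "b (h * hd (us @ [x * r, y] @ vs) # tl (us @ [x * r, y] @ vs)) =
      b (h * hd (us @ [x, r * y] @ vs) # tl (us @ [x, r * y] @ vs))"
  proof (cases us)
    case Nil
    then show ?thesis using balancedD(2)[OF b, of "[]" vs r "h * x" y] a by (simp add: mult.assoc)
  next
    case (Cons u us')
    then show ?thesis using balancedD(2)[OF b, of "(h * u) # us'" vs r x y] a by simp
  qed
qed

lemma balanced_right: "balanced sc n b \<Longrightarrow> balanced sc n (\<lambda>w. b (butlast w @ [last w * h]))"
  unfolding balanced_def[of sc n "\<lambda>w. b (butlast w @ [last w * h])"]
proof (intro conjI allI impI)
  assume b: "balanced sc n b"
  have sc: "vector_space sc" using balancedD(1)[OF b] by (rule mlinD)
  have "lin hs sc (\<lambda>x. b (butlast (us @ x # vs) @ [last (us @ x # vs) * h]))" if l: "length us + 1 + length vs = n" for us vs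
  proof (cases vs rule: rev_cases)
    case Nil
    then show ?thesis
      using lin_at[OF balancedD(1)[OF b], of us "[]", OF _ lin_mult_right[OF lin_id[OF hs_vs], of h]] l by (simp add: butlast_append)
  next
    case (snoc vs' u)
    then show ?thesis using mlinD(2)[OF balancedD(1)[OF b], of us "vs' @ [u * h]"] l by (simp add: butlast_append)
  qed
  then show "mlin sc n (\<lambda>w. b (butlast w @ [last w * h]))" by (simp add: mlin_def sc)
  fix us vs :: "'h list" and x y r assume a: "length us + 2 + length vs = n \<and> r \<in> R"
  show "b (butlast (us @ [x * r, y] @ vs) @ [last (us @ [x * r, y] @ vs) * h]) =
      b (butlast (us @ [x, r * y] @ vs) @ [last (us @ [x, r * y] @ vs) * h])"
  proof (cases vs rule: rev_cases)
    case Nil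
    then show ?thesis using balancedD(2)[OF b, of us "[]" r x "y * h"] a by (simp add: butlast_append mult.assoc)
  next
    case (snoc vs' u)
    then show ?thesis using balancedD(2)[OF b, of us "vs' @ [u * h]" r x y] a by (simp add: butlast_append)
  qed
qed

lemma actB_pure:
  "actB (Inl h) (pure w) = pure (h * hd w # tl w)" "actB (Inr h) (pure w) = pure (butlast w @ [last w * h])"
  by (simp_all add: actB_def lin_ext_pure[OF vs_fscale])

lemma actB_lin: "lin fscale fscale (actB s)"
  unfolding actB_def by (cases s) (auto intro: lin_lin_ext[OF vs_fscale])

text \<open>The action changes the first or the last letter, so words must be nonempty. It preserves
  the relations because acting and then projecting is again \<open>balanced\<close>, by
  \<open>balanced_left\<close> and \<open>balanced_right\<close>.\<close>

lemma tensor_power_over_action: "n \<ge> 1 \<Longrightarrow> quotient_action (CB n) (NB n) actB A"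
proof (rule quotient_action.intro)
  assume n: "n \<ge> 1"
  show "fs.subspace (CB n)" by (rule subspace_formal_tensors)
  show "fs.subspace (NB n)" by simp
  show "NB n \<subseteq> CB n"
  proof (rule fs.span_minimal[OF _ subspace_formal_tensors], rule Un_least)
    have "tensor_null (hspace H) n \<subseteq> formal_tensors (carrier (hspace H)) n"
      by (rule tensor_null_formal) (auto simp: underlying_space_def mk_module_def)
    then show "multilinear_rels (hspace H) n \<subseteq> CB n"
      using fs.span_superset by (fastforce simp: tensor_null_def underlying_space_def mk_module_def)
    show "balanced_rels R n \<subseteq> CB n"
      unfolding balanced_rels_def
      by (auto intro!: fs.subspace_diff[OF subspace_formal_tensors] pure_formal)
  qed
  show "lin fscale fscale (actB s)" for s by (rule actB_lin)
  show "actB s x \<in> CB n" if "x \<in> CB n" for s x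
  proof -
    have "actB s (pure w) \<in> CB n" if "length w = n" for w
      using that n by (cases s) (auto simp: actB_pure intro!: pure_formal)
    moreover have "actB s x = lin_ext fscale (\<lambda>w. actB s (pure w)) x" by (rule lin_ext_unique[OF actB_lin])
    ultimately show ?thesis
      using that by (simp, intro lin_ext_mem[OF vs_fscale subspace_formal_tensors]) (auto simp: formal_tensors_def)
  qed
  show "actB s x \<in> NB n" if x: "x \<in> NB n" for s x
  proof -
    have e: "nproj (NB n) (actB s x) = lin_ext fscale (\<lambda>w. nproj (NB n) (actB s (pure w))) x"
      by (rule lin_ext_unique[OF lin_comp[OF actB_lin nproj_NB(1)]])
    have "balanced fscale n (\<lambda>w. nproj (NB n) (actB s (pure w)))"
    proof (cases s)
      case (Inl h)
      then show ?thesis using balanced_left[OF balanced_vB, of n h] by (simp add: actB_pure vB_def)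
    next
      case (Inr h)
      then show ?thesis using balanced_right[OF balanced_vB, of n h] by (simp add: actB_pure vB_def)
    qed
    from balanced_null[OF this x] e show ?thesis by (simp add: nproj_NB(2))
  qed
qed

end

section \<open>Integrals and averaging\<close>

lemma regular_right_module_additive:
  assumes "\<And>x y. x \<in> R \<Longrightarrow> y \<in> R \<Longrightarrow> x + y \<in> R" "0 \<in> R" "\<And>x. x \<in> R \<Longrightarrow> - x \<in> R"
    "\<And>x y. x \<in> R \<Longrightarrow> y \<in> R \<Longrightarrow> x * y \<in> R"
  shows "additive_module R (regular_right_module R)"
  unfolding additive_module_def
proof (intro conjI)
  show "abelian_group (regular_right_module R)"
    by (rule abelian_groupI)
      (use assms in \<open>auto simp: regular_right_module_def mk_module_def add.assoc add.commute intro!: bexI[of _ "- _"]\<close>)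
qed (use assms in \<open>auto simp: regular_right_module_def mk_module_def distrib_right\<close>)

context hopf_pair
begin

lemma R_zero: "0 \<in> R" and R_add: "x \<in> R \<Longrightarrow> y \<in> R \<Longrightarrow> x + y \<in> R" and R_minus: "x \<in> R \<Longrightarrow> - x \<in> R"
  and R_diff: "x \<in> R \<Longrightarrow> y \<in> R \<Longrightarrow> x - y \<in> R" and R_scale: "x \<in> R \<Longrightarrow> hs c x \<in> R"
  using R_sub by (auto intro: subspace_0 subspace_add subspace_neg subspace_diff subspace_scale)

lemma RR_additive: "additive_module R (regular_right_module R)"
  by (rule regular_right_module_additive) (auto intro: R_zero R_add R_minus R_mult)

lemma RR_simps: "carrier (regular_right_module R) = R" "x \<oplus>\<^bsub>regular_right_module R\<^esub> y = x + y"
  "\<zero>\<^bsub>regular_right_module R\<^esub> = 0" "r \<odot>\<^bsub>regular_right_module R\<^esub> x = x * r"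
  by (simp_all add: regular_right_module_def mk_module_def)

lemma eps_W: "x \<in> W \<Longrightarrow> eps x = 0"
  unfolding W_def
  by (rule span_subset_kernel[OF counit_linear]) (auto simp: augmentation_ideal_def counit_mult)

lemma eps_Qrep: "eps (Qrep (Qc x)) = eps x"
proof -
  have "Qc (Qrep (Qc x)) = Qc x" by (rule Qrep) (simp add: Qmod_simps)
  then have "eps (Qrep (Qc x) - x) = 0" by (intro eps_W) (simp add: Qc_eq)
  then show ?thesis by (simp add: linD(6)[OF counit_linear])
qed

text \<open>The coset of 1 spans a trivial submodule of \<open>Q\<close> on which the counit does not vanish; its
  coordinates in a free module containing \<open>Q\<close> as a summand are integrals, and not all of them
  have counit 0.\<close>

lemma exists_integral:
  assumes "projective_right_module R (Qmod H R)"
  obtains t where "t \<in> R" "\<And>r. r \<in> R \<Longrightarrow> t * r = hs (eps r) t" "eps t = 1"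
proof -
  let ?Q = "Qmod H R" and ?F = "regular_right_module R"
  obtain I :: "'h set set" where rm: "right_module R ?Q" and I: "iso_to_summand R ?Q (direct_power I ?F)"
    using assms by (auto simp: projective_right_module_def)
  from summand_retract[OF right_module_additive[OF rm] direct_power_additive[OF RR_additive] I]
  obtain F where F: "F \<in> mod_hom R ?Q (direct_power I ?F)"
    and "\<exists>g\<in>mod_hom R (direct_power I ?F) ?Q. \<forall>x\<in>carrier ?Q. g (F x) = x" by (rule bexE)
  from this(2) obtain G where G: "G \<in> mod_hom R (direct_power I ?F) ?Q"
    and "\<forall>x\<in>carrier ?Q. G (F x) = x" by (rule bexE)
  from this(2) have GF: "G (F x) = x" if "x \<in> carrier ?Q" for x using that by (rule bspec)
  define f g where "f = (\<lambda>i x. F x i)" and "g = (\<lambda>i y. G (dp_inj I ?F i y))"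
  have f: "f i \<in> mod_hom R ?Q ?F" and g: "g i \<in> mod_hom R ?F ?Q" if "i \<in> I" for i
    using power_retract_homs[OF RR_additive F G that] by (simp_all add: f_def g_def)
  have c1: "Qc 1 \<in> carrier ?Q" by (simp add: Qmod_simps)
  have badd: "eps (Qrep (X \<oplus>\<^bsub>?Q\<^esub> Y)) = eps (Qrep X) + eps (Qrep Y)" if "X \<in> carrier ?Q" "Y \<in> carrier ?Q" for X Y
    using that by (auto simp: Qmod_simps eps_Qrep linD(3)[OF counit_linear])
  note ps = power_retract_sum[where A = R and N = ?F and M = ?Q and F = F and G = G and I = I and x = "Qc 1"
      and B = "\<lambda>X. eps (Qrep X)"]
  have "eps (Qrep (Qc 1)) = (\<Sum>i\<in>{i \<in> I. f i (Qc 1) \<noteq> \<zero>\<^bsub>?F\<^esub>}. eps (Qrep (g i (f i (Qc 1)))))"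
    using ps[OF RR_additive F G GF[OF c1] c1 badd] by (simp only: f_def g_def)
  then have "(\<Sum>i\<in>{i \<in> I. f i (Qc 1) \<noteq> \<zero>\<^bsub>?F\<^esub>}. eps (Qrep (g i (f i (Qc 1))))) \<noteq> 0"
    by (simp add: eps_Qrep counit_one)
  then obtain i where "i \<in> {i \<in> I. f i (Qc 1) \<noteq> \<zero>\<^bsub>?F\<^esub>}" and i2: "eps (Qrep (g i (f i (Qc 1)))) \<noteq> 0"
    by (rule sum.not_neutral_contains_not_neutral)
  then have i: "i \<in> I" by simp
  note i = i i2
  define x where "x = f i (Qc 1)"
  have xR: "x \<in> R" using mod_homD(1)[OF f[OF i(1)] c1] by (simp add: x_def RR_simps)
  have xr: "x * r = hs (eps r) x" if r: "r \<in> R" for r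
  proof -
    have "x * r = f i (r \<odot>\<^bsub>?Q\<^esub> Qc 1)"
      using mod_homD(3)[OF f[OF i(1)] r c1] by (simp add: x_def RR_simps)
    also have "r \<odot>\<^bsub>?Q\<^esub> Qc 1 = hs (eps r) 1 \<odot>\<^bsub>?Q\<^esub> Qc 1"
    proof -
      have "r - hs (eps r) 1 \<in> augmentation_ideal H R"
        using r R_one by (simp add: augmentation_ideal_def R_diff R_scale linD[OF counit_linear] counit_one)
      then have "(r - hs (eps r) 1) * 1 \<in> W" unfolding W_def by (intro span_base) blast
      then show ?thesis by (simp add: Qmod_simps Qc_eq)
    qed
    also have "f i \<dots> = x * hs (eps r) 1"
      using mod_homD(3)[OF f[OF i(1)] R_scale[OF R_one] c1] by (simp add: x_def RR_simps)
    finally show ?thesis by (simp add: scale_mult_right)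
  qed
  \<comment> \<open>In the regular module \<open>x\<close> is the result of \<open>x\<close> acting
    on 1, so \<open>g i x\<close> arises from \<open>g i 1\<close> by the action of
    \<open>x\<close>, and its counit has the factor \<open>eps x\<close>. That counit is nonzero, so
    \<open>x\<close> can be normalised.\<close>
  have "g i x = g i (x \<odot>\<^bsub>?F\<^esub> 1)" by (simp add: RR_simps)
  also have "\<dots> = x \<odot>\<^bsub>?Q\<^esub> g i 1" by (rule mod_homD(3)[OF g[OF i(1)] xR]) (simp add: RR_simps R_one)
  finally have gx: "g i x = x \<odot>\<^bsub>?Q\<^esub> g i 1" .
  have "g i 1 \<in> carrier ?Q" by (rule mod_homD(1)[OF g[OF i(1)]]) (simp add: RR_simps R_one)
  then obtain y where "g i 1 = Qc y" by (auto simp: Qmod_simps)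
  then have "eps y * eps x \<noteq> 0" using i(2) gx by (simp add: x_def Qmod_simps eps_Qrep counit_mult)
  then have ex: "eps x \<noteq> 0" by auto
  show ?thesis
  proof (rule that[of "hs (1 / eps x) x"])
    show "hs (1 / eps x) x \<in> R" using xR by (rule R_scale)
    show "hs (1 / eps x) x * r = hs (eps r) (hs (1 / eps x) x)" if "r \<in> R" for r
      using xr[OF that] by (simp add: scale_mult_left scale_left_commute)
    show "eps (hs (1 / eps x) x) = 1" using ex by (simp add: linD(4)[OF counit_linear])
  qed
qed

text \<open>A right \<open>H\<close>-module on a subspace \<open>X\<close>, with operators defined
  on the whole ambient space. This form fits \<open>alpha\<close>, which is defined for all formal
  sums and satisfies the module axioms on \<open>UQ n\<close>.\<close>

definition ract :: "('k \<Rightarrow> 'v::ab_group_add \<Rightarrow> 'v) \<Rightarrow> 'v set \<Rightarrow> ('h \<Rightarrow> 'v \<Rightarrow> 'v) \<Rightarrow> bool" where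
  "ract sc X \<rho> \<longleftrightarrow> Modules.module.subspace sc X \<and> (\<forall>h. lin sc sc (\<rho> h)) \<and> (\<forall>x\<in>X. lin hs sc (\<lambda>h. \<rho> h x)) \<and>
     (\<forall>x\<in>X. \<forall>h. \<rho> h x \<in> X) \<and> (\<forall>x\<in>X. \<forall>g h. \<rho> h (\<rho> g x) = \<rho> (g * h) x) \<and> (\<forall>x\<in>X. \<rho> 1 x = x)"

lemma ractD:
  assumes "ract sc X \<rho>"
  shows "Modules.module.subspace sc X" "lin sc sc (\<rho> h)" "x \<in> X \<Longrightarrow> lin hs sc (\<lambda>h. \<rho> h x)"
    "x \<in> X \<Longrightarrow> \<rho> h x \<in> X" "x \<in> X \<Longrightarrow> \<rho> h (\<rho> g x) = \<rho> (g * h) x" "x \<in> X \<Longrightarrow> \<rho> 1 x = x"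
  using assms by (auto simp: ract_def)

lemma ract_right: "ract hs UNIV (\<lambda>h x. x * h)"
  unfolding ract_def by (auto intro!: lin_mult_left lin_mult_right lin_id hs_vs simp: mult.assoc)

text \<open>The action on Q^n transported along the projection; \<open>UQ n\<close> below is the
  image of \<open>CQ n\<close>, a copy of Q^n inside the formal sums.\<close>

definition alpha :: "nat \<Rightarrow> 'h \<Rightarrow> ('h set list \<Rightarrow>\<^sub>0 'k) \<Rightarrow> ('h set list \<Rightarrow>\<^sub>0 'k)" where
  "alpha n h x = nproj (NQ n) (actQ n h x)"

definition UQ :: "nat \<Rightarrow> ('h set list \<Rightarrow>\<^sub>0 'k) set" where
  "UQ n = fs.span {uQ n w | w. length w = n}"

lemma alpha_lin: "lin fscale fscale (alpha n h)"
proof -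
  interpret q: quotient_action "CQ n" "NQ n" "actQ n" UNIV by (rule Qpower_action)
  show ?thesis unfolding alpha_def[abs_def] by (rule lin_comp[OF q.act_lin[OF UNIV_I] nproj_NQ(1)])
qed

lemma alpha_nproj: "alpha n h (nproj (NQ n) x) = alpha n h x"
proof -
  interpret q: quotient_action "CQ n" "NQ n" "actQ n" UNIV by (rule Qpower_action)
  have "actQ n h (x - nproj (NQ n) x) \<in> NQ n" by (intro q.act_N UNIV_I nproj_NQ(3))
  then have "alpha n h (x - nproj (NQ n) x) = 0" by (simp add: alpha_def nproj_NQ)
  then show ?thesis by (simp add: linD(6)[OF alpha_lin])
qed

lemma alpha_uQ: "length w = n \<Longrightarrow> alpha n h (uQ n w) = dact fscale w (uQ n) h"
  by (simp add: uQ_def alpha_nproj) (simp add: alpha_def actQ_pure uQ_def[abs_def])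

lemma uQ_UQ: "length w = n \<Longrightarrow> uQ n w \<in> UQ n"
  unfolding UQ_def by (rule fs.span_base) blast

lemma UQ_induct:
  assumes "x \<in> UQ n" "fs.subspace {x. P x}" "\<And>w. length w = n \<Longrightarrow> P (uQ n w)"
  shows "P x"
  using assms(1) unfolding UQ_def
  by (rule fs.span_induct[OF _ assms(2)]) (use assms(3) in auto)

lemma UQ_lin_eq:
  assumes "lin fscale sc f" "lin fscale sc g" "\<And>w. length w = n \<Longrightarrow> f (uQ n w) = g (uQ n w)" "x \<in> UQ n"
  shows "f x = g x"
  using assms(4) unfolding UQ_def
  by (rule lin_eq_on_span[OF assms(1,2), rotated]) (use assms(3) in auto)

lemma dact_UQ: "length w = n \<Longrightarrow> dact fscale w (uQ n) h \<in> UQ n"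
proof -
  assume w: "length w = n"
  obtain p where p: "p \<in> formal_tensors UNIV n" "\<And>g :: _ \<Rightarrow> 'h set list \<Rightarrow>\<^sub>0 'k. dact fscale w g h = lin_ext fscale g p"
    using comb_dact[OF vs_fscale w, of h] unfolding comb_def by blast
  show ?thesis unfolding p(2) UQ_def
    by (rule lin_ext_mem[OF vs_fscale fs.subspace_span], rule fs.span_base)
      (use p(1) in \<open>auto simp: formal_tensors_def\<close>)
qed

lemma ract_alpha: "ract fscale (UQ n) (alpha n)"
proof -
  have mu: "mlin fscale n (uQ n)" by (rule QgoodD(1)[OF Qgood_uQ])
  have 1: "fs.subspace (UQ n)" by (simp add: UQ_def)
  have 2: "lin hs fscale (\<lambda>h. alpha n h x)" if "x \<in> UQ n" for x
    using that
  proof (rule UQ_induct)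
    show "fs.subspace {x. lin hs fscale (\<lambda>h. alpha n h x)}"
      by (rule fs.subspaceI)
        (auto simp: linD[OF alpha_lin] intro: lin_plus lin_scale lin_zero[OF hs_vs vs_fscale])
    show "lin hs fscale (\<lambda>h. alpha n h (uQ n w))" if "length w = n" for w
      using that lin_dact[of fscale w "uQ n"] mu by (simp add: alpha_uQ)
  qed
  have 3: "alpha n h x \<in> UQ n" if "x \<in> UQ n" for h x
    using that
  proof (rule UQ_induct)
    show "fs.subspace {x. alpha n h x \<in> UQ n}"
      by (rule fs.subspaceI) (auto simp: linD[OF alpha_lin] fs.subspace_0[OF 1] fs.subspace_add[OF 1] fs.subspace_scale[OF 1])
  qed (simp add: alpha_uQ dact_UQ)
  have 4: "alpha n h (alpha n g x) = alpha n (g * h) x" if "x \<in> UQ n" for g h x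
  proof (rule UQ_lin_eq[OF lin_comp[OF alpha_lin alpha_lin] alpha_lin _ that])
    fix w :: "'h list" assume w: "length w = n"
    have "alpha n h (alpha n g (uQ n w)) = dact fscale w (\<lambda>v. alpha n h (uQ n v)) g"
      unfolding alpha_uQ[OF w] by (rule dact_push[OF alpha_lin])
    also have "\<dots> = dact fscale w (\<lambda>v. dact fscale v (uQ n) h) g"
      by (rule comb_cong[OF comb_dact[OF vs_fscale w]]) (simp add: alpha_uQ)
    also have "\<dots> = alpha n (g * h) (uQ n w)" using mu w by (simp add: dact_dact alpha_uQ)
    finally show "alpha n h (alpha n g (uQ n w)) = alpha n (g * h) (uQ n w)" .
  qed
  have 5: "alpha n 1 x = x" if "x \<in> UQ n" for x
    by (rule UQ_lin_eq[OF alpha_lin lin_id[OF vs_fscale] _ that]) (use mu in \<open>simp add: alpha_uQ dact_one\<close>)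
  show ?thesis unfolding ract_def using 1 2 3 4 5 alpha_lin by blast
qed

lemma ann_alpha: "r \<in> ann_power H R n \<longleftrightarrow> r \<in> R \<and> (\<forall>x\<in>UQ n. alpha n r x = 0)"
proof -
  have "(\<forall>x\<in>UQ n. alpha n r x = 0) \<longleftrightarrow> (\<forall>w. length w = n \<longrightarrow> dact fscale w (uQ n) r = 0)"
  proof
    assume "\<forall>x\<in>UQ n. alpha n r x = 0"
    then show "\<forall>w. length w = n \<longrightarrow> dact fscale w (uQ n) r = 0" using uQ_UQ alpha_uQ by metis
  next
    assume a: "\<forall>w. length w = n \<longrightarrow> dact fscale w (uQ n) r = 0"
    show "\<forall>x\<in>UQ n. alpha n r x = 0"
    proof
      fix x assume x: "x \<in> UQ n"
      show "alpha n r x = 0"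
        by (rule UQ_lin_eq[OF alpha_lin lin_zero[OF vs_fscale vs_fscale] _ x]) (use a in \<open>simp add: alpha_uQ\<close>)
    qed
  qed
  then show ?thesis by (simp add: ann_power_iff)
qed

text \<open>Letters are expanded in \<open>B\<close> one after another; for finite \<open>B\<close>
  this makes Q^n finite-dimensional in \<open>UQ_finite\<close>.\<close>

lemma mlin_span:
  assumes g: "mlin sc n g" and B: "span B = UNIV" and w: "length w = n"
  shows "g w \<in> Modules.module.span sc (g ` {v. length v = n \<and> set v \<subseteq> B})"
proof -
  interpret v: vector_space sc using g by (rule mlinD)
  let ?S = "v.span (g ` {v. length v = n \<and> set v \<subseteq> B})"
  have "g (us @ w) \<in> ?S" if "length us + length w = n" "set us \<subseteq> B" for us w
    using that
  proof (induction w arbitrary: us)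
    case Nil
    then show ?case by (intro v.span_base) auto
  next
    case (Cons x w)
    have L: "lin hs sc (\<lambda>x. g (us @ x # w))" by (rule mlinD(2)[OF g]) (use Cons.prems in simp)
    have "g (us @ x # w) \<in> (\<lambda>x. g (us @ x # w)) ` span B" using B by blast
    also have "\<dots> = v.span ((\<lambda>x. g (us @ x # w)) ` B)" by (rule lin_span_image[OF L])
    also have "\<dots> \<subseteq> ?S"
    proof (rule v.span_minimal[OF _ v.subspace_span], rule image_subsetI)
      fix b assume "b \<in> B"
      then show "g (us @ b # w) \<in> ?S" using Cons.IH[of "us @ [b]"] Cons.prems by simp
    qed
    finally show ?case .
  qed
  from this[of "[]" w] w show ?thesis by simp
qed

lemma UQ_finite: obtains X where "finite X" "X \<subseteq> UQ n" "fs.span X = UQ n"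
proof -
  obtain B where B: "finite B" "span B = UNIV" using fin_dim by (auto simp: fin_dim_def)
  let ?X = "uQ n ` {v. length v = n \<and> set v \<subseteq> B}"
  have "{v. length v = n \<and> set v \<subseteq> B} = {v. set v \<subseteq> B \<and> length v = n}" by auto
  then have fin: "finite ?X" using finite_lists_length_eq[OF B(1), of n] by simp
  have sub: "?X \<subseteq> UQ n" by (auto intro: uQ_UQ)
  have "UQ n \<subseteq> fs.span ?X"
    unfolding UQ_def
    by (rule fs.span_minimal[OF _ fs.subspace_span])
      (use mlin_span[OF QgoodD(1)[OF Qgood_uQ] B(2)] in auto)
  moreover have "fs.span ?X \<subseteq> UQ n"
    by (rule fs.span_minimal[OF sub]) (simp add: UQ_def)
  ultimately show ?thesis using that[OF fin sub] by blast
qed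

end

section \<open>Averaging with a normalised integral\<close>

locale hopf_integral = hopf_pair H R for H :: "('k::field, 'h::ring_1) hopf" and R +
  fixes t :: 'h
  assumes t_R: "t \<in> R" and t_right: "\<And>r. r \<in> R \<Longrightarrow> t * r = hs (eps r) t" and t_eps: "eps t = 1"
begin

text \<open>\<open>S t1 \<otimes> t2\<close> is a separability (Casimir) element for
  \<open>R\<close>. The sum of \<open>f (r1 * S (t1 * r2)) (t2 * r3)\<close> is evaluated twice:
  \<open>t * u\<close> is the counit of \<open>u\<close> times \<open>t\<close>, which gives the
  left side, and \<open>r1 * S r2\<close> contracts, which gives the right side.\<close>

lemma t_separable:
  assumes f: "bil sc f" and r: "r \<in> R"
  shows "sw sc (\<lambda>a b. f (r * S a) b) t = sw sc (\<lambda>a b. f (S a) (b * r)) t"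
proof -
  note sc = bil_vs[OF f]
  note li = lin_intros bil1[OF f] bil2[OF f]
  let ?F = "\<lambda>r1 r2 r3. sw sc (\<lambda>t1 t2. f (r1 * S (t1 * r2)) (t2 * r3)) t"
  have "sw sc (\<lambda>r1 u. sw sc (\<lambda>r2 r3. ?F r1 r2 r3) u) r = sw sc (\<lambda>a b. f (r * S a) b) t"
  proof (rule sw_eps_R[OF r])
    show "bil sc (\<lambda>r1 u. sw sc (\<lambda>r2 r3. ?F r1 r2 r3) u)" by (intro li)
    show "lin hs sc (\<lambda>r. sw sc (\<lambda>a b. f (r * S a) b) t)" by (intro li)
    fix r1 u assume u: "u \<in> R"
    have "sw sc (\<lambda>r2 r3. ?F r1 r2 r3) u = sw sc (\<lambda>a b. f (r1 * S a) b) (t * u)"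
      by (subst sw_swap[OF sc], rule sw_mult[symmetric]) (intro li)
    also have "\<dots> = sc (eps u) (sw sc (\<lambda>a b. f (r1 * S a) b) t)"
      unfolding t_right[OF u] by (rule linD(4)[OF lin_sw]) (intro li)
    finally show "sw sc (\<lambda>r2 r3. ?F r1 r2 r3) u = sc (eps u) (sw sc (\<lambda>a b. f (r1 * S a) b) t)" .
  qed
  moreover have "sw sc (\<lambda>r1 u. sw sc (\<lambda>r2 r3. ?F r1 r2 r3) u) r = sw sc (\<lambda>a b. f (S a) (b * r)) t"
  proof -
    have 1: "sw sc (\<lambda>r1 r2. ?F r1 r2 r3) u = sc (eps u) (sw sc (\<lambda>t1 t2. f (S t1) (t2 * r3)) t)" for r3 u
    proof -
      have "lin hs sc (\<lambda>z. sw sc (\<lambda>t1 t2. f (z * S t1) (t2 * r3)) t)" by (intro li)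
      from sw_antipode_right[OF this, of u] show ?thesis by (simp add: S_mult mult.assoc)
    qed
    have 2: "sw sc (\<lambda>u r3. sc (eps u) (sw sc (\<lambda>t1 t2. f (S t1) (t2 * r3)) t)) r = sw sc (\<lambda>t1 t2. f (S t1) (t2 * r)) t"
      by (rule sw_counit_left) (intro li)
    have "sw sc (\<lambda>r1 u. sw sc (\<lambda>r2 r3. ?F r1 r2 r3) u) r = sw sc (\<lambda>u r3. sw sc (\<lambda>r1 r2. ?F r1 r2 r3) u) r"
      by (rule sw_coassoc) (intro li)+
    then show ?thesis by (simp only: 1 2)
  qed
  ultimately show ?thesis by simp
qed

text \<open>The Maschke average of a linear map over the separability element; by
  \<open>avg_hom\<close> it is \<open>R\<close>-linear on \<open>X\<close>.\<close>

definition avg :: "('k \<Rightarrow> 'w::ab_group_add \<Rightarrow> 'w) \<Rightarrow> ('h \<Rightarrow> 'v \<Rightarrow> 'v) \<Rightarrow> ('h \<Rightarrow> 'w \<Rightarrow> 'w) \<Rightarrow> ('v \<Rightarrow> 'w) \<Rightarrow> 'v \<Rightarrow> 'w" where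
  "avg sc \<rho> \<sigma> \<phi> x = sw sc (\<lambda>a b. \<sigma> b (\<phi> (\<rho> (S a) x))) t"

lemma avg_bil:
  assumes "ract s1 X \<rho>" "ract s2 Y \<sigma>" "lin s1 s2 \<phi>" "\<And>x. \<phi> x \<in> Y" "x \<in> X"
  shows "bil s2 (\<lambda>a b. \<sigma> b (\<phi> (\<rho> a x)))"
  by (intro bilI ractD(3)[OF assms(2)] assms(4) lin_comp[OF lin_comp[OF ractD(3)[OF assms(1,5)] assms(3)] ractD(2)[OF assms(2)]])

lemma avg_bil_S:
  assumes "ract s1 X \<rho>" "ract s2 Y \<sigma>" "lin s1 s2 \<phi>" "\<And>x. \<phi> x \<in> Y" "x \<in> X"
  shows "bil s2 (\<lambda>a b. \<sigma> b (\<phi> (\<rho> (S a) x)))"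
  using avg_bil[OF assms] antipode_linear unfolding bil_def by (auto intro: lin_comp)

lemma avg_hom:
  assumes "ract s1 X \<rho>" "ract s2 Y \<sigma>" "lin s1 s2 \<phi>" "\<And>x. \<phi> x \<in> Y" "x \<in> X" and r: "r \<in> R"
  shows "avg s2 \<rho> \<sigma> \<phi> (\<rho> r x) = \<sigma> r (avg s2 \<rho> \<sigma> \<phi> x)"
proof -
  have "avg s2 \<rho> \<sigma> \<phi> (\<rho> r x) = sw s2 (\<lambda>a b. \<sigma> b (\<phi> (\<rho> (r * S a) x))) t"
    by (simp add: avg_def ractD(5)[OF assms(1,5)])
  also have "\<dots> = sw s2 (\<lambda>a b. \<sigma> (b * r) (\<phi> (\<rho> (S a) x))) t"
    by (rule t_separable[OF avg_bil[OF assms(1-5)] r])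
  also have "\<dots> = \<sigma> r (avg s2 \<rho> \<sigma> \<phi> x)"
    unfolding avg_def by (simp add: sw_push[OF ractD(2)[OF assms(2)]] ractD(5)[OF assms(2,4)])
  finally show ?thesis .
qed

lemma avg_lin:
  assumes "ract s1 X \<rho>" "ract s2 Y \<sigma>" "lin s1 s2 \<phi>"
  shows "lin s1 s2 (avg s2 \<rho> \<sigma> \<phi>)"
  unfolding avg_def[abs_def]
  by (rule lin_sw_fun) (intro lin_comp[OF lin_comp[OF ractD(2)[OF assms(1)] assms(3)] ractD(2)[OF assms(2)]])

text \<open>Stability of \<open>U\<close> under \<open>R\<close> is enough, since the coproduct of
  \<open>t\<close> has a representative with entries in \<open>R\<close>.\<close>

lemma avg_mem:
  assumes "ract s1 X \<rho>" "ract s2 Y \<sigma>" "lin s1 s2 \<phi>" "\<And>x. \<phi> x \<in> Y" "x \<in> X"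
    and U: "Modules.module.subspace s2 U" "\<And>x. \<phi> x \<in> U" "\<And>u r. r \<in> R \<Longrightarrow> u \<in> U \<Longrightarrow> \<sigma> r u \<in> U"
  shows "avg s2 \<rho> \<sigma> \<phi> x \<in> U"
  unfolding avg_def by (rule sw_R_mem[OF t_R avg_bil_S[OF assms(1-5)] U(1)]) (use U in auto)

text \<open>If \<open>\<phi>\<close> is already equivariant on the \<open>R\<close>-orbit of
  \<open>x\<close>, with \<open>y\<close> in the role of the image of \<open>x\<close>, then the
  average at \<open>x\<close> is \<open>S t1 * t2\<close> acting on \<open>y\<close>, which is
  \<open>y\<close> because \<open>t\<close> has counit 1.\<close>

lemma avg_id:
  assumes "ract s1 X \<rho>" "ract s2 Y \<sigma>" "lin s1 s2 \<phi>" "\<And>x. \<phi> x \<in> Y" "x \<in> X" "y \<in> Y"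
    "\<And>r. r \<in> R \<Longrightarrow> \<phi> (\<rho> r x) = \<sigma> r y"
  shows "avg s2 \<rho> \<sigma> \<phi> x = y"
proof -
  have l: "lin hs s2 (\<lambda>h. \<sigma> h y)" by (rule ractD(3)[OF assms(2,6)])
  have "avg s2 \<rho> \<sigma> \<phi> x = sw s2 (\<lambda>a b. \<sigma> (S a * b) y) t"
    unfolding avg_def
  proof (rule sw_R_cong[OF t_R avg_bil_S[OF assms(1-5)]])
    show "bil s2 (\<lambda>a b. \<sigma> (S a * b) y)" by (intro bilI lin_comp[OF _ l] lin_intros)
    show "\<sigma> b (\<phi> (\<rho> (S a) x)) = \<sigma> (S a * b) y" if "a \<in> R" for a b
      using assms(7)[OF R_S[OF that]] ractD(5)[OF assms(2,6)] by simp
  qed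
  also have "\<dots> = y"
    using sw_antipode_left[OF l, of t] ractD(6)[OF assms(2,6)]
    by (simp add: t_eps vector_space.vector_space_assms(4)[OF linD(2)[OF l]])
  finally show ?thesis .
qed

end

lemma sum_fun_at: "(sum f A) x = (\<Sum>a\<in>A. f a x)"
  for f :: "'a \<Rightarrow> 'b \<Rightarrow> 'c::ab_group_add"
  by (induction A rule: infinite_finite_induct) auto

text \<open>Coordinates with respect to a basis of the span of \<open>X\<close>, made linear on the
  whole space by completing that basis.\<close>

lemma fs_dual_family:
  fixes X :: "('x \<Rightarrow>\<^sub>0 'k::field) set"
  assumes "finite X"
  shows "\<exists>C co. finite C \<and> C \<subseteq> X \<and> (\<forall>c. lin fscale (*) (co c)) \<and>
    (\<forall>x\<in>fs.span X. (\<Sum>c\<in>C. fscale (co c x) c) = x)"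
proof -
  obtain C where C: "C \<subseteq> X" "fs.independent C" "X \<subseteq> fs.span C"
    using fs.maximal_independent_subset by metis
  have sp: "fs.span X = fs.span C"
    by (intro equalityI fs.span_minimal C(3) fs.subspace_span fs.span_mono C(1))
  let ?E = "fs.extend_basis C"
  have E: "C \<subseteq> ?E" "fs.independent ?E" "fs.span ?E = UNIV"
    using C(2) by (simp_all add: fs.extend_basis_superset fs.independent_extend_basis fs.span_extend_basis)
  have fin: "finite C" using C(1) assms by (rule finite_subset)
  show ?thesis
  proof (intro exI[of _ C] exI[of _ "\<lambda>c x. fs.representation ?E x c"] conjI allI ballI)
    show "lin fscale (*) (\<lambda>x. fs.representation ?E x c)" for c
      by (rule linI[OF vs_fscale vs_field]) (auto simp: fs.representation_add fs.representation_scale E)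
    fix x assume "x \<in> fs.span X"
    then have x: "x \<in> fs.span C" by (simp add: sp)
    have "fs.representation ?E x = fs.representation C x"
      by (rule fs.representation_extend[OF E(2) x E(1)])
    then show "(\<Sum>c\<in>C. fscale (fs.representation ?E x c) c) = x"
      using fs.sum_representation_eq[OF C(2) x fin order_refl] by simp
  qed (use fin C(1) in auto)
qed

context hopf_pair
begin

lemma good_tail: "good sc n g \<Longrightarrow> Qgood sc n (\<lambda>v. g (x # v))"
  unfolding Qgood_def
proof (intro conjI allI impI)
  assume g: "good sc n g"
  show "mlin sc n (\<lambda>v. g (x # v))" by (rule mlin_Cons[OF goodD(1)[OF g]])
  show "g (x # us @ (r * y) # vs) = sc (eps r) (g (x # us @ y # vs))"
    if "length us + 1 + length vs = n \<and> r \<in> R" for us vs r y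
    using goodD(2)[OF g, of "x # us" vs r y] that by simp
qed

lemma Qgood_good: "Qgood sc (Suc n) g \<Longrightarrow> good sc n g"
  by (auto simp: Qgood_def good_def)

end

section \<open>Homomorphisms between tensor powers of \<open>Q\<close>\<close>

context hopf_integral
begin

definition qhom :: "nat \<Rightarrow> nat \<Rightarrow> (('h set list \<Rightarrow>\<^sub>0 'k) \<Rightarrow> ('h set list \<Rightarrow>\<^sub>0 'k)) \<Rightarrow> bool" where
  "qhom m n f \<longleftrightarrow> lin fscale fscale f \<and> (\<forall>x\<in>UQ m. f x \<in> UQ n) \<and>
     (\<forall>x\<in>UQ m. \<forall>r\<in>R. f (alpha m r x) = alpha n r (f x))"

lemma qhomD: "qhom m n f \<Longrightarrow> lin fscale fscale f" "qhom m n f \<Longrightarrow> x \<in> UQ m \<Longrightarrow> f x \<in> UQ n"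
  "qhom m n f \<Longrightarrow> x \<in> UQ m \<Longrightarrow> r \<in> R \<Longrightarrow> f (alpha m r x) = alpha n r (f x)"
  by (auto simp: qhom_def)

lemma sub_UQ: "fs.subspace (UQ n)" by (simp add: UQ_def)

lemma sw_sum: "vector_space sc \<Longrightarrow> sw sc (\<lambda>a b. \<Sum>j\<in>J. F j a b) h = (\<Sum>j\<in>J. sw sc (F j) h)"
  unfolding sweedler_def lin_ext_def
proof -
  assume "vector_space sc"
  then interpret v: vector_space sc .
  show "(\<Sum>x\<in>Poly_Mapping.keys (comult_rep H h). sc (poly_mapping.lookup (comult_rep H h) x) (\<Sum>j\<in>J. F j (x ! 0) (x ! 1))) =
    (\<Sum>j\<in>J. \<Sum>x\<in>Poly_Mapping.keys (comult_rep H h). sc (poly_mapping.lookup (comult_rep H h) x) (F j (x ! 0) (x ! 1)))"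
    unfolding v.scale_sum_right by (rule sum.swap)
qed

text \<open>If the annihilator of Q^n lies in that of Q^m, the action of an element of
  \<open>R\<close> on Q^m can be recovered linearly from its action on a spanning family of Q^n.
  This gives linear maps \<open>\<phi>\<close> and \<open>\<psi>\<close>, which are averaged one
  after the other: \<open>\<psi>\<close> to \<open>G\<close>, so that the composites of
  \<open>\<phi>\<close> and \<open>G\<close> still sum to the identity, and then
  \<open>\<phi>\<close> to \<open>F\<close>.\<close>

lemma hom_family:
  assumes ann: "ann_power H R n \<subseteq> ann_power H R m"
  obtains J :: "(('h set list \<Rightarrow>\<^sub>0 'k) \<times> ('h set list \<Rightarrow>\<^sub>0 'k)) set" and F G
  where "finite J" "\<And>j. j \<in> J \<Longrightarrow> qhom m n (F j)" "\<And>j. j \<in> J \<Longrightarrow> qhom n m (G j)"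
    "\<And>x. x \<in> UQ m \<Longrightarrow> (\<Sum>j\<in>J. G j (F j x)) = x"
proof -
  obtain X where X: "finite X" "X \<subseteq> UQ n" "fs.span X = UQ n" by (rule UQ_finite)
  obtain Y where Y: "finite Y" "Y \<subseteq> UQ m" "fs.span Y = UQ m" by (rule UQ_finite)
  obtain C co where CC: "finite C \<and> C \<subseteq> Y \<and> (\<forall>c. lin fscale (*) (co c)) \<and>
    (\<forall>x\<in>UQ m. (\<Sum>c\<in>C. fscale (co c x) c) = x)"
    using fs_dual_family[OF Y(1)] unfolding Y(3) by (elim exE)
  have C: "finite C" "C \<subseteq> Y" "lin fscale (*) (co c)" "x \<in> UQ m \<Longrightarrow> (\<Sum>c\<in>C. fscale (co c x) c) = x" for c x
    using CC by simp_all
  have CU: "c \<in> UQ m" if "c \<in> C" for c using C(2) Y(2) that by blast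
  note am = ract_alpha[of m] and an = ract_alpha[of n]
  let ?scF = "\<lambda>(c::'k) (f :: ('h set list \<Rightarrow>\<^sub>0 'k) \<Rightarrow> ('h set list \<Rightarrow>\<^sub>0 'k)) w. fscale c (f w)"
  have vsF: "vector_space ?scF"
    by unfold_locales (auto simp: fun_eq_iff fs.scale_right_distrib fs.scale_left_distrib)
  \<comment> \<open>\<open>j r\<close> lists the images of the spanning family \<open>X\<close>
    under \<open>r\<close>, so its kernel in \<open>R\<close> is the annihilator of Q^n. The map
    \<open>g\<close> below is a linear section over the image of \<open>R\<close>, with values in
    \<open>R\<close>.\<close>
  define j where "j r = (\<lambda>w. if w \<in> X then alpha n r w else 0)" for r
  have jl: "lin hs ?scF j"
  proof (rule linI[OF hs_vs vsF])
    have L: "lin hs fscale (\<lambda>r. alpha n r w)" if "w \<in> X" for w using ractD(3)[OF an] X(2) that by blast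
    show "j (x + y) = j x + j y" for x y using linD(3)[OF L] by (auto simp: j_def fun_eq_iff)
    show "j (hs c x) = ?scF c (j x)" for c x using linD(4)[OF L] by (auto simp: j_def fun_eq_iff)
  qed
  interpret p: vector_space_pair hs ?scF by (intro vector_space_pair.intro hs_vs vsF)
  obtain g where g: "range g \<subseteq> R" "lin ?scF hs g" "\<And>r. r \<in> R \<Longrightarrow> j (g (j r)) = j r"
    using p.linear_exists_right_inverse_on[OF jl R_sub] by blast
  define bl where "bl w y = g (\<lambda>w'. if w' = w then y else 0)" for w y
  have bll: "lin fscale hs (bl w)" for w
    unfolding bl_def[abs_def]
    by (rule lin_comp[OF _ g(2)], rule linI[OF vs_fscale vsF]) (auto simp: fun_eq_iff)
  \<comment> \<open>Here the inclusion of annihilators is used: \<open>g (j r)\<close> and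
    \<open>r\<close> act alike on Q^n, hence also on Q^m.\<close>
  have key: "(\<Sum>w\<in>X. alpha m (bl w (alpha n r w)) c) = alpha m r c" if r: "r \<in> R" and c: "c \<in> UQ m" for r c
  proof -
    have "(\<Sum>w\<in>X. bl w (alpha n r w)) = g (\<Sum>w\<in>X. (\<lambda>w'. if w' = w then alpha n r w else 0))"
      unfolding bl_def by (simp add: linD(7)[OF g(2)])
    also have "(\<Sum>w\<in>X. (\<lambda>w'. if w' = w then alpha n r w else 0)) = j r"
      using X(1) by (simp add: fun_eq_iff sum_fun_at j_def sum.delta)
    finally have e: "(\<Sum>w\<in>X. bl w (alpha n r w)) = g (j r)" .
    let ?d = "g (j r) - r"
    have "g (j r) \<in> R" using g(1) by blast
    then have dR: "?d \<in> R" using r by (rule R_diff)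
    have dX: "alpha n ?d w = 0" if w: "w \<in> X" for w
    proof -
      have "j (g (j r)) w = j r w" using g(3)[OF r] by (rule fun_cong)
      then have e: "alpha n (g (j r)) w = alpha n r w" using w by (simp add: j_def)
      have "lin hs fscale (\<lambda>h. alpha n h w)" by (rule ractD(3)[OF an]) (use X(2) w in blast)
      from linD(6)[OF this, of "g (j r)" r] show ?thesis using e by simp
    qed
    have "alpha n ?d x = 0" if "x \<in> UQ n" for x
    proof (rule span_subset_kernel[OF alpha_lin[of n ?d] dX])
      show "x \<in> fs.span X" unfolding X(3) by (rule that)
    qed
    then have "?d \<in> ann_power H R n" using dR by (simp add: ann_alpha)
    then have "?d \<in> ann_power H R m" using ann by blast
    then have "alpha m ?d c = 0" using c by (simp add: ann_alpha)
    moreover have lc: "lin hs fscale (\<lambda>h. alpha m h c)" by (rule ractD(3)[OF am c])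
    ultimately have "alpha m (g (j r)) c = alpha m r c"
      using linD(6)[OF lc, of "g (j r)" r] by simp
    then show ?thesis using e linD(7)[OF lc, of "\<lambda>w. bl w (alpha n r w)" X] by simp
  qed
  \<comment> \<open>\<open>\<phi>\<close> sends the coordinate at \<open>c\<close> to a multiple of
    \<open>w\<close>. \<open>\<psi>\<close> takes the part \<open>bl w y\<close> of an element of
    \<open>R\<close> that is determined by its effect \<open>y\<close> on \<open>w\<close>, and lets
    it act on \<open>c\<close>; by \<open>key\<close> these parts add up to the action of
    \<open>r\<close> on \<open>c\<close>.\<close>
  define \<phi> :: "('h set list \<Rightarrow>\<^sub>0 'k) \<times> ('h set list \<Rightarrow>\<^sub>0 'k) \<Rightarrow> ('h set list \<Rightarrow>\<^sub>0 'k) \<Rightarrow> ('h set list \<Rightarrow>\<^sub>0 'k)" where "\<phi> = (\<lambda>(c, w) x. fscale (co c x) w)"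
  define F where "F j = avg fscale (alpha m) (alpha n) (\<phi> j)" for j
  define \<psi> :: "('h set list \<Rightarrow>\<^sub>0 'k) \<times> ('h set list \<Rightarrow>\<^sub>0 'k) \<Rightarrow> ('h set list \<Rightarrow>\<^sub>0 'k) \<Rightarrow> ('h set list \<Rightarrow>\<^sub>0 'k)" where "\<psi> = (\<lambda>(c, w) y. alpha m (bl w y) c)"
  define G where "G j = avg fscale (alpha n) (alpha m) (\<psi> j)" for j
  let ?J = "C \<times> X"
  have \<phi>l: "lin fscale fscale (\<phi> j)" for j
    unfolding \<phi>_def by (cases j) (auto intro!: lin_scale_left vs_fscale C(3))
  have \<phi>m: "\<phi> j x \<in> UQ n" if "j \<in> ?J" for j x
    using that X(2) unfolding \<phi>_def by (auto intro!: fs.subspace_scale[OF sub_UQ])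
  have \<psi>l: "lin fscale fscale (\<psi> j)" if "j \<in> ?J" for j
    using that unfolding \<psi>_def by (auto intro!: lin_comp[OF bll ractD(3)[OF am]] CU)
  have \<psi>m: "\<psi> j x \<in> UQ m" if "j \<in> ?J" for j x
    using that unfolding \<psi>_def by (auto intro!: ractD(4)[OF am] dest: CU)
  have F: "qhom m n (F j)" if j: "j \<in> ?J" for j
    unfolding qhom_def F_def
  proof (intro conjI ballI)
    show "lin fscale fscale (avg fscale (alpha m) (alpha n) (\<phi> j))" by (rule avg_lin[OF am an \<phi>l])
    show "avg fscale (alpha m) (alpha n) (\<phi> j) x \<in> UQ n" if "x \<in> UQ m" for x
      by (rule avg_mem[OF am an \<phi>l \<phi>m[OF j] that sub_UQ \<phi>m[OF j]]) (rule ractD(4)[OF an])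
    show "avg fscale (alpha m) (alpha n) (\<phi> j) (alpha m r x) = alpha n r (avg fscale (alpha m) (alpha n) (\<phi> j) x)"
      if "x \<in> UQ m" "r \<in> R" for x r
      by (rule avg_hom[OF am an \<phi>l \<phi>m[OF j] that])
  qed
  have G: "qhom n m (G j)" if j: "j \<in> ?J" for j
    unfolding qhom_def G_def
  proof (intro conjI ballI)
    show "lin fscale fscale (avg fscale (alpha n) (alpha m) (\<psi> j))" by (rule avg_lin[OF an am \<psi>l[OF j]])
    show "avg fscale (alpha n) (alpha m) (\<psi> j) x \<in> UQ m" if "x \<in> UQ n" for x
      by (rule avg_mem[OF an am \<psi>l[OF j] \<psi>m[OF j] that sub_UQ \<psi>m[OF j]]) (rule ractD(4)[OF am])
    show "avg fscale (alpha n) (alpha m) (\<psi> j) (alpha n r x) = alpha m r (avg fscale (alpha n) (alpha m) (\<psi> j) x)"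
      if "x \<in> UQ n" "r \<in> R" for x r
      by (rule avg_hom[OF an am \<psi>l[OF j] \<psi>m[OF j] that])
  qed
  \<comment> \<open>The summed map \<open>?\<kappa>\<close> on \<open>H\<close> takes
    \<open>r\<close> in \<open>R\<close> to the image of \<open>c\<close> under \<open>r\<close>, so
    \<open>avg_id\<close> applies at the element 1 of the regular module.\<close>
  have Gw: "(\<Sum>w\<in>X. G (c, w) w) = c" if c: "c \<in> C" for c
  proof -
    let ?\<kappa> = "\<lambda>h. \<Sum>w\<in>X. alpha m (bl w (alpha n h w)) c"
    have \<kappa>l: "lin hs fscale ?\<kappa>"
      by (intro lin_sum hs_vs vs_fscale lin_comp[OF lin_comp[OF ractD(3)[OF an] bll] ractD(3)[OF am CU[OF c]]])
        (use X(2) in auto)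
    have \<kappa>m: "?\<kappa> h \<in> UQ m" for h
      by (intro fs.subspace_sum[OF sub_UQ] ractD(4)[OF am CU[OF c]])
    have "(\<Sum>w\<in>X. G (c, w) w) = avg fscale (\<lambda>h x. x * h) (alpha m) ?\<kappa> 1"
      unfolding G_def avg_def \<psi>_def by (simp add: linD(7)[OF alpha_lin] sw_sum[OF vs_fscale])
    also have "\<dots> = c"
      by (rule avg_id[OF ract_right am \<kappa>l \<kappa>m UNIV_I CU[OF c]]) (simp add: key[OF _ CU[OF c]])
    finally show ?thesis .
  qed
  \<comment> \<open>With \<open>\<phi>\<close> not yet averaged this is the identity of
    \<open>UQ m\<close> as a linear map. Its average is the identity again, and as every
    \<open>G j\<close> is already \<open>R\<close>-linear, the average can be moved inside, where it
    turns \<open>\<phi>\<close> into \<open>F\<close>.\<close>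
  let ?\<Psi> = "\<lambda>x. \<Sum>j\<in>?J. G j (\<phi> j x)"
  have \<Psi>l: "lin fscale fscale ?\<Psi>"
    by (intro lin_sum vs_fscale lin_comp[OF \<phi>l]) (use G qhomD(1) in blast)
  have \<Psi>m: "?\<Psi> x \<in> UQ m" for x
    by (intro fs.subspace_sum[OF sub_UQ] qhomD(2)[OF G] \<phi>m) auto
  have \<Psi>id: "?\<Psi> z = z" if z: "z \<in> UQ m" for z
  proof -
    have "?\<Psi> z = (\<Sum>c\<in>C. \<Sum>w\<in>X. G (c, w) (fscale (co c z) w))"
      unfolding sum.cartesian_product \<phi>_def by (rule sum.cong) auto
    also have "\<dots> = (\<Sum>c\<in>C. fscale (co c z) (\<Sum>w\<in>X. G (c, w) w))"
      unfolding fs.scale_sum_right by (intro sum.cong refl linD(4)[OF qhomD(1)[OF G]]) auto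
    also have "\<dots> = z" using Gw C(4)[OF z] by simp
    finally show ?thesis .
  qed
  have sum: "(\<Sum>j\<in>?J. G j (F j x)) = x" if x: "x \<in> UQ m" for x
  proof -
    have e: "G j (F j x) = sw fscale (\<lambda>a b. alpha m b (G j (\<phi> j (alpha m (S a) x)))) t" if j: "j \<in> ?J" for j
    proof -
      have Gl: "lin fscale fscale (G j)" by (rule qhomD(1)[OF G[OF j]])
      have "G j (F j x) = sw fscale (\<lambda>a b. G j (alpha n b (\<phi> j (alpha m (S a) x)))) t"
        unfolding F_def avg_def by (rule sw_push[OF Gl])
      also have "\<dots> = sw fscale (\<lambda>a b. alpha m b (G j (\<phi> j (alpha m (S a) x)))) t"
      proof (rule sw_R_cong[OF t_R])
        have b: "bil fscale (\<lambda>a b. alpha n b (\<phi> j (alpha m (S a) x)))"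
          by (rule avg_bil_S[OF am an \<phi>l \<phi>m[OF j] x])
        show "bil fscale (\<lambda>a b. G j (alpha n b (\<phi> j (alpha m (S a) x))))"
          using b lin_comp[OF _ Gl] unfolding bil_def by blast
        have "lin hs fscale (\<lambda>a. alpha m (S a) x)" by (rule lin_comp[OF antipode_linear ractD(3)[OF am x]])
        then show "bil fscale (\<lambda>a b. alpha m b (G j (\<phi> j (alpha m (S a) x))))"
          by (intro bilI ractD(3)[OF am] qhomD(2)[OF G[OF j]] \<phi>m[OF j] lin_comp[OF _ alpha_lin] lin_comp[OF _ Gl] lin_comp[OF _ \<phi>l])
        show "G j (alpha n b (\<phi> j (alpha m (S a) x))) = alpha m b (G j (\<phi> j (alpha m (S a) x)))" if "b \<in> R" for a b
          by (rule qhomD(3)[OF G[OF j] \<phi>m[OF j] that])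
      qed
      finally show ?thesis .
    qed
    have "(\<Sum>j\<in>?J. G j (F j x)) = (\<Sum>j\<in>?J. sw fscale (\<lambda>a b. alpha m b (G j (\<phi> j (alpha m (S a) x)))) t)"
      by (rule sum.cong[OF refl e])
    also have "\<dots> = avg fscale (alpha m) (alpha m) ?\<Psi> x"
      unfolding avg_def linD(7)[OF alpha_lin] by (simp add: sw_sum[OF vs_fscale])
    also have "\<dots> = x"
      by (rule avg_id[OF am am \<Psi>l \<Psi>m x x]) (rule \<Psi>id[OF ractD(4)[OF am x]])
    finally show ?thesis .
  qed
  have fin: "finite ?J" using C(1) X(1) by simp
  show ?thesis by (rule that[OF fin F G sum])
qed

text \<open>Composition of functions on H \<otimes> Q^n with the identity of \<open>H\<close>
  tensored with \<open>f\<close>. It is contravariant: \<open>f\<close> from Q^m to Q^n turns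
  functions on words of length \<open>n + 1\<close> into functions on words of length
  \<open>m + 1\<close>.\<close>

definition Tf :: "('k \<Rightarrow> 'v::ab_group_add \<Rightarrow> 'v) \<Rightarrow> nat \<Rightarrow>
    (('h set list \<Rightarrow>\<^sub>0 'k) \<Rightarrow> ('h set list \<Rightarrow>\<^sub>0 'k)) \<Rightarrow> ('h list \<Rightarrow> 'v) \<Rightarrow> 'h list \<Rightarrow> 'v" where
  "Tf sc m f \<gamma> w = hat sc (\<lambda>v. \<gamma> (hd w # v)) (f (uQ m (tl w)))"

lemma UQ_CQ: "UQ n \<subseteq> CQ n"
proof -
  interpret q: quotient_action "CQ n" "NQ n" "actQ n" UNIV by (rule Qpower_action)
  have "uQ n w \<in> CQ n" if "length w = n" for w
  proof -
    have p: "pure (map (\<lambda>x. Qc x) w) \<in> CQ n" by (rule pure_formal) (use that in \<open>auto simp: Qmod_simps\<close>)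
    have "pure (map (\<lambda>x. Qc x) w) - uQ n w \<in> CQ n"
      using q.NC nproj_NQ(3) unfolding uQ_def by blast
    from fs.subspace_diff[OF q.C p this] show ?thesis by simp
  qed
  then show ?thesis unfolding UQ_def by (intro fs.span_minimal q.C) auto
qed

lemma UQ_keys: "y \<in> UQ n \<Longrightarrow> qs \<in> Poly_Mapping.keys y \<Longrightarrow> length qs = n"
  using UQ_CQ by (auto simp: formal_tensors_def)

lemma hat_cong: "y \<in> UQ n \<Longrightarrow> (\<And>v. length v = n \<Longrightarrow> g v = g' v) \<Longrightarrow> hat sc g y = hat sc g' y"
  unfolding hat_def by (rule lin_ext_cong) (simp add: UQ_keys)

lemma hat_push: "lin sc sc' L \<Longrightarrow> L (hat sc g y) = hat sc' (\<lambda>v. L (g v)) y"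
  unfolding hat_def by (rule lin_ext_push)

lemma hat_dact:
  assumes "Qgood sc n g" "y \<in> UQ n"
  shows "hat sc (\<lambda>v. dact sc v g h) y = hat sc g (alpha n h y)"
proof (rule UQ_lin_eq[OF _ _ _ assms(2)])
  have sc: "vector_space sc" using QgoodD(1)[OF assms(1)] by (rule mlinD)
  show "lin fscale sc (hat sc (\<lambda>v. dact sc v g h))" by (rule lin_hat[OF sc])
  show "lin fscale sc (\<lambda>y. hat sc g (alpha n h y))" by (rule lin_comp[OF alpha_lin lin_hat[OF sc]])
  fix w :: "'h list" assume w: "length w = n"
  have "hat sc g (alpha n h (uQ n w)) = dact sc w (\<lambda>v. hat sc g (uQ n v)) h"
    unfolding alpha_uQ[OF w] by (rule dact_push[OF lin_hat[OF sc]])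
  also have "\<dots> = dact sc w g h"
    by (rule comb_cong[OF comb_dact[OF sc w]]) (simp add: hat_uQ[OF assms(1)])
  finally show "hat sc (\<lambda>v. dact sc v g h) (uQ n w) = hat sc g (alpha n h (uQ n w))"
    by (simp add: hat_uQ[OF Qgood_dact[OF assms(1)] w])
qed

lemma good_lin_hat:
  assumes "mlin sc (Suc n) g" "y \<in> UQ n"
  shows "lin hs sc (\<lambda>x. hat sc (\<lambda>v. g (x # v)) y)"
  unfolding hat_def
  by (rule lin_ext_lin_fun[OF _ hs_vs mlinD(1)[OF assms(1)]], rule lin_hd[OF assms(1) _ lin_id[OF hs_vs]])
    (simp add: UQ_keys[OF assms(2)])

lemma Tf_good:
  assumes f: "qhom m n f" and g: "good sc n g"
  shows "good sc m (Tf sc m f g)"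
  unfolding good_def
proof (intro conjI allI impI)
  have sc: "vector_space sc" using goodD(1)[OF g] by (rule mlinD)
  have mu: "mlin fscale m (uQ m)" by (rule QgoodD(1)[OF Qgood_uQ])
  have "lin hs sc (\<lambda>x. Tf sc m f g (us @ x # vs))" if l: "length us + 1 + length vs = Suc m" for us vs
  proof (cases us)
    case Nil
    then show ?thesis unfolding Tf_def
      using good_lin_hat[OF goodD(1)[OF g] qhomD(2)[OF f uQ_UQ[of vs m]]] l by simp
  next
    case (Cons u us')
    then show ?thesis unfolding Tf_def
      using l by (simp, intro lin_comp[OF lin_comp[OF mlinD(2)[OF mu] qhomD(1)[OF f]] lin_hat[OF sc]]) simp
  qed
  then show "mlin sc (Suc m) (Tf sc m f g)" by (simp add: mlin_def sc)
  fix us vs :: "'h list" and x r assume a: "length us + length vs = m \<and> us \<noteq> [] \<and> r \<in> R"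
  then obtain u us' where us: "us = u # us'" by (cases us) auto
  have "uQ m (us' @ (r * x) # vs) = fscale (eps r) (uQ m (us' @ x # vs))"
    by (rule QgoodD(2)[OF Qgood_uQ]) (use a us in auto)
  then show "Tf sc m f g (us @ (r * x) # vs) = sc (eps r) (Tf sc m f g (us @ x # vs))"
    by (simp add: Tf_def us linD(4)[OF qhomD(1)[OF f]] linD(4)[OF lin_hat[OF sc]])
qed

text \<open>If the first slot factors through \<open>Q\<close> as well, the operator is composition
  with the identity of \<open>Q\<close> tensored with \<open>f\<close>.\<close>

lemma Tf_Qgood:
  assumes f: "qhom m n f" and g: "Qgood sc (Suc n) g"
  shows "Qgood sc (Suc m) (Tf sc m f g)"
  unfolding Qgood_def
proof (intro conjI allI impI)
  note gg = Tf_good[OF f Qgood_good[OF g]]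
  have sc: "vector_space sc" using QgoodD(1)[OF g] by (rule mlinD)
  show "mlin sc (Suc m) (Tf sc m f g)" by (rule goodD(1)[OF gg])
  fix us vs :: "'h list" and x r assume a: "length us + 1 + length vs = Suc m \<and> r \<in> R"
  show "Tf sc m f g (us @ (r * x) # vs) = sc (eps r) (Tf sc m f g (us @ x # vs))"
  proof (cases "us = []")
    case True
    have y: "f (uQ m vs) \<in> UQ n" by (rule qhomD(2)[OF f uQ_UQ]) (use a True in simp)
    have "hat sc (\<lambda>v. g ((r * x) # v)) (f (uQ m vs)) = hat sc (\<lambda>v. sc (eps r) (g (x # v))) (f (uQ m vs))"
      by (rule hat_cong[OF y]) (use QgoodD(2)[OF g, of "[]" _ r x] a in simp)
    also have "\<dots> = sc (eps r) (hat sc (\<lambda>v. g (x # v)) (f (uQ m vs)))"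
      by (rule hat_push[symmetric]) (intro lin_scale lin_id sc)
    finally show ?thesis using True by (simp add: Tf_def)
  next
    case False
    then show ?thesis using goodD(2)[OF gg, of us vs r x] a by simp
  qed
qed

text \<open>The second leg of \<open>r\<close> can be taken in \<open>R\<close>, where its action
  commutes with \<open>f\<close>; hence the restriction to elements of \<open>R\<close>.\<close>

lemma Tf_dact:
  assumes f: "qhom m n f" and g: "good sc n g" and r: "r \<in> R" and w: "length w = Suc m"
  shows "dact sc w (Tf sc m f g) r = Tf sc m f (\<lambda>v. dact sc v g r) w"
proof -
  have sc: "vector_space sc" using goodD(1)[OF g] by (rule mlinD)
  obtain x w' where w': "w = x # w'" "length w' = m" using w by (cases w) auto
  note q = good_tail[OF g]
  let ?y = "f (uQ m w')"
  have y: "?y \<in> UQ n" by (rule qhomD(2)[OF f uQ_UQ[OF w'(2)]])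
  have lhat: "lin hs sc (\<lambda>a. hat sc (\<lambda>v. g ((x * a) # v)) z)" if "z \<in> UQ n" for z
    by (rule lin_comp[OF lin_mult_left[OF lin_id[OF hs_vs]] good_lin_hat[OF goodD(1)[OF g] that]])
  have b1: "bil sc (\<lambda>a u. hat sc (\<lambda>v. g ((x * a) # v)) (f (alpha m u (uQ m w'))))"
    by (intro bilI lhat qhomD(2)[OF f] ractD(4)[OF ract_alpha] uQ_UQ w'(2)
        lin_comp[OF lin_comp[OF ractD(3)[OF ract_alpha] qhomD(1)[OF f]] lin_hat[OF sc]])
  have b2: "bil sc (\<lambda>a u. hat sc (\<lambda>v. g ((x * a) # v)) (alpha n u ?y))"
    by (intro bilI lhat ractD(4)[OF ract_alpha] y lin_comp[OF ractD(3)[OF ract_alpha] lin_hat[OF sc]])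
  have "dact sc w (Tf sc m f g) r = sw sc (\<lambda>a u. dact sc w' (\<lambda>v. hat sc (\<lambda>v'. g ((x * a) # v')) (f (uQ m v))) u) r"
    by (simp add: w'(1) Tf_def)
  also have "\<dots> = sw sc (\<lambda>a u. hat sc (\<lambda>v. g ((x * a) # v)) (f (alpha m u (uQ m w')))) r"
    unfolding alpha_uQ[OF w'(2)]
    by (simp only: dact_push[OF lin_comp[OF qhomD(1)[OF f] lin_hat[OF sc]]])
  also have "\<dots> = sw sc (\<lambda>a u. hat sc (\<lambda>v. g ((x * a) # v)) (alpha n u ?y)) r"
    by (rule sw_R_cong[OF r b1 b2]) (simp add: qhomD(3)[OF f uQ_UQ[OF w'(2)]])
  also have "\<dots> = sw sc (\<lambda>a u. hat sc (\<lambda>v. dact sc v (\<lambda>v'. g ((x * a) # v')) u) ?y) r"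
    by (simp only: hat_dact[OF q y])
  also have "\<dots> = hat sc (\<lambda>v. sw sc (\<lambda>a u. dact sc v (\<lambda>v'. g ((x * a) # v')) u) r) ?y"
    unfolding hat_def sweedler_def by (rule lin_ext_swap[OF sc])
  also have "\<dots> = Tf sc m f (\<lambda>v. dact sc v g r) w"
    by (simp add: Tf_def w'(1))
  finally show ?thesis .
qed

lemma Tf_family:
  assumes J: "finite J" "\<And>j. j \<in> J \<Longrightarrow> qhom m n (F j)" "\<And>j. j \<in> J \<Longrightarrow> qhom n m (G j)"
    "\<And>x. x \<in> UQ m \<Longrightarrow> (\<Sum>j\<in>J. G j (F j x)) = x"
    and g: "good sc m g" and w: "length w = Suc m"
  shows "(\<Sum>j\<in>J. Tf sc m (F j) (Tf sc n (G j) g) w) = g w"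
proof -
  have sc: "vector_space sc" using goodD(1)[OF g] by (rule mlinD)
  obtain x w' where w': "w = x # w'" "length w' = m" using w by (cases w) auto
  note q = good_tail[OF g, of x]
  have "Tf sc m (F j) (Tf sc n (G j) g) w = hat sc (\<lambda>v. g (x # v)) (G j (F j (uQ m w')))" if j: "j \<in> J" for j
  proof -
    have "hat sc (\<lambda>v. hat sc (\<lambda>v. g (x # v)) (G j (uQ n v))) y = hat sc (\<lambda>v. g (x # v)) (G j y)" if "y \<in> UQ n" for y
    proof (rule UQ_lin_eq[OF _ _ _ that])
      show "lin fscale sc (hat sc (\<lambda>v. hat sc (\<lambda>v. g (x # v)) (G j (uQ n v))))" by (rule lin_hat[OF sc])
      show "lin fscale sc (\<lambda>y. hat sc (\<lambda>v. g (x # v)) (G j y))"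
        by (rule lin_comp[OF qhomD(1)[OF J(3)[OF j]] lin_hat[OF sc]])
      fix v :: "'h list" assume v: "length v = n"
      have "Qgood sc n (\<lambda>v. hat sc (\<lambda>v. g (x # v)) (G j (uQ n v)))"
        using good_tail[OF Tf_good[OF J(3)[OF j] g], of x] by (simp add: Tf_def)
      from hat_uQ[OF this v]
      show "hat sc (\<lambda>v. hat sc (\<lambda>v. g (x # v)) (G j (uQ n v))) (uQ n v) = hat sc (\<lambda>v. g (x # v)) (G j (uQ n v))" .
    qed
    from this[OF qhomD(2)[OF J(2)[OF j] uQ_UQ[OF w'(2)]]] show ?thesis by (simp add: Tf_def w'(1))
  qed
  then have "(\<Sum>j\<in>J. Tf sc m (F j) (Tf sc n (G j) g) w) = (\<Sum>j\<in>J. hat sc (\<lambda>v. g (x # v)) (G j (F j (uQ m w'))))"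
    by simp
  also have "\<dots> = hat sc (\<lambda>v. g (x # v)) (uQ m w')"
    unfolding linD(7)[OF lin_hat[OF sc], symmetric] J(4)[OF uQ_UQ[OF w'(2)]] ..
  finally show ?thesis by (simp add: hat_uQ[OF q w'(2)] w'(1))
qed

lemma ann_power_step:
  assumes "ann_power H R n \<subseteq> ann_power H R (Suc n)"
  shows "ann_power H R (Suc n) \<subseteq> ann_power H R (Suc (Suc n))"
proof
  fix r assume r: "r \<in> ann_power H R (Suc n)"
  then have rR: "r \<in> R" by (simp add: ann_power_iff)
  obtain J :: "(('h set list \<Rightarrow>\<^sub>0 'k) \<times> ('h set list \<Rightarrow>\<^sub>0 'k)) set" and F G where J: "finite J"
    "\<And>j. j \<in> J \<Longrightarrow> qhom (Suc n) n (F j)" "\<And>j. j \<in> J \<Longrightarrow> qhom n (Suc n) (G j)"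
    "\<And>x. x \<in> UQ (Suc n) \<Longrightarrow> (\<Sum>j\<in>J. G j (F j x)) = x"
    using hom_family[OF assms] by blast
  let ?g = "uQ (Suc (Suc n))"
  note g = Qgood_good[OF Qgood_uQ[of "Suc (Suc n)"]]
  have "dact fscale w ?g r = 0" if w: "length w = Suc (Suc n)" for w
  proof -
    have "dact fscale w ?g r = dact fscale w (\<lambda>v. \<Sum>j\<in>J. Tf fscale (Suc n) (F j) (Tf fscale n (G j) ?g) v) r"
      by (rule comb_cong[OF comb_dact[OF vs_fscale w]]) (simp add: Tf_family[OF J g])
    also have "\<dots> = (\<Sum>j\<in>J. dact fscale w (Tf fscale (Suc n) (F j) (Tf fscale n (G j) ?g)) r)"
    proof -
      obtain p where p: "\<And>g :: _ \<Rightarrow> 'h set list \<Rightarrow>\<^sub>0 'k. dact fscale w g r = lin_ext fscale g p"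
        using comb_dact[OF vs_fscale w, of r] unfolding comb_def by blast
      show ?thesis unfolding p lin_ext_def fs.scale_sum_right by (rule sum.swap)
    qed
    also have "\<dots> = 0"
    proof (rule sum.neutral, rule ballI)
      fix j assume j: "j \<in> J"
      \<comment> \<open>Commuting with the operator of \<open>F j\<close>, the action of
        \<open>r\<close> reaches a \<open>Qgood\<close> function on words of length
        \<open>n + 1\<close>, on which it is zero.\<close>
      have "dact fscale w (Tf fscale (Suc n) (F j) (Tf fscale n (G j) ?g)) r =
          Tf fscale (Suc n) (F j) (\<lambda>v. dact fscale v (Tf fscale n (G j) ?g) r) w"
        by (rule Tf_dact[OF J(2)[OF j] Tf_good[OF J(3)[OF j] g] rR w])
      also have "\<dots> = hat fscale (\<lambda>v. 0) (F j (uQ (Suc n) (tl w)))"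
        unfolding Tf_def[of fscale "Suc n" "F j"]
        by (rule hat_cong[OF qhomD(2)[OF J(2)[OF j] uQ_UQ]])
          (use w in simp, rule ann_power_Qgood[OF r Tf_Qgood[OF J(3)[OF j] Qgood_uQ]], simp)
      finally show "dact fscale w (Tf fscale (Suc n) (F j) (Tf fscale n (G j) ?g)) r = 0"
        by (simp add: hat_def lin_ext_def)
    qed
    finally show ?thesis .
  qed
  then show "r \<in> ann_power H R (Suc (Suc n))" using rR by (simp add: ann_power_iff)
qed

end

section \<open>Depth\<close>

context hopf_pair
begin

definition actW :: "'h + 'h \<Rightarrow> 'h list \<Rightarrow> 'h list" where
  "actW s w = (case s of Inl h \<Rightarrow> h * hd w # tl w | Inr h \<Rightarrow> butlast w @ [last w * h])"

lemma actW_simps: "actW (Inl h) w = h * hd w # tl w" "actW (Inr h) w = butlast w @ [last w * h]"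
  by (simp_all add: actW_def)

lemma actB_actW: "actB s (pure w) = pure (actW s w)"
  by (cases s) (simp_all add: actB_pure actW_simps)

abbreviation "TP n \<equiv> tensor_power_over hs R n"
abbreviation "cB n p \<equiv> p +o NB n"

lemma TP_additive: "n \<ge> 1 \<Longrightarrow> additive_module A (TP n)"
proof -
  assume n: "n \<ge> 1"
  interpret q: quotient_action "CB n" "NB n" actB A by (rule tensor_power_over_action[OF n])
  show ?thesis unfolding tensor_power_over_quotient by (rule q.additive_M)
qed

lemma TP_simps:
  assumes n: "n \<ge> 1"
  shows "carrier (TP n) = cB n ` CB n" "cB n x \<oplus>\<^bsub>TP n\<^esub> cB n y = cB n (x + y)"
    "\<zero>\<^bsub>TP n\<^esub> = cB n 0" "s \<odot>\<^bsub>TP n\<^esub> cB n x = cB n (actB s x)" "cB n x = cB n y \<longleftrightarrow> nproj (NB n) x = nproj (NB n) y"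
    "x \<in> CB n \<Longrightarrow> actB s x \<in> CB n" "nproj (NB n) (actB s (nproj (NB n) x)) = nproj (NB n) (actB s x)"
proof -
  interpret q: quotient_action "CB n" "NB n" actB UNIV by (rule tensor_power_over_action[OF n])
  show "carrier (TP n) = cB n ` CB n" "cB n x \<oplus>\<^bsub>TP n\<^esub> cB n y = cB n (x + y)"
    "\<zero>\<^bsub>TP n\<^esub> = cB n 0" "s \<odot>\<^bsub>TP n\<^esub> cB n x = cB n (actB s x)"
    unfolding tensor_power_over_quotient using q.carrier_M q.add_M q.zero_M q.smult_M by auto
  show "cB n x = cB n y \<longleftrightarrow> nproj (NB n) x = nproj (NB n) y"
    unfolding q.cls_eq nproj_NB(2)[symmetric] by (simp add: linD(6)[OF nproj_NB(1)])
  show "x \<in> CB n \<Longrightarrow> actB s x \<in> CB n" by (rule q.act_C) auto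
  have "actB s (x - nproj (NB n) x) \<in> NB n" by (rule q.act_N) (auto intro: nproj_NB(3))
  then have "nproj (NB n) (actB s (x - nproj (NB n) x)) = 0" using nproj_NB(2) by blast
  then show "nproj (NB n) (actB s (nproj (NB n) x)) = nproj (NB n) (actB s x)"
    by (simp add: linD(6)[OF nproj_NB(1)] linD(6)[OF actB_lin])
qed

lemma pure_CB: "length w = n \<Longrightarrow> pure w \<in> CB n"
  by (rule pure_formal) auto

lemma CB_induct:
  assumes "p \<in> CB n" "P 0" "\<And>x y. x \<in> CB n \<Longrightarrow> y \<in> CB n \<Longrightarrow> P x \<Longrightarrow> P y \<Longrightarrow> P (x + y)"
    "\<And>c x. x \<in> CB n \<Longrightarrow> P x \<Longrightarrow> P (fscale c x)" "\<And>w. length w = n \<Longrightarrow> P (pure w)"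
  shows "P p"
proof -
  have "p \<in> fs.span {pure w | w. length w = n \<and> set w \<subseteq> UNIV}" using assms(1) by (simp add: formal_tensors_span)
  then have "p \<in> CB n \<and> P p"
  proof (rule fs.span_induct)
    show "fs.subspace {x. x \<in> CB n \<and> P x}"
      using assms(2-4) by (intro fs.subspaceI)
        (auto intro: fs.subspace_0[OF subspace_formal_tensors] fs.subspace_add[OF subspace_formal_tensors]
          fs.subspace_scale[OF subspace_formal_tensors])
  qed (use assms(5) pure_CB in auto)
  then show ?thesis ..
qed

lemma vB_scalar:
  assumes "length w = n" "n \<ge> 1" "e = Inl (hs c 1) \<or> e = Inr (hs c 1)"
  shows "vB n (actW e w) = fscale c (vB n w)"
  using assms(3)
proof
  assume e: "e = Inl (hs c 1)"
  obtain x w' where w: "w = x # w'" using assms by (cases w) auto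
  have "vB n ([] @ hs c x # w') = fscale c (vB n ([] @ x # w'))"
    by (rule linD(4)[OF mlinD(2)[OF balancedD(1)[OF balanced_vB]]]) (use w assms in simp)
  then show ?thesis by (simp add: e actW_simps w scale_mult_left)
next
  assume e: "e = Inr (hs c 1)"
  obtain x w' where w: "w = w' @ [x]" using assms by (cases w rule: rev_cases) auto
  have "vB n (w' @ hs c x # []) = fscale c (vB n (w' @ x # []))"
    by (rule linD(4)[OF mlinD(2)[OF balancedD(1)[OF balanced_vB]]]) (use w assms in simp)
  then show ?thesis by (simp add: e actW_simps w scale_mult_right)
qed

text \<open>Homomorphisms are additive and commute with the bimodule scalars; linearity over
  \<open>k\<close> is recovered because the multiples of 1 act, from either side, as the field
  does.\<close>

lemma TP_scalar:
  assumes p: "p \<in> CB n" and n: "n \<ge> 1" and e: "e = Inl (hs c 1) \<or> e = Inr (hs c 1)"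
  shows "e \<odot>\<^bsub>TP n\<^esub> cB n p = cB n (fscale c p)"
  unfolding TP_simps(4)[OF n] TP_simps(5)[OF n]
  using p
proof (rule CB_induct)
  fix w :: "'h list" assume w: "length w = n"
  show "nproj (NB n) (actB e (pure w)) = nproj (NB n) (fscale c (pure w))"
    using vB_scalar[OF w n e] by (simp add: vB_def actB_actW linD(4)[OF nproj_NB(1)])
qed (auto simp: linD[OF actB_lin] linD[OF nproj_NB(1)] fs.scale_right_distrib fs.scale_left_commute)

text \<open>\<open>E\<close> is a set of bimodule scalars that act through the character
  \<open>\<chi>\<close>. It contains, for every \<open>c\<close>, the multiple \<open>hs c 1\<close>
  on one of the sides with character value \<open>c\<close>, which makes an additive function linear
  and its restriction to words \<open>balanced\<close>.\<close>

lemma TP_function: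
  assumes n: "n \<ge> 1" and sc: "vector_space sc"
    and add: "\<forall>X\<in>carrier (TP n). \<forall>Y\<in>carrier (TP n). \<beta> (X \<oplus>\<^bsub>TP n\<^esub> Y) = \<beta> X + \<beta> Y"
    and E: "\<forall>c. \<exists>e\<in>E. (e = Inl (hs c 1) \<or> e = Inr (hs c 1)) \<and> \<chi> e = c"
    and inv: "\<forall>e\<in>E. \<forall>X\<in>carrier (TP n). \<beta> (e \<odot>\<^bsub>TP n\<^esub> X) = sc (\<chi> e) (\<beta> X)"
  shows "balanced sc n (\<lambda>w. \<beta> (cB n (pure w)))"
    "\<And>e w. e \<in> E \<Longrightarrow> length w = n \<Longrightarrow> \<beta> (cB n (pure (actW e w))) = sc (\<chi> e) (\<beta> (cB n (pure w)))"
    "\<And>s X. \<forall>w. length w = n \<longrightarrow> \<beta> (cB n (pure (actW s w))) = 0 \<Longrightarrow> X \<in> carrier (TP n) \<Longrightarrow> \<beta> (s \<odot>\<^bsub>TP n\<^esub> X) = 0"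
proof -
  interpret v: vector_space sc by fact
  have c: "cB n p \<in> carrier (TP n)" if "p \<in> CB n" for p using that by (simp add: TP_simps(1)[OF n])
  have add': "\<beta> (cB n (p + q)) = \<beta> (cB n p) + \<beta> (cB n q)" if "p \<in> CB n" "q \<in> CB n" for p q
    using add c[OF that(1)] c[OF that(2)] by (simp add: TP_simps(2)[OF n, symmetric])
  have scale: "\<beta> (cB n (fscale c p)) = sc c (\<beta> (cB n p))" if p: "p \<in> CB n" for p c
  proof -
    obtain e where e: "e \<in> E" "e = Inl (hs c 1) \<or> e = Inr (hs c 1)" "\<chi> e = c" using E by blast
    show ?thesis using inv e(1) c[OF p] TP_scalar[OF p n e(2), symmetric] e(3) by simp
  qed
  have eq: "\<beta> (cB n p) = \<beta> (cB n q)" if "nproj (NB n) p = nproj (NB n) q" for p q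
    using that TP_simps(5)[OF n, of p q] by simp
  note mv = balancedD(1)[OF balanced_vB[of n]]
  show "balanced sc n (\<lambda>w. \<beta> (cB n (pure w)))"
    unfolding balanced_def mlin_def
  proof (intro conjI allI impI sc)
    fix us vs :: "'h list" assume l: "length us + 1 + length vs = n"
    note L = mlinD(2)[OF mv l]
    note nl = linD[OF nproj_NB(1)]
    have p: "pure (us @ x # vs) \<in> CB n" for x by (rule pure_CB) (use l in simp)
    show "lin hs sc (\<lambda>x. \<beta> (cB n (pure (us @ x # vs))))"
    proof (rule linI[OF hs_vs sc])
      show "\<beta> (cB n (pure (us @ (x + y) # vs))) = \<beta> (cB n (pure (us @ x # vs))) + \<beta> (cB n (pure (us @ y # vs)))" for x y
        unfolding add'[OF p p, symmetric] by (rule eq) (use linD(3)[OF L] in \<open>simp add: vB_def nl\<close>)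
      show "\<beta> (cB n (pure (us @ hs c x # vs))) = sc c (\<beta> (cB n (pure (us @ x # vs))))" for c x
        unfolding scale[OF p, symmetric] by (rule eq) (use linD(4)[OF L] in \<open>simp add: vB_def nl\<close>)
    qed
  next
    fix us vs :: "'h list" and x y r assume "length us + 2 + length vs = n \<and> r \<in> R"
    then show "\<beta> (cB n (pure (us @ [x * r, y] @ vs))) = \<beta> (cB n (pure (us @ [x, r * y] @ vs)))"
      using balancedD(2)[OF balanced_vB, of us vs n r x y] by (intro eq) (auto simp: vB_def)
  qed
  show "\<beta> (cB n (pure (actW e w))) = sc (\<chi> e) (\<beta> (cB n (pure w)))" if "e \<in> E" "length w = n" for e w
    using inv that(1) c[OF pure_CB[OF that(2)]] by (simp add: TP_simps(4)[OF n, symmetric] actB_actW[symmetric])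
  fix s X assume z: "\<forall>w. length w = n \<longrightarrow> \<beta> (cB n (pure (actW s w))) = 0" and "X \<in> carrier (TP n)"
  then obtain p where p: "p \<in> CB n" "X = cB n p" by (auto simp: TP_simps(1)[OF n])
  have z0: "\<beta> (cB n 0) = 0" using add'[of 0 0] fs.subspace_0[OF subspace_formal_tensors] by auto
  have "\<beta> (cB n (actB s p)) = 0"
    using p(1)
  proof (rule CB_induct)
    show "\<beta> (cB n (actB s 0)) = 0" using z0 by (simp add: linD(5)[OF actB_lin])
    show "\<beta> (cB n (actB s (x + y))) = 0" if "x \<in> CB n" "y \<in> CB n" "\<beta> (cB n (actB s x)) = 0" "\<beta> (cB n (actB s y)) = 0" for x y
      using add'[OF TP_simps(6)[OF n that(1)] TP_simps(6)[OF n that(2)], of s s] that by (simp add: linD(3)[OF actB_lin])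
    show "\<beta> (cB n (actB s (fscale c x))) = 0" if "x \<in> CB n" "\<beta> (cB n (actB s x)) = 0" for c x
      using scale[OF TP_simps(6)[OF n that(1)], of c s] that by (simp add: linD(4)[OF actB_lin])
    show "\<beta> (cB n (actB s (pure w))) = 0" if "length w = n" for w
      using z that by (simp add: actB_actW)
  qed
  then show "\<beta> (s \<odot>\<^bsub>TP n\<^esub> X) = 0" by (simp add: p(2) TP_simps(4)[OF n])
qed

lemma TP_lift:
  assumes n: "n \<ge> 1" and b: "balanced sc n b"
  obtains \<beta> where "\<And>p. \<beta> (cB n p) = lin_ext sc b p"
proof -
  interpret q: quotient_action "CB n" "NB n" actB UNIV by (rule tensor_power_over_action[OF n])
  have sc: "vector_space sc" using balancedD(1)[OF b] by (rule mlinD)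
  have "q.lift (lin_ext sc b) (cB n p) = lin_ext sc b p" for p
    by (rule q.lift_cls) (use balanced_null[OF b] linD(6)[OF lin_lin_ext[OF sc]] in \<open>metis eq_iff_diff_eq_0\<close>)
  then show ?thesis by (rule that)
qed

text \<open>By \<open>power_retract_sum\<close> the function \<open>b\<close> splits into
  contributions through single copies of \<open>M\<close>, each transforming under \<open>E\<close>
  by the same character. If all such functions on \<open>M\<close> vanish on multiples by
  \<open>s\<close>, then so does \<open>b\<close>. \<open>M\<close> is left open to cover the
  regular bimodule in depth 1.\<close>

lemma summand_vanish:
  fixes b :: "'h list \<Rightarrow> 'v::ab_group_add"
  assumes n: "n \<ge> 1" and b: "balanced sc n b" and M: "additive_module A M"
    and sm: "iso_to_summand A (TP n) (direct_power I M)"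
    and E: "E \<subseteq> A" "\<And>e w. e \<in> E \<Longrightarrow> length w = n \<Longrightarrow> b (actW e w) = sc (\<chi> e) (b w)"
    and s: "s \<in> A"
    and hyp: "\<And>\<beta> X. \<forall>X\<in>carrier M. \<forall>Y\<in>carrier M. \<beta> (X \<oplus>\<^bsub>M\<^esub> Y) = \<beta> X + \<beta> Y \<Longrightarrow>
       \<forall>e\<in>E. \<forall>X\<in>carrier M. \<beta> (e \<odot>\<^bsub>M\<^esub> X) = sc (\<chi> e) (\<beta> X) \<Longrightarrow>
       X \<in> carrier M \<Longrightarrow> \<beta> (s \<odot>\<^bsub>M\<^esub> X) = (0 :: 'v)"
    and w: "length w = n"
  shows "b (actW s w) = 0"
proof -
  have sc: "vector_space sc" using balancedD(1)[OF b] by (rule mlinD)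
  note l = lin_lin_ext[OF sc, of b]
  obtain B where B: "\<And>p. B (cB n p) = lin_ext sc b p" using TP_lift[OF n b] by blast
  have Badd: "B (X \<oplus>\<^bsub>TP n\<^esub> Y) = B X + B Y" if "X \<in> carrier (TP n)" "Y \<in> carrier (TP n)" for X Y
    using that unfolding TP_simps(1)[OF n] by (auto simp: TP_simps(2)[OF n] B linD(3)[OF l])
  have Binv: "B (e \<odot>\<^bsub>TP n\<^esub> X) = sc (\<chi> e) (B X)" if e: "e \<in> E" and "X \<in> carrier (TP n)" for e X
  proof -
    interpret v: vector_space sc by fact
    obtain p where p: "p \<in> CB n" "X = cB n p" using \<open>X \<in> carrier (TP n)\<close> by (auto simp: TP_simps(1)[OF n])
    have "lin_ext sc b (actB e p) = sc (\<chi> e) (lin_ext sc b p)"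
      using p(1)
    proof (rule CB_induct)
      show "lin_ext sc b (actB e (pure w)) = sc (\<chi> e) (lin_ext sc b (pure w))" if "length w = n" for w
        using E(2)[OF e that] by (simp add: actB_actW lin_ext_pure[OF sc])
    qed (auto simp: linD[OF actB_lin] linD[OF l] v.scale_right_distrib v.scale_left_commute)
    then show ?thesis by (simp add: p(2) TP_simps(4)[OF n] B)
  qed
  from summand_retract[OF TP_additive[OF n] direct_power_additive[OF M] sm]
  obtain F where F: "F \<in> mod_hom A (TP n) (direct_power I M)"
    and "\<exists>g\<in>mod_hom A (direct_power I M) (TP n). \<forall>x\<in>carrier (TP n). g (F x) = x" by (rule bexE)
  from this(2) obtain G where G: "G \<in> mod_hom A (direct_power I M) (TP n)"
    and "\<forall>x\<in>carrier (TP n). G (F x) = x" by (rule bexE)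
  from this(2) have GF: "G (F x) = x" if "x \<in> carrier (TP n)" for x using that by (rule bspec)
  let ?x = "cB n (pure w)"
  have x: "?x \<in> carrier (TP n)" using pure_CB[OF w] by (simp add: TP_simps(1)[OF n])
  have sx: "s \<odot>\<^bsub>TP n\<^esub> ?x \<in> carrier (TP n)" using TP_additive[OF n, of A] x s by (simp add: additive_module_def)
  note ps = power_retract_sum[where A = A and N = M and M = "TP n" and F = F and G = G and I = I and x = "s \<odot>\<^bsub>TP n\<^esub> ?x"
      and B = B]
  have "B (s \<odot>\<^bsub>TP n\<^esub> ?x) = (\<Sum>i\<in>{i \<in> I. F (s \<odot>\<^bsub>TP n\<^esub> ?x) i \<noteq> \<zero>\<^bsub>M\<^esub>}. B (G (dp_inj I M i (F (s \<odot>\<^bsub>TP n\<^esub> ?x) i))))"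
    by (rule ps[OF M F G GF[OF sx] sx Badd])
  also have "\<dots> = 0"
  proof (rule sum.neutral, rule ballI)
    fix i assume "i \<in> {i \<in> I. F (s \<odot>\<^bsub>TP n\<^esub> ?x) i \<noteq> \<zero>\<^bsub>M\<^esub>}"
    then have i: "i \<in> I" by simp
    note f = power_retract_homs(1)[OF M F G i] and g = power_retract_homs(2)[OF M F G i]
    have "B (G (dp_inj I M i (s \<odot>\<^bsub>M\<^esub> F ?x i))) = 0"
    proof (rule hyp[of "\<lambda>y. B (G (dp_inj I M i y))"]; (intro ballI)?)
      show "B (G (dp_inj I M i (X \<oplus>\<^bsub>M\<^esub> Y))) = B (G (dp_inj I M i X)) + B (G (dp_inj I M i Y))"
        if "X \<in> carrier M" "Y \<in> carrier M" for X Y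
        using Badd[OF mod_homD(1)[OF g that(1)] mod_homD(1)[OF g that(2)]] mod_homD(2)[OF g that] by simp
      show "B (G (dp_inj I M i (e \<odot>\<^bsub>M\<^esub> X))) = sc (\<chi> e) (B (G (dp_inj I M i X)))" if "e \<in> E" "X \<in> carrier M" for e X
        using Binv[OF that(1) mod_homD(1)[OF g that(2)]] mod_homD(3)[OF g subsetD[OF E(1) that(1)] that(2)] by simp
      show "F ?x i \<in> carrier M" by (rule mod_homD(1)[OF f x])
    qed
    then show "B (G (dp_inj I M i (F (s \<odot>\<^bsub>TP n\<^esub> ?x) i))) = 0"
      unfolding mod_homD(3)[OF f s x] .
  qed
  finally show ?thesis by (simp add: TP_simps(4)[OF n] actB_actW B lin_ext_pure[OF sc])
qed

lemma summand_vanish_TP: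
  fixes b :: "'h list \<Rightarrow> 'v::ab_group_add"
  assumes n: "n \<ge> 1" "m \<ge> 1" and b: "balanced sc n b"
    and sm: "iso_to_summand A (TP n) (direct_power I (TP m))"
    and E: "E \<subseteq> A" "\<And>e w. e \<in> E \<Longrightarrow> length w = n \<Longrightarrow> b (actW e w) = sc (\<chi> e) (b w)"
    and E1: "\<And>c. \<exists>e\<in>E. (e = Inl (hs c 1) \<or> e = Inr (hs c 1)) \<and> \<chi> e = c"
    and s: "s \<in> A"
    and hyp: "\<And>b' w. balanced sc m b' \<Longrightarrow> (\<And>e w. e \<in> E \<Longrightarrow> length w = m \<Longrightarrow> b' (actW e w) = sc (\<chi> e) (b' w)) \<Longrightarrow>
       length w = m \<Longrightarrow> b' (actW s w) = (0 :: 'v)"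
    and w: "length w = n"
  shows "b (actW s w) = 0"
proof (rule summand_vanish[OF n(1) b TP_additive[OF n(2)] sm E s _ w])
  have sc: "vector_space sc" using balancedD(1)[OF b] by (rule mlinD)
  fix \<beta> :: "('h list \<Rightarrow>\<^sub>0 'k) set \<Rightarrow> 'v" and X
  assume a: "\<forall>X\<in>carrier (TP m). \<forall>Y\<in>carrier (TP m). \<beta> (X \<oplus>\<^bsub>TP m\<^esub> Y) = \<beta> X + \<beta> Y"
    "\<forall>e\<in>E. \<forall>X\<in>carrier (TP m). \<beta> (e \<odot>\<^bsub>TP m\<^esub> X) = sc (\<chi> e) (\<beta> X)"
    and X: "X \<in> carrier (TP m)"
  have E1': "\<forall>c. \<exists>e\<in>E. (e = Inl (hs c 1) \<or> e = Inr (hs c 1)) \<and> \<chi> e = c" using E1 by (rule allI)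
  note T = TP_function[OF n(2) sc a(1) E1' a(2)]
  show "\<beta> (s \<odot>\<^bsub>TP m\<^esub> X) = 0"
  proof (rule T(3)[OF _ X], intro allI impI)
    show "\<beta> (cB m (pure (actW s w))) = 0" if "length w = m" for w
      by (rule hyp[OF T(1) T(2) that])
  qed
qed

text \<open>Right multiplication of the last letter by \<open>r\<close> corresponds to the diagonal
  action on H \<otimes> Q^n; this lemma and \<open>Ph_vanish\<close> translate vanishing in the two
  directions.\<close>

lemma Ps_vanish:
  assumes b: "balanced sc (Suc n) b" and r: "\<And>w. length w = Suc n \<Longrightarrow> dact sc w (Ps sc n b) r = 0" and w: "length w = Suc n"
  shows "b (actW (Inr r) w) = 0"
proof -
  note m = balancedD(1)[OF b]
  have sc: "vector_space sc" using m by (rule mlinD)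
  note mr = balancedD(1)[OF balanced_right[OF b, of r]]
  have "b (actW (Inr r) w) = Ph sc n (Ps sc n (\<lambda>w. b (butlast w @ [last w * r]))) w"
    using Ph_Ps[OF mr w] by (simp add: actW_simps)
  also have "\<dots> = Ph sc n (\<lambda>w. 0) w"
    by (rule comb_cong[OF comb_Ph[OF sc w]]) (use r in \<open>simp add: Ps_dact[OF m, symmetric]\<close>)
  also have "\<dots> = 0"
    using comb_Ph[OF sc w]
    by (auto simp: comb_def lin_ext_def module.scale_zero_right[OF module_iff_vector_space[THEN iffD2, OF sc]])
  finally show ?thesis .
qed

lemma Ph_vanish:
  assumes g: "mlin sc (Suc n) g" and r: "\<And>w. length w = Suc n \<Longrightarrow> Ph sc n g (actW (Inr r) w) = 0" and w: "length w = Suc n"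
  shows "dact sc w g r = 0"
proof -
  have sc: "vector_space sc" using g by (rule mlinD)
  have "dact sc w g r = Ps sc n (Ph sc n (\<lambda>v. dact sc v g r)) w"
    by (rule Ps_Ph[OF mlin_dact[OF g] w, symmetric])
  also have "\<dots> = Ps sc n (\<lambda>w. 0) w"
  proof (rule comb_cong[OF comb_Ps[OF sc w]])
    fix v :: "'h list" assume v: "length v = Suc n"
    then obtain v' y where "v = v' @ [y]" "length v' = n" by (cases v rule: rev_cases) auto
    then show "Ph sc n (\<lambda>v. dact sc v g r) v = 0" using Ph_dact[OF g, of v' r y] r[OF v] by (simp add: actW_simps)
  qed
  also have "\<dots> = 0"
    using comb_Ps[OF sc w] 
    by (auto simp: comb_def lin_ext_def module.scale_zero_right[OF module_iff_vector_space[THEN iffD2, OF sc]])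
  finally show ?thesis .
qed

text \<open>The left coinvariants of H \<otimes> Q^n under \<open>R\<close> are Q^(n+1): balanced
  functions on which \<open>R\<close> acts from the left by the counit correspond to
  \<open>Qgood\<close> functions of the full length \<open>n + 1\<close>. The summand therefore
  compares Q^(n+2) with Q^(n+1).\<close>

lemma bimodule_ann_R:
  assumes sm: "iso_to_summand (bi_scalars R R) (TP (Suc (Suc n))) (direct_power I (TP (Suc n)))"
  shows "ann_power H R (Suc n) \<subseteq> ann_power H R (Suc (Suc n))"
proof
  fix r assume r: "r \<in> ann_power H R (Suc n)"
  then have rR: "r \<in> R" by (simp add: ann_power_iff)
  let ?m = "Suc (Suc n)"
  let ?\<chi> = "\<lambda>e. eps (case e of Inl x \<Rightarrow> x | Inr x \<Rightarrow> x)"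
  have bal: "balanced fscale ?m (Ph fscale (Suc n) (uQ ?m))"
    by (rule balanced_Ph[OF Qgood_good[OF Qgood_uQ]])
  have inv: "Ph fscale (Suc n) (uQ ?m) (actW e w) = fscale (?\<chi> e) (Ph fscale (Suc n) (uQ ?m) w)"
    if "e \<in> Inl ` R" and w: "length w = ?m" for e w
  proof -
    obtain x where x: "e = Inl x" "x \<in> R" using \<open>e \<in> Inl ` R\<close> by blast
    have "Ph fscale (Suc n) (uQ ?m) (actW e w) = Ph fscale (Suc n) (\<lambda>v. uQ ?m (x * hd v # tl v)) w"
      unfolding x(1) actW_simps by (rule Ph_left[OF vs_fscale w])
    also have "\<dots> = Ph fscale (Suc n) (\<lambda>v. fscale (eps x) (uQ ?m v)) w"
    proof (rule comb_cong[OF comb_Ph[OF vs_fscale w]])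
      fix v :: "'h list" assume v: "length v = ?m"
      then obtain y v' where "v = y # v'" by (cases v) auto
      then show "uQ ?m (x * hd v # tl v) = fscale (eps x) (uQ ?m v)"
        using QgoodD(2)[OF Qgood_uQ, of "[]" v' ?m x y] v x by simp
    qed
    also have "\<dots> = fscale (eps x) (Ph fscale (Suc n) (uQ ?m) w)"
      by (rule comb_push[OF comb_Ph[OF vs_fscale w], symmetric]) (intro lin_scale lin_id vs_fscale)
    finally show ?thesis by (simp add: x)
  qed
  have "Ph fscale (Suc n) (uQ ?m) (actW (Inr r) w) = 0" if w: "length w = ?m" for w
  proof (rule summand_vanish_TP[OF _ _ bal sm _ inv _ _ _ w])
    show "\<exists>e\<in>Inl ` R. (e = Inl (hs c 1) \<or> e = Inr (hs c 1)) \<and> ?\<chi> e = c" for c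
      by (rule bexI[of _ "Inl (hs c 1)"]) (auto simp: R_scale R_one linD(4)[OF counit_linear] counit_one)
    fix b' :: "'h list \<Rightarrow> 'h set list \<Rightarrow>\<^sub>0 'k" and w :: "'h list"
    assume b: "balanced fscale (Suc n) b'"
      and inv: "\<And>e w. e \<in> Inl ` R \<Longrightarrow> length w = Suc n \<Longrightarrow> b' (actW e w) = fscale (?\<chi> e) (b' w)"
      and w: "length w = Suc n"
    have good: "good fscale n (Ps fscale n b')" by (rule good_Ps[OF b])
    have "Qgood fscale (Suc n) (Ps fscale n b')"
      unfolding Qgood_def
    proof (intro conjI allI impI)
      show "mlin fscale (Suc n) (Ps fscale n b')" by (rule goodD(1)[OF good])
      fix us vs :: "'h list" and x r assume a: "length us + 1 + length vs = Suc n \<and> r \<in> R"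
      show "Ps fscale n b' (us @ (r * x) # vs) = fscale (eps r) (Ps fscale n b' (us @ x # vs))"
      proof (cases "us = []")
        case True
        have l: "length (x # vs) = Suc n" using a True by simp
        have "Ps fscale n b' ((r * x) # vs) = Ps fscale n (\<lambda>v. b' (r * hd v # tl v)) (x # vs)"
          using Ps_left[OF vs_fscale l, of b' r] by simp
        also have "\<dots> = Ps fscale n (\<lambda>v. fscale (eps r) (b' v)) (x # vs)"
          by (rule comb_cong[OF comb_Ps[OF vs_fscale l]]) (use inv[of "Inl r"] a in \<open>auto simp: actW_simps\<close>)
        also have "\<dots> = fscale (eps r) (Ps fscale n b' (x # vs))"
          by (rule comb_push[OF comb_Ps[OF vs_fscale l], symmetric]) (intro lin_scale lin_id vs_fscale)
        finally show ?thesis by (simp add: True)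
      next
        case False
        then show ?thesis using goodD(2)[OF good, of us vs r x] a by simp
      qed
    qed
    then show "b' (actW (Inr r) w) = 0"
      using ann_power_Qgood[OF r] by (intro Ps_vanish[OF b _ w])
  qed (use rR in \<open>auto simp: bi_scalars_def\<close>)
  then have "dact fscale w (uQ ?m) r = 0" if "length w = ?m" for w
    using that by (intro Ph_vanish[OF QgoodD(1)[OF Qgood_uQ]])
  then show "r \<in> ann_power H R ?m" using rR by (simp add: ann_power_iff)
qed

lemma ann_zero: "r \<in> ann_power H R 0 \<Longrightarrow> eps r = 0"
proof -
  assume r: "r \<in> ann_power H R 0"
  have "Qgood (*) 0 (\<lambda>w. 1 :: 'k)" by (simp add: Qgood_def mlin_def vs_field)
  from ann_power_Qgood[OF r this, of "[]"] show ?thesis by simp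
qed

lemma regular_bimodule_simps:
  "carrier (regular_bimodule R) = R" "x \<oplus>\<^bsub>regular_bimodule R\<^esub> y = x + y" "\<zero>\<^bsub>regular_bimodule R\<^esub> = 0"
  "Inl a \<odot>\<^bsub>regular_bimodule R\<^esub> x = a * x" "Inr a \<odot>\<^bsub>regular_bimodule R\<^esub> x = x * a"
  by (simp_all add: regular_bimodule_def mk_module_def)

lemma regular_bimodule_additive: "additive_module (bi_scalars R R) (regular_bimodule R)"
  unfolding additive_module_def
proof (intro conjI)
  show "abelian_group (regular_bimodule R)"
    by (rule abelian_groupI)
      (auto simp: regular_bimodule_simps add.assoc add.commute R_zero R_add R_minus intro!: bexI[of _ "- _"])
qed (auto simp: bi_scalars_def regular_bimodule_simps distrib_left distrib_right R_mult)

text \<open>Depth 1: the left coinvariants of the regular bimodule form the trivial module Q^0,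
  those of \<open>H\<close> form \<open>Q\<close>.\<close>

lemma bimodule_ann_zero:
  assumes sm: "iso_to_summand (bi_scalars R R) (TP 1) (direct_power I (regular_bimodule R))"
  shows "ann_power H R 0 \<subseteq> ann_power H R 1"
proof
  fix r assume r: "r \<in> ann_power H R 0"
  then have rR: "r \<in> R" by (simp add: ann_power_iff)
  let ?\<chi> = "\<lambda>e. eps (case e of Inl x \<Rightarrow> x | Inr x \<Rightarrow> x)"
  have "balanced fscale (Suc 0) (Ph fscale 0 (uQ 1))"
    by (rule balanced_Ph[OF Qgood_good]) (use Qgood_uQ[of 1] in simp)
  then have bal: "balanced fscale 1 (uQ 1)" by (simp add: Ph.simps(1)[abs_def])
  have inv: "uQ 1 (actW e w) = fscale (?\<chi> e) (uQ 1 w)" if "e \<in> Inl ` R" and w: "length w = 1" for e w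
  proof -
    obtain x where x: "e = Inl x" "x \<in> R" using \<open>e \<in> Inl ` R\<close> by blast
    obtain y where "w = [y]" using w by (auto simp: length_Suc_conv)
    then show ?thesis using QgoodD(2)[OF Qgood_uQ, of "[]" "[]" 1 x y] x by (simp add: actW_simps)
  qed
  have "uQ 1 (actW (Inr r) w) = 0" if w: "length w = 1" for w
  proof (rule summand_vanish[OF _ bal regular_bimodule_additive sm _ inv _ _ w])
    fix \<beta> :: "'h \<Rightarrow> 'h set list \<Rightarrow>\<^sub>0 'k" and X
    assume inv: "\<forall>e\<in>Inl ` R. \<forall>X\<in>carrier (regular_bimodule R).
        \<beta> (e \<odot>\<^bsub>regular_bimodule R\<^esub> X) = fscale (?\<chi> e) (\<beta> X)" and X: "X \<in> carrier (regular_bimodule R)"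
    \<comment> \<open>A left invariant function on \<open>R\<close> is the counit times its value at
      1.\<close>
    have "\<beta> (X * r) = fscale (eps (X * r)) (\<beta> 1)"
      using bspec[OF bspec[OF inv, of "Inl (X * r)"], of 1] X rR by (simp add: regular_bimodule_simps R_mult R_one)
    then show "\<beta> (Inr r \<odot>\<^bsub>regular_bimodule R\<^esub> X) = 0"
      using ann_zero[OF r] by (simp add: regular_bimodule_simps counit_mult)
  qed (use rR in \<open>auto simp: bi_scalars_def\<close>)
  then have "dact fscale w (uQ 1) r = 0" if "length w = 1" for w
    using that Ph_vanish[of fscale 0 "uQ 1" r w] QgoodD(1)[OF Qgood_uQ, of 1] by simp
  then show "r \<in> ann_power H R 1" using rR by (simp add: ann_power_iff)
qed

text \<open>Pullback of a function on Q^n along the counit of the factor \<open>H\<close>.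
  Compatibility with the action, on words that start with 1, is
  \<open>dact_eps_prefix\<close>.\<close>

lemma eps_prefix_good:
  assumes "Qgood sc n g"
  shows "good sc n (\<lambda>w. sc (eps (hd w)) (g (tl w)))"
  unfolding good_def
proof (intro conjI allI impI)
  have sc: "vector_space sc" using QgoodD(1)[OF assms] by (rule mlinD)
  have "lin hs sc (\<lambda>x. sc (eps (hd (us @ x # vs))) (g (tl (us @ x # vs))))" if "length us + 1 + length vs = Suc n" for us vs
  proof (cases us)
    case Nil
    then show ?thesis by (auto intro!: lin_scale_left sc counit_linear)
  next
    case (Cons u us')
    then show ?thesis using that mlinD(2)[OF QgoodD(1)[OF assms], of us' vs] by (auto intro!: lin_scale)
  qed
  then show "mlin sc (Suc n) (\<lambda>w. sc (eps (hd w)) (g (tl w)))" by (simp add: mlin_def sc)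
  fix us vs :: "'h list" and x r assume a: "length us + length vs = n \<and> us \<noteq> [] \<and> r \<in> R"
  then obtain u us' where us: "us = u # us'" by (cases us) auto
  interpret v: vector_space sc by fact
  show "sc (eps (hd (us @ (r * x) # vs))) (g (tl (us @ (r * x) # vs))) =
      sc (eps r) (sc (eps (hd (us @ x # vs))) (g (tl (us @ x # vs))))"
    using QgoodD(2)[OF assms, of us' vs r x] a by (simp add: us mult.commute)
qed

lemma dact_eps_prefix:
  assumes "Qgood sc n g" "length w = n"
  shows "dact sc (1 # w) (\<lambda>w. sc (eps (hd w)) (g (tl w))) r = dact sc w g r"
proof -
  have sc: "vector_space sc" using QgoodD(1)[OF assms(1)] by (rule mlinD)
  have "dact sc (1 # w) (\<lambda>w. sc (eps (hd w)) (g (tl w))) r = sw sc (\<lambda>a u. sc (eps a) (dact sc w g u)) r"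
    by (simp, subst comb_push[OF comb_dact[OF sc assms(2)], symmetric]) (intro lin_scale lin_id sc refl)+
  also have "\<dots> = dact sc w g r"
    by (rule sw_counit_left[OF lin_dact]) (use QgoodD(1)[OF assms(1)] assms(2) in simp)
  finally show ?thesis .
qed

text \<open>A balanced function which is invariant under left multiplication by all of \<open>H\<close> comes from a
  function on \<open>k \<otimes> Q\<^sup>n\<close>.\<close>

lemma left_invariant_vanish:
  fixes b :: "'h list \<Rightarrow> 'v::ab_group_add"
  assumes r: "r \<in> ann_power H R n" and b: "balanced sc (Suc n) b"
    and inv: "\<And>h w. length w = Suc n \<Longrightarrow> b (h * hd w # tl w) = sc (eps h) (b w)" and w: "length w = Suc n"
  shows "b (actW (Inr r) w) = 0"
proof (rule Ps_vanish[OF b _ w])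
  have sc: "vector_space sc" using balancedD(1)[OF b] by (rule mlinD)
  interpret v: vector_space sc by fact
  fix w :: "'h list" assume w: "length w = Suc n"
  then obtain x w' where w': "w = x # w'" "length w' = n" by (cases w) auto
  have good: "good sc n (Ps sc n b)" by (rule good_Ps[OF b])
  let ?g = "\<lambda>v. Ps sc n b (1 # v)"
  have e: "Ps sc n b (y # v) = sc (eps y) (?g v)" if l: "length v = n" for y v
  proof -
    have l: "length (1 # v) = Suc n" using l by simp
    have "Ps sc n b (y # v) = Ps sc n (\<lambda>v. b (y * hd v # tl v)) (1 # v)"
      using Ps_left[OF sc l, of b y] by simp
    also have "\<dots> = Ps sc n (\<lambda>v. sc (eps y) (b v)) (1 # v)"
      by (rule comb_cong[OF comb_Ps[OF sc l]]) (rule inv)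
    also have "\<dots> = sc (eps y) (?g v)"
      by (rule comb_push[OF comb_Ps[OF sc l], symmetric]) (intro lin_scale lin_id sc)
    finally show ?thesis .
  qed
  have q: "Qgood sc n ?g" by (rule good_tail[OF good])
  have "dact sc w' (\<lambda>v. Ps sc n b ((x * a) # v)) u = dact sc w' (\<lambda>v. sc (eps (x * a)) (?g v)) u" for a u
    by (rule comb_cong[OF comb_dact[OF sc w'(2)] e])
  then have "dact sc w (Ps sc n b) r = sw sc (\<lambda>a u. dact sc w' (\<lambda>v. sc (eps (x * a)) (?g v)) u) r"
    unfolding w'(1) dact.simps by presburger
  also have "\<dots> = sw sc (\<lambda>a u. sc (eps x) (sc (eps a) (dact sc w' ?g u))) r"
    by (simp add: comb_push[OF comb_dact[OF sc w'(2)] lin_scale[OF lin_id[OF sc]], symmetric] counit_mult)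
  also have "\<dots> = sc (eps x) (sw sc (\<lambda>a u. sc (eps a) (dact sc w' ?g u)) r)"
    by (rule sw_push[symmetric]) (intro lin_scale lin_id sc)
  also have "sw sc (\<lambda>a u. sc (eps a) (dact sc w' ?g u)) r = dact sc w' ?g r"
    by (rule sw_counit_left[OF lin_dact]) (use QgoodD(1)[OF q] w' in simp)
  also have "\<dots> = 0" by (rule ann_power_Qgood[OF r q w'(2)])
  finally show "dact sc w (Ps sc n b) r = 0" by simp
qed

text \<open>The universal function of Q^n as a function on the tensor power of \<open>n + 1\<close>
  copies of \<open>H\<close> over \<open>R\<close>; left multiplication by \<open>H\<close> acts on
  it by the counit.\<close>

abbreviation "epsuQ n \<equiv> Ph fscale n (\<lambda>w. fscale (eps (hd w)) (uQ n (tl w)))"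

lemma balanced_epsuQ: "balanced fscale (Suc n) (epsuQ n)"
  by (rule balanced_Ph[OF eps_prefix_good[OF Qgood_uQ]])

lemma epsuQ_inv: "length w = Suc n \<Longrightarrow> epsuQ n (h * hd w # tl w) = fscale (eps h) (epsuQ n w)"
proof -
  assume w: "length w = Suc n"
  have "epsuQ n (h * hd w # tl w) = Ph fscale n (\<lambda>v. fscale (eps h) (fscale (eps (hd v)) (uQ n (tl v)))) w"
    unfolding Ph_left[OF vs_fscale w] by (simp add: counit_mult)
  also have "\<dots> = fscale (eps h) (epsuQ n w)"
    by (rule comb_push[OF comb_Ph[OF vs_fscale w], symmetric]) (intro lin_scale lin_id vs_fscale)
  finally show ?thesis .
qed

lemma epsuQ_ann:
  assumes "r \<in> R" "\<And>w. length w = Suc n \<Longrightarrow> epsuQ n (actW (Inr r) w) = 0"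
  shows "r \<in> ann_power H R n"
proof -
  have "dact fscale w (uQ n) r = 0" if w: "length w = n" for w
  proof -
    have "dact fscale (1 # w) (\<lambda>w. fscale (eps (hd w)) (uQ n (tl w))) r = 0"
      by (rule Ph_vanish[OF goodD(1)[OF eps_prefix_good[OF Qgood_uQ]] assms(2)]) (use w in simp_all)
    then show ?thesis unfolding dact_eps_prefix[OF Qgood_uQ w] .
  qed
  then show ?thesis using assms(1) by (simp add: ann_power_iff)
qed

text \<open>With all of \<open>H\<close> on the left the coinvariants of H \<otimes> Q^n are only
  Q^n, so the annihilators have an index one lower than in \<open>bimodule_ann_R\<close>.\<close>

lemma bimodule_ann_left:
  assumes sm: "iso_to_summand (bi_scalars UNIV R) (TP (Suc (Suc n))) (direct_power I (TP (Suc n)))"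
  shows "ann_power H R n \<subseteq> ann_power H R (Suc n)"
proof
  fix r assume r: "r \<in> ann_power H R n"
  then have rR: "r \<in> R" by (simp add: ann_power_iff)
  let ?\<chi> = "\<lambda>e. eps (case e of Inl x \<Rightarrow> x | Inr x \<Rightarrow> x)"
  show "r \<in> ann_power H R (Suc n)"
  proof (rule epsuQ_ann[OF rR])
    fix w :: "'h list" assume w: "length w = Suc (Suc n)"
    show "epsuQ (Suc n) (actW (Inr r) w) = 0"
    proof (rule summand_vanish_TP[OF _ _ balanced_epsuQ sm, where E = "range Inl" and \<chi> = ?\<chi>, OF _ _ _ _ _ _ _ w])
      show "epsuQ (Suc n) (actW e w) = fscale (?\<chi> e) (epsuQ (Suc n) w)" if "e \<in> range Inl" "length w = Suc (Suc n)" for e w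
      proof -
        obtain h where h: "e = Inl h" using \<open>e \<in> range Inl\<close> by blast
        show ?thesis unfolding h actW_simps sum.case by (rule epsuQ_inv[OF that(2)])
      qed
      show "\<exists>e\<in>range Inl. (e = Inl (hs c 1) \<or> e = Inr (hs c 1)) \<and> ?\<chi> e = c" for c
        by (rule bexI[of _ "Inl (hs c 1)"]) (auto simp: linD(4)[OF counit_linear] counit_one)
      fix b' :: "'h list \<Rightarrow> 'h set list \<Rightarrow>\<^sub>0 'k" and w :: "'h list"
      assume b: "balanced fscale (Suc n) b'"
        and inv: "\<And>e w. e \<in> range Inl \<Longrightarrow> length w = Suc n \<Longrightarrow> b' (actW e w) = fscale (?\<chi> e) (b' w)"
        and w: "length w = Suc n"
      show "b' (actW (Inr r) w) = 0"
        by (rule left_invariant_vanish[OF r b _ w]) (use inv[of "Inl _"] in \<open>auto simp: actW_simps\<close>)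
    qed (use rR in \<open>auto simp: bi_scalars_def\<close>)
  qed
qed

text \<open>An antimultiplicative map that preserves \<open>R\<close> exchanges the sides of the
  balancing relation, and the reversal of the word exchanges them back.\<close>

lemma balanced_rev:
  assumes b: "balanced sc n b" and f: "lin hs hs f" "\<And>x y. f (x * y) = f y * f x" "\<And>r. r \<in> R \<Longrightarrow> f r \<in> R"
  shows "balanced sc n (\<lambda>w. b (rev (map f w)))"
  unfolding balanced_def
proof (intro conjI allI impI)
  have sc: "vector_space sc" using balancedD(1)[OF b] by (rule mlinD)
  have "lin hs sc (\<lambda>x. b (rev (map f (us @ x # vs))))" if l: "length us + 1 + length vs = n" for us vs
    using lin_at[OF balancedD(1)[OF b] _ f(1), of "rev (map f vs)" "rev (map f us)"] l by simp
  then show "mlin sc n (\<lambda>w. b (rev (map f w)))" by (simp add: mlin_def sc)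
  fix us vs :: "'h list" and x y r assume a: "length us + 2 + length vs = n \<and> r \<in> R"
  then show "b (rev (map f (us @ [x * r, y] @ vs))) = b (rev (map f (us @ [x, r * y] @ vs)))"
    using balancedD(2)[OF b, of "rev (map f vs)" "rev (map f us)" "f r" "f y" "f x"] f(3)
    by (simp add: f(2))
qed

text \<open>Equality ensures that the inverse of the antipode preserves \<open>R\<close> as
  well.\<close>

lemma S_R: "S ` R = R"
  by (rule surj_on_subspace[OF fin_dim R_sub antipode_linear inj_antipode[OF fin_dim]]) (auto intro: R_S)

lemma S_bij: "bij S"
proof (rule bijI)
  show "inj S" by (rule inj_antipode[OF fin_dim])
  show "surj S" using surj_on_subspace[OF fin_dim subspace_UNIV antipode_linear inj_antipode[OF fin_dim]] by auto
qed

lemma eps_S: "eps (S x) = eps x"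
proof -
  have "eps (S x) = sw (*) (\<lambda>a b. eps b * eps (S a)) x"
    by (rule sw_counit_right[symmetric]) (rule lin_comp[OF antipode_linear counit_linear])
  also have "\<dots> = sw (*) (\<lambda>a b. eps (S a * b)) x" by (simp add: counit_mult mult.commute)
  also have "\<dots> = eps x" using sw_antipode_left[OF counit_linear, of x] by (simp add: counit_one)
  finally show ?thesis .
qed

text \<open>The antipode turns \<open>R\<close>-\<open>H\<close>-bimodules into \<open>H\<close>-\<open>R\<close>-bimodules and reverses tensor products.\<close>

lemma bimodule_ann_right:
  assumes sm: "iso_to_summand (bi_scalars R UNIV) (TP (Suc (Suc n))) (direct_power I (TP (Suc n)))"
  shows "ann_power H R n \<subseteq> ann_power H R (Suc n)"
proof
  fix r assume r: "r \<in> ann_power H R n"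
  then have rR: "r \<in> R" by (simp add: ann_power_iff)
  \<comment> \<open>After the reversal, right multiplication by \<open>r\<close> is left
    multiplication by its preimage \<open>r'\<close>.\<close>
  then obtain r' where r': "r' \<in> R" "r = S r'" using S_R by blast
  let ?\<chi> = "\<lambda>e. eps (case e of Inl x \<Rightarrow> x | Inr x \<Rightarrow> x)"
  let ?T = "inv_into UNIV S"
  have SiS: "S (?T x) = x" "?T (S x) = x" for x
    using S_bij by (auto simp: bij_def surj_f_inv_f inv_f_f)
  have Tl: "lin hs hs ?T"
  proof (rule linI[OF hs_vs hs_vs])
    show "?T (x + y) = ?T x + ?T y" for x y
      using SiS linD(3)[OF antipode_linear] by metis
    show "?T (hs c x) = hs c (?T x)" for c x
      using SiS linD(4)[OF antipode_linear] by metis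
  qed
  have Tm: "?T (x * y) = ?T y * ?T x" for x y using SiS S_mult by metis
  have TR: "?T r \<in> R" if "r \<in> R" for r using that S_R SiS(2) by (metis imageE)
  have Te: "eps (?T x) = eps x" for x using eps_S SiS by metis
  show "r \<in> ann_power H R (Suc n)"
  proof (rule epsuQ_ann[OF rR])
    fix w :: "'h list" assume w: "length w = Suc (Suc n)"
    let ?b = "\<lambda>w. epsuQ (Suc n) (rev (map S w))"
    have "?b (actW (Inl r') (rev (map ?T w))) = 0"
    proof (rule summand_vanish_TP[OF _ _ balanced_rev[OF balanced_epsuQ antipode_linear S_mult R_S] sm,
        where E = "range Inr" and \<chi> = ?\<chi>])
      show "?b (actW e w) = fscale (?\<chi> e) (?b w)" if "e \<in> range Inr" and l: "length w = Suc (Suc n)" for e w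
      proof -
        obtain h where h: "e = Inr h" using \<open>e \<in> range Inr\<close> by blast
        obtain w' y where w': "w = w' @ [y]" using l by (cases w rule: rev_cases) auto
        show ?thesis using epsuQ_inv[of "rev (map S w)" "Suc n" "S h"] l
          by (simp add: h w' actW_simps S_mult eps_S)
      qed
      show "\<exists>e\<in>range Inr. (e = Inl (hs c 1) \<or> e = Inr (hs c 1)) \<and> ?\<chi> e = c" for c
        by (rule bexI[of _ "Inr (hs c 1)"]) (auto simp: linD(4)[OF counit_linear] counit_one)
      fix b' :: "'h list \<Rightarrow> 'h set list \<Rightarrow>\<^sub>0 'k" and w :: "'h list"
      assume b: "balanced fscale (Suc n) b'"
        and inv: "\<And>e w. e \<in> range Inr \<Longrightarrow> length w = Suc n \<Longrightarrow> b' (actW e w) = fscale (?\<chi> e) (b' w)"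
        and w: "length w = Suc n"
      \<comment> \<open>The inverse antipode turns \<open>b'\<close>, on which right multiplication
        acts by the counit, into a left invariant function, so that
        \<open>left_invariant_vanish\<close> applies.\<close>
      let ?b' = "\<lambda>w. b' (rev (map ?T w))"
      have "?b' (actW (Inr r) (rev (map S w))) = 0"
      proof (rule left_invariant_vanish[OF r balanced_rev[OF b Tl Tm TR]])
        show "?b' (h * hd w # tl w) = fscale (eps h) (?b' w)" if "length w = Suc n" for h w
        proof -
          obtain x w' where w': "w = x # w'" using \<open>length w = Suc n\<close> by (cases w) auto
          show ?thesis using inv[of "Inr (?T h)" "rev (map ?T w)"] \<open>length w = Suc n\<close>
            by (simp add: w' actW_simps Tm Te)
        qed
      qed (use w in auto)
      moreover obtain x w' where w': "w = x # w'" using w by (cases w) auto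
      moreover have "rev (map ?T (actW (Inr r) (rev (map S w)))) = actW (Inl r') w"
        by (simp add: w' actW_simps Tm SiS r' rev_map o_def butlast_append)
      ultimately show "b' (actW (Inl r') w) = 0" by simp
    qed (use r'(1) w in \<open>auto simp: bi_scalars_def\<close>)
    moreover have "rev (map S (actW (Inl r') (rev (map ?T w)))) = actW (Inr r) w"
    proof -
      obtain y w' where "w = w' @ [y]" using w by (cases w rule: rev_cases) auto
      then show ?thesis by (simp add: actW_simps S_mult SiS r' rev_map o_def)
    qed
    ultimately show "epsuQ (Suc n) (actW (Inr r) w) = 0" by (simp only:)
  qed
qed

end

section \<open>Upper bound for the depth: inclusions of annihilators give bimodule summands\<close>

context hopf_integral
begin

text \<open>\<open>Tf\<close> conjugated by the isomorphism: composition with the map between the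
  powers of \<open>H\<close> over \<open>R\<close> that corresponds to the identity of
  \<open>H\<close> tensored with \<open>f\<close>.\<close>

definition Theta :: "('k \<Rightarrow> 'v::ab_group_add \<Rightarrow> 'v) \<Rightarrow> nat \<Rightarrow> nat \<Rightarrow>
    (('h set list \<Rightarrow>\<^sub>0 'k) \<Rightarrow> ('h set list \<Rightarrow>\<^sub>0 'k)) \<Rightarrow> ('h list \<Rightarrow> 'v) \<Rightarrow> 'h list \<Rightarrow> 'v" where
  "Theta sc m n f b = Ph sc m (Tf sc m f (Ps sc n b))"

lemma Theta_balanced: "qhom m n f \<Longrightarrow> balanced sc (Suc n) b \<Longrightarrow> balanced sc (Suc m) (Theta sc m n f b)"
  unfolding Theta_def by (drule (1) Tf_good[OF _ good_Ps]) (rule balanced_Ph)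

lemma Tf_cong:
  assumes "qhom m n f" "length w = Suc m" "\<And>v. length v = Suc n \<Longrightarrow> g v = g' v"
  shows "Tf sc m f g w = Tf sc m f g' w"
  unfolding Tf_def
  by (rule hat_cong[OF qhomD(2)[OF assms(1) uQ_UQ]]) (use assms in auto)

lemma Theta_cong:
  assumes sc: "vector_space sc" and f: "qhom m n f" and w: "length w = Suc m"
    and b: "\<And>v. length v = Suc n \<Longrightarrow> b v = b' v"
  shows "Theta sc m n f b w = Theta sc m n f b' w"
  unfolding Theta_def
  by (intro comb_cong[OF comb_Ph[OF sc w]] Tf_cong[OF f] comb_cong[OF comb_Ps[OF sc]] b)

lemma Theta_push:
  assumes L: "lin sc sc L" and f: "qhom m n f" and w: "length w = Suc m"
  shows "L (Theta sc m n f b w) = Theta sc m n f (\<lambda>v. L (b v)) w"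
proof -
  have sc: "vector_space sc" using L by (rule linD)
  have "L (Theta sc m n f b w) = Ph sc m (\<lambda>v. L (Tf sc m f (Ps sc n b) v)) w"
    unfolding Theta_def by (rule comb_push[OF comb_Ph[OF sc w] L])
  also have "\<dots> = Ph sc m (Tf sc m f (\<lambda>v. L (Ps sc n b v))) w"
    unfolding Tf_def by (simp only: hat_push[OF L])
  also have "\<dots> = Theta sc m n f (\<lambda>v. L (b v)) w"
    unfolding Theta_def
    by (intro comb_cong[OF comb_Ph[OF sc w]] Tf_cong[OF f] comb_push[OF comb_Ps[OF sc] L])
  finally show ?thesis .
qed

text \<open>The left action of \<open>H\<close> touches only the factor \<open>H\<close>, on which
  nothing else happens; on the right the scalars are those of \<open>R\<close>, for which
  \<open>f\<close> is linear.\<close>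

lemma Theta_act:
  assumes f: "qhom m n f" and b: "balanced sc (Suc n) b" and w: "length w = Suc m"
    and s: "s \<in> bi_scalars UNIV R"
  shows "Theta sc m n f b (actW s w) = Theta sc m n f (\<lambda>v. b (actW s v)) w"
proof -
  have sc: "vector_space sc" using balancedD(1)[OF b] by (rule mlinD)
  note mb = balancedD(1)[OF b]
  show ?thesis
  proof (cases s)
    case (Inl h)
    have "Theta sc m n f b (actW s w) = Ph sc m (\<lambda>v. Tf sc m f (Ps sc n b) (h * hd v # tl v)) w"
      unfolding Theta_def Inl actW_simps by (rule Ph_left[OF sc w])
    also have "\<dots> = Theta sc m n f (\<lambda>v. b (actW s v)) w"
      unfolding Theta_def Inl actW_simps
    proof (rule comb_cong[OF comb_Ph[OF sc w]])
      fix v :: "'h list" assume v: "length v = Suc m"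
      have "Tf sc m f (Ps sc n b) (h * hd v # tl v) = hat sc (\<lambda>u. Ps sc n b (h * hd (hd v # u) # tl (hd v # u))) (f (uQ m (tl v)))"
        by (simp add: Tf_def)
      also have "\<dots> = hat sc (\<lambda>u. Ps sc n (\<lambda>v. b (h * hd v # tl v)) (hd v # u)) (f (uQ m (tl v)))"
        by (rule hat_cong[OF qhomD(2)[OF f uQ_UQ]]) (use v in simp, intro Ps_left[OF sc], simp)
      finally show "Tf sc m f (Ps sc n b) (h * hd v # tl v) = Tf sc m f (Ps sc n (\<lambda>v. b (h * hd v # tl v))) v"
        by (simp add: Tf_def)
    qed
    finally show ?thesis .
  next
    case (Inr r)
    then have r: "r \<in> R" using s by (auto simp: bi_scalars_def)
    obtain w' y where w': "w = w' @ [y]" "length w' = m" using w by (cases w rule: rev_cases) auto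
    note g = Tf_good[OF f good_Ps[OF b]]
    have "Theta sc m n f b (actW s w) = Ph sc m (\<lambda>v. dact sc v (Tf sc m f (Ps sc n b)) r) w"
      unfolding Theta_def Inr actW_simps w'(1) using Ph_dact[OF goodD(1)[OF g] w'(2), of r y] by simp
    also have "\<dots> = Theta sc m n f (\<lambda>v. b (actW s v)) w"
      unfolding Theta_def Inr actW_simps
    proof (rule comb_cong[OF comb_Ph[OF sc w]])
      fix v :: "'h list" assume v: "length v = Suc m"
      have "dact sc v (Tf sc m f (Ps sc n b)) r = Tf sc m f (\<lambda>v. dact sc v (Ps sc n b) r) v"
        by (rule Tf_dact[OF f good_Ps[OF b] r v])
      also have "\<dots> = Tf sc m f (Ps sc n (\<lambda>v. b (butlast v @ [last v * r]))) v"
        by (rule Tf_cong[OF f v]) (rule Ps_dact[OF mb])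
      finally show "dact sc v (Tf sc m f (Ps sc n b)) r = Tf sc m f (Ps sc n (\<lambda>v. b (butlast v @ [last v * r]))) v" .
    qed
    finally show ?thesis .
  qed
qed

lemma Theta_family:
  assumes J: "finite J" "\<And>j. j \<in> J \<Longrightarrow> qhom m n (F j)" "\<And>j. j \<in> J \<Longrightarrow> qhom n m (G j)"
    "\<And>x. x \<in> UQ m \<Longrightarrow> (\<Sum>j\<in>J. G j (F j x)) = x"
    and b: "balanced sc (Suc m) b" and w: "length w = Suc m"
  shows "(\<Sum>j\<in>J. Theta sc m n (F j) (Theta sc n m (G j) b) w) = b w"
proof -
  have sc: "vector_space sc" using balancedD(1)[OF b] by (rule mlinD)
  note g = good_Ps[OF b]
  have "Theta sc m n (F j) (Theta sc n m (G j) b) w = Ph sc m (Tf sc m (F j) (Tf sc n (G j) (Ps sc m b))) w" if j: "j \<in> J" for j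
    unfolding Theta_def
    by (intro comb_cong[OF comb_Ph[OF sc w]] Tf_cong[OF J(2)[OF j]] Ps_Ph goodD(1)[OF Tf_good[OF J(3)[OF j] g]])
  then have "(\<Sum>j\<in>J. Theta sc m n (F j) (Theta sc n m (G j) b) w) =
      (\<Sum>j\<in>J. Ph sc m (Tf sc m (F j) (Tf sc n (G j) (Ps sc m b))) w)" by simp
  also have "\<dots> = Ph sc m (\<lambda>v. \<Sum>j\<in>J. Tf sc m (F j) (Tf sc n (G j) (Ps sc m b)) v) w"
  proof -
    obtain p where p: "\<And>g. Ph sc m g w = lin_ext sc g p" using comb_Ph[OF sc w] unfolding comb_def by blast
    interpret v: vector_space sc by fact
    show ?thesis unfolding p lin_ext_def v.scale_sum_right by (rule sum.swap)
  qed
  also have "\<dots> = Ph sc m (Ps sc m b) w"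
    by (rule comb_cong[OF comb_Ph[OF sc w]]) (rule Tf_family[OF J g])
  also have "\<dots> = b w" by (rule Ph_Ps[OF balancedD(1)[OF b] w])
  finally show ?thesis .
qed

lemma comb_mem:
  assumes "comb sc n F" "Modules.module.subspace sc U" "\<And>v. length v = n \<Longrightarrow> g v \<in> U"
  shows "F g \<in> U"
  using assms by (auto simp: comb_def formal_tensors_def intro!: lin_ext_mem)

lemma vB_CB: "length w = n \<Longrightarrow> n \<ge> 1 \<Longrightarrow> vB n w \<in> CB n"
proof -
  assume w: "length w = n" and n: "n \<ge> 1"
  interpret q: quotient_action "CB n" "NB n" actB UNIV by (rule tensor_power_over_action[OF n])
  have "pure w - vB n w \<in> CB n" using q.NC nproj_NB(3) unfolding vB_def by blast
  from fs.subspace_diff[OF q.C pure_CB[OF w] this] show ?thesis by simp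
qed

lemma Theta_CB:
  assumes f: "qhom m n f" and w: "length w = Suc m"
  shows "Theta fscale m n f (vB (Suc n)) w \<in> CB (Suc n)"
  unfolding Theta_def
proof (rule comb_mem[OF comb_Ph[OF vs_fscale w] subspace_formal_tensors])
  fix v :: "'h list" assume v: "length v = Suc m"
  have y: "f (uQ m (tl v)) \<in> UQ n" by (rule qhomD(2)[OF f uQ_UQ]) (use v in simp)
  show "Tf fscale m f (Ps fscale n (vB (Suc n))) v \<in> CB (Suc n)"
    unfolding Tf_def hat_def
  proof (rule lin_ext_mem[OF vs_fscale subspace_formal_tensors])
    fix qs assume "qs \<in> Poly_Mapping.keys (f (uQ m (tl v)))"
    then have l: "length (hd v # map Qrep qs) = Suc n" using UQ_keys[OF y] by simp
    show "Ps fscale n (vB (Suc n)) (hd v # map Qrep qs) \<in> CB (Suc n)"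
      by (rule comb_mem[OF comb_Ps[OF vs_fscale l] subspace_formal_tensors]) (rule vB_CB, auto)
  qed
qed

text \<open>The return from functions to homomorphisms: \<open>\<phi>\<close> has values in formal
  tensors instead of cosets, and equivariance is required modulo the relations, that is, after
  \<open>nproj\<close>.\<close>

lemma TP_hom:
  assumes n: "n \<ge> 1" "m \<ge> 1" and b: "balanced fscale n \<phi>"
    and mem: "\<And>w. length w = n \<Longrightarrow> \<phi> w \<in> CB m"
    and cov: "\<And>s w. s \<in> A \<Longrightarrow> length w = n \<Longrightarrow> nproj (NB m) (\<phi> (actW s w)) = nproj (NB m) (actB s (\<phi> w))"
  shows "\<exists>f\<in>mod_hom A (TP n) (TP m). \<forall>p\<in>CB n. f (cB n p) = cB m (lin_ext fscale \<phi> p)"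
proof -
  interpret q: quotient_action "CB n" "NB n" actB UNIV by (rule tensor_power_over_action[OF n(1)])
  note l = lin_lin_ext[OF vs_fscale, of \<phi>]
  let ?f = "q.lift (\<lambda>p. cB m (lin_ext fscale \<phi> p))"
  have f: "?f (cB n p) = cB m (lin_ext fscale \<phi> p)" for p
  proof (rule q.lift_cls)
    fix x y assume "x - y \<in> NB n"
    then have "lin_ext fscale \<phi> (x - y) = 0" by (rule balanced_null[OF b])
    then show "cB m (lin_ext fscale \<phi> x) = cB m (lin_ext fscale \<phi> y)" by (simp add: linD(6)[OF l])
  qed
  have C: "lin_ext fscale \<phi> p \<in> CB m" if "p \<in> CB n" for p
    using that by (intro lin_ext_mem[OF vs_fscale subspace_formal_tensors] mem) (auto simp: formal_tensors_def)
  have "?f \<in> mod_hom A (TP n) (TP m)"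
  proof (rule mod_homI)
    fix X assume "X \<in> carrier (TP n)"
    then obtain p where p: "p \<in> CB n" "X = cB n p" by (auto simp: TP_simps(1)[OF n(1)])
    show "?f X \<in> carrier (TP m)" using C[OF p(1)] by (simp add: p(2) f TP_simps(1)[OF n(2)])
    show "?f (s \<odot>\<^bsub>TP n\<^esub> X) = s \<odot>\<^bsub>TP m\<^esub> ?f X" if s: "s \<in> A" for s
    proof -
      have "nproj (NB m) (lin_ext fscale \<phi> (actB s p)) = nproj (NB m) (actB s (lin_ext fscale \<phi> p))"
        using p(1)
      proof (rule CB_induct)
        show "nproj (NB m) (lin_ext fscale \<phi> (actB s (pure w))) = nproj (NB m) (actB s (lin_ext fscale \<phi> (pure w)))"
          if "length w = n" for w
          using cov[OF s that] by (simp add: actB_actW lin_ext_pure[OF vs_fscale])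
      qed (auto simp: linD[OF actB_lin] linD[OF l] linD[OF nproj_NB(1)])
      then show ?thesis by (simp add: p(2) f TP_simps(4)[OF n(1)] TP_simps(4)[OF n(2)] TP_simps(5)[OF n(2)])
    qed
    fix Y assume "Y \<in> carrier (TP n)"
    then obtain p' where p': "p' \<in> CB n" "Y = cB n p'" by (auto simp: TP_simps(1)[OF n(1)])
    show "?f (X \<oplus>\<^bsub>TP n\<^esub> Y) = ?f X \<oplus>\<^bsub>TP m\<^esub> ?f Y"
      by (simp add: p(2) p'(2) f TP_simps(2)[OF n(1)] TP_simps(2)[OF n(2)] linD(3)[OF l])
  qed
  with f show ?thesis by blast
qed

text \<open>\<open>Theta\<close> applied to the universal balanced function is the homomorphism
  itself; equivariance follows by pushing the linear map \<open>?L\<close> through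
  \<open>Theta\<close>.\<close>

lemma Theta_hom:
  assumes f: "qhom m n f"
  shows "\<exists>g\<in>mod_hom (bi_scalars UNIV R) (TP (Suc m)) (TP (Suc n)).
    \<forall>p\<in>CB (Suc m). g (cB (Suc m) p) = cB (Suc n) (lin_ext fscale (Theta fscale m n f (vB (Suc n))) p)"
proof (rule TP_hom)
  show "balanced fscale (Suc m) (Theta fscale m n f (vB (Suc n)))"
    by (rule Theta_balanced[OF f balanced_vB])
  show "Theta fscale m n f (vB (Suc n)) w \<in> CB (Suc n)" if "length w = Suc m" for w
    by (rule Theta_CB[OF f that])
  fix s :: "'h + 'h" and w :: "'h list" assume s: "s \<in> bi_scalars UNIV R" and w: "length w = Suc m"
  let ?L = "\<lambda>x. nproj (NB (Suc n)) (actB s x)"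
  have L: "lin fscale fscale ?L" by (rule lin_comp[OF actB_lin nproj_NB(1)])
  have idem: "nproj (NB (Suc n)) (nproj (NB (Suc n)) x) = nproj (NB (Suc n)) x" for x
  proof -
    have "nproj (NB (Suc n)) (x - nproj (NB (Suc n)) x) = 0" using nproj_NB(2,3) by blast
    then show ?thesis by (simp add: linD(6)[OF nproj_NB(1)])
  qed
  have "nproj (NB (Suc n)) (Theta fscale m n f (vB (Suc n)) (actW s w)) =
      Theta fscale m n f (\<lambda>v. nproj (NB (Suc n)) (vB (Suc n) (actW s v))) w"
    unfolding Theta_act[OF f balanced_vB w s] by (rule Theta_push[OF nproj_NB(1) f w])
  also have "\<dots> = Theta fscale m n f (\<lambda>v. ?L (vB (Suc n) v)) w"
    by (rule Theta_cong[OF vs_fscale f w])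
      (simp add: vB_def idem TP_simps(7)[of "Suc n"] actB_actW)
  also have "\<dots> = ?L (Theta fscale m n f (vB (Suc n)) w)"
    by (rule Theta_push[OF L f w, symmetric])
  finally show "nproj (NB (Suc n)) (Theta fscale m n f (vB (Suc n)) (actW s w)) = ?L (Theta fscale m n f (vB (Suc n)) w)" .
qed simp_all

theorem ann_subset_summand:
  assumes ann: "ann_power H R n \<subseteq> ann_power H R m"
  shows "\<exists>N. iso_to_summand (bi_scalars UNIV R) (TP (Suc m)) (direct_power {..<N::nat} (TP (Suc n)))"
proof -
  obtain J :: "(('h set list \<Rightarrow>\<^sub>0 'k) \<times> ('h set list \<Rightarrow>\<^sub>0 'k)) set" and F G where J: "finite J"
    "\<And>j. j \<in> J \<Longrightarrow> qhom m n (F j)" "\<And>j. j \<in> J \<Longrightarrow> qhom n m (G j)"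
    "\<And>x. x \<in> UQ m \<Longrightarrow> (\<Sum>j\<in>J. G j (F j x)) = x"
    using hom_family[OF ann] by blast
  let ?A = "bi_scalars UNIV R" and ?M = "TP (Suc m)" and ?N = "TP (Suc n)"
  let ?\<phi> = "\<lambda>j. Theta fscale m n (F j) (vB (Suc n))" and ?\<psi> = "\<lambda>j. Theta fscale n m (G j) (vB (Suc m))"
  have one: "Suc m \<ge> 1" "Suc n \<ge> 1" by simp_all
  have "\<forall>j\<in>J. \<exists>h. h \<in> mod_hom ?A ?M ?N \<and> (\<forall>p\<in>CB (Suc m). h (cB (Suc m) p) = cB (Suc n) (lin_ext fscale (?\<phi> j) p))"
  proof
    fix j assume "j \<in> J"
    from Theta_hom[OF J(2)[OF this]] show "\<exists>h. h \<in> mod_hom ?A ?M ?N \<and> (\<forall>p\<in>CB (Suc m). h (cB (Suc m) p) = cB (Suc n) (lin_ext fscale (?\<phi> j) p))"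
      by (simp only: Bex_def)
  qed
  from bchoice[OF this] obtain f where f: "\<forall>j\<in>J. f j \<in> mod_hom ?A ?M ?N \<and> (\<forall>p\<in>CB (Suc m). f j (cB (Suc m) p) = cB (Suc n) (lin_ext fscale (?\<phi> j) p))"
    ..
  have "\<forall>j\<in>J. \<exists>h. h \<in> mod_hom ?A ?N ?M \<and> (\<forall>p\<in>CB (Suc n). h (cB (Suc n) p) = cB (Suc m) (lin_ext fscale (?\<psi> j) p))"
  proof
    fix j assume "j \<in> J"
    from Theta_hom[OF J(3)[OF this]] show "\<exists>h. h \<in> mod_hom ?A ?N ?M \<and> (\<forall>p\<in>CB (Suc n). h (cB (Suc n) p) = cB (Suc m) (lin_ext fscale (?\<psi> j) p))"
      by (simp only: Bex_def)
  qed
  from bchoice[OF this] obtain g where g: "\<forall>j\<in>J. g j \<in> mod_hom ?A ?N ?M \<and> (\<forall>p\<in>CB (Suc n). g j (cB (Suc n) p) = cB (Suc m) (lin_ext fscale (?\<psi> j) p))"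
    ..
  \<comment> \<open>The family is numbered because \<open>similar\<close> asks for index sets of the
    form \<open>{..<n}\<close>.\<close>
  obtain e where e: "bij_betw e {0..<card J} J" using ex_bij_betw_nat_finite[OF J(1)] by blast
  then have eJ: "e i \<in> J" if "i < card J" for i using that by (auto simp: bij_betw_def)
  have "iso_to_summand ?A ?M (direct_power {..<card J} ?N)"
  proof (rule family_summand[OF TP_additive[OF one(1)] TP_additive[OF one(2)], where f = "\<lambda>i. f (e i)" and g = "\<lambda>i. g (e i)"])
    show "f (e i) \<in> mod_hom ?A ?M ?N" "g (e i) \<in> mod_hom ?A ?N ?M" if "i \<in> {..<card J}" for i
      using bspec[OF f eJ] bspec[OF g eJ] that by auto
    fix X assume "X \<in> carrier ?M"
    then obtain p where p: "p \<in> CB (Suc m)" "X = cB (Suc m) p" by (auto simp: TP_simps(1)[OF one(1)])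
    let ?q = "\<lambda>j. lin_ext fscale (?\<psi> j) (lin_ext fscale (?\<phi> j) p)"
    have C1: "lin_ext fscale (?\<phi> j) p \<in> CB (Suc n)" if j: "j \<in> J" for j
      using p(1) by (intro lin_ext_mem[OF vs_fscale subspace_formal_tensors] Theta_CB[OF J(2)[OF j]]) (auto simp: formal_tensors_def)
    have C2: "?q j \<in> CB (Suc m)" if j: "j \<in> J" for j
      using C1[OF j] by (intro lin_ext_mem[OF vs_fscale subspace_formal_tensors] Theta_CB[OF J(3)[OF j]]) (auto simp: formal_tensors_def)
    have gf: "g j (f j X) = cB (Suc m) (?q j)" if j: "j \<in> J" for j
      using bspec[OF f j] bspec[OF g j] p C1[OF j] by simp
    have abM: "abelian_group ?M" using TP_additive[OF one(1), of ?A] by (simp add: additive_module_def)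
    then interpret M: abelian_group ?M .
    have "finsum ?M (\<lambda>i. g (e i) (f (e i) X)) {..<card J} = finsum ?M (\<lambda>i. cB (Suc m) (?q (e i))) {..<card J}"
      by (rule M.finsum_cong') (use gf eJ C2 in \<open>auto simp: TP_simps(1)[OF one(1)]\<close>)
    also have "\<dots> = cB (Suc m) (\<Sum>i\<in>{..<card J}. ?q (e i))"
    proof -
      have "finsum ?M (\<lambda>i. cB (Suc m) (?q (e i))) {..<card J} = cB (Suc m) (\<Sum>i\<in>{..<card J}. ?q (e i)) \<and>
          (\<Sum>i\<in>{..<card J}. ?q (e i)) \<in> CB (Suc m)"
        by (rule finsum_hom_sum[OF abM])
          (use C2 eJ fs.subspace_0[OF subspace_formal_tensors] fs.subspace_add[OF subspace_formal_tensors] in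
            \<open>auto simp: TP_simps(1)[OF one(1)] TP_simps(2)[OF one(1)] TP_simps(3)[OF one(1)]\<close>)
      then show ?thesis ..
    qed
    also have "(\<Sum>i\<in>{..<card J}. ?q (e i)) = (\<Sum>j\<in>J. ?q j)"
      using sum.reindex_bij_betw[OF e, of ?q] by (simp add: lessThan_atLeast0)
    also have "cB (Suc m) (\<Sum>j\<in>J. ?q j) = cB (Suc m) p"
      unfolding TP_simps(5)[OF one(1)]
      using p(1)
    proof (rule CB_induct)
      note l = linD[OF lin_lin_ext[OF vs_fscale]]
      show "nproj (NB (Suc m)) (\<Sum>j\<in>J. lin_ext fscale (?\<psi> j) (lin_ext fscale (?\<phi> j) (pure w))) = nproj (NB (Suc m)) (pure w)"
        if w: "length w = Suc m" for w
      proof -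
        \<comment> \<open>Composition of the homomorphisms becomes composition of the operators
          \<open>Theta\<close> in the reverse order, whose sum is known from
          \<open>Theta_family\<close>.\<close>
        have "lin_ext fscale (?\<psi> j) (?\<phi> j w) = Theta fscale m n (F j) (Theta fscale n m (G j) (vB (Suc m))) w" if j: "j \<in> J" for j
        proof -
          have "lin_ext fscale (?\<psi> j) (?\<phi> j w) = Theta fscale m n (F j) (\<lambda>v. lin_ext fscale (?\<psi> j) (vB (Suc n) v)) w"
            by (rule Theta_push[OF lin_lin_ext[OF vs_fscale] J(2)[OF j] w])
          also have "\<dots> = Theta fscale m n (F j) (?\<psi> j) w"
            by (rule Theta_cong[OF vs_fscale J(2)[OF j] w]) (rule bhat_vB[OF Theta_balanced[OF J(3)[OF j] balanced_vB]])
          finally show ?thesis .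
        qed
        then have "(\<Sum>j\<in>J. lin_ext fscale (?\<psi> j) (lin_ext fscale (?\<phi> j) (pure w))) =
          (\<Sum>j\<in>J. Theta fscale m n (F j) (Theta fscale n m (G j) (vB (Suc m))) w)"
          by (simp add: lin_ext_pure[OF vs_fscale])
        also have "\<dots> = vB (Suc m) w" by (rule Theta_family[OF J balanced_vB w])
        finally have e: "(\<Sum>j\<in>J. lin_ext fscale (?\<psi> j) (lin_ext fscale (?\<phi> j) (pure w))) = vB (Suc m) w" .
        have "nproj (NB (Suc m)) (pure w - vB (Suc m) w) = 0" using nproj_NB(2,3) unfolding vB_def by blast
        then show ?thesis unfolding e by (simp add: linD(6)[OF nproj_NB(1)])
      qed
    qed (simp_all add: linD(3,4,5)[OF lin_lin_ext[OF vs_fscale]] sum.distrib fs.scale_sum_right[symmetric] linD(3,4,5)[OF nproj_NB(1)])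
    finally show "finsum ?M (\<lambda>i. g (e i) (f (e i) X)) {..<card J} = X" by (simp add: p(2))
  qed simp
  then show ?thesis by blast
qed

end

section \<open>The descending chain of annihilators\<close>

context hopf_pair
begin

lemma finite_basis: obtains B where "finite_dimensional_vector_space hs B"
proof -
  obtain B0 where B0: "finite B0" "span B0 = UNIV" using fin_dim by (auto simp: fin_dim_def)
  obtain B where B: "B \<subseteq> B0" "independent B" "B0 \<subseteq> span B"
    using maximal_independent_subset by metis
  have sp: "span B = UNIV" using B(3) B0(2) by (metis span_mono span_span top.extremum_uniqueI)
  have "finite_dimensional_vector_space hs B"
    by unfold_locales (use B sp B0 finite_subset in auto)
  then show ?thesis by (rule that)
qed

lemma ann_power_subspace: "subspace (ann_power H R n)"
proof -
  have L: "lin hs fscale (\<lambda>r. dact fscale w (uQ n) r)" if "length w = n" for w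
    using lin_dact[of fscale w "uQ n"] QgoodD(1)[OF Qgood_uQ] that by simp
  show ?thesis
    by (rule subspaceI) (auto simp: ann_power_iff R_zero R_add R_scale linD[OF L])
qed

lemma ann_power_R: "r \<in> ann_power H R n \<Longrightarrow> r \<in> R"
  by (simp add: ann_power_iff)

lemma ann_power_right: "r \<in> ann_power H R n \<Longrightarrow> s \<in> R \<Longrightarrow> r * s \<in> ann_power H R n"
proof -
  assume r: "r \<in> ann_power H R n" and s: "s \<in> R"
  have "dact fscale w (uQ n) (r * s) = 0" if w: "length w = n" for w
    using ann_power_Qgood[OF r Qgood_dact[OF Qgood_uQ] w, of s] dact_dact[of fscale w "uQ n" s r]
      QgoodD(1)[OF Qgood_uQ, of n] w by simp
  then show ?thesis using r s by (simp add: ann_power_iff R_mult)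
qed

lemma ann_power_left: "r \<in> ann_power H R n \<Longrightarrow> s \<in> R \<Longrightarrow> s * r \<in> ann_power H R n"
proof -
  assume r: "r \<in> ann_power H R n" and s: "s \<in> R"
  have "dact fscale w (uQ n) (s * r) = 0" if w: "length w = n" for w
  proof -
    have "dact fscale w (uQ n) (s * r) = dact fscale w (\<lambda>v. dact fscale v (uQ n) r) s"
      using dact_dact[of fscale w "uQ n" r s] QgoodD(1)[OF Qgood_uQ, of n] w by simp
    also have "\<dots> = dact fscale w (\<lambda>v. 0) s"
      by (rule comb_cong[OF comb_dact[OF vs_fscale w]]) (use r in \<open>simp add: ann_power_iff\<close>)
    also have "\<dots> = 0"
    proof -
      obtain p where "\<And>g :: 'h list \<Rightarrow> ('h set list \<Rightarrow>\<^sub>0 'k). dact fscale w g s = lin_ext fscale g p"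
        using comb_dact[OF vs_fscale w] unfolding comb_def by blast
      then show ?thesis by (simp add: lin_ext_def)
    qed
    finally show ?thesis .
  qed
  then show ?thesis using r s by (simp add: ann_power_iff R_mult)
qed

text \<open>The counit factors through \<open>Q\<close>, and applied to the first factor it maps
  Q^(n+1) onto Q^n compatibly with the action.\<close>

lemma ann_power_decreasing: "ann_power H R (Suc n) \<subseteq> ann_power H R n"
proof
  fix r assume r: "r \<in> ann_power H R (Suc n)"
  let ?g = "\<lambda>w. fscale (eps (hd w)) (uQ n (tl w))"
  note good = eps_prefix_good[OF Qgood_uQ[of n]]
  have "Qgood fscale (Suc n) ?g"
    unfolding Qgood_def
  proof (intro conjI allI impI)
    show "mlin fscale (Suc n) ?g" by (rule goodD(1)[OF good])
    fix us vs :: "'h list" and x r assume a: "length us + 1 + length vs = Suc n \<and> r \<in> R"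
    show "?g (us @ (r * x) # vs) = fscale (eps r) (?g (us @ x # vs))"
    proof (cases "us = []")
      case True
      then show ?thesis by (simp add: counit_mult)
    next
      case False
      then show ?thesis using goodD(2)[OF good, of us vs r x] a by simp
    qed
  qed
  then have "dact fscale w (uQ n) r = 0" if "length w = n" for w
    using ann_power_Qgood[OF r, of fscale ?g "1 # w"] dact_eps_prefix[OF Qgood_uQ that, of r] that by simp
  then show "r \<in> ann_power H R n" using ann_power_R[OF r] by (simp add: ann_power_iff)
qed

end

context hopf_integral
begin

lemma ann_power_stable:
  assumes "ann_power H R n \<subseteq> ann_power H R (Suc n)" "m \<ge> n"
  shows "ann_power H R m = ann_power H R n" "ann_power H R m \<subseteq> ann_power H R (Suc m)"
proof -
  have "ann_power H R m = ann_power H R n \<and> ann_power H R m \<subseteq> ann_power H R (Suc m)"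
    using assms(2)
  proof (induction m rule: dec_induct)
    case (step m)
    then show ?case using ann_power_step[of m] ann_power_decreasing[of m] by blast
  qed (use assms(1) in simp)
  then show "ann_power H R m = ann_power H R n" "ann_power H R m \<subseteq> ann_power H R (Suc m)" by auto
qed

lemma ann_limit_eq:
  assumes "ann_power H R n \<subseteq> ann_power H R (Suc n)"
  shows "ann_limit H R = ann_power H R n"
proof
  have dec: "ann_power H R m \<subseteq> ann_power H R k" if "k \<le> m" for k m
    using that by (induction m rule: dec_induct) (use ann_power_decreasing in blast)+
  show "ann_limit H R \<subseteq> ann_power H R n"
  proof -
    \<comment> \<open>The intersection starts at index 1, so the detour over the successor takes
      care of \<open>n = 0\<close>.\<close>
    have "ann_limit H R \<subseteq> ann_power H R (Suc n)" unfolding ann_limit_def by auto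
    then show ?thesis using ann_power_decreasing by blast
  qed
  show "ann_power H R n \<subseteq> ann_limit H R"
    unfolding ann_limit_def
  proof (rule INT_greatest)
    fix m show "ann_power H R n \<subseteq> ann_power H R m"
    proof (cases "m \<le> n")
      case True then show ?thesis by (rule dec)
    next
      case False
      then have "ann_power H R m = ann_power H R n" by (intro ann_power_stable(1)[OF assms]) simp
      then show ?thesis by simp
    qed
  qed
qed

text \<open>In finite dimension the chain cannot decrease strictly forever, so the least number in
  \<open>ell_Q\<close> exists.\<close>

lemma ann_power_ell: "ann_power H R (ell_Q H R) = ann_limit H R"
proof -
  have "\<exists>n. ann_power H R n \<subseteq> ann_power H R (Suc n)"
  proof (rule ccontr)
    assume n: "\<nexists>n. ann_power H R n \<subseteq> ann_power H R (Suc n)"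
    obtain B where "finite_dimensional_vector_space hs B" by (rule finite_basis)
    then interpret fd: finite_dimensional_vector_space hs B .
    have less: "dim (ann_power H R (Suc n)) < dim (ann_power H R n)" for n
    proof -
      have "\<not> dim (ann_power H R n) \<le> dim (ann_power H R (Suc n))"
        using fd.subspace_dim_equal[OF ann_power_subspace ann_power_subspace ann_power_decreasing, of n] n by blast
      then show ?thesis by simp
    qed
    have "dim (ann_power H R n) + n \<le> dim (ann_power H R 0)" for n
    proof (induction n)
      case (Suc n)
      then show ?case using less[of n] by simp
    qed simp
    from this[of "Suc (dim (ann_power H R 0))"] show False by simp
  qed
  then obtain n where "ann_power H R n \<subseteq> ann_power H R (Suc n)" by blast
  then have "ann_power H R n = ann_limit H R" by (simp add: ann_limit_eq)
  then show ?thesis unfolding ell_Q_def by (rule LeastI)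
qed

lemma ell_le: "ann_power H R n \<subseteq> ann_power H R (Suc n) \<Longrightarrow> ell_Q H R \<le> n"
  unfolding ell_Q_def by (rule Least_le) (simp add: ann_limit_eq)

end

section \<open>Simple modules\<close>

lemma right_moduleD:
  assumes "right_module R M"
  shows "abelian_group M" "r \<in> R \<Longrightarrow> x \<in> carrier M \<Longrightarrow> r \<odot>\<^bsub>M\<^esub> x \<in> carrier M"
    "r \<in> R \<Longrightarrow> s \<in> R \<Longrightarrow> x \<in> carrier M \<Longrightarrow> (r + s) \<odot>\<^bsub>M\<^esub> x = r \<odot>\<^bsub>M\<^esub> x \<oplus>\<^bsub>M\<^esub> s \<odot>\<^bsub>M\<^esub> x"
    "r \<in> R \<Longrightarrow> x \<in> carrier M \<Longrightarrow> y \<in> carrier M \<Longrightarrow> r \<odot>\<^bsub>M\<^esub> (x \<oplus>\<^bsub>M\<^esub> y) = r \<odot>\<^bsub>M\<^esub> x \<oplus>\<^bsub>M\<^esub> r \<odot>\<^bsub>M\<^esub> y"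
    "r \<in> R \<Longrightarrow> s \<in> R \<Longrightarrow> x \<in> carrier M \<Longrightarrow> (r * s) \<odot>\<^bsub>M\<^esub> x = s \<odot>\<^bsub>M\<^esub> (r \<odot>\<^bsub>M\<^esub> x)"
    "x \<in> carrier M \<Longrightarrow> 1 \<odot>\<^bsub>M\<^esub> x = x"
  using assms by (simp_all add: right_module_def)

lemma simple_right_moduleD:
  assumes "simple_right_module R M"
  shows "right_module R M" "carrier M \<noteq> {\<zero>\<^bsub>M\<^esub>}"
    "is_submodule R U M \<Longrightarrow> x \<in> U \<Longrightarrow> x \<noteq> \<zero>\<^bsub>M\<^esub> \<Longrightarrow> U = carrier M"
  using assms by (auto simp: simple_right_module_def)

lemma additive_smult_zero:
  assumes "additive_module A M" "s \<in> A"
  shows "s \<odot>\<^bsub>M\<^esub> \<zero>\<^bsub>M\<^esub> = \<zero>\<^bsub>M\<^esub>" "x \<in> carrier M \<Longrightarrow> s \<odot>\<^bsub>M\<^esub> (\<ominus>\<^bsub>M\<^esub> x) = \<ominus>\<^bsub>M\<^esub> (s \<odot>\<^bsub>M\<^esub> x)"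
  using additive_zero_minus[of M M "\<lambda>x. s \<odot>\<^bsub>M\<^esub> x"] assms by (auto simp: additive_module_def)

lemma mod_iso_sym:
  assumes M: "additive_module A M" and N: "mod_iso A M N"
  shows "mod_iso A N M"
proof -
  interpret M: abelian_group M using M by (simp add: additive_module_def)
  obtain f where f: "f \<in> mod_hom A M N" "bij_betw f (carrier M) (carrier N)" using N unfolding mod_iso_def by blast
  let ?g = "inv_into (carrier M) f"
  have g: "x \<in> carrier N \<Longrightarrow> ?g x \<in> carrier M" "x \<in> carrier N \<Longrightarrow> f (?g x) = x" for x
    using bij_betw_inv_into[OF f(2)] bij_betw_inv_into_right[OF f(2)] by (auto simp: bij_betw_def)
  have gf: "?g (f x) = x" if "x \<in> carrier M" for x by (rule bij_betw_inv_into_left[OF f(2) that])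
  have "?g \<in> mod_hom A N M"
  proof (rule mod_homI)
    show "?g x \<in> carrier M" if "x \<in> carrier N" for x by (rule g(1)[OF that])
    show "?g (x \<oplus>\<^bsub>N\<^esub> y) = ?g x \<oplus>\<^bsub>M\<^esub> ?g y" if "x \<in> carrier N" "y \<in> carrier N" for x y
      using mod_homD(2)[OF f(1) g(1)[OF that(1)] g(1)[OF that(2)]] gf[of "?g x \<oplus>\<^bsub>M\<^esub> ?g y"] g that by simp
    show "?g (s \<odot>\<^bsub>N\<^esub> x) = s \<odot>\<^bsub>M\<^esub> ?g x" if s: "s \<in> A" and x: "x \<in> carrier N" for s x
    proof -
      have "s \<odot>\<^bsub>M\<^esub> ?g x \<in> carrier M" using M s g(1)[OF x] by (simp add: additive_module_def)
      from gf[OF this] show ?thesis using mod_homD(3)[OF f(1) s g(1)[OF x]] g(2)[OF x] by simp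
    qed
  qed
  then show ?thesis unfolding mod_iso_def by (rule bexI[where P = "\<lambda>h. bij_betw h (carrier N) (carrier M)", OF bij_betw_inv_into[OF f(2)]])
qed

lemma mod_iso_trans:
  assumes "mod_iso A M N" "mod_iso A N P"
  shows "mod_iso A M P"
proof -
  obtain f where f: "f \<in> mod_hom A M N" "bij_betw f (carrier M) (carrier N)" using assms(1) unfolding mod_iso_def by (rule bexE)
  obtain g where g: "g \<in> mod_hom A N P" "bij_betw g (carrier N) (carrier P)" using assms(2) unfolding mod_iso_def by (rule bexE)
  have "bij_betw (\<lambda>x. g (f x)) (carrier M) (carrier P)" using bij_betw_trans[OF f(2) g(2)] by (simp add: o_def)
  then show ?thesis unfolding mod_iso_def by (rule bexI[OF _ mod_hom_comp[OF f(1) g(1)]])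
qed

lemma mod_iso_refl: "mod_iso A M M"
proof -
  have "(\<lambda>x. x) \<in> mod_hom A M M" by (rule mod_homI) auto
  then show ?thesis unfolding mod_iso_def by (rule bexI[rotated]) (simp add: bij_betw_def)
qed

lemma simple_hom_inj:
  assumes M: "simple_right_module R M" and N: "additive_module R N" and f: "f \<in> mod_hom R M N"
    and x: "x \<in> carrier M" "f x \<noteq> \<zero>\<^bsub>N\<^esub>"
  shows "inj_on f (carrier M)"
proof -
  note rm = simple_right_moduleD(1)[OF M]
  note aM = right_moduleD(1)[OF rm]
  have aN: "abelian_group N" using N by (simp add: additive_module_def)
  interpret M: abelian_group M by fact
  interpret N: abelian_group N by fact
  note f' = mod_homD[OF f]
  have fz: "f \<zero>\<^bsub>M\<^esub> = \<zero>\<^bsub>N\<^esub>" "y \<in> carrier M \<Longrightarrow> f (\<ominus>\<^bsub>M\<^esub> y) = \<ominus>\<^bsub>N\<^esub> f y" for y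
    using additive_zero_minus[OF aM aN f'(1,2)] by auto
  let ?K = "{y \<in> carrier M. f y = \<zero>\<^bsub>N\<^esub>}"
  have K: "is_submodule R ?K M"
    by (rule is_submoduleI[OF aM]) (use right_moduleD[OF rm] f' fz additive_smult_zero[OF N] in auto)
  have "y = \<zero>\<^bsub>M\<^esub>" if "y \<in> ?K" for y
    using simple_right_moduleD(3)[OF M K that] x by auto
  then have ker: "y = \<zero>\<^bsub>M\<^esub>" if "y \<in> carrier M" "f y = \<zero>\<^bsub>N\<^esub>" for y using that by simp
  show ?thesis
  proof (rule inj_onI)
    fix y z assume yz: "y \<in> carrier M" "z \<in> carrier M" "f y = f z"
    have "f (y \<oplus>\<^bsub>M\<^esub> \<ominus>\<^bsub>M\<^esub> z) = \<zero>\<^bsub>N\<^esub>" using yz f'(1)[OF yz(2)] by (simp add: f'(2) fz N.r_neg)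
    then have "y \<oplus>\<^bsub>M\<^esub> \<ominus>\<^bsub>M\<^esub> z = \<zero>\<^bsub>M\<^esub>" using yz by (intro ker) auto
    then show "y = z" using yz M.minus_equality[of y "\<ominus>\<^bsub>M\<^esub> z"] by simp
  qed
qed

lemma simple_hom_surj:
  assumes M: "additive_module R M" and N: "simple_right_module R N" and f: "f \<in> mod_hom R M N"
    and x: "x \<in> carrier M" "f x \<noteq> \<zero>\<^bsub>N\<^esub>"
  shows "f ` carrier M = carrier N"
proof -
  note aN = right_moduleD(1)[OF simple_right_moduleD(1)[OF N]]
  have aM: "abelian_group M" using M by (simp add: additive_module_def)
  interpret M: abelian_group M by fact
  interpret N: abelian_group N by fact
  note f' = mod_homD[OF f]
  have fz: "f \<zero>\<^bsub>M\<^esub> = \<zero>\<^bsub>N\<^esub>" "y \<in> carrier M \<Longrightarrow> f (\<ominus>\<^bsub>M\<^esub> y) = \<ominus>\<^bsub>N\<^esub> f y" for y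
    using additive_zero_minus[OF aM aN f'(1,2)] by auto
  have "is_submodule R (f ` carrier M) N"
  proof (rule is_submoduleI[OF aN])
    show "f ` carrier M \<subseteq> carrier N" using f'(1) by auto
    show "\<zero>\<^bsub>N\<^esub> \<in> f ` carrier M" by (rule image_eqI[of _ _ "\<zero>\<^bsub>M\<^esub>"]) (simp_all add: fz)
    fix u assume "u \<in> f ` carrier M"
    then obtain a where a: "a \<in> carrier M" "u = f a" by auto
    show "\<ominus>\<^bsub>N\<^esub> u \<in> f ` carrier M" by (rule image_eqI[of _ _ "\<ominus>\<^bsub>M\<^esub> a"]) (use a fz in simp_all)
    show "s \<odot>\<^bsub>N\<^esub> u \<in> f ` carrier M" if "s \<in> R" for s
      by (rule image_eqI[of _ _ "s \<odot>\<^bsub>M\<^esub> a"]) (use a that M f'(3) in \<open>simp_all add: additive_module_def\<close>)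
    fix v assume "v \<in> f ` carrier M"
    then obtain b where b: "b \<in> carrier M" "v = f b" by auto
    show "u \<oplus>\<^bsub>N\<^esub> v \<in> f ` carrier M" by (rule image_eqI[of _ _ "a \<oplus>\<^bsub>M\<^esub> b"]) (use a b f'(2) in simp_all)
  qed
  from simple_right_moduleD(3)[OF N this imageI[OF x(1)] x(2)] show ?thesis .
qed

lemma simple_hom_iso:
  assumes "simple_right_module R M" "simple_right_module R N" "f \<in> mod_hom R M N" "x \<in> carrier M" "f x \<noteq> \<zero>\<^bsub>N\<^esub>"
  shows "mod_iso R M N"
proof -
  have "additive_module R M" "additive_module R N"
    using assms by (auto intro: right_module_additive simple_right_moduleD)
  then have "bij_betw f (carrier M) (carrier N)"
    unfolding bij_betw_def using simple_hom_inj[OF assms(1) _ assms(3-5)] simple_hom_surj[OF _ assms(2-5)] by simp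
  then show ?thesis unfolding mod_iso_def by (rule bexI[OF _ assms(3)])
qed

section \<open>Right ideals, idempotents and simple modules\<close>

context hopf_integral
begin

definition right_ideal :: "'h set \<Rightarrow> bool" where
  "right_ideal U \<longleftrightarrow> subspace U \<and> U \<subseteq> R \<and> (\<forall>u\<in>U. \<forall>r\<in>R. u * r \<in> U)"

lemma right_idealD:
  assumes "right_ideal U"
  shows "subspace U" "u \<in> U \<Longrightarrow> u \<in> R" "u \<in> U \<Longrightarrow> r \<in> R \<Longrightarrow> u * r \<in> U" "0 \<in> U"
    "u \<in> U \<Longrightarrow> v \<in> U \<Longrightarrow> u + v \<in> U" "u \<in> U \<Longrightarrow> v \<in> U \<Longrightarrow> u - v \<in> U" "u \<in> U \<Longrightarrow> - u \<in> U"
  using assms subspace_0 subspace_add subspace_diff subspace_neg by (auto simp: right_ideal_def)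

lemma right_idealI:
  assumes "U \<subseteq> R" "0 \<in> U" "\<And>u v. u \<in> U \<Longrightarrow> v \<in> U \<Longrightarrow> u + v \<in> U"
    "\<And>u r. u \<in> U \<Longrightarrow> r \<in> R \<Longrightarrow> u * r \<in> U"
  shows "right_ideal U"
proof -
  have "hs c u \<in> U" if "u \<in> U" for c u
    using assms(4)[OF that, of "hs c 1"] by (simp add: R_scale R_one scale_mult_right)
  then show ?thesis unfolding right_ideal_def by (auto intro: subspaceI assms simp: subsetD[OF assms(1)])
qed

lemma R_right_ideal: "right_ideal R"
  using R_sub R_mult by (simp add: right_ideal_def)

lemma RR_minus: "x \<in> R \<Longrightarrow> \<ominus>\<^bsub>regular_right_module R\<^esub> x = - x"
proof -
  interpret M: abelian_group "regular_right_module R" using RR_additive by (simp add: additive_module_def)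
  show "x \<in> R \<Longrightarrow> ?thesis" by (rule M.minus_equality) (auto simp: RR_simps R_minus)
qed

lemma submodule_right_ideal: "is_submodule R U (regular_right_module R) \<longleftrightarrow> right_ideal U"
proof
  assume "is_submodule R U (regular_right_module R)"
  from submodule_restrict[OF this] show "right_ideal U"
    by (intro right_idealI) (auto simp: RR_simps)
next
  assume U: "right_ideal U"
  show "is_submodule R U (regular_right_module R)"
    by (rule is_submoduleI)
      (use RR_additive in \<open>auto simp: additive_module_def RR_simps right_idealD[OF U] RR_minus\<close>)
qed

text \<open>Maschke: the image of 1 under an averaged projection onto the right ideal.\<close>

lemma left_identity:
  assumes U: "right_ideal U"
  obtains e where "e \<in> U" "\<And>u. u \<in> U \<Longrightarrow> e * u = u"
proof -
  obtain p where p: "lin hs hs p" "\<And>x. p x = 0 \<longleftrightarrow> x \<in> U" "\<And>x. x - p x \<in> U"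
    using exists_projection[OF hs_vs right_idealD(1)[OF U]] by blast
  let ?q = "\<lambda>x. x - p x" and ?\<rho> = "\<lambda>h x :: 'h. x * h"
  have q: "lin hs hs ?q" by (intro lin_minus lin_id hs_vs p)
  have qu: "?q u = u" if "u \<in> U" for u using p(2)[of u] that by simp
  let ?P = "avg hs ?\<rho> ?\<rho> ?q"
  show ?thesis
  proof
    show "?P 1 \<in> U"
      by (rule avg_mem[OF ract_right ract_right q _ _ right_idealD(1)[OF U]]) (auto simp: p right_idealD[OF U])
    fix u assume u: "u \<in> U"
    have "?P u = u"
      by (rule avg_id[OF ract_right ract_right q]) (use u in \<open>auto simp: qu right_idealD[OF U]\<close>)
    moreover have "?P (1 * u) = ?P 1 * u"
      by (rule avg_hom[OF ract_right ract_right q]) (use u in \<open>auto simp: right_idealD[OF U]\<close>)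
    ultimately show "?P 1 * u = u" by simp
  qed
qed

lemma right_ideal_kernel: "right_ideal U \<Longrightarrow> e \<in> R \<Longrightarrow> right_ideal {y \<in> U. e * y = 0}"
  by (rule right_idealI) (auto simp: right_idealD distrib_left mult.assoc[symmetric])

text \<open>Left multiplication by a left identity \<open>e\<close> of \<open>U\<close> is a
  projection of \<open>R\<close> onto \<open>U\<close>; its kernel is the complement.\<close>

theorem semisimple: "semisimple_algebra R"
  unfolding semisimple_algebra_def semisimple_module_def submodule_right_ideal
proof (intro allI impI)
  fix U assume U: "right_ideal U"
  obtain e where e: "e \<in> U" "\<And>u. u \<in> U \<Longrightarrow> e * u = u" using left_identity[OF U] by blast
  have eR: "e \<in> R" using e(1) by (rule right_idealD[OF U])
  let ?V = "{y \<in> R. e * y = 0}"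
  have "internal_direct_sum (regular_right_module R) U ?V"
    unfolding internal_direct_sum_def RR_simps
  proof (intro conjI equalityI subsetI)
    fix x assume x: "x \<in> R"
    have "x = e * x + (x - e * x)" by simp
    moreover have "e * x \<in> U" "x - e * x \<in> ?V"
      using x eR e right_idealD(3)[OF U e(1) x] by (auto simp: R_diff R_mult right_diff_distrib)
    ultimately show "x \<in> {u + v |u v. u \<in> U \<and> v \<in> ?V}" by blast
  qed (use right_idealD[OF U] e(2) R_add R_zero in auto)
  then show "\<exists>V. right_ideal V \<and> internal_direct_sum (regular_right_module R) U V"
    using right_ideal_kernel[OF R_right_ideal eR] by blast
qed

text \<open>The annihilator of \<open>x\<close> in \<open>R\<close> is (1 - e)R, so \<open>M\<close>
  is isomorphic to eR, with \<open>x\<close> corresponding to the idempotent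
  \<open>e\<close>.\<close>

definition generates :: "('h, 's) module \<Rightarrow> 's \<Rightarrow> 'h \<Rightarrow> bool" where
  "generates M x e \<longleftrightarrow> x \<in> carrier M \<and> e \<in> R \<and> e \<noteq> 0 \<and> e * e = e \<and> e \<odot>\<^bsub>M\<^esub> x = x \<and>
     carrier M = {r \<odot>\<^bsub>M\<^esub> x | r. r \<in> R} \<and> (\<forall>r\<in>R. r \<odot>\<^bsub>M\<^esub> x = \<zero>\<^bsub>M\<^esub> \<longleftrightarrow> e * r = 0)"

lemma smult_zero_minus:
  assumes "right_module R M" "x \<in> carrier M"
  shows "0 \<odot>\<^bsub>M\<^esub> x = \<zero>\<^bsub>M\<^esub>" "r \<in> R \<Longrightarrow> (- r) \<odot>\<^bsub>M\<^esub> x = \<ominus>\<^bsub>M\<^esub> (r \<odot>\<^bsub>M\<^esub> x)"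
    "r \<in> R \<Longrightarrow> s \<in> R \<Longrightarrow> (r - s) \<odot>\<^bsub>M\<^esub> x = \<zero>\<^bsub>M\<^esub> \<longleftrightarrow> r \<odot>\<^bsub>M\<^esub> x = s \<odot>\<^bsub>M\<^esub> x"
proof -
  note m = right_moduleD[OF assms(1)]
  interpret M: abelian_group M by (rule m(1))
  have z: "0 \<odot>\<^bsub>M\<^esub> x \<in> carrier M" using m(2)[OF R_zero assms(2)] .
  have "0 \<odot>\<^bsub>M\<^esub> x \<oplus>\<^bsub>M\<^esub> 0 \<odot>\<^bsub>M\<^esub> x = 0 \<odot>\<^bsub>M\<^esub> x" using m(3)[OF R_zero R_zero assms(2)] by simp
  then show z0: "0 \<odot>\<^bsub>M\<^esub> x = \<zero>\<^bsub>M\<^esub>" using M.add.l_cancel_one[OF z z] by simp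
  show mi: "(- r) \<odot>\<^bsub>M\<^esub> x = \<ominus>\<^bsub>M\<^esub> (r \<odot>\<^bsub>M\<^esub> x)" if r: "r \<in> R" for r
    by (rule M.minus_equality[symmetric]) (use m(3)[OF R_minus[OF r] r assms(2)] z0 m(2)[OF _ assms(2)] R_minus r in auto)
  assume rs: "r \<in> R" "s \<in> R"
  note c = m(2)[OF rs(1) assms(2)] m(2)[OF rs(2) assms(2)]
  have "(r - s) \<odot>\<^bsub>M\<^esub> x = r \<odot>\<^bsub>M\<^esub> x \<oplus>\<^bsub>M\<^esub> \<ominus>\<^bsub>M\<^esub> (s \<odot>\<^bsub>M\<^esub> x)"
    using m(3)[OF rs(1) R_minus[OF rs(2)] assms(2)] mi[OF rs(2)] by simp
  then show "(r - s) \<odot>\<^bsub>M\<^esub> x = \<zero>\<^bsub>M\<^esub> \<longleftrightarrow> r \<odot>\<^bsub>M\<^esub> x = s \<odot>\<^bsub>M\<^esub> x"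
    using M.minus_equality[of "r \<odot>\<^bsub>M\<^esub> x" "\<ominus>\<^bsub>M\<^esub> (s \<odot>\<^bsub>M\<^esub> x)"] c by (auto simp: M.r_neg)
qed

text \<open>Any nonzero \<open>x\<close> generates \<open>M\<close>, and its annihilator is a right
  ideal with a left identity \<open>f\<close>; the idempotent is \<open>1 - f\<close>.\<close>

lemma simple_generator:
  assumes S: "simple_right_module R M"
  shows "\<exists>x e. generates M x e"
proof -
  note rm = simple_right_moduleD(1)[OF S]
  note m = right_moduleD[OF rm]
  interpret M: abelian_group M by (rule m(1))
  obtain x where x: "x \<in> carrier M" "x \<noteq> \<zero>\<^bsub>M\<^esub>" using simple_right_moduleD(2)[OF S] M.zero_closed by blast
  note z = smult_zero_minus[OF rm x(1)]
  let ?U = "{r \<odot>\<^bsub>M\<^esub> x | r. r \<in> R}"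
  have "is_submodule R ?U M"
  proof (rule is_submoduleI[OF m(1)])
    show "?U \<subseteq> carrier M" using m(2) x by auto
    show "\<zero>\<^bsub>M\<^esub> \<in> ?U" using z(1) R_zero by force
    fix u assume "u \<in> ?U"
    then obtain r where r: "r \<in> R" "u = r \<odot>\<^bsub>M\<^esub> x" by blast
    show "\<ominus>\<^bsub>M\<^esub> u \<in> ?U" using r z(2)[OF r(1)] R_minus[OF r(1)] by (intro CollectI exI[of _ "- r"]) simp
    show "s \<odot>\<^bsub>M\<^esub> u \<in> ?U" if "s \<in> R" for s using r m(5)[OF r(1) that x(1)] R_mult[OF r(1) that] by force
    fix v assume "v \<in> ?U"
    then obtain s where s: "s \<in> R" "v = s \<odot>\<^bsub>M\<^esub> x" by blast
    show "u \<oplus>\<^bsub>M\<^esub> v \<in> ?U" using r s m(3)[OF r(1) s(1) x(1)] R_add[OF r(1) s(1)] by force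
  qed
  moreover have "x \<in> ?U" using m(6)[OF x(1)] R_one by force
  ultimately have U: "?U = carrier M" using simple_right_moduleD(3)[OF S _ _ x(2)] by blast
  let ?A = "{r \<in> R. r \<odot>\<^bsub>M\<^esub> x = \<zero>\<^bsub>M\<^esub>}"
  have "right_ideal ?A"
    by (rule right_idealI)
      (use R_zero R_add R_mult z(1) m(3,5) x(1) additive_smult_zero(1)[OF right_module_additive[OF rm]] in auto)
  then obtain f where f: "f \<in> ?A" "\<And>a. a \<in> ?A \<Longrightarrow> f * a = a" by (rule left_identity) blast
  have fR: "f \<in> R" and fx: "f \<odot>\<^bsub>M\<^esub> x = \<zero>\<^bsub>M\<^esub>" using f(1) by auto
  let ?e = "1 - f"
  have eR: "?e \<in> R" using fR R_one by (simp add: R_diff)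
  have "(1 - ?e) \<odot>\<^bsub>M\<^esub> x = \<zero>\<^bsub>M\<^esub>" using fx by simp
  then have ex: "?e \<odot>\<^bsub>M\<^esub> x = x" using z(3)[OF R_one eR] m(6)[OF x(1)] by simp
  have iff: "r \<odot>\<^bsub>M\<^esub> x = \<zero>\<^bsub>M\<^esub> \<longleftrightarrow> ?e * r = 0" if r: "r \<in> R" for r
  proof
    assume "r \<odot>\<^bsub>M\<^esub> x = \<zero>\<^bsub>M\<^esub>"
    then have "f * r = r" using r by (intro f(2)) simp
    then show "?e * r = 0" by (simp add: left_diff_distrib)
  next
    assume "?e * r = 0"
    then have "r = f * r" by (simp add: left_diff_distrib)
    then have "r \<odot>\<^bsub>M\<^esub> x = r \<odot>\<^bsub>M\<^esub> (f \<odot>\<^bsub>M\<^esub> x)" using m(5)[OF fR r x(1)] by simp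
    then show "r \<odot>\<^bsub>M\<^esub> x = \<zero>\<^bsub>M\<^esub>" using fx additive_smult_zero(1)[OF right_module_additive[OF rm] r] by simp
  qed
  have "?e \<noteq> 0" using ex z(1) x(2) by force
  moreover have "?e * ?e = ?e" using f(2)[OF f(1)] by (simp add: algebra_simps)
  ultimately have "generates M x ?e" unfolding generates_def using x(1) eR ex U iff by blast
  then show ?thesis by blast
qed

lemma generatesD:
  assumes "generates M x e"
  shows "x \<in> carrier M" "e \<in> R" "e \<noteq> 0" "e * e = e" "e \<odot>\<^bsub>M\<^esub> x = x" "carrier M = {r \<odot>\<^bsub>M\<^esub> x | r. r \<in> R}"
    "r \<in> R \<Longrightarrow> r \<odot>\<^bsub>M\<^esub> x = \<zero>\<^bsub>M\<^esub> \<longleftrightarrow> e * r = 0"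
  using assms by (auto simp: generates_def)

text \<open>The coefficient is determined by \<open>y\<close> only after left multiplication by the
  idempotent \<open>e\<close>, so the homomorphisms below are built from
  \<open>e * coeff M x y\<close>.\<close>

definition coeff :: "('h, 's) module \<Rightarrow> 's \<Rightarrow> 's \<Rightarrow> 'h" where
  "coeff M x y = (SOME r. r \<in> R \<and> y = r \<odot>\<^bsub>M\<^esub> x)"

lemma coeff:
  assumes "generates M x e" "y \<in> carrier M"
  shows "coeff M x y \<in> R" "coeff M x y \<odot>\<^bsub>M\<^esub> x = y"
proof -
  have "\<exists>r. r \<in> R \<and> y = r \<odot>\<^bsub>M\<^esub> x" using assms generatesD(6)[OF assms(1)] by blast
  from someI_ex[OF this] show "coeff M x y \<in> R" "coeff M x y \<odot>\<^bsub>M\<^esub> x = y" unfolding coeff_def by simp_all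
qed

lemma coeff_rules:
  assumes M: "right_module R M" and g: "generates M x e"
  shows "y \<in> carrier M \<Longrightarrow> z \<in> carrier M \<Longrightarrow> e * coeff M x (y \<oplus>\<^bsub>M\<^esub> z) = e * coeff M x y + e * coeff M x z"
    "y \<in> carrier M \<Longrightarrow> r \<in> R \<Longrightarrow> e * coeff M x (r \<odot>\<^bsub>M\<^esub> y) = e * coeff M x y * r"
    "e * coeff M x x = e"
proof -
  note m = right_moduleD[OF M]
  interpret M: abelian_group M by (rule m(1))
  note x = generatesD(1)[OF g]
  have eq: "e * coeff M x y = e * r" if "r \<in> R" "y = r \<odot>\<^bsub>M\<^esub> x" for y r
  proof -
    have y: "y \<in> carrier M" using that m(2) x by simp
    have "(coeff M x y - r) \<odot>\<^bsub>M\<^esub> x = \<zero>\<^bsub>M\<^esub>"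
      using smult_zero_minus(3)[OF M x coeff(1)[OF g y] that(1)] coeff(2)[OF g y] that(2) by simp
    then have "e * (coeff M x y - r) = 0" using generatesD(7)[OF g] R_diff[OF coeff(1)[OF g y] that(1)] by simp
    then show ?thesis by (simp add: right_diff_distrib)
  qed
  show "e * coeff M x x = e" using eq[OF R_one, of x] m(6)[OF x] by simp
  assume y: "y \<in> carrier M"
  note cy = coeff[OF g y]
  show "e * coeff M x (r \<odot>\<^bsub>M\<^esub> y) = e * coeff M x y * r" if r: "r \<in> R"
    using eq[OF R_mult[OF cy(1) r], of "r \<odot>\<^bsub>M\<^esub> y"] m(5)[OF cy(1) r x] cy(2) by (simp add: mult.assoc)
  assume z: "z \<in> carrier M"
  note cz = coeff[OF g z]
  show "e * coeff M x (y \<oplus>\<^bsub>M\<^esub> z) = e * coeff M x y + e * coeff M x z"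
    using eq[OF R_add[OF cy(1) cz(1)], of "y \<oplus>\<^bsub>M\<^esub> z"] m(3)[OF cy(1) cz(1) x] cy(2) cz(2) by (simp add: distrib_left)
qed

text \<open>In terms of eR and fR the map is left multiplication by \<open>f\<close>. It sends
  \<open>e\<close> to \<open>f * e\<close>, so it is nonzero, and Schur's lemma applies.\<close>

lemma nonorthogonal_iso:
  assumes M: "simple_right_module R M" and N: "simple_right_module R N"
    and g: "generates M x e" and h: "generates N y f" and fe: "f * e \<noteq> 0"
  shows "mod_iso R M N"
proof -
  note rM = simple_right_moduleD(1)[OF M] and rN = simple_right_moduleD(1)[OF N]
  note n = right_moduleD[OF rN] and y = generatesD(1)[OF h] and c = coeff[OF g] and eR = generatesD(2)[OF g]
  let ?F = "\<lambda>z. (e * coeff M x z) \<odot>\<^bsub>N\<^esub> y"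
  have "?F \<in> mod_hom R M N"
    by (rule mod_homI) (auto simp: coeff_rules[OF rM g] n(2,3,5) y c eR R_mult)
  moreover have "?F x \<noteq> \<zero>\<^bsub>N\<^esub>" using generatesD(7)[OF h eR] fe by (simp add: coeff_rules(3)[OF rM g])
  ultimately show ?thesis by (rule simple_hom_iso[OF M N _ generatesD(1)[OF g]])
qed

abbreviation simples :: "('h, 'h set) module set" where
  "simples \<equiv> {M. simple_right_module R M}"
abbreviation iso_rel :: "(('h, 'h set) module \<times> ('h, 'h set) module) set" where
  "iso_rel \<equiv> {(M, N). simple_right_module R M \<and> simple_right_module R N \<and> mod_iso R M N}"

lemma equiv_iso_rel: "equiv simples iso_rel"
proof (rule equivI)
  show "refl_on simples iso_rel" by (auto simp: refl_on_def mod_iso_refl)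
  show "sym iso_rel"
  proof (rule symI)
    fix M N assume "(M, N) \<in> iso_rel"
    then have MN: "simple_right_module R M" "simple_right_module R N" "mod_iso R M N" by auto
    have "mod_iso R N M"
      by (rule mod_iso_sym[OF right_module_additive[OF simple_right_moduleD(1)[OF MN(1)]] MN(3)])
    then show "(N, M) \<in> iso_rel" using MN by simp
  qed
  show "trans iso_rel"
  proof (rule transI)
    fix M N P assume "(M, N) \<in> iso_rel" "(N, P) \<in> iso_rel"
    then have MN: "simple_right_module R M" "simple_right_module R P" "mod_iso R M N" "mod_iso R N P" by auto
    show "(M, P) \<in> iso_rel" using MN(1,2) mod_iso_trans[OF MN(3,4)] by simp
  qed
qed auto

text \<open>Idempotents of different classes are orthogonal by \<open>nonorthogonal_iso\<close>, and
  nonzero orthogonal idempotents are linearly independent. Finiteness must be known before counting,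
  because \<open>card\<close> of an infinite set is 0.\<close>

lemma finite_simple_classes: "finite (simples // iso_rel)"
proof -
  let ?Q = "simples // iso_rel"
  define P where "P c e \<longleftrightarrow> (\<exists>M x. M \<in> simples \<and> c = iso_rel `` {M} \<and> generates M x e)" for c e
  have ex: "\<exists>e. P c e" if c: "c \<in> ?Q" for c
  proof -
    obtain M where M: "M \<in> simples" "c = iso_rel `` {M}" using c by (rule quotientE)
    then obtain x e where "generates M x e" using simple_generator[of M] by auto
    then show ?thesis unfolding P_def by (intro exI conjI) (rule M)+
  qed
  define E where "E c = (SOME e. P c e)" for c
  have E: "P c (E c)" if "c \<in> ?Q" for c unfolding E_def by (rule someI_ex) (use ex that in blast)
  have idem: "E c * E c = E c" "E c \<noteq> 0" if c: "c \<in> ?Q" for c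
  proof -
    obtain M x where "M \<in> simples" "c = iso_rel `` {M}" and g: "generates M x (E c)"
      using E[OF c] unfolding P_def by (elim exE conjE) (rule that)
    show "E c * E c = E c" "E c \<noteq> 0" by (rule generatesD[OF g])+
  qed
  have orth: "E c * E d = 0" if cd: "c \<in> ?Q" "d \<in> ?Q" "c \<noteq> d" for c d
  proof (rule ccontr)
    assume n: "E c * E d \<noteq> 0"
    obtain M x where M: "M \<in> simples" "c = iso_rel `` {M}" "generates M x (E c)" 
      using E[OF cd(1)] unfolding P_def by (elim exE conjE) (rule that)
    obtain N y where N: "N \<in> simples" "d = iso_rel `` {N}" "generates N y (E d)" 
      using E[OF cd(2)] unfolding P_def by (elim exE conjE) (rule that)
    have "mod_iso R N M" by (rule nonorthogonal_iso[OF _ _ N(3) M(3) n]) (use M(1) N(1) in simp_all)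
    then have "(N, M) \<in> iso_rel" using M(1) N(1) by simp
    from equiv_class_eq[OF equiv_iso_rel this] show False using M(2) N(2) cd(3) by simp
  qed
  have inj: "inj_on E ?Q"
  proof (rule inj_onI, rule ccontr)
    fix c d assume "c \<in> ?Q" "d \<in> ?Q" "E c = E d" "c \<noteq> d"
    then show False using orth[of c d] idem[of d] by simp
  qed
  have "independent (E ` ?Q)"
    unfolding dependent_def
  proof
    assume "\<exists>a\<in>E ` ?Q. a \<in> span (E ` ?Q - {a})"
    then obtain c where c: "c \<in> ?Q" "E c \<in> span (E ` ?Q - {E c})" by blast
    \<comment> \<open>Left multiplication by \<open>E c\<close> kills all the other idempotents and
      hence their span, but not \<open>E c\<close> itself.\<close>
    have "span (E ` ?Q - {E c}) \<subseteq> {y. E c * y = 0}"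
    proof (rule span_minimal)
      show "E ` ?Q - {E c} \<subseteq> {y. E c * y = 0}"
      proof
        fix y assume "y \<in> E ` ?Q - {E c}"
        then obtain d where "d \<in> ?Q" "y = E d" "c \<noteq> d" by blast
        then show "y \<in> {y. E c * y = 0}" using orth[OF c(1)] by simp
      qed
      show "subspace {y. E c * y = 0}"
        by (rule subspaceI) (auto simp: distrib_left scale_mult_right)
    qed
    then have "E c * E c = 0" using c(2) by blast
    then show False using idem[OF c(1)] by simp
  qed
  moreover obtain B0 where "finite B0" "span B0 = UNIV" using fin_dim by (auto simp: fin_dim_def)
  ultimately have "finite (E ` ?Q)" using independent_span_bound[of B0 "E ` ?Q"] by simp
  then show ?thesis by (rule finite_imageD[OF _ inj])
qed

text \<open>Singletons serve to represent the ideal on the type of sets, where isomorphism classes are counted.\<close>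

definition ideal_module :: "'h set \<Rightarrow> ('h, 'h set) module" where
  "ideal_module U = mk_module ((\<lambda>x. {x}) ` U) (\<lambda>X Y. {the_elem X + the_elem Y}) {0} (\<lambda>r X. {the_elem X * r})"

lemma ideal_module_simps:
  "carrier (ideal_module U) = (\<lambda>x. {x}) ` U" "{x} \<oplus>\<^bsub>ideal_module U\<^esub> {y} = {x + y}"
  "\<zero>\<^bsub>ideal_module U\<^esub> = {0}" "r \<odot>\<^bsub>ideal_module U\<^esub> {x} = {x * r}"
  by (simp_all add: ideal_module_def mk_module_def)

lemma ideal_module_right:
  assumes U: "right_ideal U"
  shows "right_module R (ideal_module U)"
proof -
  note u = right_idealD[OF U]
  have "abelian_group (ideal_module U)"
  proof (rule abelian_groupI)
    fix X assume "X \<in> carrier (ideal_module U)"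
    then obtain x where x: "x \<in> U" "X = {x}" by (auto simp: ideal_module_simps)
    have "{- x} \<in> carrier (ideal_module U)" using u(7)[OF x(1)] by (simp add: ideal_module_simps)
    then show "\<exists>Y\<in>carrier (ideal_module U). Y \<oplus>\<^bsub>ideal_module U\<^esub> X = \<zero>\<^bsub>ideal_module U\<^esub>"
      by (rule bexI[rotated]) (simp add: x(2) ideal_module_simps)
  qed (auto simp: ideal_module_simps u add_ac)
  then show ?thesis
    unfolding right_module_def by (auto simp: ideal_module_simps u distrib_left distrib_right mult.assoc)
qed

lemma ideal_module_simple:
  assumes U: "right_ideal U" "U \<noteq> {0}"
    and min: "\<And>U'. right_ideal U' \<Longrightarrow> U' \<subseteq> U \<Longrightarrow> U' \<noteq> {0} \<Longrightarrow> U' = U"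
  shows "simple_right_module R (ideal_module U)"
  unfolding simple_right_module_def
proof (intro conjI allI impI)
  show "right_module R (ideal_module U)" by (rule ideal_module_right[OF U(1)])
  show "carrier (ideal_module U) \<noteq> {\<zero>\<^bsub>ideal_module U\<^esub>}"
    using U(2) by (auto simp: ideal_module_simps)
  fix W assume W: "is_submodule R W (ideal_module U)"
  note w = submodule_restrict[OF W]
  let ?U = "{x. {x} \<in> W}"
  have WU: "W = (\<lambda>x. {x}) ` ?U" using w(1) by (auto simp: ideal_module_simps)
  have sub: "?U \<subseteq> U" using w(1) by (auto simp: ideal_module_simps)
  have "right_ideal ?U"
  proof (rule right_idealI)
    show "?U \<subseteq> R" using sub right_idealD(2)[OF U(1)] by blast
    show "0 \<in> ?U" using w(2) by (simp add: ideal_module_simps)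
    show "u + v \<in> ?U" if "u \<in> ?U" "v \<in> ?U" for u v using w(3)[of "{u}" "{v}"] that by (simp add: ideal_module_simps)
    show "u * r \<in> ?U" if "u \<in> ?U" "r \<in> R" for u r using w(5)[of r "{u}"] that by (simp add: ideal_module_simps)
  qed
  from min[OF this sub] show "W = {\<zero>\<^bsub>ideal_module U\<^esub>} \<or> W = carrier (ideal_module U)"
    by (cases "?U = {0}") (simp_all only: WU[symmetric] ideal_module_simps, (subst WU, simp)+)
qed

definition kills :: "nat \<Rightarrow> ('h, 's) module \<Rightarrow> bool" where
  "kills n M \<longleftrightarrow> (\<forall>a\<in>ann_power H R n. \<forall>x\<in>carrier M. a \<odot>\<^bsub>M\<^esub> x = \<zero>\<^bsub>M\<^esub>)"

lemma kills_iso: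
  assumes M: "right_module R M" and N: "right_module R N" and iso: "mod_iso R M N" and k: "kills n M"
  shows "kills n N"
  unfolding kills_def
proof (intro ballI)
  fix a y assume a: "a \<in> ann_power H R n" and y: "y \<in> carrier N"
  obtain f where f: "f \<in> mod_hom R M N" "bij_betw f (carrier M) (carrier N)" using iso unfolding mod_iso_def by (rule bexE)
  obtain x where x: "x \<in> carrier M" "y = f x" using f(2) y by (auto simp: bij_betw_def)
  have "f (a \<odot>\<^bsub>M\<^esub> x) = a \<odot>\<^bsub>N\<^esub> f x" by (rule mod_homD(3)[OF f(1) ann_power_R[OF a] x(1)])
  moreover have "a \<odot>\<^bsub>M\<^esub> x = \<zero>\<^bsub>M\<^esub>" using k a x(1) by (simp add: kills_def)
  moreover have "f \<zero>\<^bsub>M\<^esub> = \<zero>\<^bsub>N\<^esub>"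
    by (rule additive_zero_minus(1)[OF right_moduleD(1)[OF M] right_moduleD(1)[OF N] mod_homD(1,2)[OF f(1)]])
  ultimately show "a \<odot>\<^bsub>N\<^esub> y = \<zero>\<^bsub>N\<^esub>" using x(2) by simp
qed

lemma ann_right_ideal: "right_ideal (ann_power H R n)"
  using ann_power_subspace ann_power_R ann_power_right by (auto simp: right_ideal_def)

text \<open>A minimal right ideal in a complement of \<open>I\<^sub>n\<^sub>+\<^sub>1\<close> in \<open>I\<^sub>n\<close>.\<close>

lemma exists_layer_simple:
  assumes "\<not> ann_power H R n \<subseteq> ann_power H R (Suc n)"
  shows "\<exists>M\<in>simples. kills (Suc n) M \<and> \<not> kills n M"
proof -
  obtain e where e: "e \<in> ann_power H R (Suc n)" "\<And>u. u \<in> ann_power H R (Suc n) \<Longrightarrow> e * u = u"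
    using left_identity[OF ann_right_ideal] by blast
  let ?V = "{y \<in> ann_power H R n. e * y = 0}"
  have V: "right_ideal ?V" by (rule right_ideal_kernel[OF ann_right_ideal ann_power_R[OF e(1)]])
  obtain y where y: "y \<in> ann_power H R n" "y \<notin> ann_power H R (Suc n)" using assms by blast
  have ey: "e * y \<in> ann_power H R (Suc n)" by (rule ann_power_right[OF e(1) ann_power_R[OF y(1)]])
  have "y - e * y \<in> ?V"
    using y(1) subsetD[OF ann_power_decreasing ey] e(2)[OF ey]
    by (simp add: right_idealD[OF ann_right_ideal] right_diff_distrib)
  moreover have "y - e * y \<noteq> 0" using ey y(2) by auto
  ultimately have V0: "?V \<noteq> {0}" by blast
  let ?P = "\<lambda>U. right_ideal U \<and> U \<noteq> {0} \<and> U \<subseteq> ?V"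
  \<comment> \<open>A nonzero right ideal of least dimension is minimal, hence simple as a
    module.\<close>
  have "\<exists>U. ?P U \<and> (\<forall>U'. ?P U' \<longrightarrow> dim U \<le> dim U')"
    by (rule ex_has_least_nat[of ?P ?V dim]) (use V V0 in blast)
  then obtain U where U: "right_ideal U" "U \<noteq> {0}" "U \<subseteq> ?V" and min: "\<And>U'. ?P U' \<Longrightarrow> dim U \<le> dim U'" by blast
  obtain B where "finite_dimensional_vector_space hs B" by (rule finite_basis)
  then interpret fd: finite_dimensional_vector_space hs B .
  have "simple_right_module R (ideal_module U)"
  proof (rule ideal_module_simple[OF U(1,2)])
    fix U' assume U': "right_ideal U'" "U' \<subseteq> U" "U' \<noteq> {0}"
    show "U' = U"
      by (rule fd.subspace_dim_equal[OF right_idealD(1)[OF U'(1)] right_idealD(1)[OF U(1)] U'(2)])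
        (rule min, use U U' in blast)
  qed
  moreover have "kills (Suc n) (ideal_module U)"
    unfolding kills_def ideal_module_simps
  proof (intro ballI)
    fix a X assume a: "a \<in> ann_power H R (Suc n)" and "X \<in> (\<lambda>x. {x}) ` U"
    then obtain x where x: "x \<in> U" "X = {x}" by blast
    \<comment> \<open>The annihilator is a two-sided ideal of \<open>R\<close>: \<open>x * a\<close>
      lies in it and is therefore fixed by \<open>e\<close>, while \<open>e * x = 0\<close>; so
      \<open>x * a\<close> is zero.\<close>
    have "x * a \<in> ann_power H R (Suc n)" using a right_idealD(2)[OF U(1) x(1)] by (rule ann_power_left)
    then have "e * (x * a) = x * a" by (rule e(2))
    moreover have "e * x = 0" using x(1) U(3) by blast
    ultimately show "a \<odot>\<^bsub>ideal_module U\<^esub> X = {0}" by (simp add: x(2) ideal_module_simps mult.assoc[symmetric])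
  qed
  moreover have "\<not> kills n (ideal_module U)"
  proof
    assume k: "kills n (ideal_module U)"
    \<comment> \<open>Every \<open>u\<close> in \<open>U\<close> belongs to the annihilator of index
      \<open>n\<close>, so it would kill the left identity \<open>f\<close> of \<open>U\<close>,
      although \<open>f * u = u\<close>.\<close>
    obtain f where f: "f \<in> U" "\<And>u. u \<in> U \<Longrightarrow> f * u = u" using left_identity[OF U(1)] by blast
    have "u = 0" if u: "u \<in> U" for u
    proof -
      have "u \<odot>\<^bsub>ideal_module U\<^esub> {f} = {0}"
        using k u U(3) f(1) unfolding kills_def ideal_module_simps(1,3) by blast
      then show "u = 0" using f(2)[OF u] by (simp add: ideal_module_simps)
    qed
    then show False using U(2) right_idealD(4)[OF U(1)] by blast
  qed
  ultimately show ?thesis by (intro bexI[of _ "ideal_module U"]) simp_all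
qed

lemma ann_power_antimono: "k \<le> m \<Longrightarrow> ann_power H R m \<subseteq> ann_power H R k"
  by (induction m rule: dec_induct) (use ann_power_decreasing in blast)+

theorem ell_le_simples: "ell_Q H R \<le> num_simple_modules R"
proof -
  let ?l = "ell_Q H R"
  define L where "L n = (SOME M. M \<in> simples \<and> kills (Suc n) M \<and> \<not> kills n M)" for n
  have L: "L n \<in> simples \<and> kills (Suc n) (L n) \<and> \<not> kills n (L n)" if "n < ?l" for n
  proof -
    have "\<not> ann_power H R n \<subseteq> ann_power H R (Suc n)" using ell_le[of n] that by fastforce
    from exists_layer_simple[OF this] show ?thesis
      unfolding L_def Bex_def by (rule someI_ex)
  qed
  have distinct: "(L n, L m) \<notin> iso_rel" if nm: "n < m" "m < ?l" for n m
  proof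
    assume "(L n, L m) \<in> iso_rel"
    then have nm': "simple_right_module R (L n)" "simple_right_module R (L m)" "mod_iso R (L n) (L m)" by auto
    have "kills (Suc n) (L n)" using L[of n] nm by simp
    then have "kills (Suc n) (L m)"
      by (rule kills_iso[OF simple_right_moduleD(1)[OF nm'(1)] simple_right_moduleD(1)[OF nm'(2)] nm'(3)])
    moreover have "ann_power H R m \<subseteq> ann_power H R (Suc n)" using nm by (intro ann_power_antimono) simp
    ultimately have "kills m (L m)" unfolding kills_def by blast
    then show False using L[OF nm(2)] by simp
  qed
  let ?c = "\<lambda>n. iso_rel `` {L n}"
  have "inj_on ?c {..<?l}"
  proof (rule inj_onI)
    fix n m assume nm: "n \<in> {..<?l}" "m \<in> {..<?l}" and eq: "?c n = ?c m"
    have "(L n, L m) \<in> iso_rel" by (rule eq_equiv_class[OF eq equiv_iso_rel]) (use L nm in auto)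
    moreover have "(L m, L n) \<in> iso_rel" by (rule eq_equiv_class[OF eq[symmetric] equiv_iso_rel]) (use L nm in auto)
    ultimately show "n = m" using distinct[of n m] distinct[of m n] nm by (cases n m rule: linorder_cases) auto
  qed
  moreover have "?c ` {..<?l} \<subseteq> simples // iso_rel"
    by (rule image_subsetI, rule quotientI) (use L in simp)
  ultimately have "card {..<?l} \<le> card (simples // iso_rel)"
    using finite_simple_classes by (rule card_inj_on_le)
  then show ?thesis by (simp add: num_simple_modules_def)
qed

lemma nproj_UQ: "p \<in> CQ n \<Longrightarrow> nproj (NQ n) p \<in> UQ n"
proof -
  have "CQ n \<subseteq> {p. nproj (NQ n) p \<in> UQ n}"
    unfolding CQ_span
  proof (rule fs.span_minimal)
    show "{pure (map (\<lambda>x. Qc x) w) |w. length w = n} \<subseteq> {p. nproj (NQ n) p \<in> UQ n}"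
      using uQ_UQ by (auto simp: uQ_def)
    show "fs.subspace {p. nproj (NQ n) p \<in> UQ n}"
      by (rule fs.subspaceI)
        (auto simp: linD[OF nproj_NQ(1)] fs.subspace_0 fs.subspace_add fs.subspace_scale sub_UQ)
  qed
  then show "p \<in> CQ n \<Longrightarrow> ?thesis" by blast
qed

text \<open>With \<open>M\<close> isomorphic to eR, faithfulness gives an \<open>X\<close> in Q^n on
  which \<open>e\<close> does not act as zero. Letting eR act on \<open>X\<close> is injective
  because \<open>M\<close> is simple, and the average of a linear left inverse splits this
  embedding.\<close>

theorem simple_summand:
  assumes faithful: "ann_power H R n = {0}" and S: "simple_right_module R M"
  shows "iso_to_summand R M (Qpower H R n)"
proof -
  note rm = simple_right_moduleD(1)[OF S]
  note m = right_moduleD[OF rm]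
  obtain x e where g: "generates M x e" using simple_generator[OF S] by blast
  note x = generatesD(1)[OF g] and eR = generatesD(2)[OF g]
  have "e \<notin> ann_power H R n" using faithful generatesD(3)[OF g] by simp
  then obtain X where X: "X \<in> UQ n" "alpha n e X \<noteq> 0" using eR by (auto simp: ann_alpha)
  note ra = ractD[OF ract_alpha[of n]]
  interpret q: quotient_action "CQ n" "NQ n" "actQ n" R by (rule Qpower_action)
  note l = ra(3)[OF X(1)]
  \<comment> \<open>This is eR, the copy of \<open>M\<close> inside \<open>R\<close>.\<close>
  let ?E = "{y \<in> R. e * y = y}"
  have eE: "e * r \<in> ?E" if "r \<in> R" for r using that eR generatesD(4)[OF g] by (simp add: R_mult mult.assoc[symmetric])
  have E: "right_ideal ?E"
    by (rule right_idealI) (auto simp: R_zero R_add R_mult distrib_left mult.assoc[symmetric])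
  have null: "y = 0" if y: "y \<in> ?E" "alpha n y X = 0" for y
  proof (rule ccontr)
    assume "y \<noteq> 0"
    \<comment> \<open>The submodule of \<open>M\<close> that corresponds to the kernel on eR. If it
      were nonzero, it would contain \<open>x\<close>, and then \<open>e\<close> would act on
      \<open>X\<close> as zero.\<close>
    let ?K = "{r \<odot>\<^bsub>M\<^esub> x | r. r \<in> R \<and> alpha n (e * r) X = 0}"
    have yR: "y \<in> R" "e * y = y" using y(1) by auto
    have a_mult: "alpha n (e * (r * s)) X = alpha n s (alpha n (e * r) X)" for r s
      by (simp add: ra(5)[OF X(1)] mult.assoc)
    have sub: "is_submodule R ?K M"
    proof (rule is_submoduleI[OF m(1)])
      show "?K \<subseteq> carrier M" using m(2) x by auto
      show "\<zero>\<^bsub>M\<^esub> \<in> ?K"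
        by (intro CollectI exI[of _ 0]) (simp add: smult_zero_minus(1)[OF rm x] R_zero linD(5)[OF l])
      fix u assume "u \<in> ?K"
      then obtain r where r: "u = r \<odot>\<^bsub>M\<^esub> x" "r \<in> R" "alpha n (e * r) X = 0" by blast
      show "\<ominus>\<^bsub>M\<^esub> u \<in> ?K"
        by (intro CollectI exI[of _ "- r"])
          (use r linD(6)[OF l, of 0 "e * r"] in \<open>simp add: smult_zero_minus(2)[OF rm x] R_minus linD(5)[OF l]\<close>)
      show "s \<odot>\<^bsub>M\<^esub> u \<in> ?K" if s: "s \<in> R" for s
        by (intro CollectI exI[of _ "r * s"])
          (use r s in \<open>simp add: m(5)[OF r(2) s x] R_mult a_mult linD(5)[OF ra(2)]\<close>)
      fix v assume "v \<in> ?K"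
      then obtain s where s: "v = s \<odot>\<^bsub>M\<^esub> x" "s \<in> R" "alpha n (e * s) X = 0" by blast
      show "u \<oplus>\<^bsub>M\<^esub> v \<in> ?K"
        by (intro CollectI exI[of _ "r + s"])
          (use r s in \<open>simp add: m(3)[OF r(2) s(2) x] R_add distrib_left linD(3)[OF l]\<close>)
    qed
    have "y \<odot>\<^bsub>M\<^esub> x \<in> ?K" using y by (intro CollectI exI[of _ y]) simp
    moreover have "y \<odot>\<^bsub>M\<^esub> x \<noteq> \<zero>\<^bsub>M\<^esub>" using generatesD(7)[OF g yR(1)] yR(2) \<open>y \<noteq> 0\<close> by simp
    ultimately have "?K = carrier M" using simple_right_moduleD(3)[OF S sub] by blast
    then obtain r where r: "x = r \<odot>\<^bsub>M\<^esub> x" "r \<in> R" "alpha n (e * r) X = 0" using x by blast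
    have "(e - r) \<odot>\<^bsub>M\<^esub> x = \<zero>\<^bsub>M\<^esub>" using smult_zero_minus(3)[OF rm x eR r(2)] generatesD(5)[OF g] r(1) by simp
    then have "e * r = e" using generatesD(7)[OF g] R_diff[OF eR r(2)] generatesD(4)[OF g] by (simp add: right_diff_distrib)
    then show False using r(3) X(2) by simp
  qed
  interpret vp: vector_space_pair hs "fscale :: 'k \<Rightarrow> ('h set list \<Rightarrow>\<^sub>0 'k) \<Rightarrow> _" by (rule vector_space_pair.intro[OF hs_vs vs_fscale])
  have "inj_on (\<lambda>h. alpha n h X) ?E"
  proof (rule inj_onI)
    fix y z assume "y \<in> ?E" "z \<in> ?E" "alpha n y X = alpha n z X"
    then have "y - z = 0" by (intro null right_idealD[OF E]) (auto simp: linD(6)[OF l])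
    then show "y = z" by simp
  qed
  from vp.linear_exists_left_inverse_on[OF l right_idealD(1)[OF E] this]
  obtain \<psi> where psi: "range \<psi> \<subseteq> ?E" "lin fscale hs \<psi>" "\<And>v. v \<in> ?E \<Longrightarrow> \<psi> (alpha n v X) = v" by blast
  let ?G = "avg hs (alpha n) (\<lambda>h x. x * h) \<psi>"
  have G_lin: "lin fscale hs ?G" by (rule avg_lin[OF ract_alpha ract_right psi(2)])
  have G_hom: "?G (alpha n r y) = ?G y * r" if "y \<in> UQ n" "r \<in> R" for y r
    by (rule avg_hom[OF ract_alpha ract_right psi(2) UNIV_I that])
  have G_R: "?G y \<in> R" if "y \<in> UQ n" for y
  proof -
    have "?G y \<in> ?E"
      by (rule avg_mem[OF ract_alpha ract_right psi(2) UNIV_I that right_idealD(1)[OF E]])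
        (use psi(1) right_idealD(3)[OF E] in blast)+
    then show ?thesis by simp
  qed
  have G_id: "?G (alpha n y X) = y" if "y \<in> ?E" for y
  proof (rule avg_id[OF ract_alpha ract_right psi(2) UNIV_I ra(4)[OF X(1)] UNIV_I])
    show "\<psi> (alpha n r (alpha n y X)) = y * r" if "r \<in> R" for r
      using psi(3)[OF right_idealD(3)[OF E \<open>y \<in> ?E\<close> that]] by (simp add: ra(5)[OF X(1)])
  qed
  have idem: "nproj (NQ n) (nproj (NQ n) z) = nproj (NQ n) z" for z
  proof -
    have "nproj (NQ n) (z - nproj (NQ n) z) = 0" using nproj_NQ(2,3) by blast
    then show ?thesis by (simp add: linD(6)[OF nproj_NQ(1)])
  qed
  let ?cls = "\<lambda>p. p +o NQ n" and ?T = "Qpower H R n"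
  \<comment> \<open>Both maps pass through eR: \<open>?f\<close> goes from \<open>M\<close> to eR
    and acts on \<open>X\<close>, \<open>?g\<close> applies the averaged left inverse and acts on
    \<open>x\<close>.\<close>
  let ?f = "\<lambda>y. ?cls (alpha n (e * coeff M x y) X)"
  let ?g = "q.lift (\<lambda>p. ?G (nproj (NQ n) p) \<odot>\<^bsub>M\<^esub> x)"
  have g_cls: "?g (?cls p) = ?G (nproj (NQ n) p) \<odot>\<^bsub>M\<^esub> x" for p
  proof (rule q.lift_cls)
    fix y z assume "y - z \<in> NQ n"
    then have "nproj (NQ n) (y - z) = 0" by (simp add: nproj_NQ)
    then show "?G (nproj (NQ n) y) \<odot>\<^bsub>M\<^esub> x = ?G (nproj (NQ n) z) \<odot>\<^bsub>M\<^esub> x" by (simp add: linD(6)[OF nproj_NQ(1)])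
  qed
  have cls_nproj: "?cls (nproj (NQ n) z) = ?cls z" for z
    by (simp add: q.cls_eq nproj_NQ(2)[symmetric] linD(6)[OF nproj_NQ(1)] idem)
  have aR: "e * coeff M x y \<in> R" if "y \<in> carrier M" for y using coeff(1)[OF g that] eR by (rule R_mult[rotated])
  note cr = coeff_rules[OF rm g]
  have f: "?f \<in> mod_hom R M ?T"
    unfolding Qpower_quotient
  proof (rule mod_homI)
    show "?f y \<in> carrier q.M" for y using UQ_CQ ra(4)[OF X(1)] by (auto simp: q.carrier_M)
    show "?f (y \<oplus>\<^bsub>M\<^esub> z) = ?f y \<oplus>\<^bsub>q.M\<^esub> ?f z" if "y \<in> carrier M" "z \<in> carrier M" for y z
      by (simp add: cr(1)[OF that] linD(3)[OF l] q.add_M)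
    show "?f (r \<odot>\<^bsub>M\<^esub> y) = r \<odot>\<^bsub>q.M\<^esub> ?f y" if "r \<in> R" "y \<in> carrier M" for r y
    proof -
      have "alpha n (e * coeff M x y * r) X = nproj (NQ n) (actQ n r (alpha n (e * coeff M x y) X))"
        unfolding alpha_def[of n r, symmetric] by (rule ra(5)[OF X(1), symmetric])
      then show ?thesis by (simp add: cr(2)[OF that(2,1)] cls_nproj q.smult_M[OF that(1)])
    qed
  qed
  have g': "?g \<in> mod_hom R ?T M"
    unfolding Qpower_quotient
  proof (rule mod_homI)
    fix Y assume "Y \<in> carrier q.M"
    then obtain p where p: "p \<in> CQ n" "Y = ?cls p" by (auto simp: q.carrier_M)
    note pU = nproj_UQ[OF p(1)]
    show "?g Y \<in> carrier M" unfolding p(2) g_cls using m(2)[OF G_R[OF pU] x] .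
    show "?g (r \<odot>\<^bsub>q.M\<^esub> Y) = r \<odot>\<^bsub>M\<^esub> ?g Y" if r: "r \<in> R" for r
    proof -
      have "?g (r \<odot>\<^bsub>q.M\<^esub> Y) = ?G (alpha n r (nproj (NQ n) p)) \<odot>\<^bsub>M\<^esub> x"
        unfolding p(2) q.smult_M[OF r] g_cls alpha_nproj by (simp add: alpha_def)
      then show ?thesis unfolding p(2) g_cls G_hom[OF pU r] using m(5)[OF G_R[OF pU] r x] by simp
    qed
    fix Z assume "Z \<in> carrier q.M"
    then obtain p' where p': "p' \<in> CQ n" "Z = ?cls p'" by (auto simp: q.carrier_M)
    show "?g (Y \<oplus>\<^bsub>q.M\<^esub> Z) = ?g Y \<oplus>\<^bsub>M\<^esub> ?g Z"
      unfolding p(2) p'(2) q.add_M g_cls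
      using m(3)[OF G_R[OF pU] G_R[OF nproj_UQ[OF p'(1)]] x] by (simp add: linD(3)[OF nproj_NQ(1)] linD(3)[OF G_lin])
  qed
  have "?g (?f y) = y" if y: "y \<in> carrier M" for y
  proof -
    note c = coeff[OF g y]
    have "nproj (NQ n) (alpha n (e * coeff M x y) X) = alpha n (e * coeff M x y) X" by (simp add: alpha_def idem)
    then have "?g (?f y) = (e * coeff M x y) \<odot>\<^bsub>M\<^esub> x" by (simp only: g_cls G_id[OF eE[OF c(1)]])
    then show ?thesis using m(5)[OF eR c(1) x] generatesD(5)[OF g] c(2) by simp
  qed
  moreover have "additive_module R ?T" unfolding Qpower_quotient by (rule q.additive_M)
  ultimately show ?thesis using retract_summand[OF right_module_additive[OF rm] _ f g'] by blast
qed

theorem depth_bounds: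
  assumes faithful: "ann_power H R (ell_Q H R) = {0}"
  shows "enat (2 * ell_Q H R + 1) \<le> min_depth hs R" "min_depth hs R \<le> enat (2 * ell_Q H R + 2)"
proof -
  let ?l = "ell_Q H R"
  have sub: "ann_power H R ?l \<subseteq> ann_power H R (Suc ?l)"
    using right_idealD(4)[OF ann_right_ideal] by (simp add: faithful)
  have "similar (bi_scalars UNIV R) (TP (Suc (Suc ?l))) (TP (Suc ?l))"
    unfolding similar_def using ann_subset_summand[OF sub] ann_subset_summand[OF ann_power_decreasing] by (rule conjI)
  \<comment> \<open>The powers of \<open>H\<close> with \<open>?l + 2\<close> and
    \<open>?l + 1\<close> factors correspond to the exponents \<open>?l + 1\<close> and
    \<open>?l\<close> of \<open>Q\<close>; hence the depth is twice \<open>?l + 1\<close>.\<close>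
  then have "has_depth hs R (2 * Suc ?l)"
    unfolding has_depth_def by (intro disjI2 exI[of _ "Suc ?l"]) simp
  then show "min_depth hs R \<le> enat (2 * ?l + 2)"
    unfolding min_depth_def by (intro INF_lower2[of "2 * Suc ?l"]) simp_all
  \<comment> \<open>Odd depth \<open>2 * n + 1\<close> yields \<open>?l \<le> n\<close>. Even depth
    \<open>2 * n\<close> yields \<open>?l \<le> n - 1\<close>, and then even
    \<open>2 * ?l + 2 \<le> m\<close>.\<close>
  have low: "2 * ?l + 1 \<le> m" if "has_depth hs R m" for m
    using that unfolding has_depth_def
  proof (elim disjE conjE exE)
    assume m: "m = 1" and "similar (bi_scalars R R) (TP 1) (regular_bimodule R)"
    then obtain N :: nat where "iso_to_summand (bi_scalars R R) (TP 1) (direct_power {..<N} (regular_bimodule R))"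
      unfolding similar_def by blast
    then have "ann_power H R 0 \<subseteq> ann_power H R (Suc 0)" using bimodule_ann_zero by simp
    from ell_le[OF this] m show ?thesis by simp
  next
    fix n assume n: "n \<ge> 1" and m: "m = 2 * n + 1" and "similar (bi_scalars R R) (TP (n + 1)) (TP n)"
    then obtain N :: nat where N: "iso_to_summand (bi_scalars R R) (TP (n + 1)) (direct_power {..<N} (TP n))"
      unfolding similar_def by blast
    obtain k where k: "n = Suc k" using n by (cases n) auto
    have "ell_Q H R \<le> Suc k" by (rule ell_le[OF bimodule_ann_R]) (use N in \<open>simp add: k\<close>)
    then show ?thesis using m by (simp add: k)
  next
    fix n assume n: "n \<ge> 1" and m: "m = 2 * n" and "similar (bi_scalars R UNIV) (TP (n + 1)) (TP n)"
    then obtain N :: nat where N: "iso_to_summand (bi_scalars R UNIV) (TP (n + 1)) (direct_power {..<N} (TP n))"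
      unfolding similar_def by blast
    obtain k where k: "n = Suc k" using n by (cases n) auto
    have "ell_Q H R \<le> k" by (rule ell_le[OF bimodule_ann_right]) (use N in \<open>simp add: k\<close>)
    then show ?thesis using m by (simp add: k)
  next
    fix n assume n: "n \<ge> 1" and m: "m = 2 * n" and "similar (bi_scalars UNIV R) (TP (n + 1)) (TP n)"
    then obtain N :: nat where N: "iso_to_summand (bi_scalars UNIV R) (TP (n + 1)) (direct_power {..<N} (TP n))"
      unfolding similar_def by blast
    obtain k where k: "n = Suc k" using n by (cases n) auto
    have "ell_Q H R \<le> k" by (rule ell_le[OF bimodule_ann_left]) (use N in \<open>simp add: k\<close>)
    then show ?thesis using m by (simp add: k)
  qed
  show "enat (2 * ?l + 1) \<le> min_depth hs R"
    unfolding min_depth_def by (rule INF_greatest) (use low in simp)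
qed

end

theorem theorem4p9:
  fixes H :: "('k::field, 'h::ring_1) hopf" and R :: "'h set"
  assumes "hopf_algebra H"
    and "fin_dim H"
    and "hopf_subalgebra H R"
    and "projective_right_module R (Qmod H R)"
    and "conditionally_faithful H R"
  shows "semisimple_algebra R \<and>
         ell_Q H R \<le> num_simple_modules R \<and>
         (\<forall>S :: ('h, 's) module. simple_right_module R S \<longrightarrow>
            iso_to_summand R S (Qpower H R (ell_Q H R))) \<and>
         enat (2 * ell_Q H R + 1) \<le> min_depth (hscale H) R \<and>
         min_depth (hscale H) R \<le> enat (2 * ell_Q H R + 2)"
proof -
  interpret hopf_pair H R
    by (rule hopf_pair.intro[OF assms(1)]) (unfold_locales, rule assms, rule assms)
  obtain t where t: "t \<in> R" "\<And>r. r \<in> R \<Longrightarrow> t * r = hscale H (counit H r) t" "counit H t = 1"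
    using exists_integral[OF assms(4)] by blast
  interpret hopf_integral H R t
    by unfold_locales (use t in auto)
  have faithful: "ann_power H R (ell_Q H R) = {0}"
    using ann_power_ell assms(5) by (simp add: conditionally_faithful_def)
  show ?thesis
    using semisimple ell_le_simples simple_summand[OF faithful] depth_bounds[OF faithful] by blast
qed

end
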